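(* Let $1\le p,q\le\infty$ and $s\in\mathbb{R}$. Then the weighted modulation space $M^s_{p,q}$ on $\mathbb{R}^n$ is an algebra with respect to pointwise multiplication if and only if either $s\ge 0$ and $q=1$, or $s>n/q'$.
   Context: All function spaces are on $\mathbb{R}^n$; $\langle\xi\rangle:=(1+|\xi|^2)^{1/2}$; $q'$ is the conjugate exponent, $\frac1q+\frac1{q'}=1$ (with $1/\infty=0$). For a nontrivial $\phi\in\mathcal{S}$ (Schwartz space) and $f\in\mathcal{S}'$ the short-time Fourier transform is $V_\phi f(x,\xi)=(2\pi)^{-n/2}\int_{\mathbb{R}^n} f(s)\overline{\phi(s-x)}e^{-is\cdot\xi}\,ds$. For $1\le p,q\le\infty$, $s\in\mathbb{R}$, the weighted modulation space $M^s_{p,q}$ is the set of all $f\in\mathcal{S}'$ with $\|f\|_{M^s_{p,q}}=\big(\int(\int|V_\phi f(x,\xi)\langle\xi\rangle^s|^p\,dx)^{q/p}d\xi\big)^{1/q}<\infty$ (usual modifications if $p$ or $q$ is $\infty$), $\phi$ being a fixed window; different windows give the same space with equivalent norms. The product of $f,g\in\mathcal{S}'$ is $f\cdot g:=\lim_{j\to\infty}S^jf\cdot S^jg$ whenever this limit exists in $\mathcal{S}'$, where $S^jf=\mathcal{F}^{-1}[\psi(2^{-j}\xi)\mathcal{F}f(\xi)]$ for a fixed $\psi\in C_0^\infty(\mathbb{R}^n)$ equal to $1$ in a neighbourhood of the origin. "$M^s_{p,q}$ is an algebra with respect to pointwise multiplication" means $M^s_{p,q}\cdot M^s_{p,q}\hookrightarrow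 M^s_{p,q}$, i.e. the product of any two $f,g\in M^s_{p,q}$ exists, belongs to $M^s_{p,q}$, and $\|f\cdot g\|_{M^s_{p,q}}\le c\,\|f\|_{M^s_{p,q}}\|g\|_{M^s_{p,q}}$ with $c$ independent of $f,g$. *)

theory Defs
  imports "HOL-Analysis.Analysis" "HOL-Probability.Essential_Supremum"
begin

definition japanese_bracket :: "real ^ 'n::finite \<Rightarrow> real" where
  "japanese_bracket \<xi> = sqrt (1 + (norm \<xi>)\<^sup>2)"

subsection \<open>Schwartz functions\<close>

definition partial_deriv ::
  "'n \<Rightarrow> (real ^ 'n::finite \<Rightarrow> complex) \<Rightarrow> real ^ 'n \<Rightarrow> complex" where
  "partial_deriv i f x = frechet_derivative f (at x) (axis i 1)"

text \<open>A multi-index derivative is given by the list of the coordinate directions in which to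
  differentiate; for smooth functions the order of the list is immaterial.\<close>

definition partial_derivs ::
  "'n list \<Rightarrow> (real ^ 'n::finite \<Rightarrow> complex) \<Rightarrow> real ^ 'n \<Rightarrow> complex" where
  "partial_derivs is f = fold partial_deriv is f"

definition smooth_fun :: "(real ^ 'n::finite \<Rightarrow> complex) \<Rightarrow> bool" where
  "smooth_fun f \<longleftrightarrow> (\<forall>is x. partial_derivs is f differentiable (at x))"

definition schwartz_space :: "(real ^ 'n::finite \<Rightarrow> complex) set" where
  "schwartz_space = {f. smooth_fun f \<and>
     (\<forall>k is. bdd_above (range (\<lambda>x. japanese_bracket x ^ k * cmod (partial_derivs is f x))))}"

definition schwartz_seminorm ::
  "nat \<Rightarrow> 'n list \<Rightarrow> (real ^ 'n::finite \<Rightarrow> complex) \<Rightarrow> real" where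
  "schwartz_seminorm k is f = (SUP x. japanese_bracket x ^ k * cmod (partial_derivs is f x))"

definition schwartz_topology :: "(real ^ 'n::finite \<Rightarrow> complex) topology" where
  "schwartz_topology = topology_generated_by
     {{g \<in> schwartz_space. schwartz_seminorm k is (\<lambda>x. g x - f x) < e} | k is f e.
        f \<in> schwartz_space \<and> e > 0}"

definition fourier :: "(real ^ 'n::finite \<Rightarrow> complex) \<Rightarrow> real ^ 'n \<Rightarrow> complex" where
  "fourier f \<xi> = complex_of_real ((2 * pi) powr (- real CARD('n) / 2)) *
     (LINT x|lborel. exp (- \<i> * complex_of_real (x \<bullet> \<xi>)) * f x)"

definition inv_fourier :: "(real ^ 'n::finite \<Rightarrow> complex) \<Rightarrow> real ^ 'n \<Rightarrow> complex" where
  "inv_fourier f x = complex_of_real ((2 * pi) powr (- real CARD('n) / 2)) *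
     (LINT \<xi>|lborel. exp (\<i> * complex_of_real (x \<bullet> \<xi>)) * f \<xi>)"

subsection \<open>Tempered distributions\<close>

type_synonym 'n distr = "(real ^ 'n \<Rightarrow> complex) \<Rightarrow> complex"

text \<open>Functionals are taken in \<^const>\<open>extensional\<close> form, so that two tempered distributions are
  equal as HOL functions iff they agree on all Schwartz functions.\<close>

definition tempered_distr :: "('n::finite) distr set" where
  "tempered_distr = {u \<in> extensional schwartz_space.
     (\<forall>f\<in>schwartz_space. \<forall>g\<in>schwartz_space. \<forall>a b.
        u (\<lambda>x. a * f x + b * g x) = a * u f + b * u g) \<and>
     continuous_map schwartz_topology euclidean u}"

text \<open>Sequential convergence for the weak-* topology.\<close>

definition distr_tendsto :: "(nat \<Rightarrow> ('n::finite) distr) \<Rightarrow> 'n distr \<Rightarrow> bool" where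
  "distr_tendsto U u \<longleftrightarrow> u \<in> tempered_distr \<and> (\<forall>f\<in>schwartz_space. (\<lambda>j. U j f) \<longlonglongrightarrow> u f)"

definition distr_fourier :: "('n::finite) distr \<Rightarrow> 'n distr" where
  "distr_fourier u = (\<lambda>f\<in>schwartz_space. u (fourier f))"

definition distr_inv_fourier :: "('n::finite) distr \<Rightarrow> 'n distr" where
  "distr_inv_fourier u = (\<lambda>f\<in>schwartz_space. u (inv_fourier f))"

definition distr_mult :: "(real ^ 'n::finite \<Rightarrow> complex) \<Rightarrow> 'n distr \<Rightarrow> 'n distr" where
  "distr_mult m u = (\<lambda>f\<in>schwartz_space. u (\<lambda>\<xi>. m \<xi> * f \<xi>))"

definition distr_of_fun :: "(real ^ 'n::finite \<Rightarrow> complex) \<Rightarrow> 'n distr" where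
  "distr_of_fun h = (\<lambda>f\<in>schwartz_space. LINT x|lborel. h x * f x)"

text \<open>The continuous function representing a distribution. It is unique if it exists; for
  distributions with compactly supported Fourier transform, the only ones to which it is applied
  below, it exists by the Paley-Wiener-Schwartz theorem.\<close>

definition fun_of_distr :: "('n::finite) distr \<Rightarrow> real ^ 'n \<Rightarrow> complex" where
  "fun_of_distr u = (THE h. continuous_on UNIV h \<and>
     (\<forall>f\<in>schwartz_space. integrable lborel (\<lambda>x. h x * f x)) \<and> distr_of_fun h = u)"

text \<open>\<open>low_pass \<psi> j f\<close> is \<open>S\<^sup>j f\<close> for the cutoff function \<open>\<psi>\<close>.\<close>

definition low_pass :: "(real ^ 'n::finite \<Rightarrow> complex) \<Rightarrow> nat \<Rightarrow> 'n distr \<Rightarrow> 'n distr" where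
  "low_pass \<psi> j f =
     distr_inv_fourier (distr_mult (\<lambda>\<xi>. \<psi> ((1 / 2 ^ j) *\<^sub>R \<xi>)) (distr_fourier f))"

text \<open>\<open>distr_product \<psi> f g h\<close>: the product of \<open>f\<close> and \<open>g\<close> exists and equals \<open>h\<close>.\<close>

definition distr_product ::
  "(real ^ 'n::finite \<Rightarrow> complex) \<Rightarrow> 'n distr \<Rightarrow> 'n distr \<Rightarrow> 'n distr \<Rightarrow> bool" where
  "distr_product \<psi> f g h \<longleftrightarrow>
     distr_tendsto
       (\<lambda>j. distr_of_fun
          (\<lambda>x. fun_of_distr (low_pass \<psi> j f) x * fun_of_distr (low_pass \<psi> j g) x)) h"

subsection \<open>Modulation spaces\<close>

definition stft ::
  "(real ^ 'n::finite \<Rightarrow> complex) \<Rightarrow> 'n distr \<Rightarrow> real ^ 'n \<Rightarrow> real ^ 'n \<Rightarrow> complex" where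
  "stft \<phi> f x \<xi> = complex_of_real ((2 * pi) powr (- real CARD('n) / 2)) *
     f (\<lambda>t. cnj (\<phi> (t - x)) * exp (- \<i> * complex_of_real (t \<bullet> \<xi>)))"

text \<open>Only used for exponents \<open>a > 0\<close>.\<close>

definition ennreal_powr :: "ennreal \<Rightarrow> real \<Rightarrow> ennreal" where
  "ennreal_powr x a = (if x = \<infinity> then \<infinity> else ennreal (enn2real x powr a))"

definition Lp_norm :: "ereal \<Rightarrow> (real ^ 'n::finite \<Rightarrow> ennreal) \<Rightarrow> ennreal" where
  "Lp_norm p h =
     (if p = \<infinity> then esssup lborel h
      else ennreal_powr (\<integral>\<^sup>+ x. ennreal_powr (h x) (real_of_ereal p) \<partial>lborel)
             (1 / real_of_ereal p))"

definition modulation_norm ::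
  "(real ^ 'n::finite \<Rightarrow> complex) \<Rightarrow> ereal \<Rightarrow> ereal \<Rightarrow> real \<Rightarrow> 'n distr \<Rightarrow> ennreal" where
  "modulation_norm \<phi> p q s f =
     Lp_norm q (\<lambda>\<xi>. Lp_norm p (\<lambda>x.
       ennreal (cmod (stft \<phi> f x \<xi> * complex_of_real (japanese_bracket \<xi> powr s)))))"

definition modulation_space ::
  "(real ^ 'n::finite \<Rightarrow> complex) \<Rightarrow> ereal \<Rightarrow> ereal \<Rightarrow> real \<Rightarrow> 'n distr set" where
  "modulation_space \<phi> p q s = {f \<in> tempered_distr. modulation_norm \<phi> p q s f < \<infinity>}"

definition is_multiplication_algebra ::
  "(real ^ 'n::finite \<Rightarrow> complex) \<Rightarrow> (real ^ 'n \<Rightarrow> complex) \<Rightarrow>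
     ereal \<Rightarrow> ereal \<Rightarrow> real \<Rightarrow> bool" where
  "is_multiplication_algebra \<phi> \<psi> p q s \<longleftrightarrow>
     (\<exists>c::real. \<forall>f\<in>modulation_space \<phi> p q s. \<forall>g\<in>modulation_space \<phi> p q s.
        \<exists>h\<in>modulation_space \<phi> p q s. distr_product \<psi> f g h \<and>
          modulation_norm \<phi> p q s h
            \<le> ennreal c * modulation_norm \<phi> p q s f * modulation_norm \<phi> p q s g)"

end

(*
  The short-time Fourier transform of u is u tested against time-frequency shifts (atoms) of the
  window, and every test function is a superposition of such atoms (reproducing formula).

  Sufficiency.  If s >= 0 and <xi>^(-s) lies in L^q', then V u(x, xi) is dominated, uniformly in x,
  by a function of xi that is integrable, so u is a bounded continuous function and the product is
  the pointwise one.  The transform of a product is a convolution in frequency of the transforms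
  of the factors; by <xi+eta>^s <= C (<xi>^s + <eta>^s) and Minkowski's inequality the norm of f g
  is controlled by one factor in M^s_{p,q} and the other in M^0_{infinity,1}.

  Necessity.  Fix a window gamma >= 0 with gamma(0) = 1 and put f(t) = gamma(t) * int a(eta) e^(i t eta)
  for an even a >= 0.  Then ||f|| <= C ||<.>^s a||_q, while applying the algebra inequality to the
  powers f^m forces f(0) = int a <= C ||f||.  Testing int a <= C ||<.>^s a||_q on indicators of
  annuli (q = 1) and on powers of <xi> cut off to balls (q > 1) gives the condition on s.
*)
theory Submission imports Defs "HOL-Probability.Probability" begin

subsection \<open>Weights\<close>

text \<open>Two difficulties shape the proof. Distributions are bare functionals here, so an
  expansion of a test function into atoms can be tested against \<open>u\<close> only after
  \<open>u\<close> has been moved under an integral over phase space;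
  \<open>tempered_integral\<close> does this by approximating the parameter by simple functions, for
  which linearity is enough. The product is a limit of products of low-pass filtered distributions,
  so it becomes accessible only once the factors are known to be bounded continuous functions: then
  the filters are approximate identities.

  In the necessity part \<open>a\<close> is even so that \<open>f\<close> is real. Even powers of
  \<open>f\<close>, tested against a nonnegative function, then involve no cancellation, and a
  comparison of m-th roots removes every constant that does not grow with the power.

  Constants are never optimised. The inequalities of Minkowski and Hoelder are proved with an extra
  factor 2, which lets both follow from elementary convexity bounds.\<close>

abbreviation jb :: "real ^ 'n::finite \<Rightarrow> real" where
  "jb \<equiv> japanese_bracket"

lemma jb_ge_1: "1 \<le> jb x"
  by (simp add: japanese_bracket_def)

lemma jb_pos [simp]: "0 < jb x" and jb_nonneg [simp]: "0 \<le> jb x" and jb_nonzero [simp]: "jb x \<noteq> 0"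
  using jb_ge_1[of x] by auto

lemma jb_minus [simp]: "jb (- x) = jb x"
  by (simp add: japanese_bracket_def)

lemma jb_minus_commute: "jb (x - y) = jb (y - x)"
  by (simp add: japanese_bracket_def norm_minus_commute)

lemma norm_le_jb: "norm x \<le> jb x"
  unfolding japanese_bracket_def by (rule real_le_rsqrt) simp

lemma jb_le: "jb x \<le> 1 + norm x"
  unfolding japanese_bracket_def by (rule real_le_lsqrt) (auto simp: power2_eq_square algebra_simps)

lemma continuous_on_jb [continuous_intros]: "continuous_on A f \<Longrightarrow> continuous_on A (\<lambda>x. jb (f x))"
  unfolding japanese_bracket_def by (intro continuous_intros)

lemma borel_measurable_jb [measurable]: "jb \<in> borel_measurable borel"
  by (intro borel_measurable_continuous_onI continuous_intros)

text \<open>Peetre's inequality for the bracket. Squares are compared, since expanding the product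
  on the right yields every term of (|x| + |y|)^2 with room to spare.\<close>

lemma jb_add_le: "jb (x + y) \<le> 2 * jb x * jb y"
proof -
  have "(jb (x+y))\<^sup>2 = 1 + (norm (x+y))\<^sup>2" by (simp add: japanese_bracket_def)
  also have "(norm (x + y))\<^sup>2 \<le> (norm x + norm y)\<^sup>2" by (intro power_mono norm_triangle_ineq) auto
  also have "1 + (norm x + norm y)\<^sup>2 \<le> 4 * ((1 + (norm x)\<^sup>2) * (1 + (norm y)\<^sup>2))"
  proof -
    have "(norm x + norm y)\<^sup>2 \<le> 2 * (norm x)\<^sup>2 + 2 * (norm y)\<^sup>2"
      using sum_squares_bound[of "norm x" "norm y"] by (simp add: power2_sum)
    moreover have "4 * ((1 + (norm x)\<^sup>2) * (1 + (norm y)\<^sup>2)) = 4 + 4 * (norm x)\<^sup>2 + 4 * (norm y)\<^sup>2 + 4 * (norm x * norm y)\<^sup>2"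
      by (simp add: power_mult_distrib algebra_simps)
    moreover have "0 \<le> (norm x)\<^sup>2" "0 \<le> (norm y)\<^sup>2" "0 \<le> (norm x * norm y)\<^sup>2" by simp_all
    ultimately show ?thesis by linarith
  qed
  also have "\<dots> = (2 * jb x * jb y)\<^sup>2" by (simp add: japanese_bracket_def power_mult_distrib)
  finally show ?thesis by (rule power2_le_imp_le) auto
qed

text \<open>Peetre's inequality for real exponents. A negative exponent reverses the estimate, so it
  is applied to y = (-x) + (x + y); this is why the factor of \<open>x\<close> carries |s| while
  that of \<open>y\<close> keeps \<open>s\<close>.\<close>

lemma jb_powr_add_le: "jb (x + y) powr s \<le> 2 powr \<bar>s\<bar> * jb x powr \<bar>s\<bar> * jb y powr s"
proof (cases "s \<ge> 0")
  case True
  have "jb (x+y) powr s \<le> (2 * jb x * jb y) powr s"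
    by (intro powr_mono2 True jb_add_le) auto
  then show ?thesis using True by (simp add: powr_mult)
next
  case False
  have "jb y \<le> 2 * jb x * jb (x + y)" using jb_add_le[of "-x" "x+y"] by simp
  then have "jb y powr (-s) \<le> (2 * jb x * jb (x + y)) powr (-s)"
    using False by (intro powr_mono2) auto
  then show ?thesis using False
    by (simp add: powr_mult powr_minus field_simps)
qed

text \<open>The additive counterpart of Peetre's inequality: the larger of the two brackets alone
  controls the sum. In the product estimate it lets the weight fall on one factor at a time, where
  the multiplicative form would weight both.\<close>

lemma jb_powr_add_le_sum:
  assumes "s \<ge> 0" shows "jb (x + y) powr s \<le> 4 powr s * (jb x powr s + jb y powr s)"
proof -
  have 1: "jb (x+y) \<le> 4 * max (jb x) (jb y)"
    using jb_le[of "x+y"] norm_triangle_ineq[of x y] norm_le_jb[of x] norm_le_jb[of y] jb_ge_1[of x] jb_ge_1[of y]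
    by (simp add: max_def)
  have "jb (x+y) powr s \<le> (4 * max (jb x) (jb y)) powr s"
    by (intro powr_mono2 1 assms) auto
  also have "\<dots> = 4 powr s * (max (jb x) (jb y)) powr s"
    by (subst powr_mult) auto
  also have "(max (jb x) (jb y)) powr s \<le> jb x powr s + jb y powr s"
    by (simp add: max_def)
  finally show ?thesis by simp
qed

section \<open>Monotonicity and integrability of powers of the weight\<close>

lemma jb_powr_le_1: "a \<le> 0 \<Longrightarrow> jb x powr a \<le> 1"
  using powr_mono2'[of a 1 "jb x"] jb_ge_1[of x] by simp

lemma jb_powr_mono: "a \<le> b \<Longrightarrow> jb x powr a \<le> jb x powr b"
  using jb_ge_1[of x] by (intro powr_mono) auto

text \<open>If k >= 1 is the first index with |x| < 2^k, then the bracket of \<open>x\<close> is at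
  least 2^(k-1). The weight is therefore dominated by a sum of constants times indicators of dyadic
  balls, whose integrals form a geometric series of ratio 2^(n - a).\<close>

lemma nn_integral_jb_finite:
  assumes "a > real CARD('n::finite)"
  shows "(\<integral>\<^sup>+x. ennreal (jb (x::real^'n) powr - a) \<partial>lborel) < \<infinity>"
proof -
  define V where "V = unit_ball_vol (real CARD('n))"
  have V: "V \<ge> 0" by (simp add: V_def)
  have a: "a > 0" using assms by simp
  have pw: "ennreal (jb x powr - a) \<le>
      (\<Sum>k. ennreal (2 powr a * 2 powr (-(a * k))) * indicator (ball 0 (2^k)) x)" for x :: "real^'n"
  proof -
    have ex: "\<exists>k::nat. norm x < 2 ^ k"
      by (metis one_less_numeral_iff real_arch_pow semiring_norm(76))
    define k where "k = (LEAST k::nat. norm x < 2 ^ k)"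
    have k: "norm x < 2 ^ k" unfolding k_def using ex by (rule LeastI_ex)
    have "jb x powr - a \<le> 2 powr a * 2 powr (- (a * k))"
    proof (cases k)
      case 0
      then have "2 powr a * 2 powr (- (a * k)) \<ge> 1" using a by (simp add: ge_one_powr_ge_zero)
      then show ?thesis using jb_powr_le_1[of "-a" x] a by simp
    next
      case (Suc m)
      then have "\<not> norm x < 2 ^ m" using not_less_Least[of m "\<lambda>k. norm x < 2^k"] unfolding k_def by simp
      then have "2 powr m \<le> jb x" using norm_le_jb[of x] by (simp add: powr_realpow)
      then have "jb x powr - a \<le> (2 powr m) powr - a"
        using a by (intro powr_mono2') auto
      also have "\<dots> = 2 powr a * 2 powr (- (a * k))"
        by (simp add: powr_powr Suc algebra_simps flip: powr_add)
      finally show ?thesis .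
    qed
    then have "ennreal (jb x powr - a) \<le> ennreal (2 powr a * 2 powr (-(a * k))) * indicator (ball 0 (2^k)) x"
      using k by (simp add: ennreal_leI)
    also have "\<dots> \<le> (\<Sum>k. ennreal (2 powr a * 2 powr (-(a * k))) * indicator (ball 0 (2^k)) x)"
    proof -
      have "h k \<le> (\<Sum>k. h k)" for h :: "nat \<Rightarrow> ennreal" using sum_le_suminf[OF summableI, of "{k}" h] by simp
      from this[of "\<lambda>k. ennreal (2 powr a * 2 powr (-(a * k))) * indicator (ball 0 (2^k)) x"] show ?thesis .
    qed
    finally show ?thesis .
  qed
  have "(\<integral>\<^sup>+x. ennreal (jb (x::real^'n) powr - a) \<partial>lborel) \<le>
     (\<integral>\<^sup>+x. (\<Sum>k. ennreal (2 powr a * 2 powr (-(a * k))) * indicator (ball (0::real^'n) (2^k)) x) \<partial>lborel)"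
    by (rule nn_integral_mono) (rule pw)
  also have "\<dots> = (\<Sum>k. \<integral>\<^sup>+x. ennreal (2 powr a * 2 powr (-(a * k))) * indicator (ball (0::real^'n) (2^k)) x \<partial>lborel)"
    by (intro nn_integral_suminf borel_measurable_times_ennreal borel_measurable_const borel_measurable_indicator) simp
  also have "\<dots> = (\<Sum>k. ennreal (2 powr a * V * (2 powr (real CARD('n) - a)) ^ k))"
  proof (intro suminf_cong)
    fix k :: nat
    have "(\<integral>\<^sup>+x. ennreal (2 powr a * 2 powr (-(a * k))) * indicator (ball (0::real^'n) (2^k)) x \<partial>lborel)
        = ennreal (2 powr a * 2 powr (-(a * k))) * ennreal (V * (2^k) ^ CARD('n))"
      by (subst nn_integral_cmult_indicator) (simp_all add: emeasure_ball V_def)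
    also have "\<dots> = ennreal (2 powr a * 2 powr (-(a * k)) * (V * (2^k) ^ CARD('n)))"
      using V by (intro ennreal_mult[symmetric]) auto
    also have "2 powr a * 2 powr (-(a * k)) * (V * (2^k) ^ CARD('n)) = 2 powr a * V * (2 powr (real CARD('n) - a)) ^ k"
    proof -
      have "(2::real) powr (-(a * k)) * (2^k) ^ CARD('n) = (2 powr (real CARD('n) - a)) ^ k"
        by (simp add: powr_realpow[symmetric] powr_powr algebra_simps flip: powr_add power_mult)
      then show ?thesis by simp
    qed
    finally show "(\<integral>\<^sup>+x. ennreal (2 powr a * 2 powr (-(a * k))) * indicator (ball (0::real^'n) (2^k)) x \<partial>lborel)
       = ennreal (2 powr a * V * (2 powr (real CARD('n) - a)) ^ k)" .
  qed
  also have "\<dots> < \<infinity>"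
  proof -
    have "2 powr (real CARD('n) - a) < (1::real)" using assms by (simp add: powr_less_one)
    then have "summable (\<lambda>k. 2 powr a * V * (2 powr (real CARD('n) - a)) ^ k)"
      by (intro summable_mult summable_geometric) auto
    then show ?thesis using V by (subst suminf_ennreal2) auto
  qed
  finally show ?thesis .
qed

lemma integrable_jb:
  assumes "a > real CARD('n::finite)"
  shows "integrable lborel (\<lambda>x::real^'n. jb x powr - a)"
  using nn_integral_jb_finite[OF assms] by (intro integrableI_nonneg) auto

text \<open>By contraposition: if a <= n the integrand dominates the power -n, and for that power
  every dyadic shell adds at least a fixed amount. The integrals over the balls of radius 2^k then
  grow linearly in \<open>k\<close>, which no finite bound survives.\<close>

lemma nn_integral_jb_bounded_imp:
  assumes "C < \<infinity>" and bd: "\<And>R. (\<integral>\<^sup>+x\<in>ball 0 R. ennreal (jb (x::real^'n::finite) powr - a) \<partial>lborel) \<le> C"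
  shows "a > real CARD('n)"
proof (rule ccontr)
  assume "\<not> a > real CARD('n)"
  then have a: "a \<le> real CARD('n)" by simp
  define n where "n = CARD('n)"
  have n: "n > 0" by (simp add: n_def)
  define V where "V = unit_ball_vol (real n)"
  have V: "V > 0" by (simp add: V_def)
  define I where "I k = (\<integral>\<^sup>+x\<in>ball 0 (2^k). ennreal (jb (x::real^'n) powr - real n) \<partial>lborel)" for k :: nat
  \<comment> \<open>The shell between 2^k and 2^(k+1) has volume at least V (2^k)^n and bracket at
    most 4 * 2^k, so the powers of 2^k cancel and the bound is uniform in \<open>k\<close>.\<close>
  define c where "c = V / 4 ^ n"
  have c: "c > 0" using V by (simp add: c_def)
  have step: "I (Suc k) \<ge> I k + ennreal c" for k
  proof -
    let ?D = "ball (0::real^'n) (2^Suc k) - ball 0 (2^k)"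
    have Dm: "ball 0 (2^k) \<in> sets (lborel :: (real^'n) measure)" "?D \<in> sets lborel" by (simp, intro sets.Diff) simp_all
    have D: "emeasure lborel ?D \<ge> ennreal (V * (2^k)^n)"
    proof -
      have "emeasure lborel ?D = emeasure lborel (ball (0::real^'n) (2^Suc k)) - emeasure lborel (ball (0::real^'n) (2^k))"
        by (intro emeasure_Diff subset_ball) (simp_all add: emeasure_ball)
      also have "\<dots> = ennreal (V * (2^Suc k)^n) - ennreal (V * (2^k)^n)"
        by (simp add: emeasure_ball V_def n_def)
      also have "\<dots> = ennreal (V * (2^Suc k)^n - V * (2^k)^n)"
        using V by (intro ennreal_minus) auto
      also have "\<dots> \<ge> ennreal (V * (2^k)^n)"
      proof (intro ennreal_leI)
        have "(2::real) * (2^k)^n \<le> 2^n * (2^k)^n"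
          using n by (intro mult_right_mono) (auto intro: self_le_power)
        also have "\<dots> = (2^Suc k)^n" by (simp add: power_mult_distrib)
        finally have "V * (2 * (2^k)^n) \<le> V * (2^Suc k)^n" using V by (intro mult_left_mono) auto
        then show "V * (2 ^ k) ^ n \<le> V * (2 ^ Suc k) ^ n - V * (2 ^ k) ^ n" by (simp add: algebra_simps)
      qed
      finally show ?thesis .
    qed
    have "ennreal c = ennreal (1 / (4 * 2^k)^n) * ennreal (V * (2^k)^n)"
      using V by (simp add: c_def power_mult_distrib flip: ennreal_mult)
    also have "\<dots> \<le> ennreal (1 / (4 * 2^k)^n) * emeasure lborel ?D"
      by (intro mult_left_mono D) auto
    also have "\<dots> = (\<integral>\<^sup>+x\<in>?D. ennreal (1 / (4 * 2^k)^n) \<partial>lborel)"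
      by (rule nn_integral_cmult_indicator[symmetric, OF Dm(2)])
    also have "\<dots> \<le> (\<integral>\<^sup>+x\<in>?D. ennreal (jb x powr - real n) \<partial>lborel)"
    proof (intro nn_integral_mono)
      fix x :: "real^'n"
      show "ennreal (1 / (4 * 2^k)^n) * indicator ?D x \<le> ennreal (jb x powr - real n) * indicator ?D x"
      proof (cases "x \<in> ?D")
        case True
        then have "jb x \<le> 1 + 2 * 2^k" using jb_le[of x] by simp
        also have "\<dots> \<le> 4 * 2^k" using one_le_power[of "2::real" k] by linarith
        finally have "jb x ^ n \<le> (4 * 2^k)^n" by (intro power_mono) auto
        then have "1 / (4 * 2^k)^n \<le> 1 / jb x ^ n" by (intro divide_left_mono) auto
        then show ?thesis using True by (simp add: powr_minus powr_realpow divide_inverse ennreal_leI)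
      qed simp
    qed
    finally have "I k + ennreal c \<le> I k + (\<integral>\<^sup>+x\<in>?D. ennreal (jb x powr - real n) \<partial>lborel)"
      by (intro add_left_mono)
    also have "\<dots> = (\<integral>\<^sup>+x. ennreal (jb (x::real^'n) powr - real n) * indicator (ball 0 (2^k)) x
        + ennreal (jb x powr - real n) * indicator ?D x \<partial>lborel)"
      unfolding I_def
      by (intro nn_integral_add[symmetric] borel_measurable_times_ennreal borel_measurable_indicator Dm; measurable)
    also have "\<dots> = I (Suc k)"
    proof -
      have "r < 2 * 2 ^ k" if "r < 2 ^ k" for r :: real
        using that zero_less_power[of "2::real" k] by linarith
      then show ?thesis
        unfolding I_def by (intro nn_integral_cong) (auto simp: indicator_def)
    qed
    finally show ?thesis .
  qed
  have lower: "I k \<ge> ennreal (real k * c)" for k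
  proof (induction k)
    case (Suc k)
    have "ennreal (Suc k * c) = ennreal (k * c) + ennreal c"
      using c by (simp add: algebra_simps flip: ennreal_plus)
    also have "\<dots> \<le> I k + ennreal c" by (intro add_right_mono Suc)
    also have "\<dots> \<le> I (Suc k)" by (rule step)
    finally show ?case .
  qed simp
  have "I k \<le> C" for k
  proof -
    have "I k \<le> (\<integral>\<^sup>+x\<in>ball 0 (2^k). ennreal (jb (x::real^'n) powr - a) \<partial>lborel)"
      unfolding I_def using a
      by (intro nn_integral_mono mult_right_mono ennreal_leI jb_powr_mono) (auto simp: n_def)
    also have "\<dots> \<le> C" by (rule bd)
    finally show ?thesis .
  qed
  then have *: "ennreal (real k * c) \<le> C" for k :: nat using order_trans[OF lower[of k]] by blast
  obtain r where r: "C = ennreal r" "r \<ge> 0" using \<open>C < \<infinity>\<close> by (cases C) auto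
  obtain k :: nat where "r < real k * c" using reals_Archimedean3[OF c] by blast
  with *[of k] r show False by simp
qed

section \<open>Translation and reflection invariance of Lebesgue integrals\<close>

lemma lborel_distr_reflect: "distr lborel borel (\<lambda>x. c - x) = (lborel :: (real^'n::finite) measure)"
  by (subst lborel_affine[of "-1" c]) (auto simp: density_1)

lemma nn_integral_shift:
  fixes c :: "'a::euclidean_space" assumes [measurable]: "f \<in> borel_measurable borel"
  shows "(\<integral>\<^sup>+x. f (x + c) \<partial>lborel) = (\<integral>\<^sup>+x. f x \<partial>lborel)"
proof -
  have "(\<integral>\<^sup>+x. f x \<partial>lborel) = (\<integral>\<^sup>+x. f x \<partial>(distr lborel borel ((+) c)))"
    by (simp add: lborel_distr_plus)
  also have "\<dots> = (\<integral>\<^sup>+x. f (x + c) \<partial>lborel)" by (subst nn_integral_distr) (auto simp: add.commute)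
  finally show ?thesis by simp
qed

lemma nn_integral_reflect:
  fixes c :: "real^'n::finite" assumes [measurable]: "f \<in> borel_measurable borel"
  shows "(\<integral>\<^sup>+x. f (c - x) \<partial>lborel) = (\<integral>\<^sup>+x. f x \<partial>lborel)"
proof -
  have "(\<integral>\<^sup>+x. f x \<partial>lborel) = (\<integral>\<^sup>+x. f x \<partial>(distr lborel borel (\<lambda>x. c - x)))"
    by (simp add: lborel_distr_reflect)
  also have "\<dots> = (\<integral>\<^sup>+x. f (c - x) \<partial>lborel)" by (subst nn_integral_distr) auto
  finally show ?thesis by simp
qed

lemma integral_shift:
  fixes c :: "'a::euclidean_space" and f :: "'a \<Rightarrow> 'b::{banach, second_countable_topology}"
  assumes [measurable]: "f \<in> borel_measurable borel"
  shows "(LINT x|lborel. f (x + c)) = (LINT x|lborel. f x)"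
    and "integrable lborel (\<lambda>x. f (x + c)) \<longleftrightarrow> integrable lborel f"
proof -
  have "(LINT x|lborel. f x) = (LINT x|(distr lborel borel ((+) c)). f x)"
    by (simp add: lborel_distr_plus)
  also have "\<dots> = (LINT x|lborel. f (x + c))" by (subst integral_distr) (auto simp: add.commute)
  finally show "(LINT x|lborel. f (x + c)) = (LINT x|lborel. f x)" by simp
  have "integrable lborel f \<longleftrightarrow> integrable (distr lborel borel ((+) c)) f"
    by (simp add: lborel_distr_plus)
  also have "\<dots> \<longleftrightarrow> integrable lborel (\<lambda>x. f (x + c))" by (subst integrable_distr_eq) (auto simp: add.commute)
  finally show "integrable lborel (\<lambda>x. f (x + c)) \<longleftrightarrow> integrable lborel f" by simp
qed

lemma integral_reflect:
  fixes c :: "real^'n::finite" and f :: "real^'n \<Rightarrow> 'b::{banach, second_countable_topology}"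
  assumes [measurable]: "f \<in> borel_measurable borel"
  shows "(LINT x|lborel. f (c - x)) = (LINT x|lborel. f x)"
    and "integrable lborel (\<lambda>x. f (c - x)) \<longleftrightarrow> integrable lborel f"
proof -
  have "(LINT x|lborel. f x) = (LINT x|(distr lborel borel (\<lambda>x. c - x)). f x)"
    by (simp add: lborel_distr_reflect)
  also have "\<dots> = (LINT x|lborel. f (c - x))" by (subst integral_distr) auto
  finally show "(LINT x|lborel. f (c - x)) = (LINT x|lborel. f x)" by simp
  have "integrable lborel f \<longleftrightarrow> integrable (distr lborel borel (\<lambda>x. c - x)) f"
    by (simp add: lborel_distr_reflect)
  also have "\<dots> \<longleftrightarrow> integrable lborel (\<lambda>x. f (c - x))" by (subst integrable_distr_eq) auto
  finally show "integrable lborel (\<lambda>x. f (c - x)) \<longleftrightarrow> integrable lborel f" by simp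
qed


subsection \<open>Lebesgue norms\<close>

lemma ennreal_powr_mono: "x \<le> y \<Longrightarrow> 0 \<le> a \<Longrightarrow> ennreal_powr x a \<le> ennreal_powr y a"
  unfolding ennreal_powr_def
  by (auto simp: less_top[symmetric] top_unique intro!: ennreal_leI powr_mono2 enn2real_mono)

lemma ennreal_powr_ennreal [simp]: "0 \<le> r \<Longrightarrow> ennreal_powr (ennreal r) a = ennreal (r powr a)"
  by (simp add: ennreal_powr_def)

lemma ennreal_powr_top [simp]: "ennreal_powr \<top> a = \<top>"
  by (simp add: ennreal_powr_def)

lemma ennreal_powr_0 [simp]: "ennreal_powr 0 a = 0"
  by (simp add: ennreal_powr_def)

lemma ennreal_powr_eq_0_iff [simp]: "ennreal_powr x a = 0 \<longleftrightarrow> x = 0"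
  by (cases x) (auto simp: ennreal_powr_def)

lemma ennreal_powr_eq_top_iff [simp]: "ennreal_powr x a = \<top> \<longleftrightarrow> x = \<top>"
  by (cases x) (auto simp: ennreal_powr_def)

lemma ennreal_powr_1 [simp]: "ennreal_powr x 1 = x"
  by (cases x) auto

lemma ennreal_powr_mult: "ennreal_powr (x * y) a = ennreal_powr x a * ennreal_powr y a"
proof (cases x; cases y)
  fix r s :: real assume "x = ennreal r" "0 \<le> r" "y = ennreal s" "0 \<le> s"
  then show ?thesis by (simp add: powr_mult flip: ennreal_mult)
qed (auto simp: ennreal_mult_top ennreal_top_mult)

lemma ennreal_powr_powr: "ennreal_powr (ennreal_powr x a) b = ennreal_powr x (a * b)"
  by (cases x) (auto simp: powr_powr)

lemma borel_measurable_ennreal_powr [measurable]: "(\<lambda>x. ennreal_powr x a) \<in> borel_measurable borel"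
  unfolding ennreal_powr_def by measurable

lemma Lp_norm_infinity: "Lp_norm \<infinity> f = esssup lborel f"
  by (simp add: Lp_norm_def)

lemma Lp_norm_ereal:
  "Lp_norm (ereal r) f = ennreal_powr (\<integral>\<^sup>+ x. ennreal_powr (f x) r \<partial>lborel) (1 / r)"
  by (simp add: Lp_norm_def)

lemma ennreal_powr_Lp_norm:
  "r \<noteq> 0 \<Longrightarrow> ennreal_powr (Lp_norm (ereal r) f) r = (\<integral>\<^sup>+ x. ennreal_powr (f x) r \<partial>lborel)"
  by (simp add: Lp_norm_ereal ennreal_powr_powr)

lemma Lp_norm_1: "Lp_norm 1 f = (\<integral>\<^sup>+ x. f x \<partial>lborel)"
  by (simp add: Lp_norm_def)

lemma exponent_cases:
  assumes "(1::ereal) \<le> p"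
  obtains "p = \<infinity>" | r where "p = ereal r" "1 \<le> r"
  using assms by (cases p) (auto simp: one_ereal_def)

lemma Lp_norm_mono:
  assumes "1 \<le> p" and [measurable]: "f \<in> borel_measurable borel" and "\<And>x. f x \<le> g x"
  shows "Lp_norm p f \<le> Lp_norm p g"
  using assms(1)
proof (cases rule: exponent_cases)
  case 1
  then show ?thesis using assms by (simp add: Lp_norm_infinity esssup_mono)
next
  case (2 r)
  then show ?thesis using assms
    by (auto simp: Lp_norm_ereal intro!: ennreal_powr_mono nn_integral_mono)
qed

lemma Lp_norm_cmult:
  assumes "1 \<le> p" and [measurable]: "f \<in> borel_measurable borel"
  shows "Lp_norm p (\<lambda>x. c * f x) \<le> c * Lp_norm p f"
  using assms(1)
proof (cases rule: exponent_cases)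
  case 1
  have "AE x in lborel. c * f x \<le> c * esssup lborel f"
    using esssup_AE[of f lborel] by eventually_elim (auto intro: mult_left_mono)
  then show ?thesis using 1 by (auto simp: Lp_norm_infinity)
next
  case (2 r)
  then show ?thesis
    by (simp add: Lp_norm_ereal ennreal_powr_mult nn_integral_cmult ennreal_powr_powr)
qed

lemma Lp_norm_shift:
  assumes "1 \<le> p" and [measurable]: "f \<in> borel_measurable borel"
  shows "Lp_norm p (\<lambda>x. f (x + c)) = Lp_norm p f"
  using assms(1)
proof (cases rule: exponent_cases)
  case 1
  have *: "esssup lborel (\<lambda>x. f (x + c)) \<le> esssup lborel f"
    if [measurable]: "f \<in> borel_measurable borel" for f :: "real^'n \<Rightarrow> ennreal" and c
  proof -
    have "AE x in distr lborel borel ((+) c). f x \<le> esssup lborel f"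
      unfolding lborel_distr_plus by (rule esssup_AE)
    then have "AE x in lborel. f (x + c) \<le> esssup lborel f"
      by (subst (asm) AE_distr_iff) (auto simp: add.commute)
    then show ?thesis by auto
  qed
  from *[of f c] *[of "\<lambda>x. f (x + c)" "- c"] show ?thesis
    using 1 by (auto simp: Lp_norm_infinity intro: antisym)
next
  case (2 r)
  then show ?thesis using nn_integral_shift[of "\<lambda>x. ennreal_powr (f x) r" c]
    by (simp add: Lp_norm_ereal)
qed

text \<open>For finite exponents this is Tonelli. For p = infinity the superlevel sets are
  rewritten: the essential supremum exceeds \<open>a\<close> exactly when the set where the slice
  exceeds \<open>a\<close> has positive measure, and that measure is again measurable in
  \<open>y\<close>.\<close>

lemma Lp_norm_measurable:
  fixes F :: "real^'n::finite \<Rightarrow> 'b::euclidean_space \<Rightarrow> ennreal"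
  assumes "1 \<le> p" and [measurable]: "case_prod F \<in> borel_measurable (borel \<Otimes>\<^sub>M borel)"
  shows "(\<lambda>y. Lp_norm p (\<lambda>x. F x y)) \<in> borel_measurable borel"
  using assms(1)
proof (cases rule: exponent_cases)
  case 1
  have "(\<lambda>y. esssup lborel (\<lambda>x. F x y)) \<in> borel_measurable borel"
  proof (rule borel_measurableI_greater)
    fix a
    have eq: "a < esssup lborel (\<lambda>x. F x y) \<longleftrightarrow> emeasure lborel {x. a < F x y} \<noteq> 0" for y
    proof
      assume "a < esssup lborel (\<lambda>x. F x y)"
      then show "emeasure lborel {x. a < F x y} \<noteq> 0"
        using esssup_pos_measure[of "\<lambda>x. F x y" lborel a] by auto
    next
      assume *: "emeasure lborel {x. a < F x y} \<noteq> 0"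
      show "a < esssup lborel (\<lambda>x. F x y)"
      proof (rule ccontr)
        assume "\<not> a < esssup lborel (\<lambda>x. F x y)"
        then have "AE x in lborel. F x y \<le> a"
          using esssup_AE[of "\<lambda>x. F x y" lborel] by (auto elim: eventually_mono)
        then have "emeasure lborel {x \<in> space lborel. \<not> F x y \<le> a} = 0"
          by (subst (asm) AE_iff_measurable[OF _ refl]) auto
        then show False using * by (simp add: not_le)
      qed
    qed
    have "(\<lambda>y. \<integral>\<^sup>+x. indicator {x. a < F x y} x \<partial>lborel) \<in> borel_measurable borel"
    proof -
      have "(\<lambda>y. \<integral>\<^sup>+x. (if a < F x y then 1 else 0) \<partial>lborel) \<in> borel_measurable borel"
        by measurable
      then show ?thesis by (simp add: indicator_def)
    qed
    then have "(\<lambda>y. emeasure lborel {x. a < F x y}) \<in> borel_measurable borel"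
      by (subst (asm) nn_integral_indicator) auto
    then show "{y \<in> space borel. a < esssup lborel (\<lambda>x. F x y)} \<in> sets borel"
      unfolding eq by measurable
  qed
  then show ?thesis using 1 by (simp add: Lp_norm_infinity)
next
  case (2 r)
  have "(\<lambda>y. \<integral>\<^sup>+x. ennreal_powr (F x y) r \<partial>lborel) \<in> borel_measurable borel" by measurable
  then show ?thesis unfolding 2 Lp_norm_ereal by measurable
qed

text \<open>A Jensen inequality with a lossy constant. The pointwise bound u <= l + l^(1-r) u^r,
  applied to u = \<phi> / w and integrated against \<open>w\<close>, gives \<open>key\<close> for
  every l > 0; the choice of \<open>l\<close> that balances the two terms costs the factor 2^r. Its
  r-th root is the factor 2 in Minkowski's inequality.\<close>

lemma weighted_power_mean_le:
  fixes w \<phi> :: "'a \<Rightarrow> ennreal"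
  assumes r: "1 \<le> r" and [measurable]: "w \<in> borel_measurable M" "\<phi> \<in> borel_measurable M"
    and w: "AE y in M. 0 < w y \<and> w y < \<infinity>"
    and B: "(\<integral>\<^sup>+y. w y \<partial>M) = ennreal B" "B > 0"
  shows "ennreal_powr (\<integral>\<^sup>+y. \<phi> y \<partial>M) r \<le>
    ennreal (2 powr r * B powr (r - 1)) * (\<integral>\<^sup>+y. w y * ennreal_powr (\<phi> y / w y) r \<partial>M)"
proof -
  define J where "J = (\<integral>\<^sup>+y. w y * ennreal_powr (\<phi> y / w y) r \<partial>M)"
  have key: "(\<integral>\<^sup>+y. \<phi> y \<partial>M) \<le> ennreal (l * B) + ennreal (l powr (1 - r)) * J" if l: "l > 0" for l :: real
  proof -
    have "(\<integral>\<^sup>+y. \<phi> y \<partial>M) \<le> (\<integral>\<^sup>+y. ennreal l * w y + ennreal (l powr (1 - r)) * (w y * ennreal_powr (\<phi> y / w y) r) \<partial>M)"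
    proof (rule nn_integral_mono_AE)
      show "AE y in M. \<phi> y \<le> ennreal l * w y + ennreal (l powr (1 - r)) * (w y * ennreal_powr (\<phi> y / w y) r)"
        using w
      proof eventually_elim
        case (elim y)
        obtain v where v: "w y = ennreal v" "v > 0" using elim by (cases "w y") auto
        show ?case
        proof (cases "\<phi> y")
          case top
          then show ?thesis using v l
            by (simp add: ennreal_top_divide ennreal_mult_top)
        next
          case (real t)
          define u where "u = t / v"
          have u: "u \<ge> 0" "t = u * v" using v real by (auto simp: u_def)
          have "u \<le> l + l powr (1 - r) * u powr r"
          proof (cases "u \<le> l")
            case True
            then show ?thesis using l by (simp add: add_increasing2)
          next
            case False
            then have "u > 0" using l by simp
            have "1 \<le> (u / l) powr (r - 1)" using False l r by (intro ge_one_powr_ge_zero) auto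
            then have "u \<le> u * (u / l) powr (r - 1)" using u by (simp add: mult_le_cancel_left1)
            also have "\<dots> = l powr (1 - r) * u powr r"
              using \<open>u > 0\<close> l by (simp add: powr_divide powr_diff field_simps)
            finally show ?thesis using l by simp
          qed
          then have "v * u \<le> v * (l + l powr (1 - r) * u powr r)" using v by (intro mult_left_mono) auto
          then have "t \<le> l * v + l powr (1 - r) * (v * u powr r)" using u by (simp add: algebra_simps)
          then have "ennreal t \<le> ennreal (l * v + l powr (1 - r) * (v * u powr r))" by (rule ennreal_leI)
          also have "\<dots> = ennreal l * ennreal v + ennreal (l powr (1 - r)) * (ennreal v * ennreal (u powr r))"
            using v l u by (simp add: ennreal_mult ennreal_plus)
          also have "\<phi> y / w y = ennreal u" using v real by (simp add: divide_ennreal u_def)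
          then have "ennreal l * ennreal v + ennreal (l powr (1 - r)) * (ennreal v * ennreal (u powr r))
              = ennreal l * w y + ennreal (l powr (1 - r)) * (w y * ennreal_powr (\<phi> y / w y) r)"
            using v u(1) by simp
          finally show ?thesis using real by simp
        qed
      qed
    qed
    also have "\<dots> = ennreal l * (\<integral>\<^sup>+y. w y \<partial>M) + ennreal (l powr (1 - r)) * J"
      unfolding J_def by (subst nn_integral_add) (auto simp: nn_integral_cmult)
    finally show ?thesis using l B by (simp add: ennreal_mult)
  qed
  show ?thesis
  proof (cases J)
    case top
    have "ennreal (2 powr r * B powr (r - 1)) \<noteq> 0" using B by simp
    then show ?thesis using top unfolding J_def by (simp add: ennreal_mult_top)
  next
    case (real j)
    show ?thesis
    proof (cases "j = 0")
      \<comment> \<open>With J = 0 there is nothing to balance; \<open>l\<close> is sent to 0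
        instead.\<close>
      case True
      have "(\<integral>\<^sup>+y. \<phi> y \<partial>M) \<le> ennreal e" if "e > 0" for e
        using key[of "e / B"] that B real True by simp
      then have "(\<integral>\<^sup>+y. \<phi> y \<partial>M) \<le> 0" by - (rule ennreal_le_epsilon, simp)
      then show ?thesis by simp
    next
      case False
      then have j: "j > 0" using real by simp
      \<comment> \<open>Solves l^(1-r) J = l B, so that both terms of \<open>key\<close>
        agree.\<close>
      define l where "l = (j / B) powr (1 / r)"
      have l: "l > 0" using j B by (simp add: l_def)
      have "l powr r = j / B" using r j B by (simp add: l_def powr_powr)
      then have "l powr (1 - r) * j = l * B" using l j B by (simp add: powr_diff field_simps)
      then have "(\<integral>\<^sup>+y. \<phi> y \<partial>M) \<le> ennreal (2 * l * B)"
        using key[OF l] real l B by (simp add: mult_ac flip: ennreal_mult ennreal_plus)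
      then have "ennreal_powr (\<integral>\<^sup>+y. \<phi> y \<partial>M) r \<le> ennreal_powr (ennreal (2 * l * B)) r"
        using r by (intro ennreal_powr_mono) auto
      also have "\<dots> = ennreal ((2 * l * B) powr r)" using l B by simp
      also have "(2 * l * B) powr r = 2 powr r * (j / B) * B powr r"
        using l B \<open>l powr r = j / B\<close> by (simp add: powr_mult)
      also have "\<dots> = 2 powr r * B powr (r - 1) * j"
        using B by (simp add: powr_diff field_simps)
      also have "\<dots> = ennreal (2 powr r * B powr (r - 1)) * J"
        using real j by (simp add: ennreal_mult)
      finally show ?thesis by (simp add: J_def)
    qed
  qed
qed

text \<open>The weight in the power mean inequality is the norm of the slice F(., y) itself: after
  Tonelli the inner integral is at most w(y), and what remains is the total mass of
  \<open>w\<close>. A vanishing slice norm would be divided by, so \<open>w\<close> adds to it a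
  small multiple of a positive integrable function, which disappears at the end as \<open>e\<close>
  tends to 0.\<close>

lemma Lp_norm_Minkowski:
  fixes F :: "real^'n::finite \<Rightarrow> 'b::euclidean_space \<Rightarrow> ennreal"
  assumes "1 \<le> p" and M[measurable]: "case_prod F \<in> borel_measurable (borel \<Otimes>\<^sub>M borel)"
  shows "Lp_norm p (\<lambda>x. \<integral>\<^sup>+y. F x y \<partial>lborel) \<le> 2 * (\<integral>\<^sup>+y. Lp_norm p (\<lambda>x. F x y) \<partial>lborel)"
  using assms(1)
proof (cases rule: exponent_cases)
  case 1
  define n where "n y = esssup lborel (\<lambda>x. F x y)" for y
  have [measurable]: "n \<in> borel_measurable borel"
    using Lp_norm_measurable[OF _ M, of \<infinity>] unfolding n_def by (simp add: Lp_norm_infinity)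
  \<comment> \<open>The null sets of the single slices have to be merged into one; exchanging the
    two almost-everywhere quantifiers uses joint measurability of the exceptional set.\<close>
  have "AE y in lborel. AE x in lborel. F x y \<le> n y"
    unfolding n_def by (intro AE_I2 esssup_AE)
  moreover have "{z \<in> space (lborel \<Otimes>\<^sub>M lborel). F (fst z) (snd z) \<le> n (snd z)} \<in> sets (lborel \<Otimes>\<^sub>M lborel)"
    by measurable
  ultimately have "AE x in lborel. AE y in lborel. F x y \<le> n y"
    using lborel_pair.AE_commute[of "\<lambda>x y. F x y \<le> n y"] by simp
  then have "AE x in lborel. (\<integral>\<^sup>+y. F x y \<partial>lborel) \<le> (\<integral>\<^sup>+y. n y \<partial>lborel)"
    by eventually_elim (rule nn_integral_mono_AE)
  then have "esssup lborel (\<lambda>x. \<integral>\<^sup>+y. F x y \<partial>lborel) \<le> (\<integral>\<^sup>+y. esssup lborel (\<lambda>x. F x y) \<partial>lborel)"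
    unfolding n_def[symmetric] by (intro esssup_I) auto
  also have "\<dots> \<le> 2 * \<dots>" by (simp add: mult_2 add_increasing)
  finally show ?thesis using 1 by (simp add: Lp_norm_infinity)
next
  case (2 r)
  define N where "N y = Lp_norm p (\<lambda>x. F x y)" for y
  have [measurable]: "N \<in> borel_measurable borel"
    unfolding N_def by (rule Lp_norm_measurable[OF assms])
  show ?thesis
  proof (cases "\<integral>\<^sup>+y. N y \<partial>lborel")
    case top
    then show ?thesis unfolding N_def by (simp add: ennreal_mult_top)
  next
    case (real A)
    obtain k :: "'b \<Rightarrow> real" where k[measurable]: "k \<in> borel_measurable lborel"
      and kpos: "\<And>x. 0 < k x" and "\<And>x. k x \<le> 1" and kint: "integrable lborel k"
      using sigma_finite_measure.obtain_positive_integrable_function[OF sigma_finite_lborel] by blast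
    define K where "K = integral\<^sup>L lborel k"
    have K: "(\<integral>\<^sup>+y. ennreal (k y) \<partial>lborel) = ennreal K"
      unfolding K_def using kint kpos by (intro nn_integral_eq_integral) (auto intro: less_imp_le)
    have "K \<noteq> 0"
    proof
      assume "K = 0"
      then have "(\<integral>\<^sup>+y. ennreal (k y) \<partial>lborel) = 0" using K by simp
      then have "AE y in (lborel::'b measure). ennreal (k y) = 0"
        by (subst (asm) nn_integral_0_iff_AE) (use k in auto)
      then have "AE y in (lborel::'b measure). False" by (rule eventually_mono) (metis ennreal_eq_0_iff kpos not_le)
      then have "ae_filter (lborel::'b measure) = bot" by (simp only: eventually_False)
      then show False by (simp add: ae_filter_eq_bot_iff)
    qed
    moreover have "K \<ge> 0" unfolding K_def using kpos by (intro integral_nonneg_AE) (auto intro: less_imp_le)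
    ultimately have Kpos: "K > 0" by simp
    have bound: "Lp_norm p (\<lambda>x. \<integral>\<^sup>+y. F x y \<partial>lborel) \<le> ennreal (2 * A + 2 * e)" if e: "e > 0" for e
    proof -
      define w where "w y = N y + ennreal (e / K) * ennreal (k y)" for y
      have [measurable]: "w \<in> borel_measurable borel" unfolding w_def using k by measurable
      define B where "B = A + e"
      have B: "(\<integral>\<^sup>+y. w y \<partial>lborel) = ennreal B" "B > 0"
      proof -
        have "(\<integral>\<^sup>+y. w y \<partial>lborel) = ennreal A + (\<integral>\<^sup>+y. ennreal (e / K) * ennreal (k y) \<partial>lborel)"
          unfolding w_def real(2)[symmetric] by (rule nn_integral_add) (use k in measurable)
        also have "\<dots> = ennreal A + ennreal (e / K) * ennreal K"
          by (subst nn_integral_cmult) (use k K in auto)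
        also have "\<dots> = ennreal B" using e Kpos real by (simp add: B_def flip: ennreal_mult)
        finally show "(\<integral>\<^sup>+y. w y \<partial>lborel) = ennreal B" .
        show "B > 0" using e real by (simp add: B_def)
      qed
      have wpos: "0 < w y" for y
        using e Kpos kpos[of y] by (simp add: w_def add_nonneg_pos ennreal_zero_less_mult_iff)
      have wfin: "AE y in lborel. w y < \<infinity>"
        using nn_integral_PInf_AE[of w lborel] B by (auto simp: less_top)
      have wAE: "AE y in lborel. 0 < w y \<and> w y < \<infinity>" using wfin wpos by auto
      have "(\<integral>\<^sup>+x. ennreal_powr (\<integral>\<^sup>+y. F x y \<partial>lborel) r \<partial>lborel) \<le>
         (\<integral>\<^sup>+x. ennreal (2 powr r * B powr (r - 1)) * (\<integral>\<^sup>+y. w y * ennreal_powr (F x y / w y) r \<partial>lborel) \<partial>lborel)"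
        by (rule nn_integral_mono, rule weighted_power_mean_le[OF 2(2) _ _ wAE B]) measurable
      also have "\<dots> = ennreal (2 powr r * B powr (r - 1)) * (\<integral>\<^sup>+x. \<integral>\<^sup>+y. w y * ennreal_powr (F x y / w y) r \<partial>lborel \<partial>lborel)"
        by (rule nn_integral_cmult) measurable
      also have "(\<integral>\<^sup>+x. \<integral>\<^sup>+y. w y * ennreal_powr (F x y / w y) r \<partial>lborel \<partial>lborel)
          = (\<integral>\<^sup>+y. \<integral>\<^sup>+x. w y * ennreal_powr (F x y / w y) r \<partial>lborel \<partial>lborel)"
        by (rule lborel_pair.Fubini') measurable
      also have "\<dots> \<le> (\<integral>\<^sup>+y. w y \<partial>lborel)"
      proof (rule nn_integral_mono_AE, use wAE in eventually_elim)
        case (elim y)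
        obtain v where v: "w y = ennreal v" "v > 0" using elim by (cases "w y") auto
        have "(\<integral>\<^sup>+x. w y * ennreal_powr (F x y / w y) r \<partial>lborel)
          = (\<integral>\<^sup>+x. w y * ennreal_powr (1 / w y) r * ennreal_powr (F x y) r \<partial>lborel)"
          by (intro nn_integral_cong) (simp add: divide_ennreal_def ennreal_powr_mult mult_ac)
        also have "\<dots> = w y * ennreal_powr (1 / w y) r * ennreal_powr (N y) r"
        proof (subst nn_integral_cmult)
          show "(\<lambda>x. ennreal_powr (F x y) r) \<in> borel_measurable lborel" by measurable
        qed (use 2 in \<open>simp add: N_def ennreal_powr_Lp_norm\<close>)
        also have "\<dots> \<le> w y * ennreal_powr (1 / w y) r * ennreal_powr (w y) r"
          using 2 by (intro mult_left_mono ennreal_powr_mono) (auto simp: w_def)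
        also have "inverse v powr r * v powr r = 1" using v by (simp flip: powr_mult)
        then have "w y * ennreal_powr (1 / w y) r * ennreal_powr (w y) r = w y"
          using v by (simp add: mult.assoc divide_ennreal_def inverse_ennreal flip: ennreal_powr_mult ennreal_mult)
        finally show ?case .
      qed
      finally have "(\<integral>\<^sup>+x. ennreal_powr (\<integral>\<^sup>+y. F x y \<partial>lborel) r \<partial>lborel) \<le> ennreal (2 powr r * B powr (r - 1)) * ennreal B"
        using B by (simp add: mult_left_mono)
      also have "\<dots> = ennreal ((2 * B) powr r)"
        using B by (simp add: powr_mult powr_diff flip: ennreal_mult)
      finally have "Lp_norm p (\<lambda>x. \<integral>\<^sup>+y. F x y \<partial>lborel) \<le> ennreal_powr (ennreal ((2 * B) powr r)) (1 / r)"
        unfolding 2 Lp_norm_ereal using 2 by (intro ennreal_powr_mono) auto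
      also have "\<dots> = ennreal (2 * A + 2 * e)" using B 2 by (simp add: powr_powr B_def algebra_simps)
      finally show ?thesis .
    qed
    have "Lp_norm p (\<lambda>x. \<integral>\<^sup>+y. F x y \<partial>lborel) \<le> ennreal (2 * A)"
    proof (rule ennreal_le_epsilon)
      fix e :: real assume "e > 0"
      then show "Lp_norm p (\<lambda>x. \<integral>\<^sup>+y. F x y \<partial>lborel) \<le> ennreal (2 * A) + ennreal e"
        using bound[of "e / 2"] real by simp
    qed
    then show ?thesis using real unfolding N_def[symmetric] by (simp add: ennreal_mult)
  qed
qed

text \<open>The sum is an integral over y in [0, 2) of a two-step family, which makes it a special
  case of the integral inequality.\<close>

lemma Lp_norm_add:
  fixes f g :: "real^'n::finite \<Rightarrow> ennreal"
  assumes "1 \<le> p" and [measurable]: "f \<in> borel_measurable borel" "g \<in> borel_measurable borel"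
  shows "Lp_norm p (\<lambda>x. f x + g x) \<le> 2 * (Lp_norm p f + Lp_norm p g)"
proof -
  define F where "F x y = f x * indicator {0..<1} y + g x * indicator {1..<2} y" for x :: "real^'n" and y :: real
  have [measurable]: "case_prod F \<in> borel_measurable (borel \<Otimes>\<^sub>M borel)"
    unfolding F_def by measurable
  have "(\<integral>\<^sup>+y. F x y \<partial>lborel) = f x + g x" for x
    unfolding F_def by (subst nn_integral_add) (auto simp: nn_integral_cmult_indicator)
  then have *: "Lp_norm p (\<lambda>x. f x + g x) \<le> 2 * (\<integral>\<^sup>+y. Lp_norm p (\<lambda>x. F x y) \<partial>lborel)"
    using Lp_norm_Minkowski[of p F] assms by simp
  have "(\<integral>\<^sup>+y. Lp_norm p (\<lambda>x. F x y) \<partial>lborel) \<le>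
     (\<integral>\<^sup>+(y::real). Lp_norm p f * indicator {0..<1} y + Lp_norm p g * indicator {1..<2} y \<partial>lborel)"
  proof (intro nn_integral_mono)
    fix y :: real
    have z: "Lp_norm p (\<lambda>x::real^'n. 0) = 0"
      using Lp_norm_cmult[of p "\<lambda>_::real^'n. 0" 0] assms by simp
    consider "y \<in> {0..<1}" | "y \<in> {1..<2}" | "y \<notin> {0..<1}" "y \<notin> {1..<2}" by auto
    then show "Lp_norm p (\<lambda>x. F x y) \<le> Lp_norm p f * indicator {0..<1} y + Lp_norm p g * indicator {1..<2} y"
      by cases (auto simp: F_def z)
  qed
  also have "\<dots> = Lp_norm p f + Lp_norm p g"
    by (subst nn_integral_add) (auto simp: nn_integral_cmult_indicator)
  finally show ?thesis using * by (meson mult_left_mono order_trans zero_le)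
qed

section \<open>Conjugate exponents and the inequalities of Hoelder and Young\<close>

lemma conjugate_exponent_cases:
  assumes "1 \<le> p" "1 \<le> p'" "1 / p + 1 / p' = (1::ereal)"
  obtains "p = 1" "p' = \<infinity>" | "p = \<infinity>" "p' = 1"
    | r r' where "p = ereal r" "p' = ereal r'" "1 < r" "1 < r'" "1 / r + 1 / r' = 1"
proof (cases p; cases p')
  fix r r' assume *: "p = ereal r" "p' = ereal r'"
  then have "r \<ge> 1" "r' \<ge> 1" using assms by (auto simp: one_ereal_def)
  moreover have "1 / r + 1 / r' = 1" using assms * \<open>r \<ge> 1\<close> \<open>r' \<ge> 1\<close>
    by (simp add: one_ereal_def divide_ereal_def inverse_eq_divide)
  moreover from this have "r \<noteq> 1" "r' \<noteq> 1" using \<open>r \<ge> 1\<close> \<open>r' \<ge> 1\<close> by (auto simp: field_simps)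
  ultimately show ?thesis using that(3)[OF *] by linarith
next
  fix r assume *: "p = ereal r" "p' = \<infinity>"
  then have "r \<ge> 1" using assms by (auto simp: one_ereal_def)
  moreover have "1 / r = 1" using * assms \<open>r \<ge> 1\<close> by (simp add: one_ereal_def divide_ereal_def inverse_eq_divide)
  ultimately show ?thesis using that(1) * by (simp add: one_ereal_def)
next
  fix r assume *: "p' = ereal r" "p = \<infinity>"
  then have "r \<ge> 1" using assms by (auto simp: one_ereal_def)
  moreover have "1 / r = 1" using * assms \<open>r \<ge> 1\<close> by (simp add: one_ereal_def divide_ereal_def inverse_eq_divide)
  ultimately show ?thesis using that(2) * by (simp add: one_ereal_def)
qed (use assms in auto)

lemma conjugate_exponent_exists:
  assumes "1 \<le> (p::ereal)" obtains p' where "1 \<le> p'" "1 / p + 1 / p' = 1"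
proof (cases "p = 1 \<or> p = \<infinity>")
  case True
  then show ?thesis using that[of "if p = 1 then \<infinity> else 1"] by auto
next
  case False
  then obtain r where r: "p = ereal r" "r > 1" using assms by (cases p) (auto simp: one_ereal_def)
  show ?thesis
  proof (rule that[of "ereal (r / (r - 1))"])
    show "1 \<le> ereal (r / (r - 1))" using r by (simp add: one_ereal_def)
    show "1 / p + 1 / ereal (r / (r - 1)) = 1" using r
      by (simp add: one_ereal_def divide_ereal_def field_simps)
  qed
qed

lemma Lp_norm_eq_0_imp:
  assumes "1 \<le> p" and [measurable]: "f \<in> borel_measurable borel" and "Lp_norm p f = 0"
  shows "AE x in lborel. f x = 0"
  using assms(1)
proof (cases rule: exponent_cases)
  case 1
  then show ?thesis using assms esssup_AE[of f lborel] by (simp add: Lp_norm_infinity)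
next
  case (2 r)
  then show ?thesis using assms(3) by (simp add: Lp_norm_ereal nn_integral_0_iff_AE)
qed

text \<open>Both functions are normalised by their norms and Young's inequality is applied
  pointwise. The factors 1/r and 1/r' are bounded by 1, so each of the two terms integrates to 1 and
  the constant is 2. Vanishing and infinite norms are split off because the normalisation divides by
  them.\<close>

lemma Lp_Hoelder:
  fixes f g :: "real^'n::finite \<Rightarrow> ennreal"
  assumes p: "1 \<le> p" "1 \<le> p'" "1 / p + 1 / p' = 1"
    and [measurable]: "f \<in> borel_measurable borel" "g \<in> borel_measurable borel"
  shows "(\<integral>\<^sup>+x. f x * g x \<partial>lborel) \<le> 2 * (Lp_norm p f * Lp_norm p' g)"
proof -
  have two: "a \<le> b \<Longrightarrow> a \<le> 2 * b" for a b :: ennreal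
    by (simp add: mult_2 add_increasing)
  have inf: "(\<integral>\<^sup>+x. f x * g x \<partial>lborel) \<le> Lp_norm 1 f * Lp_norm \<infinity> g"
    if [measurable]: "f \<in> borel_measurable borel" "g \<in> borel_measurable borel" for f g :: "real^'n \<Rightarrow> ennreal"
  proof -
    have "(\<integral>\<^sup>+x. f x * g x \<partial>lborel) \<le> (\<integral>\<^sup>+x. f x * esssup lborel g \<partial>lborel)"
      by (rule nn_integral_mono_AE) (use esssup_AE[of g lborel] in \<open>eventually_elim, simp add: mult_left_mono\<close>)
    also have "\<dots> = Lp_norm 1 f * Lp_norm \<infinity> g"
      by (simp add: nn_integral_multc Lp_norm_1 Lp_norm_infinity)
    finally show ?thesis .
  qed
  from p show ?thesis
  proof (cases rule: conjugate_exponent_cases)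
    case 1
    then show ?thesis using two[OF inf[of f g]] by simp
  next
    case 2
    then show ?thesis using two[OF inf[of g f]] by (simp add: mult.commute)
  next
    case (3 r r')
    show ?thesis
    proof (cases "Lp_norm p f = 0 \<or> Lp_norm p' g = 0")
      case True
      then have "AE x in lborel. f x * g x = 0"
        using Lp_norm_eq_0_imp[of p f] Lp_norm_eq_0_imp[of p' g] p by auto
      then have "(\<integral>\<^sup>+x. f x * g x \<partial>lborel) = 0" by (subst nn_integral_0_iff_AE) auto
      then show ?thesis by simp
    next
      case False
      show ?thesis
      proof (cases "Lp_norm p f = \<infinity> \<or> Lp_norm p' g = \<infinity>")
        case True
        then show ?thesis using False by (auto simp: ennreal_mult_top ennreal_top_mult)
      next
        case fin: False
        obtain a where a: "Lp_norm p f = ennreal a" "a > 0" using False fin by (cases "Lp_norm p f") auto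
        obtain b where b: "Lp_norm p' g = ennreal b" "b > 0" using False fin by (cases "Lp_norm p' g") auto
        have fa: "(\<integral>\<^sup>+x. ennreal_powr (f x) r \<partial>lborel) = ennreal (a powr r)"
          using ennreal_powr_Lp_norm[of r f] a 3 by simp
        have gb: "(\<integral>\<^sup>+x. ennreal_powr (g x) r' \<partial>lborel) = ennreal (b powr r')"
          using ennreal_powr_Lp_norm[of r' g] b 3 by simp
        have "f x * g x \<le> ennreal (a * b) * (ennreal (a powr - r) * ennreal_powr (f x) r
            + ennreal (b powr - r') * ennreal_powr (g x) r')" for x
        proof (cases "f x"; cases "g x")
          fix s t assume st: "f x = ennreal s" "0 \<le> s" "g x = ennreal t" "0 \<le> t"
          have "(s / a) * (t / b) \<le> (s / a) powr r / r + (t / b) powr r' / r'"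
            using 3 st a b by (intro Youngs_inequality) auto
          also have "\<dots> \<le> (s / a) powr r + (t / b) powr r'"
            using 3 by (intro add_mono) (auto simp: divide_le_eq intro!: mult_le_cancel_left1[THEN iffD2])
          finally have "a * b * ((s / a) * (t / b)) \<le> a * b * ((s / a) powr r + (t / b) powr r')"
            using a b by (intro mult_left_mono) auto
          then have "s * t \<le> a * b * (a powr - r * s powr r + b powr - r' * t powr r')"
            using a b st by (simp add: powr_divide powr_minus field_simps)
          then have "ennreal (s * t) \<le> ennreal (a * b * (a powr - r * s powr r + b powr - r' * t powr r'))"
            by (rule ennreal_leI)
          then show ?thesis using st a b by (simp add: ennreal_mult ennreal_plus)
        qed (use a b in \<open>auto simp: ennreal_mult_top ennreal_top_mult\<close>)
        then have "(\<integral>\<^sup>+x. f x * g x \<partial>lborel) \<le> (\<integral>\<^sup>+x. ennreal (a * b) * (ennreal (a powr - r) * ennreal_powr (f x) r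
            + ennreal (b powr - r') * ennreal_powr (g x) r') \<partial>lborel)"
          by (rule nn_integral_mono)
        also have "\<dots> = ennreal (a * b) * (ennreal (a powr - r) * ennreal (a powr r)
            + ennreal (b powr - r') * ennreal (b powr r'))"
          by (simp add: nn_integral_cmult nn_integral_add fa gb)
        also have "ennreal (a powr - r) * ennreal (a powr r) = 1"
          using a by (simp flip: ennreal_mult powr_add)
        also have "ennreal (b powr - r') * ennreal (b powr r') = 1"
          using b by (simp flip: ennreal_mult powr_add)
        also have "ennreal (a * b) * (1 + 1) = 2 * (Lp_norm p f * Lp_norm p' g)"
          using a b by (simp add: ennreal_mult mult_ac)
        finally show ?thesis .
      qed
    qed
  qed
qed

lemma Lp_norm_jb_finite:
  assumes "1 \<le> p" "a > real CARD('n::finite)"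
  shows "Lp_norm p (\<lambda>x::real^'n. ennreal (jb x powr - a)) < \<infinity>"
  using assms(1)
proof (cases rule: exponent_cases)
  case 1
  have "Lp_norm p (\<lambda>x::real^'n. ennreal (jb x powr - a)) \<le> 1"
    using 1 assms by (auto simp: Lp_norm_infinity intro!: esssup_I AE_I2 jb_powr_le_1)
  then show ?thesis by (simp add: order_le_less_trans)
next
  case (2 r)
  have "0 \<le> a" using assms(2) by simp
  then have "a * 1 \<le> a * r" using 2 by (intro mult_left_mono) auto
  then have "(\<integral>\<^sup>+x. ennreal (jb (x::real^'n) powr - (a * r)) \<partial>lborel) < \<infinity>"
    using assms(2) by (intro nn_integral_jb_finite) linarith
  then show ?thesis using 2 by (simp add: Lp_norm_ereal powr_powr less_top[symmetric])
qed

text \<open>Young's inequality for the convolution of L^1 with L^p: Minkowski's inequality moves the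
  norm inside, where translation invariance frees it from \<open>y\<close>.\<close>

lemma Lp_norm_convolution:
  fixes k g :: "real^'n::finite \<Rightarrow> ennreal"
  assumes "1 \<le> p" and [measurable]: "k \<in> borel_measurable borel" "g \<in> borel_measurable borel"
  shows "Lp_norm p (\<lambda>x. \<integral>\<^sup>+y. k y * g (x - y) \<partial>lborel) \<le> 2 * ((\<integral>\<^sup>+y. k y \<partial>lborel) * Lp_norm p g)"
proof -
  have *: "Lp_norm p (\<lambda>x. \<integral>\<^sup>+y. k y * g (x - y) \<partial>lborel) \<le> 2 * (\<integral>\<^sup>+y. Lp_norm p (\<lambda>x. k y * g (x - y)) \<partial>lborel)"
    by (intro Lp_norm_Minkowski assms) measurable
  have "(\<integral>\<^sup>+y. Lp_norm p (\<lambda>x. k y * g (x - y)) \<partial>lborel) \<le> (\<integral>\<^sup>+y. k y * Lp_norm p g \<partial>lborel)"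
  proof (rule nn_integral_mono)
    fix y
    have "Lp_norm p (\<lambda>x. k y * g (x - y)) \<le> k y * Lp_norm p (\<lambda>x. g (x - y))"
      by (intro Lp_norm_cmult assms) measurable
    also have "Lp_norm p (\<lambda>x. g (x - y)) = Lp_norm p g"
      using Lp_norm_shift[of p g "-y"] assms by simp
    finally show "Lp_norm p (\<lambda>x. k y * g (x - y)) \<le> k y * Lp_norm p g" .
  qed
  also have "\<dots> = (\<integral>\<^sup>+y. k y \<partial>lborel) * Lp_norm p g" by (simp add: nn_integral_multc)
  finally show ?thesis using * by (meson mult_left_mono order_trans zero_le)
qed

lemma convolution_commute:
  fixes k g :: "real^'n::finite \<Rightarrow> ennreal"
  assumes [measurable]: "k \<in> borel_measurable borel" "g \<in> borel_measurable borel"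
  shows "(\<integral>\<^sup>+y. k y * g (x - y) \<partial>lborel) = (\<integral>\<^sup>+y. k (x - y) * g y \<partial>lborel)"
  using nn_integral_reflect[of "\<lambda>y. k y * g (x - y)" x] by simp

subsection \<open>Smooth functions\<close>

lemma partial_derivs_Nil [simp]: "partial_derivs [] f = f"
  and partial_derivs_Cons [simp]: "partial_derivs (i # is) f = partial_derivs is (partial_deriv i f)"
  by (simp_all add: partial_derivs_def)

abbreviation differentiable_all :: "(real ^ 'n::finite \<Rightarrow> complex) \<Rightarrow> bool" where
  "differentiable_all f \<equiv> (\<forall>x. f differentiable (at x))"

lemma smooth_fun_differentiable: "smooth_fun f \<Longrightarrow> f differentiable (at x)"
  unfolding smooth_fun_def by (drule spec[of _ "[]"]) simp

lemma smooth_fun_partial_deriv: "smooth_fun f \<Longrightarrow> smooth_fun (partial_deriv i f)"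
  unfolding smooth_fun_def
proof (intro allI)
  fix js x assume "\<forall>is x. partial_derivs is f differentiable at x"
  from this[rule_format, of "i # js" x] show "partial_derivs js (partial_deriv i f) differentiable at x"
    by simp
qed

lemma partial_deriv_eqI: "(f has_derivative f') (at x) \<Longrightarrow> partial_deriv i f x = f' (axis i 1)"
  unfolding partial_deriv_def by (drule frechet_derivative_at) simp

lemma has_derivative_partial_deriv:
  fixes f :: "real ^ 'n::finite \<Rightarrow> complex"
  assumes "f differentiable (at x)"
  shows "(f has_derivative (\<lambda>h. \<Sum>i\<in>UNIV. (h $ i) *\<^sub>R partial_deriv i f x)) (at x)"
proof -
  let ?D = "frechet_derivative f (at x)"
  have D: "(f has_derivative ?D) (at x)" using assms by (simp add: frechet_derivative_works)
  then have lin: "linear ?D" by (rule has_derivative_linear)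
  have "?D h = (\<Sum>i\<in>UNIV. (h $ i) *\<^sub>R partial_deriv i f x)" for h
  proof -
    have "?D h = ?D (\<Sum>i\<in>UNIV. (h $ i) *\<^sub>R axis i 1)"
      by (simp add: basis_expansion flip: scalar_mult_eq_scaleR)
    also have "\<dots> = (\<Sum>i\<in>UNIV. (h $ i) *\<^sub>R ?D (axis i 1))"
      by (simp add: linear_sum[OF lin] linear_scale[OF lin])
    finally show ?thesis by (simp add: partial_deriv_def)
  qed
  then have "?D = (\<lambda>h. \<Sum>i\<in>UNIV. (h $ i) *\<^sub>R partial_deriv i f x)" by (rule ext)
  then show ?thesis using D by simp
qed

lemma differentiable_all_continuous: "differentiable_all f \<Longrightarrow> continuous_on A f"
  by (meson continuous_at_imp_continuous_on differentiable_imp_continuous_within)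

lemma partial_deriv_add:
  assumes "f differentiable (at x)" "g differentiable (at x)"
  shows "partial_deriv i (\<lambda>x. f x + g x) x = partial_deriv i f x + partial_deriv i g x"
  using partial_deriv_eqI[OF has_derivative_add[OF assms[unfolded frechet_derivative_works]], of i]
  by (simp add: partial_deriv_def)

lemma partial_deriv_mult:
  assumes "f differentiable (at x)" "g differentiable (at x)"
  shows "partial_deriv i (\<lambda>x. f x * g x) x = partial_deriv i f x * g x + f x * partial_deriv i g x"
  using partial_deriv_eqI[OF has_derivative_mult[OF assms[unfolded frechet_derivative_works]], of i]
  by (simp add: partial_deriv_def add.commute)

lemma partial_deriv_const [simp]: "partial_deriv i (\<lambda>x. c) = (\<lambda>x. 0)"
  by (rule ext, rule partial_deriv_eqI[THEN trans]) (auto intro: derivative_eq_intros)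

lemma partial_deriv_cmult:
  assumes "f differentiable (at x)"
  shows "partial_deriv i (\<lambda>x. c * f x) x = c * partial_deriv i f x"
  using partial_deriv_mult[of "\<lambda>_. c" x f i] assms by simp

lemma differentiable_shift:
  fixes f :: "real ^ 'n::finite \<Rightarrow> complex"
  assumes "f differentiable (at (x - c))"
  shows "(\<lambda>x. f (x - c)) differentiable (at x)"
    and "partial_deriv i (\<lambda>x. f (x - c)) x = partial_deriv i f (x - c)"
proof -
  have "((\<lambda>x. f (x - c)) has_derivative (\<lambda>h. frechet_derivative f (at (x - c)) h)) (at x)"
    using assms by (intro has_derivative_compose[of "\<lambda>x. x - c" _ _ _ f, simplified])
      (auto intro!: derivative_eq_intros simp: frechet_derivative_works)
  then show "(\<lambda>x. f (x - c)) differentiable (at x)"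
    and "partial_deriv i (\<lambda>x. f (x - c)) x = partial_deriv i f (x - c)"
    by (auto simp: differentiable_def partial_deriv_eqI) (simp add: partial_deriv_def)
qed

lemma differentiable_scale:
  fixes f :: "real ^ 'n::finite \<Rightarrow> complex"
  assumes "f differentiable (at (r *\<^sub>R x))"
  shows "(\<lambda>x. f (r *\<^sub>R x)) differentiable (at x)"
    and "partial_deriv i (\<lambda>x. f (r *\<^sub>R x)) x = of_real r * partial_deriv i f (r *\<^sub>R x)"
proof -
  have D: "(f has_derivative frechet_derivative f (at (r *\<^sub>R x))) (at (r *\<^sub>R x))"
    using assms by (simp add: frechet_derivative_works)
  have "((\<lambda>x. r *\<^sub>R x) has_derivative (\<lambda>h. r *\<^sub>R h)) (at x)"
    by (auto intro!: derivative_eq_intros)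
  from has_derivative_compose[OF this D]
  have *: "((\<lambda>x. f (r *\<^sub>R x)) has_derivative (\<lambda>h. frechet_derivative f (at (r *\<^sub>R x)) (r *\<^sub>R h))) (at x)" .
  then show "(\<lambda>x. f (r *\<^sub>R x)) differentiable (at x)" by (auto simp: differentiable_def)
  show "partial_deriv i (\<lambda>x. f (r *\<^sub>R x)) x = of_real r * partial_deriv i f (r *\<^sub>R x)"
    using partial_deriv_eqI[OF *, of i] linear_scale[OF has_derivative_linear[OF D]]
    by (simp add: partial_deriv_def scaleR_conv_of_real)
qed

lemma differentiable_cnj:
  fixes f :: "real ^ 'n::finite \<Rightarrow> complex"
  assumes "f differentiable (at x)"
  shows "(\<lambda>x. cnj (f x)) differentiable (at x)"
    and "partial_deriv i (\<lambda>x. cnj (f x)) x = cnj (partial_deriv i f x)"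
proof -
  have *: "((\<lambda>x. cnj (f x)) has_derivative (\<lambda>h. cnj (frechet_derivative f (at x) h))) (at x)"
    using assms by (intro has_derivative_cnj) (simp add: frechet_derivative_works)
  then show "(\<lambda>x. cnj (f x)) differentiable (at x)" by (auto simp: differentiable_def)
  show "partial_deriv i (\<lambda>x. cnj (f x)) x = cnj (partial_deriv i f x)"
    using partial_deriv_eqI[OF *, of i] by (simp add: partial_deriv_def)
qed

subsection \<open>Rapid decay and moderate growth\<close>

text \<open>Sums of generators, without scalar multiples. By Leibniz's rule a family such as the
  products of two kinds of functions is closed under differentiation only up to sums; this closure
  makes an induction over multi-indices possible. Scalars have to be built into the
  generators.\<close>

inductive_set add_span :: "(real ^ 'n::finite \<Rightarrow> complex) set \<Rightarrow> (real ^ 'n \<Rightarrow> complex) set"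
  for B where
    base: "g \<in> B \<Longrightarrow> g \<in> add_span B"
  | add: "u \<in> add_span B \<Longrightarrow> v \<in> add_span B \<Longrightarrow> (\<lambda>x. u x + v x) \<in> add_span B"

text \<open>If every first derivative of a generator is again a sum of generators, then so is every
  iterated derivative, and an additive property of the generators reaches all of them. Membership in
  the Schwartz space or in the space of multipliers is thereby reduced to a single
  differentiation.\<close>

lemma add_span_partial_derivs:
  assumes diff: "\<And>g. g \<in> B \<Longrightarrow> differentiable_all g"
    and pd: "\<And>g i. g \<in> B \<Longrightarrow> partial_deriv i g \<in> add_span B"
    and P: "\<And>g. g \<in> B \<Longrightarrow> P g" and Padd: "\<And>u v. P u \<Longrightarrow> P v \<Longrightarrow> P (\<lambda>x. u x + v x)"
    and f: "f \<in> add_span B"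
  shows "smooth_fun f" "P (partial_derivs is f)"
proof -
  have 1: "differentiable_all g \<and> (\<forall>i. partial_deriv i g \<in> add_span B) \<and> P g" if "g \<in> add_span B" for g
    using that
  proof induction
    case (base g)
    then show ?case using diff pd P by auto
  next
    case (add u v)
    then have "partial_deriv i (\<lambda>x. u x + v x) = (\<lambda>x. partial_deriv i u x + partial_deriv i v x)" for i
      by (intro ext partial_deriv_add) auto
    then show ?case using add by (auto intro: add_span.add Padd)
  qed
  have 2: "partial_derivs is f \<in> add_span B" for "is"
    using f by (induction "is" arbitrary: f) (use 1 in auto)
  then show "smooth_fun f" "P (partial_derivs is f)"
    using 1 by (auto simp: smooth_fun_def)
qed

text \<open>Real exponents are allowed so that decay rates can be traded by \<open>powr\<close>
  arithmetic; \<open>schwartz_space_iff\<close> reconciles this with the natural powers of the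
  seminorms.\<close>

definition rapid :: "(real ^ 'n::finite \<Rightarrow> complex) \<Rightarrow> bool" where
  "rapid f \<longleftrightarrow> (\<forall>r. \<exists>C. \<forall>x. cmod (f x) \<le> C * jb x powr - r)"

definition slow :: "(real ^ 'n::finite \<Rightarrow> complex) \<Rightarrow> bool" where
  "slow f \<longleftrightarrow> (\<exists>r C. \<forall>x. cmod (f x) \<le> C * jb x powr r)"

lemma rapidD:
  assumes "rapid f" obtains C where "C > 0" "\<And>x. cmod (f x) \<le> C * jb x powr - r"
proof -
  obtain C where C: "\<And>x. cmod (f x) \<le> C * jb x powr - r" using assms unfolding rapid_def by blast
  have "cmod (f x) \<le> (\<bar>C\<bar> + 1) * jb x powr - r" for x
    by (rule order_trans[OF C mult_right_mono]) auto
  then show ?thesis using that[of "\<bar>C\<bar> + 1"] by simp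
qed

lemma slowD:
  assumes "slow f" obtains C r where "C > 0" "r \<ge> 0" "\<And>x. cmod (f x) \<le> C * jb x powr r"
proof -
  obtain C r where C: "\<And>x. cmod (f x) \<le> C * jb x powr r" using assms unfolding slow_def by blast
  have "cmod (f x) \<le> (\<bar>C\<bar> + 1) * jb x powr \<bar>r\<bar>" for x
  proof -
    have "C * jb x powr r \<le> (\<bar>C\<bar> + 1) * jb x powr \<bar>r\<bar>"
      by (intro mult_mono jb_powr_mono) auto
    then show ?thesis using C[of x] by simp
  qed
  then show ?thesis using that[of "\<bar>C\<bar> + 1" "\<bar>r\<bar>"] by simp
qed

lemma rapid_add: assumes "rapid f" "rapid g" shows "rapid (\<lambda>x. f x + g x)"
  unfolding rapid_def
proof
  fix r
  obtain C where C: "\<And>x. cmod (f x) \<le> C * jb x powr - r" using rapidD[OF assms(1)] by metis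
  obtain D where D: "\<And>x. cmod (g x) \<le> D * jb x powr - r" using rapidD[OF assms(2)] by metis
  have "cmod (f x + g x) \<le> (C + D) * jb x powr - r" for x
    using C[of x] D[of x] norm_triangle_ineq[of "f x" "g x"] by (simp add: algebra_simps)
  then show "\<exists>C. \<forall>x. cmod (f x + g x) \<le> C * jb x powr - r" by blast
qed

lemma slow_add: assumes "slow f" "slow g" shows "slow (\<lambda>x. f x + g x)"
proof -
  obtain C r where C: "C > 0" "r \<ge> 0" "\<And>x. cmod (f x) \<le> C * jb x powr r" using slowD[OF assms(1)] by metis
  obtain D s where D: "D > 0" "s \<ge> 0" "\<And>x. cmod (g x) \<le> D * jb x powr s" using slowD[OF assms(2)] by metis
  have "cmod (f x + g x) \<le> (C + D) * jb x powr (r + s)" for x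
  proof -
    have "C * jb x powr r \<le> C * jb x powr (r + s)" "D * jb x powr s \<le> D * jb x powr (r + s)"
      using C D by (auto intro!: jb_powr_mono)
    then show ?thesis
      using C(3)[of x] D(3)[of x] norm_triangle_ineq[of "f x" "g x"] by (simp add: algebra_simps)
  qed
  then show ?thesis unfolding slow_def by blast
qed

lemma rapid_mult_slow: assumes "rapid f" "slow g" shows "rapid (\<lambda>x. f x * g x)"
  unfolding rapid_def
proof
  fix r
  obtain D s where D: "D > 0" "s \<ge> 0" "\<And>x. cmod (g x) \<le> D * jb x powr s" using slowD[OF assms(2)] by metis
  obtain C where C: "C > 0" "\<And>x. cmod (f x) \<le> C * jb x powr - (r + s)" using rapidD[OF assms(1)] by metis
  have "cmod (f x * g x) \<le> (C * D) * jb x powr - r" for x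
  proof -
    have "cmod (f x * g x) \<le> (C * jb x powr - (r + s)) * (D * jb x powr s)"
      unfolding norm_mult using C D by (intro mult_mono) auto
    also have "\<dots> = (C * D) * jb x powr - r"
      by (simp add: powr_diff powr_minus field_simps powr_add)
    finally show ?thesis .
  qed
  then show "\<exists>C. \<forall>x. cmod (f x * g x) \<le> C * jb x powr - r" by blast
qed

lemma rapid_imp_slow: "rapid f \<Longrightarrow> slow f"
  unfolding rapid_def slow_def by blast

lemma bounded_imp_slow: "(\<And>x. cmod (f x) \<le> C) \<Longrightarrow> slow f"
  unfolding slow_def by (rule exI[of _ 0], rule exI[of _ C]) simp

lemma schwartz_space_iff: "f \<in> schwartz_space \<longleftrightarrow> smooth_fun f \<and> (\<forall>is. rapid (partial_derivs is f))"
proof -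
  have eq: "(\<forall>k. bdd_above (range (\<lambda>x. jb x ^ k * cmod (g x)))) \<longleftrightarrow> rapid g" for g :: "real^'n \<Rightarrow> complex"
  proof
    assume *: "\<forall>k. bdd_above (range (\<lambda>x. jb x ^ k * cmod (g x)))"
    show "rapid g" unfolding rapid_def
    proof
      fix r
      obtain k :: nat where k: "r \<le> real k" using real_arch_simple by blast
      obtain C where C: "\<And>x. jb x ^ k * cmod (g x) \<le> C" using * unfolding bdd_above_def by auto
      have "cmod (g x) \<le> C * jb x powr - r" for x
      proof -
        have "C \<ge> 0" using order_trans[OF _ C[of x]] by simp
        have "cmod (g x) = (jb x ^ k * cmod (g x)) * jb x powr - real k"
          by (simp add: powr_minus powr_realpow)
        also have "\<dots> \<le> C * jb x powr - r"
          using C[of x] k \<open>C \<ge> 0\<close> by (intro mult_mono jb_powr_mono) auto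
        finally show ?thesis .
      qed
      then show "\<exists>C. \<forall>x. cmod (g x) \<le> C * jb x powr - r" by blast
    qed
  next
    assume *: "rapid g"
    show "\<forall>k. bdd_above (range (\<lambda>x. jb x ^ k * cmod (g x)))"
    proof
      fix k :: nat
      obtain C where C: "C > 0" "\<And>x. cmod (g x) \<le> C * jb x powr - real k" using rapidD[OF *] by metis
      have "jb x ^ k * cmod (g x) \<le> C" for x
      proof -
        have "jb x ^ k * cmod (g x) \<le> jb x ^ k * (C * jb x powr - real k)"
          using C(2)[of x] by (intro mult_left_mono) auto
        also have "\<dots> = C" by (simp add: powr_minus powr_realpow)
        finally show ?thesis .
      qed
      then show "bdd_above (range (\<lambda>x. jb x ^ k * cmod (g x)))" unfolding bdd_above_def by auto
    qed
  qed
  show ?thesis unfolding schwartz_space_def by (auto simp: eq[symmetric])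
qed

lemma schwartz_smooth: "f \<in> schwartz_space \<Longrightarrow> smooth_fun f"
  by (simp add: schwartz_space_iff)

lemma schwartz_differentiable: "f \<in> schwartz_space \<Longrightarrow> f differentiable (at x)"
  by (simp add: schwartz_smooth smooth_fun_differentiable)

lemma schwartz_rapid: assumes "f \<in> schwartz_space" shows "rapid f"
  using assms[unfolded schwartz_space_iff, THEN conjunct2, rule_format, of "[]"] by simp

lemma schwartz_partial_deriv:
  assumes "f \<in> schwartz_space" shows "partial_deriv i f \<in> schwartz_space"
proof -
  have "rapid (partial_derivs js (partial_deriv i f))" for js
    using assms[unfolded schwartz_space_iff, THEN conjunct2, rule_format, of "i # js"] by simp
  moreover have "smooth_fun f" using assms unfolding schwartz_space_iff by simp
  ultimately show ?thesis by (simp add: schwartz_space_iff smooth_fun_partial_deriv)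
qed

lemma schwartz_partial_derivs: "f \<in> schwartz_space \<Longrightarrow> partial_derivs is f \<in> schwartz_space"
  by (induction "is" arbitrary: f) (simp_all add: schwartz_partial_deriv)

lemma schwartz_continuous: "f \<in> schwartz_space \<Longrightarrow> continuous_on A f"
  by (intro differentiable_all_continuous allI schwartz_differentiable)

lemma schwartz_measurable: "f \<in> schwartz_space \<Longrightarrow> f \<in> borel_measurable borel"
  by (intro borel_measurable_continuous_onI schwartz_continuous)

lemma schwartz_spanI:
  assumes "\<And>g. g \<in> B \<Longrightarrow> differentiable_all g" "\<And>g i. g \<in> B \<Longrightarrow> partial_deriv i g \<in> add_span B"
    "\<And>g. g \<in> B \<Longrightarrow> rapid g" "f \<in> add_span B"
  shows "f \<in> schwartz_space"
proof -
  have "smooth_fun f"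
    by (rule add_span_partial_derivs(1)[where P=rapid, OF assms(1) assms(2) assms(3) rapid_add assms(4)])
  moreover have "rapid (partial_derivs js f)" for js
    by (rule add_span_partial_derivs(2)[where P=rapid, OF assms(1) assms(2) assms(3) rapid_add assms(4)])
  ultimately show ?thesis by (simp add: schwartz_space_iff)
qed

text \<open>The multipliers of the Schwartz space, usually written O_M: the order of growth may
  depend on the derivative.\<close>

definition slow_space :: "(real ^ 'n::finite \<Rightarrow> complex) set" where
  "slow_space = {f. smooth_fun f \<and> (\<forall>is. slow (partial_derivs is f))}"

lemma slow_spanI:
  assumes "\<And>g. g \<in> B \<Longrightarrow> differentiable_all g" "\<And>g i. g \<in> B \<Longrightarrow> partial_deriv i g \<in> add_span B"
    "\<And>g. g \<in> B \<Longrightarrow> slow g" "f \<in> add_span B"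
  shows "f \<in> slow_space"
proof -
  have "smooth_fun f"
    by (rule add_span_partial_derivs(1)[where P=slow, OF assms(1) assms(2) assms(3) slow_add assms(4)])
  moreover have "slow (partial_derivs js f)" for js
    by (rule add_span_partial_derivs(2)[where P=slow, OF assms(1) assms(2) assms(3) slow_add assms(4)])
  ultimately show ?thesis by (simp add: slow_space_def)
qed

lemma slow_partial_deriv:
  assumes "f \<in> slow_space" shows "partial_deriv i f \<in> slow_space"
proof -
  have "slow (partial_derivs js (partial_deriv i f))" for js
    using assms[unfolded slow_space_def mem_Collect_eq, THEN conjunct2, rule_format, of "i # js"] by simp
  moreover have "smooth_fun f" using assms unfolding slow_space_def by simp
  ultimately show ?thesis by (simp add: slow_space_def smooth_fun_partial_deriv)
qed

lemma slow_space_slow: assumes "f \<in> slow_space" shows "slow f"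
  using assms[unfolded slow_space_def mem_Collect_eq, THEN conjunct2, rule_format, of "[]"] by simp

lemma slow_space_differentiable: "f \<in> slow_space \<Longrightarrow> f differentiable (at x)"
  unfolding slow_space_def by (auto intro: smooth_fun_differentiable)

lemma schwartz_slow: "f \<in> schwartz_space \<Longrightarrow> f \<in> slow_space"
  by (simp add: slow_space_def schwartz_space_iff rapid_imp_slow)

lemma schwartz_add: "f \<in> schwartz_space \<Longrightarrow> g \<in> schwartz_space \<Longrightarrow> (\<lambda>x. f x + g x) \<in> schwartz_space"
  by (rule schwartz_spanI[of schwartz_space])
    (auto intro: add_span.intros schwartz_differentiable schwartz_partial_deriv schwartz_rapid)

text \<open>Leibniz's rule stays within sums of products of a Schwartz function and a multiplier,
  and rapid decay absorbs polynomial growth.\<close>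

lemma schwartz_mult_slow:
  assumes "f \<in> schwartz_space" "g \<in> slow_space"
  shows "(\<lambda>x. f x * g x) \<in> schwartz_space"
proof (rule schwartz_spanI)
  let ?B = "{(\<lambda>x. f x * g x) | f g. f \<in> schwartz_space \<and> g \<in> slow_space}"
  show "(\<lambda>x. f x * g x) \<in> add_span ?B" using assms by (blast intro: add_span.base)
  fix h assume "h \<in> ?B"
  then obtain f g where h: "h = (\<lambda>x. f x * g x)" and fg: "f \<in> schwartz_space" "g \<in> slow_space" by auto
  show "differentiable_all h"
    unfolding h using fg
    by (intro allI differentiable_mult) (simp_all add: schwartz_differentiable slow_space_differentiable)
  show "rapid h" unfolding h using fg by (intro rapid_mult_slow schwartz_rapid slow_space_slow)
  fix i
  have "partial_deriv i h = (\<lambda>x. partial_deriv i f x * g x + f x * partial_deriv i g x)"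
    unfolding h using fg by (intro ext partial_deriv_mult schwartz_differentiable slow_space_differentiable)
  also have "\<dots> \<in> add_span ?B"
    using fg schwartz_partial_deriv[of f i] slow_partial_deriv[of g i]
    by (intro add_span.add add_span.base) blast+
  finally show "partial_deriv i h \<in> add_span ?B" .
qed

lemma slow_const: "(\<lambda>x. c) \<in> slow_space"
  by (rule slow_spanI[of "range (\<lambda>c x. c)"]) (auto intro: add_span.base bounded_imp_slow)

lemma schwartz_cmult: "f \<in> schwartz_space \<Longrightarrow> (\<lambda>x. c * f x) \<in> schwartz_space"
  using schwartz_mult_slow[OF _ slow_const[of c], of f] by (simp add: mult.commute)

lemma schwartz_mult: "f \<in> schwartz_space \<Longrightarrow> g \<in> schwartz_space \<Longrightarrow> (\<lambda>x. f x * g x) \<in> schwartz_space"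
  by (intro schwartz_mult_slow schwartz_slow)

lemma schwartz_0: "(\<lambda>x. 0) \<in> schwartz_space"
  by (rule schwartz_spanI[of "{\<lambda>x. 0}"]) (auto intro: add_span.base simp: rapid_def intro!: exI[of _ 0])

lemma schwartz_diff:
  assumes "f \<in> schwartz_space" "g \<in> schwartz_space" shows "(\<lambda>x. f x - g x) \<in> schwartz_space"
  using schwartz_add[OF assms(1) schwartz_cmult[OF assms(2), of "-1"]] by simp

lemma schwartz_sum:
  "(\<And>i. i \<in> I \<Longrightarrow> f i \<in> schwartz_space) \<Longrightarrow> (\<lambda>x. \<Sum>i\<in>I. f i x) \<in> schwartz_space"
  by (induction I rule: infinite_finite_induct) (auto intro: schwartz_0 schwartz_add)

lemma schwartz_power:
  assumes "f \<in> schwartz_space" "m > 0" shows "(\<lambda>x. f x ^ m) \<in> schwartz_space"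
  using assms(2)
proof (induction m rule: nat_induct_non_zero)
  case (Suc m) then show ?case using schwartz_mult[OF assms(1)] by simp
qed (use assms in simp)

lemma slow_coordinate: "(\<lambda>x::real^'n::finite. complex_of_real (x $ i)) \<in> slow_space"
proof (rule slow_spanI)
  let ?B = "{(\<lambda>x::real^'n. a * complex_of_real (x $ i) + b) | a b. True}"
  have "(\<lambda>x::real^'n. complex_of_real (x $ i)) = (\<lambda>x. 1 * complex_of_real (x $ i) + 0)" by simp
  then show "(\<lambda>x::real^'n. complex_of_real (x $ i)) \<in> add_span ?B" by (intro add_span.base) blast
  fix g assume "g \<in> ?B"
  then obtain a b where g: "g = (\<lambda>x::real^'n. a * complex_of_real (x $ i) + b)" by auto
  have D: "(g has_derivative (\<lambda>h. a * complex_of_real (h $ i))) (at x)" for x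
    unfolding g by (auto intro!: derivative_eq_intros has_derivative_of_real bounded_linear_imp_has_derivative bounded_linear_vec_nth)
  then show "differentiable_all g" by (auto simp: differentiable_def)
  have "partial_deriv j g = (\<lambda>x. 0 * complex_of_real (x $ i) + a * complex_of_real (axis j 1 $ i))" for j
    by (rule ext) (simp add: partial_deriv_eqI[OF D])
  then show "partial_deriv j g \<in> add_span ?B" for j by (intro add_span.base) blast
  show "slow g" unfolding slow_def
  proof (intro exI allI)
    fix x
    have "cmod (g x) \<le> cmod a * \<bar>x $ i\<bar> + cmod b"
      unfolding g by (rule norm_triangle_le) (simp add: norm_mult)
    also have "\<dots> \<le> cmod a * jb x + cmod b * jb x"
      using component_le_norm_cart[of x i] norm_le_jb[of x] jb_ge_1[of x]
      by (intro add_mono mult_left_mono) (auto simp: mult_le_cancel_left1)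
    finally show "cmod (g x) \<le> (cmod a + cmod b) * jb x powr 1" by (simp add: algebra_simps)
  qed
qed

section \<open>Plane waves and the symmetries of the Schwartz space\<close>

definition wave :: "real ^ 'n::finite \<Rightarrow> real ^ 'n \<Rightarrow> complex" where
  "wave \<xi> t = exp (\<i> * complex_of_real (t \<bullet> \<xi>))"

lemma wave_commute: "wave \<xi> t = wave t \<xi>" by (simp add: wave_def inner_commute)
lemma norm_wave [simp]: "cmod (wave \<xi> t) = 1" by (simp add: wave_def)
lemma wave_add: "wave (\<xi> + \<eta>) t = wave \<xi> t * wave \<eta> t"
  by (simp add: wave_def inner_add_right distrib_left exp_add)
lemma wave_diff: "wave (\<xi> - \<eta>) t = wave \<xi> t * wave (- \<eta>) t"
  using wave_add[of \<xi> "- \<eta>" t] by simp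
lemma wave_0 [simp]: "wave 0 t = 1" "wave \<xi> 0 = 1" by (simp_all add: wave_def)
lemma wave_minus: "wave (- \<xi>) t = cnj (wave \<xi> t)"
  by (simp add: wave_def exp_cnj)
lemma wave_minus_right: "wave \<xi> (- t) = wave (- \<xi>) t" by (simp add: wave_def)
lemma wave_add_right: "wave \<xi> (s + t) = wave \<xi> s * wave \<xi> t"
  by (simp add: wave_def inner_add_left distrib_left exp_add)

lemma continuous_on_wave [continuous_intros]:
  assumes "continuous_on A f" "continuous_on A g" shows "continuous_on A (\<lambda>x. wave (f x) (g x))"
  unfolding wave_def
  by (intro continuous_on_exp continuous_on_mult continuous_on_const continuous_on_of_real continuous_on_inner assms)

lemma wave_measurable [measurable (raw)]:
  assumes "f \<in> borel_measurable M" "g \<in> borel_measurable M" shows "(\<lambda>x. wave (f x) (g x)) \<in> borel_measurable M"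
proof -
  have "(\<lambda>z. wave (fst z) (snd z)) \<in> borel_measurable (borel \<Otimes>\<^sub>M borel)"
    unfolding borel_prod
    by (intro borel_measurable_continuous_onI continuous_on_wave continuous_on_fst continuous_on_snd continuous_on_id)
  from measurable_compose[OF measurable_Pair[OF assms] this] show ?thesis by simp
qed

lemma wave_has_derivative:
  "(wave \<xi> has_derivative (\<lambda>h. \<i> * complex_of_real (h \<bullet> \<xi>) * wave \<xi> t)) (at t)"
proof -
  have "((\<lambda>t. \<i> * complex_of_real (t \<bullet> \<xi>)) has_derivative (\<lambda>h. \<i> * complex_of_real (h \<bullet> \<xi>))) (at t)"
    by (auto intro!: derivative_eq_intros has_derivative_of_real)
  from has_derivative_compose[OF this DERIV_exp[unfolded has_field_derivative_def]]
  show ?thesis unfolding wave_def by (simp add: mult_ac)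
qed

lemma wave_differentiable: "wave \<xi> differentiable (at t)"
  using wave_has_derivative[of \<xi> t] by (auto simp: differentiable_def)

lemma wave_partial_deriv: "partial_deriv i (wave \<xi>) t = \<i> * complex_of_real (\<xi> $ i) * wave \<xi> t"
  by (simp add: partial_deriv_eqI[OF wave_has_derivative] inner_axis' )

lemma slow_wave: "wave \<xi> \<in> slow_space"
proof (rule slow_spanI)
  let ?B = "{(\<lambda>t. c * wave \<xi> t) | c. True}"
  have "wave \<xi> = (\<lambda>t. 1 * wave \<xi> t)" by simp
  then show "wave \<xi> \<in> add_span ?B" by (intro add_span.base) blast
  fix g assume "g \<in> ?B"
  then obtain c where g: "g = (\<lambda>t. c * wave \<xi> t)" by auto
  show "differentiable_all g" unfolding g by (auto intro!: differentiable_mult wave_differentiable)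
  have "partial_deriv i g = (\<lambda>t. (c * (\<i> * complex_of_real (\<xi> $ i))) * wave \<xi> t)" for i
    unfolding g by (rule ext) (simp add: partial_deriv_cmult wave_differentiable wave_partial_deriv)
  then show "partial_deriv i g \<in> add_span ?B" for i by (intro add_span.base) blast
  show "slow g" unfolding g by (rule bounded_imp_slow[of _ "cmod c"]) (simp add: norm_mult)
qed

lemma rapid_shift: assumes "rapid f" shows "rapid (\<lambda>x. f (x - c))"
  unfolding rapid_def
proof
  fix r
  obtain C where C: "C > 0" "\<And>x. cmod (f x) \<le> C * jb x powr - r" using rapidD[OF assms] by metis
  have "cmod (f (x - c)) \<le> (C * (2 powr \<bar>r\<bar> * jb c powr \<bar>r\<bar>)) * jb x powr - r" for x
  proof -
    have "jb (x - c) powr - r \<le> 2 powr \<bar>r\<bar> * jb c powr \<bar>r\<bar> * jb x powr - r"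
      using jb_powr_add_le[of "- c" x "- r"] by simp
    then have "C * jb (x - c) powr - r \<le> C * (2 powr \<bar>r\<bar> * jb c powr \<bar>r\<bar> * jb x powr - r)"
      using C by (intro mult_left_mono) auto
    then show ?thesis using C(2)[of "x - c"] by (simp add: mult.assoc)
  qed
  then show "\<exists>C. \<forall>x. cmod (f (x - c)) \<le> C * jb x powr - r" by blast
qed

lemma schwartz_shift: assumes "f \<in> schwartz_space" shows "(\<lambda>x. f (x - c)) \<in> schwartz_space"
proof (rule schwartz_spanI)
  let ?B = "{(\<lambda>x. f (x - c)) | f. f \<in> schwartz_space}"
  show "(\<lambda>x. f (x - c)) \<in> add_span ?B" using assms by (blast intro: add_span.base)
  fix h assume "h \<in> ?B"
  then obtain f where h: "h = (\<lambda>x. f (x - c))" and f: "f \<in> schwartz_space" by auto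
  show "differentiable_all h" unfolding h
    using schwartz_differentiable[OF f] by (intro allI differentiable_shift(1))
  show "rapid h" unfolding h by (rule rapid_shift[OF schwartz_rapid[OF f]])
  have "partial_deriv i h = (\<lambda>x. partial_deriv i f (x - c))" for i
    unfolding h by (rule ext, rule differentiable_shift(2)[OF schwartz_differentiable[OF f]])
  then show "partial_deriv i h \<in> add_span ?B" for i
    using schwartz_partial_deriv[OF f, of i] by (auto intro: add_span.base)
qed

lemma schwartz_cnj: assumes "f \<in> schwartz_space" shows "(\<lambda>x. cnj (f x)) \<in> schwartz_space"
proof (rule schwartz_spanI)
  let ?B = "{(\<lambda>x. cnj (f x)) | f. f \<in> schwartz_space}"
  show "(\<lambda>x. cnj (f x)) \<in> add_span ?B" using assms by (blast intro: add_span.base)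
  fix h assume "h \<in> ?B"
  then obtain f where h: "h = (\<lambda>x. cnj (f x))" and f: "f \<in> schwartz_space" by auto
  show "differentiable_all h" unfolding h
    using schwartz_differentiable[OF f] by (intro allI differentiable_cnj(1))
  show "rapid h" unfolding h using schwartz_rapid[OF f] by (simp add: rapid_def)
  have "partial_deriv i h = (\<lambda>x. cnj (partial_deriv i f x))" for i
    unfolding h by (rule ext, rule differentiable_cnj(2)[OF schwartz_differentiable[OF f]])
  then show "partial_deriv i h \<in> add_span ?B" for i
    using schwartz_partial_deriv[OF f, of i] by (auto intro: add_span.base)
qed

text \<open>The dilated bracket is at least min(1, |r|) times the original one: after squaring, one
  bound on the minimum serves the constant term and the other the norm.\<close>

lemma jb_scale_powr:
  assumes "r \<noteq> 0" "s \<ge> 0" shows "jb (r *\<^sub>R x) powr - s \<le> (min 1 \<bar>r\<bar>) powr - s * jb x powr - s"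
proof -
  define m where "m = min 1 \<bar>r\<bar>"
  have m: "m > 0" "m \<le> 1" "m \<le> \<bar>r\<bar>" using assms by (auto simp: m_def)
  have "m * jb x \<le> jb (r *\<^sub>R x)"
  proof (rule power2_le_imp_le)
    have "(m * jb x)\<^sup>2 = m\<^sup>2 * 1 + m\<^sup>2 * (norm x)\<^sup>2"
      by (simp add: power_mult_distrib japanese_bracket_def distrib_left)
    also have "\<dots> \<le> 1 * 1 + \<bar>r\<bar>\<^sup>2 * (norm x)\<^sup>2"
      using m by (intro add_mono mult_right_mono power_mono) (auto simp: power_le_one)
    also have "\<dots> = (jb (r *\<^sub>R x))\<^sup>2" by (simp add: japanese_bracket_def power_mult_distrib)
    finally show "(m * jb x)\<^sup>2 \<le> (jb (r *\<^sub>R x))\<^sup>2" .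
  qed simp
  then have "jb (r *\<^sub>R x) powr - s \<le> (m * jb x) powr - s"
    using assms m by (intro powr_mono2') auto
  then show ?thesis using m by (simp add: powr_mult m_def)
qed

lemma rapid_scale: assumes "rapid f" "r \<noteq> 0" shows "rapid (\<lambda>x. f (r *\<^sub>R x))"
  unfolding rapid_def
proof
  fix s
  obtain C where C: "C > 0" "\<And>x. cmod (f x) \<le> C * jb x powr - \<bar>s\<bar>" using rapidD[OF assms(1)] by metis
  have "cmod (f (r *\<^sub>R x)) \<le> (C * (min 1 \<bar>r\<bar>) powr - \<bar>s\<bar>) * jb x powr - s" for x
  proof -
    have "cmod (f (r *\<^sub>R x)) \<le> C * ((min 1 \<bar>r\<bar>) powr - \<bar>s\<bar> * jb x powr - \<bar>s\<bar>)"
      using C by (intro order_trans[OF C(2)] mult_left_mono jb_scale_powr assms) auto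
    also have "\<dots> \<le> C * ((min 1 \<bar>r\<bar>) powr - \<bar>s\<bar> * jb x powr - s)"
      using C by (intro mult_left_mono jb_powr_mono) auto
    finally show ?thesis by (simp add: mult.assoc)
  qed
  then show "\<exists>C. \<forall>x. cmod (f (r *\<^sub>R x)) \<le> C * jb x powr - s" by blast
qed

lemma schwartz_scale: assumes "f \<in> schwartz_space" "r \<noteq> 0" shows "(\<lambda>x. f (r *\<^sub>R x)) \<in> schwartz_space"
proof (rule schwartz_spanI)
  let ?B = "{(\<lambda>x. f (r *\<^sub>R x)) | f. f \<in> schwartz_space}"
  show "(\<lambda>x. f (r *\<^sub>R x)) \<in> add_span ?B" using assms by (blast intro: add_span.base)
  fix h assume "h \<in> ?B"
  then obtain f where h: "h = (\<lambda>x. f (r *\<^sub>R x))" and f: "f \<in> schwartz_space" by auto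
  show "differentiable_all h" unfolding h
    using schwartz_differentiable[OF f] by (intro allI differentiable_scale(1))
  show "rapid h" unfolding h by (rule rapid_scale[OF schwartz_rapid[OF f] assms(2)])
  have eq: "partial_deriv i h = (\<lambda>x. (\<lambda>y. of_real r * partial_deriv i f y) (r *\<^sub>R x))" for i
    unfolding h by (rule ext, rule differentiable_scale(2)[OF schwartz_differentiable[OF f]])
  have mem: "(\<lambda>x. (\<lambda>y. of_real r * partial_deriv i f y) (r *\<^sub>R x)) \<in> ?B" for i
    by (rule CollectI, rule exI[of _ "\<lambda>y. of_real r * partial_deriv i f y"])
      (simp add: schwartz_cmult schwartz_partial_deriv f)
  show "partial_deriv i h \<in> add_span ?B" for i unfolding eq by (rule add_span.base) (rule mem)
qed

text \<open>The generators are the smooth functions vanishing off the closure \<open>K\<close>.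
  Taking the closure matters: its complement is open, so the derivatives vanish there as well, while
  on \<open>K\<close> itself compactness bounds every continuous function.\<close>

lemma schwartz_compact_support:
  assumes "smooth_fun f" "compact (closure {x. f x \<noteq> 0})"
  shows "f \<in> schwartz_space"
proof (rule schwartz_spanI)
  define K where "K = closure {x. f x \<noteq> 0}"
  let ?B = "{g. smooth_fun g \<and> (\<forall>x. x \<notin> K \<longrightarrow> g x = 0)}"
  have K: "compact K" "closed K" using assms by (auto simp: K_def)
  have "f x = 0" if "x \<notin> K" for x
    using that closure_subset[of "{x. f x \<noteq> 0}"] by (auto simp: K_def)
  with assms(1) have "f \<in> ?B" by simp
  then show "f \<in> add_span ?B" by (rule add_span.base)
  fix g assume "g \<in> ?B"
  then have g: "smooth_fun g" "\<And>x. x \<notin> K \<Longrightarrow> g x = 0" by auto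
  show d: "differentiable_all g" using g by (auto intro: smooth_fun_differentiable)
  have "partial_deriv i g x = 0" if "x \<notin> K" for i x
  proof -
    have "(g has_derivative (\<lambda>h. 0)) (at x)"
    proof (rule has_derivative_transform_within_open)
      show "((\<lambda>x. 0) has_derivative (\<lambda>h. 0)) (at x)" by simp
      show "open (- K)" using K by auto
      show "x \<in> - K" using that by simp
    qed (use g in auto)
    then show ?thesis by (simp add: partial_deriv_eqI)
  qed
  then have "partial_deriv i g \<in> ?B" for i using smooth_fun_partial_deriv[OF g(1), of i] by simp
  then show "partial_deriv i g \<in> add_span ?B" for i by (rule add_span.base)
  show "rapid g" unfolding rapid_def
  proof
    fix r
    have "continuous_on K (\<lambda>x. cmod (g x) * jb x powr r)"
      by (intro continuous_intros differentiable_all_continuous[OF d]) auto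
    then have "bdd_above ((\<lambda>x. cmod (g x) * jb x powr r) ` K)"
      by (intro bounded_imp_bdd_above compact_imp_bounded compact_continuous_image K)
    then obtain C where C: "\<And>x. x \<in> K \<Longrightarrow> cmod (g x) * jb x powr r \<le> C" by (auto simp: bdd_above_def)
    have "cmod (g x) \<le> \<bar>C\<bar> * jb x powr - r" for x
    proof (cases "x \<in> K")
      case True
      have "cmod (g x) = (cmod (g x) * jb x powr r) * jb x powr - r"
        by (simp add: powr_minus)
      also have "\<dots> \<le> \<bar>C\<bar> * jb x powr - r" using C[OF True] by (intro mult_right_mono) auto
      finally show ?thesis .
    qed (use g in simp)
    then show "\<exists>C. \<forall>x. cmod (g x) \<le> C * jb x powr - r" by blast
  qed
qed

lemma rapid_integrable:
  fixes f :: "real^'n::finite \<Rightarrow> complex"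
  assumes "rapid f" "f \<in> borel_measurable borel"
  shows "integrable lborel f"
proof -
  obtain C where C: "\<And>x. cmod (f x) \<le> C * jb x powr - (real CARD('n) + 1)" using rapidD[OF assms(1)] by metis
  have "integrable lborel (\<lambda>x::real^'n. C * jb x powr - (real CARD('n) + 1))"
    by (intro integrable_mult_right integrable_jb) simp
  then show ?thesis
  proof (rule Bochner_Integration.integrable_bound)
    show "AE x in lborel. norm (f x) \<le> norm (C * jb x powr - (real CARD('n) + 1))"
      unfolding real_norm_def by (intro AE_I2 order_trans[OF C abs_ge_self])
  qed (use assms in simp)
qed

lemma schwartz_integrable: "f \<in> schwartz_space \<Longrightarrow> integrable lborel f"
  by (intro rapid_integrable schwartz_rapid schwartz_measurable)


subsection \<open>Differentiation under the integral sign\<close>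

text \<open>Supplies the measurability of a derivative in an additional parameter, as a pointwise
  limit of difference quotients.\<close>

lemma partial_deriv_sequentially:
  assumes "f differentiable (at t)"
  shows "(\<lambda>k. real (Suc k) *\<^sub>R (f (t + (1 / real (Suc k)) *\<^sub>R axis i 1) - f t)) \<longlonglongrightarrow> partial_deriv i f t"
proof -
  define h :: "nat \<Rightarrow> real^'a" where "h k = (1 / real (Suc k)) *\<^sub>R axis i 1" for k
  let ?D = "frechet_derivative f (at t)"
  have D: "(f has_derivative ?D) (at t)" using assms by (simp add: frechet_derivative_works)
  have h0: "h \<longlonglongrightarrow> 0"
  proof -
    have "(\<lambda>k. (1 / real (Suc k)) *\<^sub>R (axis i 1 :: real^'a)) \<longlonglongrightarrow> 0 *\<^sub>R axis i 1"
      by (intro tendsto_scaleR tendsto_const LIMSEQ_Suc lim_1_over_n)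
    moreover have "h = (\<lambda>k. (1 / real (Suc k)) *\<^sub>R axis i 1)" by (rule ext) (simp only: h_def)
    ultimately show ?thesis by (simp only: scaleR_zero_left)
  qed
  have "filterlim h (at 0) sequentially"
    using h0 by (auto simp: filterlim_at h_def axis_eq_0_iff)
  with D have "(\<lambda>k. norm (f (t + h k) - f t - ?D (h k)) / norm (h k)) \<longlonglongrightarrow> 0"
    unfolding has_derivative_at by (auto intro: filterlim_compose)
  also have "(\<lambda>k. norm (f (t + h k) - f t - ?D (h k)) / norm (h k))
    = (\<lambda>k. norm (real (Suc k) *\<^sub>R (f (t + h k) - f t) - partial_deriv i f t))"
  proof
    fix k
    have "?D (h k) = (1 / real (Suc k)) *\<^sub>R partial_deriv i f t"
      using linear_scale[OF has_derivative_linear[OF D]] by (simp add: h_def partial_deriv_def)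
    then have "real (Suc k) *\<^sub>R (f (t + h k) - f t) - partial_deriv i f t
       = real (Suc k) *\<^sub>R (f (t + h k) - f t - ?D (h k))"
      by (simp add: scaleR_diff_right)
    then show "norm (f (t + h k) - f t - ?D (h k)) / norm (h k)
       = norm (real (Suc k) *\<^sub>R (f (t + h k) - f t) - partial_deriv i f t)"
      by (simp add: h_def norm_axis_1)
  qed
  finally show ?thesis unfolding h_def by (subst LIM_zero_iff[symmetric]) (simp only: tendsto_norm_zero_iff)
qed

lemma partial_deriv_bound:
  fixes f :: "real^'n::finite \<Rightarrow> complex"
  assumes "convex S" "\<And>x. x \<in> S \<Longrightarrow> f differentiable (at x)"
    "\<And>x i. x \<in> S \<Longrightarrow> cmod (partial_deriv i f x) \<le> B" "x \<in> S" "y \<in> S"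
  shows "cmod (f x - f y) \<le> real CARD('n) * B * norm (x - y)"
proof (rule differentiable_bound[OF assms(1)])
  fix z assume z: "z \<in> S"
  then show "(f has_derivative (\<lambda>h. \<Sum>i\<in>UNIV. (h $ i) *\<^sub>R partial_deriv i f z)) (at z within S)"
    using has_derivative_partial_deriv[OF assms(2)] by (blast intro: has_derivative_at_withinI)
  show "onorm (\<lambda>h. \<Sum>i\<in>UNIV. (h $ i) *\<^sub>R partial_deriv i f z) \<le> real CARD('n) * B"
  proof (rule onorm_le)
    fix h :: "real^'n"
    have "norm (\<Sum>i\<in>UNIV. (h $ i) *\<^sub>R partial_deriv i f z) \<le> (\<Sum>i\<in>(UNIV::'n set). norm h * B)"
      using z assms(3) component_le_norm_cart[of h]
      by (intro sum_norm_le) (simp add: mult_mono)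
    then show "norm (\<Sum>i\<in>UNIV. (h $ i) *\<^sub>R partial_deriv i f z) \<le> real CARD('n) * B * norm h"
      by (simp add: mult_ac)
  qed
qed (use assms in auto)

text \<open>Dominated convergence for the normalised remainder. On the unit ball the mean value
  inequality bounds an increment of the integrand by n B(z) times its length, and the linear part
  obeys the same bound, whence the majorant 2 n B(z).\<close>

lemma has_derivative_integral:
  fixes H :: "'z \<Rightarrow> real^'n::finite \<Rightarrow> complex"
  assumes int: "\<And>t. integrable M (\<lambda>z. H z t)"
    and diff: "\<And>z t. z \<in> space M \<Longrightarrow> t \<in> ball t0 1 \<Longrightarrow> H z differentiable (at t)"
    and bd: "\<And>z t i. z \<in> space M \<Longrightarrow> t \<in> ball t0 1 \<Longrightarrow> cmod (partial_deriv i (H z) t) \<le> B z"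
    and B: "integrable M B"
  shows "((\<lambda>t. LINT z|M. H z t) has_derivative
      (\<lambda>h. \<Sum>i\<in>UNIV. (h $ i) *\<^sub>R (LINT z|M. partial_deriv i (H z) t0))) (at t0)" (is ?A)
    and "integrable M (\<lambda>z. partial_deriv i (H z) t0)"
proof -
  have [measurable]: "(\<lambda>z. H z t) \<in> borel_measurable M" for t
    using int[of t] by (rule borel_measurable_integrable)
  have pm[measurable]: "(\<lambda>z. partial_deriv i (H z) t0) \<in> borel_measurable M" for i
  proof (rule borel_measurable_LIMSEQ_metric)
    show "(\<lambda>z. real (Suc k) *\<^sub>R (H z (t0 + (1 / real (Suc k)) *\<^sub>R axis i 1) - H z t0)) \<in> borel_measurable M" for k
      by measurable
    show "(\<lambda>k. real (Suc k) *\<^sub>R (H z (t0 + (1 / real (Suc k)) *\<^sub>R axis i 1) - H z t0)) \<longlonglongrightarrow> partial_deriv i (H z) t0"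
      if "z \<in> space M" for z
      by (rule partial_deriv_sequentially) (use diff that in auto)
  qed
  have pint: "integrable M (\<lambda>z. partial_deriv i (H z) t0)" for i
  proof (rule Bochner_Integration.integrable_bound[OF B])
    show "AE z in M. norm (partial_deriv i (H z) t0) \<le> norm (B z)"
      using bd[of _ t0 i] by (intro AE_I2) (auto intro: order_trans[OF _ abs_ge_self])
  qed measurable
  then show "integrable M (\<lambda>z. partial_deriv i (H z) t0)" .
  let ?I = "\<lambda>t. LINT z|M. H z t"
  let ?d = "\<lambda>z h. \<Sum>i\<in>UNIV. (h $ i) *\<^sub>R partial_deriv i (H z) t0"
  let ?D = "\<lambda>h. \<Sum>i\<in>UNIV. (h $ i) *\<^sub>R (LINT z|M. partial_deriv i (H z) t0)"
  have Dd: "?D h = (LINT z|M. ?d z h)" for h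
    using pint by (subst Bochner_Integration.integral_sum) auto
  have dint: "integrable M (\<lambda>z. ?d z h)" for h using pint by auto
  have bl: "bounded_linear ?D"
    by (intro bounded_linear_sum bounded_linear_scaleR_left[THEN bounded_linear_compose] bounded_linear_vec_nth)
  have lim: "((\<lambda>h. norm (?I (t0 + h) - ?I t0 - ?D h) / norm h) \<longlongrightarrow> 0) (at 0)"
    unfolding tendsto_at_iff_sequentially
  proof (intro allI impI)
    fix X :: "nat \<Rightarrow> real^'n"
    assume X0: "\<forall>k. X k \<in> UNIV - {0}" and X: "X \<longlonglongrightarrow> 0"
    from X have "\<forall>\<^sub>F k in sequentially. norm (X k) < 1" using LIMSEQ_D[of X 0 1] by (auto simp: eventually_sequentially)
    then obtain N where N: "\<And>k. k \<ge> N \<Longrightarrow> norm (X k) < 1" by (auto simp: eventually_sequentially)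
    \<comment> \<open>Dropping the first \<open>N\<close> terms keeps every increment inside the
      ball where the derivatives are bounded, without affecting the limit.\<close>
    define Y where "Y k = X (k + N)" for k
    have Y: "Y k \<noteq> 0" "norm (Y k) < 1" for k using X0 N by (auto simp: Y_def)
    have Ylim: "Y \<longlonglongrightarrow> 0" unfolding Y_def using X by (rule LIMSEQ_ignore_initial_segment)
    define q where "q k z = (1 / norm (Y k)) *\<^sub>R (H z (t0 + Y k) - H z t0 - ?d z (Y k))" for k z
    have "(\<lambda>k. LINT z|M. q k z) \<longlonglongrightarrow> (LINT z|M. 0)"
    proof (rule integral_dominated_convergence[where w="\<lambda>z. 2 * real CARD('n) * B z"])
      show "integrable M (\<lambda>z. 2 * real CARD('n) * B z)" using B by auto
      show "q k \<in> borel_measurable M" for k unfolding q_def by measurable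
      show "AE z in M. (\<lambda>k. q k z) \<longlonglongrightarrow> 0"
      proof (rule AE_I2)
        fix z assume z: "z \<in> space M"
        have D: "(H z has_derivative ?d z) (at t0)"
          by (rule has_derivative_partial_deriv) (use diff z in auto)
        have "filterlim Y (at 0) sequentially" using Ylim Y by (auto simp: filterlim_at)
        with D have "(\<lambda>k. norm (H z (t0 + Y k) - H z t0 - ?d z (Y k)) / norm (Y k)) \<longlonglongrightarrow> 0"
          unfolding has_derivative_at by (auto intro: filterlim_compose)
        then show "(\<lambda>k. q k z) \<longlonglongrightarrow> 0"
          by (intro tendsto_norm_zero_cancel[of "\<lambda>k. q k z"]) (simp add: q_def divide_inverse mult.commute)
      qed
      show "AE z in M. norm (q k z) \<le> 2 * real CARD('n) * B z" for k
      proof (rule AE_I2)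
        fix z assume z: "z \<in> space M"
        have "cmod (H z (t0 + Y k) - H z t0) \<le> real CARD('n) * B z * norm (t0 + Y k - t0)"
          by (rule partial_deriv_bound[of "ball t0 1"]) (use diff bd z Y in \<open>auto simp: dist_norm\<close>)
        moreover have "norm (?d z (Y k)) \<le> real CARD('n) * B z * norm (Y k)"
        proof -
          have "norm (?d z (Y k)) \<le> (\<Sum>i\<in>(UNIV::'n set). norm (Y k) * B z)"
            using bd[OF z, of t0] component_le_norm_cart[of "Y k"]
            by (intro sum_norm_le) (simp add: mult_mono)
          then show ?thesis by (simp add: mult_ac)
        qed
        ultimately have "norm (H z (t0 + Y k) - H z t0 - ?d z (Y k)) \<le> 2 * real CARD('n) * B z * norm (Y k)"
          using norm_triangle_ineq4[of "H z (t0 + Y k) - H z t0" "?d z (Y k)"] by simp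
        then have "norm (H z (t0 + Y k) - H z t0 - ?d z (Y k)) / norm (Y k) \<le> 2 * real CARD('n) * B z"
          using Y(1)[of k] by (intro pos_divide_le_eq[THEN iffD2]) simp_all
        moreover have "norm (q k z) = norm (H z (t0 + Y k) - H z t0 - ?d z (Y k)) / norm (Y k)"
          unfolding q_def norm_scaleR by simp
        ultimately show "norm (q k z) \<le> 2 * real CARD('n) * B z" by simp
      qed
    qed simp
    also have "(\<lambda>k. LINT z|M. q k z) = (\<lambda>k. (1 / norm (Y k)) *\<^sub>R (?I (t0 + Y k) - ?I t0 - ?D (Y k)))"
      unfolding q_def Dd using int dint by (intro ext) simp
    finally have "(\<lambda>k. norm ((1 / norm (Y k)) *\<^sub>R (?I (t0 + Y k) - ?I t0 - ?D (Y k)))) \<longlonglongrightarrow> 0"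
      by (intro tendsto_norm_zero) simp
    then have "(\<lambda>k. norm (?I (t0 + Y k) - ?I t0 - ?D (Y k)) / norm (Y k)) \<longlonglongrightarrow> 0"
      by (simp add: divide_inverse mult.commute)
    then have "(\<lambda>k. ((\<lambda>h. norm (?I (t0 + h) - ?I t0 - ?D h) / norm h) \<circ> X) (k + N)) \<longlonglongrightarrow> 0"
      by (simp add: Y_def o_def)
    then show "((\<lambda>h. norm (?I (t0 + h) - ?I t0 - ?D h) / norm h) \<circ> X) \<longlonglongrightarrow> 0"
      by (rule LIMSEQ_offset)
  qed
  show ?A unfolding has_derivative_at using bl lim by blast
qed

lemma partial_deriv_integral:
  fixes H :: "'z \<Rightarrow> real^'n::finite \<Rightarrow> complex"
  assumes "\<And>t. integrable M (\<lambda>z. H z t)"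
    "\<And>z t. z \<in> space M \<Longrightarrow> t \<in> ball t0 1 \<Longrightarrow> H z differentiable (at t)"
    "\<And>z t i. z \<in> space M \<Longrightarrow> t \<in> ball t0 1 \<Longrightarrow> cmod (partial_deriv i (H z) t) \<le> B z"
    "integrable M B"
  shows "(\<lambda>t. LINT z|M. H z t) differentiable (at t0)"
    and "partial_deriv i (\<lambda>t. LINT z|M. H z t) t0 = (LINT z|M. partial_deriv i (H z) t0)"
proof -
  note D = has_derivative_integral(1)[OF assms]
  show "(\<lambda>t. LINT z|M. H z t) differentiable (at t0)" using D by (auto simp: differentiable_def)
  show "partial_deriv i (\<lambda>t. LINT z|M. H z t) t0 = (LINT z|M. partial_deriv i (H z) t0)"
  proof (subst partial_deriv_eqI[OF D])
    have "(axis i (1::real) $ j) *\<^sub>R c = (if j = i then c else 0)" for j and c :: complex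
      by (simp add: axis_def)
    then show "(\<Sum>j\<in>UNIV. (axis i 1 $ j) *\<^sub>R (LINT z|M. partial_deriv j (H z) t0)) = (LINT z|M. partial_deriv i (H z) t0)"
      by simp
  qed
qed

subsection \<open>Oscillatory integrals\<close>

text \<open>An inverse Fourier transform without normalising factor. Both \<open>fourier\<close> and
  \<open>inv_fourier\<close> are multiples of it up to reflection, its kernel is symmetric in the
  two arguments, and inversion carries the single constant (2 pi)^n.\<close>

definition osc :: "(real^'n::finite \<Rightarrow> complex) \<Rightarrow> real^'n \<Rightarrow> complex" where
  "osc a t = (LINT \<eta>|lborel. a \<eta> * wave t \<eta>)"

text \<open>Each derivative of \<open>osc a\<close> uses up one moment of \<open>a\<close>. No
  smoothness is asked for, which admits the densities cut off to a ball that the necessity part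
  tests.\<close>

definition moments :: "(real^'n::finite \<Rightarrow> complex) \<Rightarrow> bool" where
  "moments a \<longleftrightarrow> a \<in> borel_measurable borel \<and> (\<forall>k::nat. integrable lborel (\<lambda>\<eta>. jb \<eta> ^ k * cmod (a \<eta>)))"

lemma momentsD:
  assumes "moments a"
  shows "a \<in> borel_measurable borel" "integrable lborel a" "integrable lborel (\<lambda>\<eta>. jb \<eta> ^ k * cmod (a \<eta>))"
proof -
  show m: "a \<in> borel_measurable borel" "integrable lborel (\<lambda>\<eta>. jb \<eta> ^ k * cmod (a \<eta>))" for k
    using assms by (auto simp: moments_def)
  show "integrable lborel a" using m(1) m(2)[of 0] by (simp add: integrable_norm_iff)
qed

lemma moments_coordinate:
  assumes "moments a" shows "moments (\<lambda>\<eta>. \<i> * complex_of_real (\<eta> $ i) * a \<eta>)"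
proof -
  have [measurable]: "a \<in> borel_measurable borel" using momentsD[OF assms] by simp
  have "integrable lborel (\<lambda>\<eta>. jb \<eta> ^ k * cmod (\<i> * complex_of_real (\<eta> $ i) * a \<eta>))" for k
  proof (rule Bochner_Integration.integrable_bound[OF momentsD(3)[OF assms, of "Suc k"]])
    show "AE \<eta> in lborel. norm (jb \<eta> ^ k * cmod (\<i> * complex_of_real (\<eta> $ i) * a \<eta>)) \<le> norm (jb \<eta> ^ Suc k * cmod (a \<eta>))"
    proof (rule AE_I2)
      fix \<eta> :: "real^'a"
      have "\<bar>\<eta> $ i\<bar> \<le> jb \<eta>" using component_le_norm_cart[of \<eta> i] norm_le_jb[of \<eta>] by linarith
      then have "jb \<eta> ^ k * cmod (a \<eta>) * \<bar>\<eta> $ i\<bar> \<le> jb \<eta> ^ k * cmod (a \<eta>) * jb \<eta>"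
        by (intro mult_left_mono) auto
      then show "norm (jb \<eta> ^ k * cmod (\<i> * complex_of_real (\<eta> $ i) * a \<eta>)) \<le> norm (jb \<eta> ^ Suc k * cmod (a \<eta>))"
        by (simp add: norm_mult abs_mult mult_ac)
    qed
  qed measurable
  then show ?thesis unfolding moments_def by simp
qed

lemma integrable_mult_wave:
  assumes "integrable lborel a" shows "integrable lborel (\<lambda>\<eta>. a \<eta> * wave t \<eta>)"
proof (rule Bochner_Integration.integrable_bound[OF assms])
  have [measurable]: "a \<in> borel_measurable borel" using assms by simp
  show "(\<lambda>\<eta>. a \<eta> * wave t \<eta>) \<in> borel_measurable lborel" by measurable
qed (simp add: norm_mult)

lemma norm_osc_le: "cmod (osc a t) \<le> (LINT \<eta>|lborel. cmod (a \<eta>))"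
  unfolding osc_def using integral_norm_bound[of lborel "\<lambda>\<eta>. a \<eta> * wave t \<eta>"] by (simp add: norm_mult)

lemma osc_derivative:
  assumes "moments a"
  shows "osc a differentiable (at t)"
    and "partial_deriv i (osc a) t = osc (\<lambda>\<eta>. \<i> * complex_of_real (\<eta> $ i) * a \<eta>) t"
proof -
  have p: "partial_deriv i (\<lambda>t. a \<eta> * wave t \<eta>) t = \<i> * complex_of_real (\<eta> $ i) * a \<eta> * wave t \<eta>" for i \<eta> t
    using partial_deriv_cmult[OF wave_differentiable, of i "a \<eta>" \<eta> t] wave_partial_deriv[of i \<eta> t]
    by (simp add: wave_commute[of _ \<eta>] mult_ac)
  have *: "\<And>t. integrable lborel (\<lambda>\<eta>. a \<eta> * wave t \<eta>)"
    "\<And>\<eta> s. (\<lambda>t. a \<eta> * wave t \<eta>) differentiable (at s)"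
    "\<And>\<eta> s i. cmod (partial_deriv i (\<lambda>t. a \<eta> * wave t \<eta>) s) \<le> jb \<eta> ^ 1 * cmod (a \<eta>)"
    "integrable lborel (\<lambda>\<eta>. jb \<eta> ^ 1 * cmod (a \<eta>))"
  proof -
    show "integrable lborel (\<lambda>\<eta>. a \<eta> * wave t \<eta>)" for t using momentsD(2)[OF assms] by (rule integrable_mult_wave)
    show "(\<lambda>t. a \<eta> * wave t \<eta>) differentiable (at s)" for \<eta> s
      unfolding wave_commute[of _ \<eta>] by (intro differentiable_mult wave_differentiable) simp
    show "cmod (partial_deriv i (\<lambda>t. a \<eta> * wave t \<eta>) s) \<le> jb \<eta> ^ 1 * cmod (a \<eta>)" for \<eta> s i
    proof -
      have "\<bar>\<eta> $ i\<bar> \<le> jb \<eta>" using component_le_norm_cart[of \<eta> i] norm_le_jb[of \<eta>] by linarith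
      then show ?thesis by (simp add: p norm_mult mult_right_mono)
    qed
    show "integrable lborel (\<lambda>\<eta>. jb \<eta> ^ 1 * cmod (a \<eta>))" by (rule momentsD(3)[OF assms])
  qed
  show "osc a differentiable (at t)"
    unfolding osc_def by (rule partial_deriv_integral(1)[OF *])
  show "partial_deriv i (osc a) t = osc (\<lambda>\<eta>. \<i> * complex_of_real (\<eta> $ i) * a \<eta>) t"
    unfolding osc_def by (subst partial_deriv_integral(2)[OF *]) (simp add: p)
qed

lemma osc_slow: assumes "moments a" shows "osc a \<in> slow_space"
proof (rule slow_spanI)
  let ?B = "{osc a | a. moments a}"
  show "osc a \<in> add_span ?B" using assms by (blast intro: add_span.base)
  fix g assume "g \<in> ?B"
  then obtain b where g: "g = osc b" and b: "moments b" by auto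
  show "differentiable_all g" unfolding g using osc_derivative(1)[OF b] by simp
  have "partial_deriv i g = osc (\<lambda>\<eta>. \<i> * complex_of_real (\<eta> $ i) * b \<eta>)" for i
    unfolding g using osc_derivative(2)[OF b] by (intro ext)
  then show "partial_deriv i g \<in> add_span ?B" for i
    using moments_coordinate[OF b, of i] by (intro add_span.base) blast
  show "slow g" unfolding g by (rule bounded_imp_slow[OF norm_osc_le])
qed

lemma rapid_moments:
  fixes f :: "real^'n::finite \<Rightarrow> complex"
  assumes "rapid f" and [measurable]: "f \<in> borel_measurable borel" shows "moments f"
  unfolding moments_def
proof (intro conjI allI assms)
  fix k :: nat
  have "slow (\<lambda>x::real^'n. complex_of_real (jb x ^ k))"
    unfolding slow_def by (rule exI[of _ "real k"], rule exI[of _ 1]) (simp add: powr_realpow norm_power)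
  then have "rapid (\<lambda>x. f x * complex_of_real (jb x ^ k))" using rapid_mult_slow[OF assms(1)] by blast
  then have "integrable lborel (\<lambda>x. f x * complex_of_real (jb x ^ k))"
    by (rule rapid_integrable) measurable
  then have "integrable lborel (\<lambda>x. norm (f x * complex_of_real (jb x ^ k)))" by (rule integrable_norm)
  then show "integrable lborel (\<lambda>x. jb x ^ k * cmod (f x))"
    by (simp add: norm_mult norm_power mult.commute)
qed

lemma schwartz_moments: "f \<in> schwartz_space \<Longrightarrow> moments f"
  by (intro rapid_moments schwartz_rapid schwartz_measurable)

text \<open>The integral of f(z + t) over \<open>z\<close> does not depend on \<open>t\<close>;
  differentiating it under the integral sign gives the claim.\<close>

lemma integral_partial_deriv_eq_0:
  fixes f :: "real^'n::finite \<Rightarrow> complex"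
  assumes f: "f \<in> schwartz_space"
  shows "(LINT x|lborel. partial_deriv i f x) = 0"
proof -
  define r where "r = real CARD('n) + 1"
  have "\<exists>C. \<forall>x. cmod (partial_deriv j f x) \<le> C * jb x powr - r" for j
    using schwartz_rapid[OF schwartz_partial_deriv[OF f]] unfolding rapid_def by blast
  then obtain C where C: "\<And>j x. cmod (partial_deriv j f x) \<le> C j * jb x powr - r" by metis
  define K where "K = (\<Sum>j\<in>UNIV. \<bar>C j\<bar>)"
  have K: "cmod (partial_deriv j f x) \<le> K * jb x powr - r" for j x
  proof -
    have "C j \<le> K" using member_le_sum[of j UNIV "\<lambda>j. \<bar>C j\<bar>"] by (simp add: K_def)
    then show ?thesis by (intro order_trans[OF C mult_right_mono]) auto
  qed
  have "K \<ge> 0" by (auto simp: K_def intro: sum_nonneg)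
  have *: "\<And>t. integrable lborel (\<lambda>z. f (z + t))"
    "\<And>z s. (\<lambda>t. f (z + t)) differentiable (at s)"
    "\<And>z s j. s \<in> ball 0 1 \<Longrightarrow> cmod (partial_deriv j (\<lambda>t. f (z + t)) s) \<le> K * (2 powr r * 2 powr r * jb z powr - r)"
    "integrable lborel (\<lambda>z::real^'n. K * (2 powr r * 2 powr r * jb z powr - r))"
  proof -
    show "integrable lborel (\<lambda>z. f (z + t))" for t
      using integral_shift(2)[OF schwartz_measurable[OF f], of t] schwartz_integrable[OF f] by simp
    have eq: "(\<lambda>t. f (z + t)) = (\<lambda>t. f (t - (- z)))" for z by (simp add: add.commute)
    show "(\<lambda>t. f (z + t)) differentiable (at s)" for z s
      unfolding eq by (intro differentiable_shift schwartz_differentiable f)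
    show "cmod (partial_deriv j (\<lambda>t. f (z + t)) s) \<le> K * (2 powr r * 2 powr r * jb z powr - r)" if "s \<in> ball 0 1" for z s j
    proof -
      \<comment> \<open>On the unit ball Peetre's inequality costs 2^r for its constant and at most
        another 2^r for the bracket of \<open>s\<close>, so the majorant does not depend on
        \<open>s\<close>.\<close>
      have "jb s \<le> 2" using that jb_le[of s] by simp
      then have "jb s powr r \<le> 2 powr r" by (intro powr_mono2) (auto simp: r_def)
      have "partial_deriv j (\<lambda>t. f (z + t)) s = partial_deriv j f (s + z)"
        unfolding eq by (subst differentiable_shift) (auto intro: schwartz_differentiable f)
      then have "cmod (partial_deriv j (\<lambda>t. f (z + t)) s) \<le> K * jb (s + z) powr - r" using K by simp
      also have "\<dots> \<le> K * (2 powr r * jb s powr r * jb z powr - r)"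
      proof -
        have "\<bar>r\<bar> = r" by (simp add: r_def)
        then show ?thesis using jb_powr_add_le[of s z "- r"] \<open>K \<ge> 0\<close> by (intro mult_left_mono) simp_all
      qed
      also have "\<dots> \<le> K * (2 powr r * 2 powr r * jb z powr - r)"
        using \<open>jb s powr r \<le> 2 powr r\<close> \<open>K \<ge> 0\<close> by (intro mult_left_mono mult_right_mono) auto
      finally show ?thesis .
    qed
    show "integrable lborel (\<lambda>z::real^'n. K * (2 powr r * 2 powr r * jb z powr - r))"
      by (intro integrable_mult_right integrable_jb) (simp add: r_def)
  qed
  have "partial_deriv i (\<lambda>t. LINT z|lborel. f (z + t)) 0 = (LINT z|lborel. partial_deriv i (\<lambda>t. f (z + t)) 0)"
    by (rule partial_deriv_integral(2)[OF *])
  also have "(\<lambda>t. LINT z|lborel. f (z + t)) = (\<lambda>t. LINT z|lborel. f z)"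
    by (intro ext integral_shift schwartz_measurable f)
  also have "(\<lambda>z. partial_deriv i (\<lambda>t. f (z + t)) 0) = partial_deriv i f"
  proof
    fix z
    have "(\<lambda>t. f (z + t)) = (\<lambda>t. f (t - (- z)))" by (simp add: add.commute)
    then show "partial_deriv i (\<lambda>t. f (z + t)) 0 = partial_deriv i f z"
      using differentiable_shift(2)[of f 0 "- z" i] schwartz_differentiable[OF f] by simp
  qed
  finally show ?thesis by simp
qed

text \<open>Integration by parts: the derivative of \<open>f\<close> times a plane wave integrates
  to 0, and Leibniz's rule splits that integral into the two sides.\<close>

lemma osc_partial_deriv:
  assumes f: "f \<in> schwartz_space"
  shows "osc (partial_deriv i f) t = - \<i> * complex_of_real (t $ i) * osc f t"
proof -
  have "0 = (LINT \<eta>|lborel. partial_deriv i (\<lambda>\<eta>. f \<eta> * wave t \<eta>) \<eta>)"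
    using integral_partial_deriv_eq_0[OF schwartz_mult_slow[OF f slow_wave]] by simp
  also have "(\<lambda>\<eta>. partial_deriv i (\<lambda>\<eta>. f \<eta> * wave t \<eta>) \<eta>)
     = (\<lambda>\<eta>. partial_deriv i f \<eta> * wave t \<eta> + (\<i> * complex_of_real (t $ i)) * (f \<eta> * wave t \<eta>))"
    by (intro ext) (simp add: partial_deriv_mult schwartz_differentiable f wave_differentiable wave_partial_deriv)
  also have "(LINT \<eta>|lborel. \<dots>  \<eta>) = osc (partial_deriv i f) t + (\<i> * complex_of_real (t $ i)) * osc f t"
    unfolding osc_def
    by (simp add: integrable_mult_wave schwartz_integrable schwartz_partial_deriv f)
  finally show ?thesis by (simp add: add_eq_0_iff2)
qed

text \<open>The operator 1 minus the Laplacian. Under \<open>osc\<close> it becomes multiplication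
  by the squared bracket, so each application buys two powers of decay without singling out a
  coordinate.\<close>

definition bessel :: "(real^'n::finite \<Rightarrow> complex) \<Rightarrow> real^'n \<Rightarrow> complex" where
  "bessel f = (\<lambda>x. f x - (\<Sum>i\<in>UNIV. partial_deriv i (partial_deriv i f) x))"

lemma schwartz_bessel: "f \<in> schwartz_space \<Longrightarrow> bessel f \<in> schwartz_space"
  unfolding bessel_def by (intro schwartz_diff schwartz_sum schwartz_partial_deriv)

lemma osc_bessel:
  assumes f: "f \<in> schwartz_space"
  shows "osc (bessel f) t = complex_of_real ((jb t)\<^sup>2) * osc f t"
proof -
  have I: "integrable lborel (\<lambda>\<eta>. g \<eta> * wave t \<eta>)" if "g \<in> schwartz_space" for g
    using that by (intro integrable_mult_wave schwartz_integrable)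
  have I2: "integrable lborel (\<lambda>\<eta>. partial_deriv i (partial_deriv i f) \<eta> * wave t \<eta>)" for i
    by (intro I schwartz_partial_deriv f)
  have sq: "- \<i> * a * (- \<i> * a * F) = - (a\<^sup>2 * F)" for a F :: complex
  proof -
    have "- \<i> * a * (- \<i> * a * F) = (\<i> * \<i>) * (a * a) * F" by (simp only: mult_ac minus_mult_minus mult_minus_left mult_minus_right minus_minus)
    then show ?thesis by (simp add: power2_eq_square)
  qed
  have "osc (bessel f) t = (LINT \<eta>|lborel. f \<eta> * wave t \<eta> - (\<Sum>i\<in>UNIV. partial_deriv i (partial_deriv i f) \<eta> * wave t \<eta>))"
    by (simp only: osc_def bessel_def left_diff_distrib sum_distrib_right)
  also have "\<dots> = osc f t - (LINT \<eta>|lborel. (\<Sum>i\<in>UNIV. partial_deriv i (partial_deriv i f) \<eta> * wave t \<eta>))"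
    unfolding osc_def by (rule Bochner_Integration.integral_diff[OF I[OF f] Bochner_Integration.integrable_sum[OF I2]])
  also have "(LINT \<eta>|lborel. (\<Sum>i\<in>UNIV. partial_deriv i (partial_deriv i f) \<eta> * wave t \<eta>))
      = (\<Sum>i\<in>UNIV. osc (partial_deriv i (partial_deriv i f)) t)"
    unfolding osc_def by (rule Bochner_Integration.integral_sum[OF I2])
  also have "osc (partial_deriv i (partial_deriv i f)) t = - (complex_of_real ((t $ i)\<^sup>2) * osc f t)" for i
    using sq[of "complex_of_real (t $ i)" "osc f t"]
    by (simp only: osc_partial_deriv schwartz_partial_deriv f of_real_power)
  then have "osc f t - (\<Sum>i\<in>UNIV. osc (partial_deriv i (partial_deriv i f)) t)
      = osc f t + (\<Sum>i\<in>UNIV. complex_of_real ((t $ i)\<^sup>2)) * osc f t"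
    by (simp only: sum_negf sum_distrib_right diff_minus_eq_add)
  also have "(\<Sum>i\<in>UNIV. complex_of_real ((t $ i)\<^sup>2)) = complex_of_real ((norm t)\<^sup>2)"
  proof -
    have "(norm t)\<^sup>2 = (\<Sum>i\<in>UNIV. (t $ i)\<^sup>2)" by (simp add: norm_vec_def L2_set_def sum_nonneg)
    then show ?thesis by (simp only: of_real_sum)
  qed
  finally show ?thesis by (simp add: japanese_bracket_def distrib_right)
qed

text \<open>The transform of a Schwartz function is bounded by its L^1 norm. Applied to iterated
  images under \<open>bessel\<close>, this bound divides out one squared bracket each time.\<close>

lemma rapid_osc: assumes f: "f \<in> schwartz_space" shows "rapid (osc f)"
proof -
  have *: "\<exists>C. \<forall>t. (jb t)^(2 * k) * cmod (osc f t) \<le> C" if "f \<in> schwartz_space" for k and f :: "real^'a \<Rightarrow> complex"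
    using that
  proof (induction k arbitrary: f)
    case 0
    show ?case using norm_osc_le[of f] by auto
  next
    case (Suc k)
    from Suc.IH[OF schwartz_bessel[OF Suc.prems]] show ?case
      by (simp add: osc_bessel Suc.prems norm_mult norm_power power_add power2_eq_square mult_ac)
  qed
  show ?thesis unfolding rapid_def
  proof
    fix r
    obtain k :: nat where k: "r \<le> real k" using real_arch_simple by blast
    obtain C where C: "\<And>t. (jb t)^(2 * k) * cmod (osc f t) \<le> C" using *[OF f, of k] by blast
    have "cmod (osc f t) \<le> C * jb t powr - r" for t
    proof -
      have "C \<ge> 0" using order_trans[OF _ C[of t]] by simp
      have "cmod (osc f t) = ((jb t)^(2 * k) * cmod (osc f t)) * jb t powr - real (2 * k)"
        by (simp add: powr_minus powr_realpow del: of_nat_mult)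
      also have "\<dots> \<le> C * jb t powr - r"
        using k \<open>C \<ge> 0\<close> by (intro mult_mono C jb_powr_mono) auto
      finally show ?thesis .
    qed
    then show "\<exists>C. \<forall>x. cmod (osc f x) \<le> C * jb x powr - r" by blast
  qed
qed

lemma schwartz_osc: assumes "f \<in> schwartz_space" shows "osc f \<in> schwartz_space"
proof (rule schwartz_spanI)
  let ?B = "{osc f | f. f \<in> schwartz_space}"
  show "osc f \<in> add_span ?B" using assms by (blast intro: add_span.base)
  fix g assume "g \<in> ?B"
  then obtain f where g: "g = osc f" and f: "f \<in> schwartz_space" by auto
  show "differentiable_all g" unfolding g using osc_derivative(1)[OF schwartz_moments[OF f]] by simp
  have eq: "partial_deriv i g = osc (\<lambda>\<eta>. \<i> * complex_of_real (\<eta> $ i) * f \<eta>)" for i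
    unfolding g using osc_derivative(2)[OF schwartz_moments[OF f]] by (intro ext)
  have "(\<lambda>\<eta>. \<i> * complex_of_real (\<eta> $ i) * f \<eta>) \<in> schwartz_space" for i
  proof -
    have "(\<lambda>\<eta>. \<i> * complex_of_real (\<eta> $ i) * f \<eta>) = (\<lambda>\<eta>. \<i> * (f \<eta> * complex_of_real (\<eta> $ i)))"
      by (simp add: mult_ac)
    then show ?thesis using schwartz_cmult[OF schwartz_mult_slow[OF f slow_coordinate[of i]], of \<i>] by simp
  qed
  then have mem: "osc (\<lambda>\<eta>. \<i> * complex_of_real (\<eta> $ i) * f \<eta>) \<in> ?B" for i by blast
  show "partial_deriv i g \<in> add_span ?B" for i unfolding eq by (rule add_span.base) (rule mem)
  show "rapid g" unfolding g by (rule rapid_osc[OF f])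
qed

subsection \<open>Fourier inversion\<close>

lemma integral_affine:
  fixes f :: "'a::euclidean_space \<Rightarrow> 'b::{banach, second_countable_topology}"
  assumes [measurable]: "f \<in> borel_measurable borel" and c: "c \<noteq> 0"
  shows "(LINT x|lborel. f x) = (\<bar>c\<bar> ^ DIM('a)) *\<^sub>R (LINT x|lborel. f (t + c *\<^sub>R x))"
    and "integrable lborel f \<Longrightarrow> integrable lborel (\<lambda>x. f (t + c *\<^sub>R x))"
proof -
  note eq = lborel_affine[OF c, of t]
  have "(LINT x|lborel. f x) = (LINT x|density (distr lborel borel (\<lambda>x. t + c *\<^sub>R x)) (\<lambda>_. \<bar>c\<bar> ^ DIM('a)). f x)"
    by (subst eq) simp
  also have "\<dots> = (LINT x|distr lborel borel (\<lambda>x. t + c *\<^sub>R x). (\<bar>c\<bar> ^ DIM('a)) *\<^sub>R f x)"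
    by (subst integral_density) simp_all
  also have "\<dots> = (LINT x|lborel. (\<bar>c\<bar> ^ DIM('a)) *\<^sub>R f (t + c *\<^sub>R x))"
    by (subst integral_distr) simp_all
  also have "\<dots> = (\<bar>c\<bar> ^ DIM('a)) *\<^sub>R (LINT x|lborel. f (t + c *\<^sub>R x))" by simp
  finally show "(LINT x|lborel. f x) = (\<bar>c\<bar> ^ DIM('a)) *\<^sub>R (LINT x|lborel. f (t + c *\<^sub>R x))" .
  assume "integrable lborel f"
  then have "integrable (density (distr lborel borel (\<lambda>x. t + c *\<^sub>R x)) (\<lambda>_. \<bar>c\<bar> ^ DIM('a))) f"
    by (subst (asm) eq) simp
  then have "integrable (distr lborel borel (\<lambda>x. t + c *\<^sub>R x)) (\<lambda>x. (\<bar>c\<bar> ^ DIM('a)) *\<^sub>R f x)"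
    by (subst (asm) integrable_density) simp_all
  then have "integrable (distr lborel borel (\<lambda>x. t + c *\<^sub>R x)) (\<lambda>x. (1 / \<bar>c\<bar> ^ DIM('a)) *\<^sub>R ((\<bar>c\<bar> ^ DIM('a)) *\<^sub>R f x))"
    by (rule integrable_scaleR_right)
  then have "integrable (distr lborel borel (\<lambda>x. t + c *\<^sub>R x)) f" using c by simp
  then show "integrable lborel (\<lambda>x. f (t + c *\<^sub>R x))"
    by (subst (asm) integrable_distr_eq) simp_all
qed

lemma integrable_pair_mult:
  fixes f :: "'a::euclidean_space \<Rightarrow> complex" and g :: "'b::euclidean_space \<Rightarrow> complex"
  assumes "integrable lborel f" "integrable lborel g"
  shows "integrable (lborel \<Otimes>\<^sub>M lborel) (\<lambda>z. f (fst z) * g (snd z))"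
proof (rule integrableI_bounded)
  have [measurable]: "f \<in> borel_measurable borel" "g \<in> borel_measurable borel" using assms by simp_all
  show "(\<lambda>z. f (fst z) * g (snd z)) \<in> borel_measurable (lborel \<Otimes>\<^sub>M lborel)" by measurable
  have "(\<integral>\<^sup>+z. ennreal (norm (f (fst z) * g (snd z))) \<partial>(lborel \<Otimes>\<^sub>M lborel))
      = (\<integral>\<^sup>+x. \<integral>\<^sup>+y. ennreal (norm (f x)) * ennreal (norm (g y)) \<partial>lborel \<partial>lborel)"
    by (subst lborel.nn_integral_fst[symmetric]) (simp_all add: norm_mult ennreal_mult)
  also have "\<dots> = (\<integral>\<^sup>+x. ennreal (norm (f x)) \<partial>lborel) * (\<integral>\<^sup>+y. ennreal (norm (g y)) \<partial>lborel)"
    by (simp add: nn_integral_cmult nn_integral_multc)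
  also have "\<dots> < \<infinity>"
    using assms by (simp add: integrable_iff_bounded ennreal_mult_less_top)
  finally show "(\<integral>\<^sup>+z. ennreal (norm (f (fst z) * g (snd z))) \<partial>(lborel \<Otimes>\<^sub>M lborel)) < \<infinity>" .
qed

lemma integrable_pair_mult_bounded:
  fixes f :: "'a::euclidean_space \<Rightarrow> complex" and g :: "'b::euclidean_space \<Rightarrow> complex"
  assumes "integrable lborel f" "integrable lborel g"
    and k: "case_prod k \<in> borel_measurable (borel \<Otimes>\<^sub>M borel)" "\<And>x y. cmod (k x y) \<le> K"
  shows "integrable (lborel \<Otimes>\<^sub>M lborel) (\<lambda>(x, y). f x * g y * k x y)"
proof (rule Bochner_Integration.integrable_bound)
  have [measurable]: "f \<in> borel_measurable borel" "g \<in> borel_measurable borel" using assms by simp_all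
  show "integrable (lborel \<Otimes>\<^sub>M lborel) (\<lambda>z. K *\<^sub>R (f (fst z) * g (snd z)))"
    by (intro integrable_scaleR_right integrable_pair_mult assms)
  have [measurable]: "(\<lambda>x. k (fst x) (snd x)) \<in> borel_measurable (borel \<Otimes>\<^sub>M borel)"
    using k(1) by (simp add: split_beta')
  show "(\<lambda>(x, y). f x * g y * k x y) \<in> borel_measurable (lborel \<Otimes>\<^sub>M lborel)"
    unfolding split_beta' by measurable
  show "AE z in lborel \<Otimes>\<^sub>M lborel. norm (case z of (x, y) \<Rightarrow> f x * g y * k x y) \<le> norm (K *\<^sub>R (f (fst z) * g (snd z)))"
  proof (rule AE_I2)
    fix z :: "'a \<times> 'b"
    have "cmod (k (fst z) (snd z)) \<le> \<bar>K\<bar>" using k(2)[of "fst z" "snd z"] by simp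
    then have "cmod (f (fst z)) * cmod (g (snd z)) * cmod (k (fst z) (snd z)) \<le> cmod (f (fst z)) * cmod (g (snd z)) * \<bar>K\<bar>"
      by (intro mult_left_mono) simp_all
    then show "norm (case z of (x, y) \<Rightarrow> f x * g y * k x y) \<le> norm (K *\<^sub>R (f (fst z) * g (snd z)))"
      by (simp add: split_beta norm_mult mult_ac)
  qed
qed

text \<open>Fubini's theorem; the kernel is symmetric in its arguments, so the transform may sit on
  either factor.\<close>

lemma osc_duality:
  assumes "integrable lborel f" "integrable lborel h"
  shows "(LINT \<xi>|lborel. osc f \<xi> * h \<xi>) = (LINT y|lborel. f y * osc h y)"
proof -
  have int: "integrable (lborel \<Otimes>\<^sub>M lborel) (\<lambda>(y, \<xi>). f y * h \<xi> * wave y \<xi>)"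
    by (rule integrable_pair_mult_bounded[OF assms, of _ 1]) simp_all
  have "(LINT \<xi>|lborel. osc f \<xi> * h \<xi>) = (LINT \<xi>|lborel. LINT y|lborel. f y * h \<xi> * wave y \<xi>)"
  proof (rule Bochner_Integration.integral_cong[OF refl])
    fix \<xi>
    have "osc f \<xi> * h \<xi> = (LINT y|lborel. f y * wave \<xi> y * h \<xi>)"
      unfolding osc_def by (rule Bochner_Integration.integral_mult_left_zero[symmetric])
    also have "\<dots> = (LINT y|lborel. f y * h \<xi> * wave y \<xi>)"
      by (simp only: mult.assoc mult.commute[of "wave _ _"] wave_commute[of \<xi>])
    finally show "osc f \<xi> * h \<xi> = (LINT y|lborel. f y * h \<xi> * wave y \<xi>)" .
  qed
  also have "\<dots> = (LINT y|lborel. LINT \<xi>|lborel. f y * h \<xi> * wave y \<xi>)"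
    by (rule lborel_pair.Fubini_integral[OF int])
  also have "\<dots> = (LINT y|lborel. f y * osc h y)"
    unfolding osc_def by (simp only: mult.assoc Bochner_Integration.integral_mult_right_zero)
  finally show ?thesis .
qed

lemma integral_lborel_prod:
  fixes f :: "'a::euclidean_space \<Rightarrow> real \<Rightarrow> complex"
  assumes "\<And>b. b \<in> Basis \<Longrightarrow> integrable lborel (f b)"
  shows "(LINT x|(lborel::'a measure). (\<Prod>b\<in>Basis. f b (x \<bullet> b))) = (\<Prod>b\<in>Basis. (LINT x|lborel. f b x))"
    and "integrable (lborel::'a measure) (\<lambda>x. (\<Prod>b\<in>Basis. f b (x \<bullet> b)))"
proof -
  interpret product_sigma_finite "\<lambda>_::'a. lborel :: real measure" ..
  have [measurable]: "b \<in> Basis \<Longrightarrow> f b \<in> borel_measurable borel" for b using assms[of b] by simp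
  have m: "(\<lambda>x::'a. (\<Prod>b\<in>Basis. f b (x \<bullet> b))) \<in> borel_measurable borel" by measurable
  have T: "(\<lambda>g. \<Sum>b\<in>Basis. g b *\<^sub>R b) \<in> measurable (\<Pi>\<^sub>M b\<in>Basis. lborel) (borel :: 'a measure)" by measurable
  have eq: "(\<Prod>b\<in>Basis. f b ((\<Sum>c\<in>Basis. g c *\<^sub>R c) \<bullet> b)) = (\<Prod>b\<in>Basis. f b (g b))" for g :: "'a \<Rightarrow> real"
    by (intro prod.cong refl) simp
  have "(LINT x|(lborel::'a measure). (\<Prod>b\<in>Basis. f b (x \<bullet> b)))
     = (LINT g|(\<Pi>\<^sub>M b\<in>(Basis::'a set). lborel). (\<Prod>b\<in>Basis. f b (g b)))"
    unfolding lborel_eq[where 'a='a] by (subst integral_distr[OF T m]) (simp only: eq)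
  also have "\<dots> = (\<Prod>b\<in>Basis. (LINT x|lborel. f b x))"
    by (rule product_integral_prod) (simp_all add: assms)
  finally show "(LINT x|(lborel::'a measure). (\<Prod>b\<in>Basis. f b (x \<bullet> b))) = (\<Prod>b\<in>Basis. (LINT x|lborel. f b x))" .
  have "integrable (\<Pi>\<^sub>M b\<in>(Basis::'a set). lborel) (\<lambda>g. (\<Prod>b\<in>Basis. f b (g b)))"
    by (rule product_integrable_prod) (simp_all add: assms)
  then show "integrable (lborel::'a measure) (\<lambda>x. (\<Prod>b\<in>Basis. f b (x \<bullet> b)))"
    unfolding lborel_eq[where 'a='a] by (subst integrable_distr_eq[OF T m]) (simp only: eq)
qed

section \<open>The Gaussian and the inversion theorem\<close>

definition gauss :: "real^'n::finite \<Rightarrow> complex" where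
  "gauss x = complex_of_real (exp (- (norm x)\<^sup>2 / 2))"

lemma continuous_on_gauss: "continuous_on A gauss"
  unfolding gauss_def by (intro continuous_intros) simp

lemma gauss_measurable [measurable]: "gauss \<in> borel_measurable borel"
  by (intro borel_measurable_continuous_onI continuous_on_gauss)

lemma norm_gauss_le: "cmod (gauss x) \<le> 1"
  by (simp add: gauss_def)

lemma integral_gauss_real:
  "(LINT x|lborel. complex_of_real (exp (- x\<^sup>2 / 2)) * exp (\<i> * complex_of_real (t * x)))
     = complex_of_real (sqrt (2 * pi) * exp (- t\<^sup>2 / 2))"
  "integrable lborel (\<lambda>x. complex_of_real (exp (- x\<^sup>2 / 2)) * exp (\<i> * complex_of_real (t * x)))"
proof -
  have e: "complex_of_real (exp (- x\<^sup>2 / 2)) * exp (\<i> * complex_of_real (t * x)) =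
      complex_of_real (sqrt (2 * pi)) * (std_normal_density x *\<^sub>R iexp (t * x))" for x
    by (simp add: std_normal_density_def scaleR_conv_of_real)
  have "char std_normal_distribution t = (LINT x|lborel. std_normal_density x *\<^sub>R iexp (t * x))"
    unfolding char_def by (subst integral_density) auto
  then have c: "(LINT x|lborel. std_normal_density x *\<^sub>R iexp (t * x)) = complex_of_real (exp (- t\<^sup>2 / 2))"
    by (simp add: char_std_normal_distribution)
  then show "(LINT x|lborel. complex_of_real (exp (- x\<^sup>2 / 2)) * exp (\<i> * complex_of_real (t * x)))
     = complex_of_real (sqrt (2 * pi) * exp (- t\<^sup>2 / 2))"
    unfolding e Bochner_Integration.integral_mult_right_zero c by simp
  \<comment> \<open>Integrability is read off from the value: a non-integrable function has Bochner
    integral 0, while this integral is nonzero.\<close>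
  have "(LINT x|lborel. std_normal_density x *\<^sub>R iexp (t * x)) \<noteq> 0" unfolding c by simp
  then have "integrable lborel (\<lambda>x. std_normal_density x *\<^sub>R iexp (t * x))"
    using not_integrable_integral_eq by blast
  then show "integrable lborel (\<lambda>x. complex_of_real (exp (- x\<^sup>2 / 2)) * exp (\<i> * complex_of_real (t * x)))"
    unfolding e by (rule integrable_mult_right)
qed

lemma osc_gauss:
  fixes t :: "real^'n::finite"
  shows "osc gauss t = complex_of_real ((2 * pi) powr (real CARD('n) / 2)) * gauss t"
    and "integrable lborel (gauss :: real^'n \<Rightarrow> complex)"
proof -
  let ?f = "\<lambda>(t::real^'n) b x. complex_of_real (exp (- x\<^sup>2 / 2)) * exp (\<i> * complex_of_real ((t \<bullet> b) * x))"
  have nrm: "(norm x)\<^sup>2 = (\<Sum>b\<in>Basis. (x \<bullet> b)\<^sup>2)" for x :: "real^'n"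
    unfolding power2_norm_eq_inner euclidean_inner[of x x] by (simp add: power2_eq_square)
  have g: "gauss x = (\<Prod>b\<in>Basis. complex_of_real (exp (- (x \<bullet> b)\<^sup>2 / 2)))" for x :: "real^'n"
    unfolding gauss_def nrm by (simp add: exp_sum[symmetric] sum_divide_distrib sum_negf flip: of_real_prod)
  have w: "wave t x = (\<Prod>b\<in>Basis. exp (\<i> * complex_of_real ((t \<bullet> b) * (x \<bullet> b))))" for t x :: "real^'n"
    unfolding wave_def euclidean_inner[of x t] by (simp add: exp_sum[symmetric] sum_distrib_left mult.commute)
  have gw: "gauss x * wave t x = (\<Prod>b\<in>Basis. ?f t b (x \<bullet> b))" for t x :: "real^'n"
    unfolding g w by (simp only: prod.distrib)
  have "osc gauss t = (\<Prod>b\<in>Basis. (LINT x|lborel. ?f t b x))"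
    unfolding osc_def gw by (rule integral_lborel_prod(1)) (rule integral_gauss_real(2))
  also have "\<dots> = (\<Prod>b\<in>(Basis::(real^'n) set). complex_of_real (sqrt (2 * pi)) * complex_of_real (exp (- (t \<bullet> b)\<^sup>2 / 2)))"
    unfolding integral_gauss_real(1) by simp
  also have "\<dots> = complex_of_real (sqrt (2 * pi)) ^ CARD('n) * gauss t"
    unfolding g prod.distrib by simp
  also have "complex_of_real (sqrt (2 * pi)) ^ CARD('n) = complex_of_real ((2 * pi) powr (real CARD('n) / 2))"
    by (simp add: powr_half_sqrt[symmetric] powr_realpow[symmetric] powr_powr flip: of_real_power)
  finally show "osc gauss t = complex_of_real ((2 * pi) powr (real CARD('n) / 2)) * gauss t" .
  have "integrable lborel (\<lambda>x::real^'n. (\<Prod>b\<in>Basis. ?f 0 b (x \<bullet> b)))"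
    by (rule integral_lborel_prod(2)) (rule integral_gauss_real(2))
  then show "integrable lborel (gauss :: real^'n \<Rightarrow> complex)" unfolding gw[symmetric] by simp
qed

lemma osc_measurable [measurable]:
  assumes [measurable]: "a \<in> borel_measurable borel"
  shows "osc a \<in> borel_measurable borel"
proof -
  have "(\<lambda>t. LINT \<eta>|lborel. a \<eta> * wave t \<eta>) \<in> borel_measurable borel"
    by (rule lborel.borel_measurable_lebesgue_integral) (unfold split_beta', measurable)
  then show ?thesis unfolding osc_def[abs_def] .
qed

text \<open>Gaussian regularisation. A factor gauss(e \<xi>) makes the plane wave integrable, so
  that duality applies and turns the integral into an average of \<open>f\<close> around
  \<open>x\<close> at scale \<open>e\<close>. Letting \<open>e\<close> tend to 0 on that side uses
  only continuity and boundedness of \<open>f\<close>; this generality is needed where the inverted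
  function is a bounded continuous function times a window.\<close>

lemma fourier_inversion:
  fixes f :: "real^'n::finite \<Rightarrow> complex"
  assumes f: "integrable lborel f" "continuous_on UNIV f" "\<And>x. cmod (f x) \<le> B"
    and Ff: "integrable lborel (osc f)"
  shows "osc (osc f) (- x) = complex_of_real ((2 * pi) ^ CARD('n)) * f x"
proof -
  have [measurable]: "f \<in> borel_measurable borel" using f(1) by simp
  define e :: "nat \<Rightarrow> real" where "e k = 1 / real (Suc k)" for k
  have e: "e k > 0" for k by (simp add: e_def)
  have elim: "e \<longlonglongrightarrow> 0" unfolding e_def by (rule LIMSEQ_Suc) (rule lim_1_over_n)
  define h where "h k \<xi> = gauss (e k *\<^sub>R \<xi>) * wave (- x) \<xi>" for k and \<xi> :: "real^'n"
  have hint: "integrable lborel (h k)" for k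
  proof -
    have "integrable lborel (\<lambda>\<xi>::real^'n. gauss (0 + e k *\<^sub>R \<xi>))"
      by (rule integral_affine(2)) (use e[of k] osc_gauss(2) in simp_all)
    then show ?thesis unfolding h_def by (simp add: integrable_mult_wave)
  qed
  have lim1: "(\<lambda>k. LINT \<xi>|lborel. osc f \<xi> * h k \<xi>) \<longlonglongrightarrow> osc (osc f) (- x)"
    unfolding osc_def[of "osc f"]
  proof (rule integral_dominated_convergence[where w="\<lambda>\<xi>. norm (osc f \<xi>)"])
    show "integrable lborel (\<lambda>\<xi>. norm (osc f \<xi>))" using Ff by (rule integrable_norm)
    show "AE \<xi> in lborel. (\<lambda>k. osc f \<xi> * h k \<xi>) \<longlonglongrightarrow> osc f \<xi> * wave (- x) \<xi>"
    proof (rule AE_I2)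
      fix \<xi> :: "real^'n"
      have "(\<lambda>k. gauss (e k *\<^sub>R \<xi>)) \<longlonglongrightarrow> gauss (0 *\<^sub>R \<xi>)"
        by (rule continuous_on_tendsto_compose[OF continuous_on_gauss[of UNIV] tendsto_scaleR[OF elim tendsto_const]])
          simp_all
      then have "(\<lambda>k. osc f \<xi> * (gauss (e k *\<^sub>R \<xi>) * wave (- x) \<xi>)) \<longlonglongrightarrow> osc f \<xi> * (gauss (0 *\<^sub>R \<xi>) * wave (- x) \<xi>)"
        by (intro tendsto_mult tendsto_const)
      then show "(\<lambda>k. osc f \<xi> * h k \<xi>) \<longlonglongrightarrow> osc f \<xi> * wave (- x) \<xi>" by (simp add: h_def gauss_def)
    qed
    show "AE \<xi> in lborel. norm (osc f \<xi> * h k \<xi>) \<le> norm (osc f \<xi>)" for k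
    proof (rule AE_I2)
      fix \<xi>
      have "cmod (osc f \<xi>) * cmod (gauss (e k *\<^sub>R \<xi>)) \<le> cmod (osc f \<xi>) * 1"
        by (intro mult_left_mono norm_gauss_le) simp
      then show "norm (osc f \<xi> * h k \<xi>) \<le> norm (osc f \<xi>)" by (simp add: h_def norm_mult)
    qed
    show "(\<lambda>\<xi>. osc f \<xi> * wave (- x) \<xi>) \<in> borel_measurable lborel" by measurable
    show "(\<lambda>\<xi>. osc f \<xi> * h k \<xi>) \<in> borel_measurable lborel" for k unfolding h_def by measurable
  qed
  have eq: "(LINT \<xi>|lborel. osc f \<xi> * h k \<xi>) = (LINT z|lborel. f (x + e k *\<^sub>R z) * osc gauss z)" for k
  proof -
    let ?n = "CARD('n)"
    have osch: "osc (h k) y = of_real ((1 / e k) ^ ?n) * osc gauss ((1 / e k) *\<^sub>R (y - x))" for y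
    proof -
      let ?H = "\<lambda>\<xi>. gauss \<xi> * wave ((1 / e k) *\<^sub>R (y - x)) \<xi>"
      have "osc gauss ((1 / e k) *\<^sub>R (y - x)) = (LINT \<xi>|lborel. ?H \<xi>)" by (simp add: osc_def)
      also have "\<dots> = (\<bar>e k\<bar> ^ DIM(real^'n)) *\<^sub>R (LINT \<xi>|lborel. ?H (0 + e k *\<^sub>R \<xi>))"
        by (rule integral_affine(1)) (measurable, use e[of k] in simp)
      also have "(LINT \<xi>|lborel. ?H (0 + e k *\<^sub>R \<xi>)) = osc (h k) y"
        unfolding osc_def
      proof (rule Bochner_Integration.integral_cong[OF refl])
        fix \<xi>
        have "wave ((1 / e k) *\<^sub>R (y - x)) (e k *\<^sub>R \<xi>) = wave (y - x) \<xi>" using e[of k] by (simp add: wave_def)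
        then show "?H (0 + e k *\<^sub>R \<xi>) = h k \<xi> * wave y \<xi>"
          by (simp add: h_def wave_diff mult_ac)
      qed
      finally show ?thesis using e[of k] by (simp add: scaleR_conv_of_real power_divide)
    qed
    have "(LINT \<xi>|lborel. osc f \<xi> * h k \<xi>) = (LINT y|lborel. f y * osc (h k) y)"
      by (rule osc_duality[OF f(1) hint])
    also have "\<dots> = (\<bar>e k\<bar> ^ DIM(real^'n)) *\<^sub>R (LINT z|lborel. f (x + e k *\<^sub>R z) * osc (h k) (x + e k *\<^sub>R z))"
    proof (rule integral_affine(1))
      have "h k \<in> borel_measurable borel" using hint[of k] by simp
      then show "(\<lambda>y. f y * osc (h k) y) \<in> borel_measurable borel" by measurable
    qed (use e[of k] in simp)
    also have "\<dots> = (LINT z|lborel. (\<bar>e k\<bar> ^ DIM(real^'n)) *\<^sub>R (f (x + e k *\<^sub>R z) * osc (h k) (x + e k *\<^sub>R z)))"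
      by simp
    also have "\<dots> = (LINT z|lborel. f (x + e k *\<^sub>R z) * osc gauss z)"
    proof (rule Bochner_Integration.integral_cong[OF refl])
      fix z
      show "(\<bar>e k\<bar> ^ DIM(real^'n)) *\<^sub>R (f (x + e k *\<^sub>R z) * osc (h k) (x + e k *\<^sub>R z)) = f (x + e k *\<^sub>R z) * osc gauss z"
      proof -
        have 1: "(1 / e k) *\<^sub>R (x + e k *\<^sub>R z - x) = z" using e[of k] by simp
        have 2: "(\<bar>e k\<bar> ^ DIM(real^'n)) *\<^sub>R (a * (of_real ((1 / e k) ^ CARD('n)) * b)) = a * b" for a b :: complex
          using e[of k] by (simp add: scaleR_conv_of_real power_divide)
        show ?thesis unfolding osch 1 2 ..
      qed
    qed
    finally show ?thesis .
  qed
  have Gint: "integrable lborel (osc gauss :: real^'n \<Rightarrow> complex)"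
    unfolding osc_gauss(1)[abs_def] by (intro integrable_mult_right osc_gauss(2))
  have lim2: "(\<lambda>k. LINT z|lborel. f (x + e k *\<^sub>R z) * osc gauss z) \<longlonglongrightarrow> (LINT z|lborel. f x * osc gauss (z :: real^'n))"
  proof (rule integral_dominated_convergence[where w="\<lambda>z. B * norm (osc gauss z)"])
    show "integrable lborel (\<lambda>z::real^'n. B * norm (osc gauss z))"
      by (intro integrable_mult_right integrable_norm Gint)
    show "AE z in lborel. (\<lambda>k. f (x + e k *\<^sub>R z) * osc gauss z) \<longlonglongrightarrow> f x * osc gauss z"
    proof (rule AE_I2)
      fix z :: "real^'n"
      have "(\<lambda>k. x + e k *\<^sub>R z) \<longlonglongrightarrow> x + 0 *\<^sub>R z" by (intro tendsto_intros elim)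
      then have "(\<lambda>k. f (x + e k *\<^sub>R z)) \<longlonglongrightarrow> f (x + 0 *\<^sub>R z)"
        by (intro continuous_on_tendsto_compose[OF f(2)]) simp_all
      then show "(\<lambda>k. f (x + e k *\<^sub>R z) * osc gauss z) \<longlonglongrightarrow> f x * osc gauss z"
        by (intro tendsto_mult tendsto_const) simp
    qed
    show "AE z in lborel. norm (f (x + e k *\<^sub>R z) * osc gauss z) \<le> B * norm (osc gauss z)" for k
      unfolding norm_mult by (intro AE_I2 mult_right_mono f(3)) simp
    show "(\<lambda>z. f x * osc gauss z) \<in> borel_measurable lborel" by measurable
    show "(\<lambda>z. f (x + e k *\<^sub>R z) * osc gauss z) \<in> borel_measurable lborel" for k by measurable
  qed
  have "(LINT z|lborel. f x * osc gauss (z :: real^'n)) = f x * (LINT z|lborel. osc gauss (z :: real^'n))" by simp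
  \<comment> \<open>The mass of the averaging kernel: the Gaussian is an eigenfunction with
    eigenvalue (2 pi)^(n/2), and its own integral contributes the same factor once more.\<close>
  also have "(LINT z|lborel. osc gauss (z :: real^'n)) = complex_of_real ((2 * pi) powr (real CARD('n) / 2)) * osc gauss (0 :: real^'n)"
  proof -
    have "osc gauss (0 :: real^'n) = (LINT z|lborel. gauss (z :: real^'n))" by (simp add: osc_def)
    moreover have "(LINT z|lborel. osc gauss (z :: real^'n))
        = complex_of_real ((2 * pi) powr (real CARD('n) / 2)) * (LINT z|lborel. gauss (z :: real^'n))"
      unfolding osc_gauss(1) by (rule Bochner_Integration.integral_mult_right_zero)
    ultimately show ?thesis by simp
  qed
  also have "\<dots> = complex_of_real ((2 * pi) ^ CARD('n))"
    by (simp add: osc_gauss(1) gauss_def powr_realpow flip: of_real_mult powr_add)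
  finally have "osc (osc f) (- x) = f x * complex_of_real ((2 * pi) ^ CARD('n))"
    using LIMSEQ_unique[OF lim1[unfolded eq] lim2] by simp
  then show ?thesis by (simp add: mult.commute)
qed

lemma schwartz_bounded: assumes "f \<in> schwartz_space" obtains B where "\<And>x. cmod (f x) \<le> B"
proof -
  obtain C where C: "\<And>x. cmod (f x) \<le> C * jb x powr - 0" using rapidD[OF schwartz_rapid[OF assms]] by metis
  show ?thesis by (rule that[of C]) (use C in simp)
qed

lemma schwartz_inversion:
  fixes f :: "real^'n::finite \<Rightarrow> complex"
  assumes "f \<in> schwartz_space"
  shows "osc (osc f) (- x) = complex_of_real ((2 * pi) ^ CARD('n)) * f x"
proof -
  obtain B where "\<And>x. cmod (f x) \<le> B" using schwartz_bounded[OF assms] by blast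
  then show ?thesis
    by (rule fourier_inversion[OF schwartz_integrable[OF assms] schwartz_continuous[OF assms]])
      (rule schwartz_integrable[OF schwartz_osc[OF assms]])
qed

subsection \<open>Low-pass filters and products of bounded continuous functions\<close>

text \<open>A translate of the bump \<psi> localises \<open>h\<close> to an integrable continuous
  function, whose transform is \<open>h\<close> tested against a Schwartz function, hence 0.
  Inversion then gives h(x) \<psi>(0) = 0.\<close>

lemma continuous_eq_0_of_schwartz:
  fixes h \<psi> :: "real^'n::finite \<Rightarrow> complex"
  assumes \<psi>: "smooth_fun \<psi>" "compact (closure {\<xi>. \<psi> \<xi> \<noteq> 0})" "\<psi> 0 = 1"
    and h: "continuous_on UNIV h" "\<And>f. f \<in> schwartz_space \<Longrightarrow> (LINT x|lborel. h x * f x) = 0"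
  shows "h x = 0"
proof -
  define u where "u y = h y * \<psi> (y - x)" for y
  have S: "\<psi> \<in> schwartz_space" by (rule schwartz_compact_support[OF \<psi>(1,2)])
  have cu: "continuous_on UNIV u" unfolding u_def
    by (intro continuous_on_mult h(1) schwartz_continuous schwartz_shift S)
  let ?K = "closure {\<xi>. \<psi> \<xi> \<noteq> 0}"
  let ?L = "(\<lambda>z. z + x) ` ?K"
  have L: "compact ?L" by (intro compact_continuous_image continuous_intros \<psi>)
  have out: "u y = 0" if "y \<notin> ?L" for y
  proof -
    have "y - x \<notin> ?K" using that by (metis diff_add_cancel image_eqI)
    then have "\<psi> (y - x) = 0" using closure_subset[of "{\<xi>. \<psi> \<xi> \<noteq> 0}"] by auto
    then show ?thesis by (simp add: u_def)
  qed
  have "bounded (u ` ?L)"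
    by (intro compact_imp_bounded compact_continuous_image L continuous_on_subset[OF cu]) simp
  then obtain B where B: "\<And>y. y \<in> ?L \<Longrightarrow> cmod (u y) \<le> B" by (auto simp: bounded_iff)
  have bu: "cmod (u y) \<le> \<bar>B\<bar>" for y using B[of y] out[of y] by (cases "y \<in> ?L") auto
  have iu: "integrable lborel u"
  proof (rule Bochner_Integration.integrable_bound)
    have "emeasure lborel ?L < \<infinity>" by (rule emeasure_compact_finite[OF L])
    then show "integrable lborel (\<lambda>y. \<bar>B\<bar> * indicator ?L y)"
      by (intro integrable_mult_right integrable_real_indicator) (use compact_imp_closed[OF L] in auto)
    show "u \<in> borel_measurable lborel" using borel_measurable_continuous_onI[OF cu] by simp
    show "AE y in lborel. norm (u y) \<le> norm (\<bar>B\<bar> * indicator ?L y)"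
      by (intro AE_I2) (use bu out in \<open>auto simp: indicator_def\<close>)
  qed
  have "osc u t = 0" for t
  proof -
    have "osc u t = (LINT y|lborel. h y * (\<psi> (y - x) * wave t y))" by (simp add: osc_def u_def mult.assoc)
    also have "\<dots> = 0" by (intro h schwartz_mult_slow schwartz_shift S slow_wave)
    finally show ?thesis .
  qed
  then have o: "osc u = (\<lambda>t. 0)" by (rule ext)
  have "osc (osc u) (- x) = complex_of_real ((2 * pi) ^ CARD('n)) * u x"
    by (rule fourier_inversion[OF iu cu bu]) (simp add: o)
  then have "u x = 0" by (simp add: o osc_def[of "\<lambda>_. 0"])
  then show ?thesis using \<psi>(3) by (simp add: u_def)
qed

lemma schwartz_bounded_integrable:
  fixes F :: "real^'n::finite \<Rightarrow> complex"
  assumes "F \<in> borel_measurable borel" "\<And>x. cmod (F x) \<le> B" "f \<in> schwartz_space"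
  shows "integrable lborel (\<lambda>x. F x * f x)"
proof (rule Bochner_Integration.integrable_bound)
  have [measurable]: "f \<in> borel_measurable borel" "F \<in> borel_measurable borel"
    using schwartz_measurable assms by auto
  show "integrable lborel (\<lambda>x. B *\<^sub>R f x)" by (intro integrable_scaleR_right schwartz_integrable assms)
  show "(\<lambda>x. F x * f x) \<in> borel_measurable lborel" by measurable
  have "cmod (F x) * cmod (f x) \<le> \<bar>B\<bar> * cmod (f x)" for x
    using assms(2)[of x] by (intro mult_right_mono) simp_all
  then show "AE x in lborel. norm (F x * f x) \<le> norm (B *\<^sub>R f x)" by (intro AE_I2) (simp add: norm_mult)
qed

text \<open>Two continuous densities of the same distribution differ by a continuous function
  orthogonal to every Schwartz function; this uniqueness resolves the definite description.\<close>

lemma fun_of_distr_eq: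
  fixes F \<psi> :: "real^'n::finite \<Rightarrow> complex"
  assumes \<psi>: "smooth_fun \<psi>" "compact (closure {\<xi>. \<psi> \<xi> \<noteq> 0})" "\<psi> 0 = 1"
    and F: "continuous_on UNIV F" "\<And>x. cmod (F x) \<le> B"
  shows "fun_of_distr (distr_of_fun F) = F"
  unfolding fun_of_distr_def
proof (rule the_equality)
  have int: "integrable lborel (\<lambda>x. F x * f x)" if "f \<in> schwartz_space" for f
    by (rule schwartz_bounded_integrable[OF borel_measurable_continuous_onI[OF F(1)] F(2) that])
  then show "continuous_on UNIV F \<and> (\<forall>f\<in>schwartz_space. integrable lborel (\<lambda>x. F x * f x)) \<and>
      distr_of_fun F = distr_of_fun F" using F by simp
  fix h assume "continuous_on UNIV h \<and> (\<forall>f\<in>schwartz_space. integrable lborel (\<lambda>x. h x * f x)) \<and>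
      distr_of_fun h = distr_of_fun F"
  then have h: "continuous_on UNIV h" "\<And>f. f \<in> schwartz_space \<Longrightarrow> integrable lborel (\<lambda>x. h x * f x)"
    "distr_of_fun h = distr_of_fun F" by auto
  have "h x - F x = 0" for x
  proof (rule continuous_eq_0_of_schwartz[OF \<psi>])
    show "continuous_on UNIV (\<lambda>x. h x - F x)" by (intro continuous_on_diff h F)
    fix f :: "real^'n \<Rightarrow> complex" assume f: "f \<in> schwartz_space"
    have "(LINT x|lborel. h x * f x) = (LINT x|lborel. F x * f x)"
      using fun_cong[OF h(3), of f] f by (simp add: distr_of_fun_def)
    then show "(LINT x|lborel. (h x - F x) * f x) = 0"
      using h(2)[OF f] int[OF f] by (simp add: left_diff_distrib)
  qed
  then show "h = F" by (auto simp: fun_eq_iff)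
qed

section \<open>Low-pass filters as mollifiers\<close>

lemma fourier_eq_osc:
  fixes f :: "real^'n::finite \<Rightarrow> complex"
  shows "fourier f \<xi> = complex_of_real ((2 * pi) powr (- real CARD('n) / 2)) * osc f (- \<xi>)"
  unfolding fourier_def osc_def wave_def by (simp add: mult.commute inner_minus_left)

lemma inv_fourier_eq_osc:
  fixes f :: "real^'n::finite \<Rightarrow> complex"
  shows "inv_fourier f x = complex_of_real ((2 * pi) powr (- real CARD('n) / 2)) * osc f x"
  unfolding inv_fourier_def osc_def wave_def by (simp add: mult.commute inner_commute)

lemma schwartz_fourier: "f \<in> schwartz_space \<Longrightarrow> fourier f \<in> schwartz_space"
  and schwartz_inv_fourier: "f \<in> schwartz_space \<Longrightarrow> inv_fourier f \<in> schwartz_space"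
proof -
  assume "f \<in> schwartz_space"
  note S = schwartz_osc[OF this]
  show "inv_fourier f \<in> schwartz_space" unfolding inv_fourier_eq_osc[abs_def] by (rule schwartz_cmult[OF S])
  have "(\<lambda>\<xi>. osc f ((-1) *\<^sub>R \<xi>)) \<in> schwartz_space" by (rule schwartz_scale[OF S]) simp
  then show "fourier f \<in> schwartz_space" unfolding fourier_eq_osc[abs_def] by (intro schwartz_cmult) simp
qed

text \<open>The low-pass filter on functions: convolution with the transform of the dilated cutoff,
  after a change of variables that moves the dilation into the argument of \<open>F\<close>. In this
  form the limit in \<open>j\<close> can be taken under the integral.\<close>

definition smoothing :: "(real^'n::finite \<Rightarrow> complex) \<Rightarrow> nat \<Rightarrow> (real^'n \<Rightarrow> complex) \<Rightarrow> real^'n \<Rightarrow> complex" where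
  "smoothing \<psi> j F y = complex_of_real (1 / (2 * pi) ^ CARD('n)) * (LINT z|lborel. osc \<psi> z * F (y - (1 / 2 ^ j) *\<^sub>R z))"

lemma smoothing_continuous:
  fixes F :: "real^'n::finite \<Rightarrow> complex"
  assumes \<psi>: "\<psi> \<in> schwartz_space" and F: "continuous_on UNIV F" "\<And>x. cmod (F x) \<le> B"
  shows "continuous_on UNIV (smoothing \<psi> j F)"
    and "\<And>y. cmod (smoothing \<psi> j F y) \<le> 1 / (2 * pi) ^ CARD('n) * (B * (LINT z|lborel. cmod (osc \<psi> z)))"
proof -
  have [measurable]: "F \<in> borel_measurable borel" by (rule borel_measurable_continuous_onI[OF F(1)])
  have [measurable]: "osc \<psi> \<in> borel_measurable borel" by (rule schwartz_measurable[OF schwartz_osc[OF \<psi>]])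
  have io: "integrable lborel (osc \<psi>)" by (rule schwartz_integrable[OF schwartz_osc[OF \<psi>]])
  have iB: "integrable lborel (\<lambda>z. B * cmod (osc \<psi> z))" by (intro integrable_mult_right integrable_norm io)
  have bd: "cmod (osc \<psi> z * F v) \<le> B * cmod (osc \<psi> z)" for z v
    using mult_left_mono[OF F(2)[of v], of "cmod (osc \<psi> z)"] by (simp add: norm_mult mult.commute)
  show "continuous_on UNIV (smoothing \<psi> j F)"
    unfolding continuous_on_sequentially
  proof (intro allI ballI impI)
    fix X :: "nat \<Rightarrow> real^'n" and a assume "(\<forall>n. X n \<in> UNIV) \<and> X \<longlonglongrightarrow> a"
    then have X: "X \<longlonglongrightarrow> a" by simp
    have "(\<lambda>k. LINT z|lborel. osc \<psi> z * F (X k - (1 / 2 ^ j) *\<^sub>R z)) \<longlonglongrightarrow> (LINT z|lborel. osc \<psi> z * F (a - (1 / 2 ^ j) *\<^sub>R z))"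
    proof (rule integral_dominated_convergence[where w="\<lambda>z. B * cmod (osc \<psi> z)"])
      show "AE z in lborel. (\<lambda>k. osc \<psi> z * F (X k - (1 / 2 ^ j) *\<^sub>R z)) \<longlonglongrightarrow> osc \<psi> z * F (a - (1 / 2 ^ j) *\<^sub>R z)"
        by (intro AE_I2 tendsto_mult tendsto_const continuous_on_tendsto_compose[OF F(1)] tendsto_diff X) simp_all
      show "AE z in lborel. norm (osc \<psi> z * F (X k - (1 / 2 ^ j) *\<^sub>R z)) \<le> B * cmod (osc \<psi> z)" for k
        by (intro AE_I2 bd)
    qed (measurable, rule iB)
    then show "(smoothing \<psi> j F \<circ> X) \<longlonglongrightarrow> smoothing \<psi> j F a"
      unfolding smoothing_def o_def by (intro tendsto_mult tendsto_const)
  qed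
  fix y
  have "cmod (LINT z|lborel. osc \<psi> z * F (y - (1 / 2 ^ j) *\<^sub>R z)) \<le> (LINT z|lborel. B * cmod (osc \<psi> z))"
    by (rule Bochner_Integration.integral_norm_bound_integral[OF _ iB bd])
      (rule Bochner_Integration.integrable_bound[OF iB], measurable, intro AE_I2, use bd in \<open>simp add: order_trans[OF _ abs_ge_self]\<close>)
  then have "1 / (2 * pi) ^ CARD('n) * cmod (LINT z|lborel. osc \<psi> z * F (y - (1 / 2 ^ j) *\<^sub>R z))
      \<le> 1 / (2 * pi) ^ CARD('n) * (B * (LINT z|lborel. cmod (osc \<psi> z)))"
    by (intro mult_left_mono) simp_all
  then show "cmod (smoothing \<psi> j F y) \<le> 1 / (2 * pi) ^ CARD('n) * (B * (LINT z|lborel. cmod (osc \<psi> z)))"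
    unfolding smoothing_def norm_mult norm_of_real by simp
qed

text \<open>The kernel is fixed and only the argument of \<open>F\<close> moves, so dominated
  convergence applies. The normalised kernel has mass \<psi>(0) = 1 by Fourier inversion.\<close>

lemma smoothing_tendsto:
  fixes F :: "real^'n::finite \<Rightarrow> complex"
  assumes \<psi>: "\<psi> \<in> schwartz_space" "\<psi> 0 = 1" and F: "continuous_on UNIV F" "\<And>x. cmod (F x) \<le> B"
  shows "(\<lambda>j. smoothing \<psi> j F y) \<longlonglongrightarrow> F y"
proof -
  have [measurable]: "F \<in> borel_measurable borel" by (rule borel_measurable_continuous_onI[OF F(1)])
  have [measurable]: "osc \<psi> \<in> borel_measurable borel" by (rule schwartz_measurable[OF schwartz_osc[OF \<psi>(1)]])
  have io: "integrable lborel (osc \<psi>)" by (rule schwartz_integrable[OF schwartz_osc[OF \<psi>(1)]])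
  have "(\<lambda>j. LINT z|lborel. osc \<psi> z * F (y - (1 / 2 ^ j) *\<^sub>R z)) \<longlonglongrightarrow> (LINT z|lborel. osc \<psi> z * F (y - 0 *\<^sub>R z))"
  proof (rule integral_dominated_convergence[where w="\<lambda>z. B * cmod (osc \<psi> z)"])
    have "(\<lambda>j. 1 / 2 ^ j :: real) \<longlonglongrightarrow> 0" using LIMSEQ_realpow_zero[of "1/2::real"] by (simp add: power_one_over)
    then show "AE z in lborel. (\<lambda>j. osc \<psi> z * F (y - (1 / 2 ^ j) *\<^sub>R z)) \<longlonglongrightarrow> osc \<psi> z * F (y - 0 *\<^sub>R z)"
      by (intro AE_I2 tendsto_mult tendsto_const continuous_on_tendsto_compose[OF F(1)] tendsto_diff tendsto_scaleR) simp_all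
    show "AE z in lborel. norm (osc \<psi> z * F (y - (1 / 2 ^ j) *\<^sub>R z)) \<le> B * cmod (osc \<psi> z)" for j
    proof (rule AE_I2)
      fix z show "norm (osc \<psi> z * F (y - (1 / 2 ^ j) *\<^sub>R z)) \<le> B * cmod (osc \<psi> z)"
        using mult_left_mono[OF F(2)[of "y - (1 / 2 ^ j) *\<^sub>R z"], of "cmod (osc \<psi> z)"] by (simp add: norm_mult mult.commute)
    qed
    show "integrable lborel (\<lambda>z. B * cmod (osc \<psi> z))" by (intro integrable_mult_right integrable_norm io)
  qed measurable
  also have "(LINT z|lborel. osc \<psi> z * F (y - 0 *\<^sub>R z)) = osc (osc \<psi>) (- 0) * F y"
    by (simp add: osc_def[of "osc \<psi>"])
  also have "osc (osc \<psi>) (- 0) = complex_of_real ((2 * pi) ^ CARD('n))"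
    using schwartz_inversion[OF \<psi>(1), of 0] \<psi>(2) by simp
  finally have "(\<lambda>j. smoothing \<psi> j F y) \<longlonglongrightarrow> complex_of_real (1 / (2 * pi) ^ CARD('n)) * (complex_of_real ((2 * pi) ^ CARD('n)) * F y)"
    unfolding smoothing_def by (intro tendsto_mult tendsto_const)
  then show ?thesis by simp
qed

text \<open>By duality the filter tests \<open>F\<close> against the Fourier transform of the cutoff
  times an inverse Fourier transform of \<theta>. In the proof, \<open>ker\<close> recognises this
  as a convolution of \<theta> with the transformed cutoff, \<open>sub\<close> rescales the kernel,
  and Fubini moves the convolution over to \<open>F\<close>.\<close>

lemma low_pass_distr_of_fun:
  fixes F :: "real^'n::finite \<Rightarrow> complex"
  assumes \<psi>: "\<psi> \<in> schwartz_space" and F: "continuous_on UNIV F" "\<And>x. cmod (F x) \<le> B"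
  shows "low_pass \<psi> j (distr_of_fun F) = distr_of_fun (smoothing \<psi> j F)"
proof -
  have [measurable]: "F \<in> borel_measurable borel" by (rule borel_measurable_continuous_onI[OF F(1)])
  define r :: real where "r = 1 / 2 ^ j"
  have r: "r > 0" by (simp add: r_def)
  define c where "c = complex_of_real ((2 * pi) powr (- real CARD('n) / 2))"
  have cc: "c * c = complex_of_real (1 / (2 * pi) ^ CARD('n))"
  proof -
    have "(2 * pi) powr (- real CARD('n) / 2) * (2 * pi) powr (- real CARD('n) / 2) = (2 * pi) powr (- real CARD('n))"
      by (subst powr_add[symmetric]) simp
    also have "\<dots> = 1 / (2 * pi) ^ CARD('n)" by (simp add: powr_minus powr_realpow divide_inverse)
    finally show ?thesis unfolding c_def of_real_mult[symmetric] by (simp only:)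
  qed
  define \<psi>j where "\<psi>j \<xi> = \<psi> (r *\<^sub>R \<xi>)" for \<xi>
  have \<psi>j: "\<psi>j \<in> schwartz_space" unfolding \<psi>j_def by (rule schwartz_scale[OF \<psi>]) (use r in simp)
  have ker: "fourier (\<lambda>\<xi>. \<psi>j \<xi> * inv_fourier \<theta> \<xi>) t = c * c * (LINT y|lborel. \<theta> y * osc \<psi>j (y - t))"
    if \<theta>: "\<theta> \<in> schwartz_space" for \<theta> t
  proof -
    have i: "integrable lborel (\<lambda>\<xi>. \<psi>j \<xi> * wave (- t) \<xi>)" by (intro integrable_mult_wave schwartz_integrable \<psi>j)
    have "osc (\<lambda>\<xi>. \<psi>j \<xi> * inv_fourier \<theta> \<xi>) (- t) = (LINT \<xi>|lborel. \<psi>j \<xi> * inv_fourier \<theta> \<xi> * wave (- t) \<xi>)"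
      unfolding osc_def by (rule refl)
    also have "\<dots> = (LINT \<xi>|lborel. \<psi>j \<xi> * (c * osc \<theta> \<xi>) * wave (- t) \<xi>)"
      unfolding inv_fourier_eq_osc c_def[symmetric] by (rule refl)
    also have "\<dots> = (LINT \<xi>|lborel. c * (osc \<theta> \<xi> * (\<psi>j \<xi> * wave (- t) \<xi>)))" by (simp only: mult_ac)
    also have "\<dots> = c * (LINT y|lborel. \<theta> y * osc (\<lambda>\<xi>. \<psi>j \<xi> * wave (- t) \<xi>) y)"
      using osc_duality[OF schwartz_integrable[OF \<theta>] i] by simp
    also have "(\<lambda>y. osc (\<lambda>\<xi>. \<psi>j \<xi> * wave (- t) \<xi>) y) = (\<lambda>y. osc \<psi>j (y - t))"
      unfolding osc_def wave_diff by (simp only: mult_ac)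
    finally show ?thesis unfolding fourier_eq_osc c_def[symmetric] by (simp only: mult.assoc)
  qed
  have main: "(LINT t|lborel. F t * (c * c * (LINT y|lborel. \<theta> y * osc \<psi>j (y - t)))) = (LINT y|lborel. smoothing \<psi> j F y * \<theta> y)"
    if \<theta>: "\<theta> \<in> schwartz_space" for \<theta>
  proof -
    have [measurable]: "\<theta> \<in> borel_measurable borel" by (rule schwartz_measurable[OF \<theta>])
    have [measurable]: "osc \<psi>j \<in> borel_measurable borel" by (rule schwartz_measurable[OF schwartz_osc[OF \<psi>j]])
    have io: "integrable lborel (osc \<psi>j)" by (rule schwartz_integrable[OF schwartz_osc[OF \<psi>j]])
    have sub: "(LINT t|lborel. F t * osc \<psi>j (y - t)) = (LINT z|lborel. osc \<psi> z * F (y - r *\<^sub>R z))" for y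
    proof -
      have sc: "osc \<psi> v = (\<bar>r\<bar> ^ DIM(real^'n)) *\<^sub>R osc \<psi>j (r *\<^sub>R v)" for v
      proof -
        have "osc \<psi> v = (\<bar>r\<bar> ^ DIM(real^'n)) *\<^sub>R (LINT \<xi>|lborel. \<psi> (0 + r *\<^sub>R \<xi>) * wave v (0 + r *\<^sub>R \<xi>))"
          unfolding osc_def
          by (rule integral_affine(1)) (use schwartz_measurable[OF \<psi>] r in \<open>measurable, simp\<close>)
        also have "(LINT \<xi>|lborel. \<psi> (0 + r *\<^sub>R \<xi>) * wave v (0 + r *\<^sub>R \<xi>)) = osc \<psi>j (r *\<^sub>R v)"
          by (simp add: osc_def \<psi>j_def wave_def)
        finally show ?thesis .
      qed
      have "(LINT t|lborel. F t * osc \<psi>j (y - t)) = (\<bar>- r\<bar> ^ DIM(real^'n)) *\<^sub>R (LINT z|lborel. F (y + (- r) *\<^sub>R z) * osc \<psi>j (y - (y + (- r) *\<^sub>R z)))"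
        by (rule integral_affine(1)) (measurable, use r in simp)
      also have "\<dots> = (LINT z|lborel. (\<bar>r\<bar> ^ DIM(real^'n)) *\<^sub>R (F (y - r *\<^sub>R z) * osc \<psi>j (r *\<^sub>R z)))" by simp
      also have "\<dots> = (LINT z|lborel. osc \<psi> z * F (y - r *\<^sub>R z))"
        unfolding sc by (simp add: mult.commute)
      finally show ?thesis .
    qed
    have int: "integrable (lborel \<Otimes>\<^sub>M lborel) (\<lambda>(y, t). F t * (\<theta> y * osc \<psi>j (y - t)))"
    proof (rule lborel_pair.Fubini_integrable)
      show "(\<lambda>(y, t). F t * (\<theta> y * osc \<psi>j (y - t))) \<in> borel_measurable (lborel \<Otimes>\<^sub>M lborel)"
        unfolding split_beta' by measurable
      have i1: "integrable lborel (\<lambda>t. osc \<psi>j (y - t))" for y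
        using integral_reflect(2)[OF schwartz_measurable[OF schwartz_osc[OF \<psi>j]], of y] io by simp
      have dom: "norm (F t * (\<theta> y * osc \<psi>j (y - t))) \<le> norm (\<bar>B\<bar> * cmod (\<theta> y) * cmod (osc \<psi>j (y - t)))" for y t
      proof -
        have "cmod (F t) * (cmod (\<theta> y) * cmod (osc \<psi>j (y - t))) \<le> \<bar>B\<bar> * (cmod (\<theta> y) * cmod (osc \<psi>j (y - t)))"
          using F(2)[of t] by (intro mult_right_mono) simp_all
        then show ?thesis by (simp add: norm_mult mult.assoc)
      qed
      have i2: "integrable lborel (\<lambda>t. F t * (\<theta> y * osc \<psi>j (y - t)))" for y
        by (rule Bochner_Integration.integrable_bound[of lborel "\<lambda>t. \<bar>B\<bar> * cmod (\<theta> y) * cmod (osc \<psi>j (y - t))"])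
          (intro integrable_mult_right integrable_norm i1, measurable, intro AE_I2 dom)
      then show "AE y in lborel. integrable lborel (\<lambda>t. case (y, t) of (y, t) \<Rightarrow> F t * (\<theta> y * osc \<psi>j (y - t)))" by simp
      have "(LINT t|lborel. norm (F t * (\<theta> y * osc \<psi>j (y - t)))) \<le> \<bar>B\<bar> * cmod (\<theta> y) * (LINT t|lborel. cmod (osc \<psi>j t))" for y
      proof -
        have "(LINT t|lborel. norm (F t * (\<theta> y * osc \<psi>j (y - t)))) \<le> (LINT t|lborel. \<bar>B\<bar> * cmod (\<theta> y) * cmod (osc \<psi>j (y - t)))"
          using dom[of _ y] by (intro integral_mono integrable_norm i2 integrable_mult_right i1) (simp add: norm_mult)
        also have "\<dots> = \<bar>B\<bar> * cmod (\<theta> y) * (LINT t|lborel. cmod (osc \<psi>j (y - t)))" by simp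
        also have "(LINT t|lborel. cmod (osc \<psi>j (y - t))) = (LINT t|lborel. cmod (osc \<psi>j t))"
          by (rule integral_reflect(1)) measurable
        finally show ?thesis .
      qed
      then have bd: "norm (LINT t|lborel. norm (case (y, t) of (y, t) \<Rightarrow> F t * (\<theta> y * osc \<psi>j (y - t)))) \<le>
          norm (\<bar>B\<bar> * cmod (\<theta> y) * (LINT t|lborel. cmod (osc \<psi>j t)))" for y
        by (simp add: abs_mult)
      have m: "(\<lambda>y. LINT t|lborel. norm (F t * (\<theta> y * osc \<psi>j (y - t)))) \<in> borel_measurable lborel"
        by (rule lborel.borel_measurable_lebesgue_integral) (unfold split_beta', measurable)
      show "integrable lborel (\<lambda>y. LINT t|lborel. norm (case (y, t) of (y, t) \<Rightarrow> F t * (\<theta> y * osc \<psi>j (y - t))))"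
        by (rule Bochner_Integration.integrable_bound[of lborel "\<lambda>y. \<bar>B\<bar> * cmod (\<theta> y) * (LINT t|lborel. cmod (osc \<psi>j t))"])
          (intro integrable_mult_left integrable_mult_right integrable_norm schwartz_integrable \<theta>, simp add: m, intro AE_I2 bd)
    qed
    have "(LINT t|lborel. F t * (c * c * (LINT y|lborel. \<theta> y * osc \<psi>j (y - t))))
        = (LINT t|lborel. c * c * (LINT y|lborel. F t * (\<theta> y * osc \<psi>j (y - t))))"
    proof (rule Bochner_Integration.integral_cong[OF refl])
      fix t
      have "(LINT y|lborel. F t * (\<theta> y * osc \<psi>j (y - t))) = F t * (LINT y|lborel. \<theta> y * osc \<psi>j (y - t))"
        by (rule Bochner_Integration.integral_mult_right_zero)
      then show "F t * (c * c * (LINT y|lborel. \<theta> y * osc \<psi>j (y - t))) = c * c * (LINT y|lborel. F t * (\<theta> y * osc \<psi>j (y - t)))"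
        by (simp only: mult_ac)
    qed
    also have "\<dots> = c * c * (LINT t|lborel. (LINT y|lborel. F t * (\<theta> y * osc \<psi>j (y - t))))"
      by (rule Bochner_Integration.integral_mult_right_zero)
    also have "\<dots> = c * c * (LINT y|lborel. (LINT t|lborel. F t * (\<theta> y * osc \<psi>j (y - t))))"
      using lborel_pair.Fubini_integral[OF int] by simp
    also have "\<dots> = (LINT y|lborel. c * c * (\<theta> y * (LINT t|lborel. F t * osc \<psi>j (y - t))))"
    proof -
      have "(LINT t|lborel. F t * (\<theta> y * osc \<psi>j (y - t))) = \<theta> y * (LINT t|lborel. F t * osc \<psi>j (y - t))" for y
        by (subst Bochner_Integration.integral_mult_right_zero[symmetric]) (simp only: mult.left_commute)
      then show ?thesis by simp
    qed
    also have "\<dots> = (LINT y|lborel. smoothing \<psi> j F y * \<theta> y)"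
      unfolding sub smoothing_def cc r_def by (simp only: mult_ac)
    finally show ?thesis .
  qed
  show ?thesis
  proof (rule ext)
    fix \<theta> :: "real^'n \<Rightarrow> complex"
    show "low_pass \<psi> j (distr_of_fun F) \<theta> = distr_of_fun (smoothing \<psi> j F) \<theta>"
    proof (cases "\<theta> \<in> schwartz_space")
      case True
      have S1: "inv_fourier \<theta> \<in> schwartz_space" by (rule schwartz_inv_fourier[OF True])
      have S2: "(\<lambda>\<xi>. \<psi>j \<xi> * inv_fourier \<theta> \<xi>) \<in> schwartz_space" by (rule schwartz_mult[OF \<psi>j S1])
      have S3: "fourier (\<lambda>\<xi>. \<psi>j \<xi> * inv_fourier \<theta> \<xi>) \<in> schwartz_space" by (rule schwartz_fourier[OF S2])
      have "low_pass \<psi> j (distr_of_fun F) \<theta> = (LINT t|lborel. F t * fourier (\<lambda>\<xi>. \<psi>j \<xi> * inv_fourier \<theta> \<xi>) t)"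
        using True S1 S2 S3
        by (simp add: low_pass_def distr_inv_fourier_def distr_mult_def distr_fourier_def distr_of_fun_def \<psi>j_def r_def)
      then show ?thesis unfolding ker[OF True] main[OF True] using True by (simp add: distr_of_fun_def)
    next
      case False
      then show ?thesis by (simp add: low_pass_def distr_inv_fourier_def distr_of_fun_def)
    qed
  qed
qed

text \<open>The filtered distributions have the mollifications as continuous densities, which
  \<open>fun_of_distr\<close> returns. These are bounded uniformly in \<open>j\<close> and converge
  pointwise, so dominated convergence against \<theta> suffices.\<close>

lemma product_tendsto:
  fixes F G :: "real^'n::finite \<Rightarrow> complex"
  assumes \<psi>: "smooth_fun \<psi>" "compact (closure {\<xi>. \<psi> \<xi> \<noteq> 0})" "\<psi> 0 = 1"
    and F: "continuous_on UNIV F" "\<And>x. cmod (F x) \<le> A" and G: "continuous_on UNIV G" "\<And>x. cmod (G x) \<le> B"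
    and \<theta>: "\<theta> \<in> schwartz_space"
  shows "(\<lambda>j. distr_of_fun (\<lambda>x. fun_of_distr (low_pass \<psi> j (distr_of_fun F)) x
      * fun_of_distr (low_pass \<psi> j (distr_of_fun G)) x) \<theta>) \<longlonglongrightarrow> distr_of_fun (\<lambda>x. F x * G x) \<theta>"
proof -
  have S: "\<psi> \<in> schwartz_space" by (rule schwartz_compact_support[OF \<psi>(1,2)])
  have eq: "fun_of_distr (low_pass \<psi> j (distr_of_fun H)) = smoothing \<psi> j H"
    if H: "continuous_on UNIV H" "\<And>x. cmod (H x) \<le> C" for H j C
    unfolding low_pass_distr_of_fun[OF S H]
    by (rule fun_of_distr_eq[OF \<psi> smoothing_continuous(1)[OF S H] smoothing_continuous(2)[OF S H]])
  define k where "k = 1 / (2 * pi) ^ CARD('n) * (LINT z|lborel. cmod (osc \<psi> z))"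
  have bF: "cmod (smoothing \<psi> j F x) \<le> A * k" for j x
    using smoothing_continuous(2)[OF S F, of j x] by (simp add: k_def)
  have bG: "cmod (smoothing \<psi> j G x) \<le> B * k" for j x
    using smoothing_continuous(2)[OF S G, of j x] by (simp add: k_def)
  have [measurable]: "smoothing \<psi> j F \<in> borel_measurable borel" "smoothing \<psi> j G \<in> borel_measurable borel" for j
    by (rule borel_measurable_continuous_onI[OF smoothing_continuous(1)[OF S F]],
        rule borel_measurable_continuous_onI[OF smoothing_continuous(1)[OF S G]])
  have [measurable]: "F \<in> borel_measurable borel" "G \<in> borel_measurable borel" "\<theta> \<in> borel_measurable borel"
    by (rule borel_measurable_continuous_onI[OF F(1)], rule borel_measurable_continuous_onI[OF G(1)], rule schwartz_measurable[OF \<theta>])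
  have "(\<lambda>j. LINT x|lborel. smoothing \<psi> j F x * smoothing \<psi> j G x * \<theta> x) \<longlonglongrightarrow> (LINT x|lborel. F x * G x * \<theta> x)"
  proof (rule integral_dominated_convergence[where w="\<lambda>x. (A * k) * (B * k) * cmod (\<theta> x)"])
    show "AE x in lborel. (\<lambda>j. smoothing \<psi> j F x * smoothing \<psi> j G x * \<theta> x) \<longlonglongrightarrow> F x * G x * \<theta> x"
      by (intro AE_I2 tendsto_mult tendsto_const smoothing_tendsto[OF S \<psi>(3) F] smoothing_tendsto[OF S \<psi>(3) G])
    show "integrable lborel (\<lambda>x. (A * k) * (B * k) * cmod (\<theta> x))"
      by (intro integrable_mult_right integrable_norm schwartz_integrable \<theta>)
    show "AE x in lborel. norm (smoothing \<psi> j F x * smoothing \<psi> j G x * \<theta> x) \<le> (A * k) * (B * k) * cmod (\<theta> x)" for j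
      unfolding norm_mult by (intro AE_I2 mult_right_mono mult_mono bF bG order_trans[OF norm_ge_zero bF]) simp_all
  qed measurable
  then show ?thesis unfolding eq[OF F] eq[OF G] using \<theta> by (simp add: distr_of_fun_def)
qed

subsection \<open>Schwartz seminorms\<close>

lemma schwartz_seminorm_upper:
  assumes "f \<in> schwartz_space"
  shows "jb x ^ k * cmod (partial_derivs is f x) \<le> schwartz_seminorm k is f"
proof -
  have "bdd_above (range (\<lambda>x. jb x ^ k * cmod (partial_derivs is f x)))"
    using assms unfolding schwartz_space_def by simp
  then show ?thesis unfolding schwartz_seminorm_def by (rule cSUP_upper[OF UNIV_I])
qed

lemma schwartz_seminorm_le:
  assumes "\<And>x. jb x ^ k * cmod (partial_derivs is f x) \<le> B" shows "schwartz_seminorm k is f \<le> B"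
  unfolding schwartz_seminorm_def by (rule cSUP_least) (simp_all add: assms)

lemma schwartz_seminorm_nonneg: assumes "f \<in> schwartz_space" shows "0 \<le> schwartz_seminorm k is f"
  by (rule order_trans[OF _ schwartz_seminorm_upper[OF assms, of 0]]) simp

lemma schwartz_seminorm_Cons: "schwartz_seminorm k (i # is) f = schwartz_seminorm k is (partial_deriv i f)"
  by (simp add: schwartz_seminorm_def)

text \<open>The directions of a list are used from the left: appending an entry adds an outermost
  derivative, whereas \<open>partial_derivs_Cons\<close> splits off the innermost one.
  Differentiating a formula already known for the lower derivatives needs this end.\<close>

lemma partial_derivs_snoc: "partial_derivs (is @ [i]) f = partial_deriv i (partial_derivs is f)"
  by (simp add: partial_derivs_def)

lemma partial_derivs_add:
  assumes "smooth_fun f" "smooth_fun g"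
  shows "partial_derivs is (\<lambda>x. f x + g x) = (\<lambda>x. partial_derivs is f x + partial_derivs is g x)"
  using assms
proof (induction "is" arbitrary: f g)
  case (Cons i js)
  have "partial_deriv i (\<lambda>x. f x + g x) = (\<lambda>x. partial_deriv i f x + partial_deriv i g x)"
    by (rule ext, rule partial_deriv_add) (rule smooth_fun_differentiable, rule Cons.prems)+
  then show ?case using Cons.IH[OF smooth_fun_partial_deriv[OF Cons.prems(1)] smooth_fun_partial_deriv[OF Cons.prems(2)]]
    by simp
qed simp

lemma partial_derivs_cmult:
  assumes "smooth_fun f" shows "partial_derivs is (\<lambda>x. c * f x) = (\<lambda>x. c * partial_derivs is f x)"
  using assms
proof (induction "is" arbitrary: f)
  case (Cons i js)
  have "partial_deriv i (\<lambda>x. c * f x) = (\<lambda>x. c * partial_deriv i f x)"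
    by (rule ext, rule partial_deriv_cmult) (rule smooth_fun_differentiable, rule Cons.prems)
  then show ?case using Cons.IH[OF smooth_fun_partial_deriv[OF Cons.prems(1)]] by simp
qed simp

lemma schwartz_seminorm_add:
  assumes f: "f \<in> schwartz_space" and g: "g \<in> schwartz_space"
  shows "schwartz_seminorm k is (\<lambda>x. f x + g x) \<le> schwartz_seminorm k is f + schwartz_seminorm k is g"
proof (rule schwartz_seminorm_le)
  fix x
  have "jb x ^ k * cmod (partial_derivs is (\<lambda>x. f x + g x) x)
      \<le> jb x ^ k * (cmod (partial_derivs is f x) + cmod (partial_derivs is g x))"
    unfolding partial_derivs_add[OF schwartz_smooth[OF f] schwartz_smooth[OF g]]
    by (intro mult_left_mono norm_triangle_ineq) simp
  also have "\<dots> \<le> schwartz_seminorm k is f + schwartz_seminorm k is g"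
    unfolding distrib_left by (intro add_mono schwartz_seminorm_upper f g)
  finally show "jb x ^ k * cmod (partial_derivs is (\<lambda>x. f x + g x) x) \<le> schwartz_seminorm k is f + schwartz_seminorm k is g" .
qed

lemma schwartz_seminorm_cmult:
  assumes f: "f \<in> schwartz_space"
  shows "schwartz_seminorm k is (\<lambda>x. c * f x) \<le> cmod c * schwartz_seminorm k is f"
proof (rule schwartz_seminorm_le)
  fix x
  have "jb x ^ k * cmod (partial_derivs is (\<lambda>x. c * f x) x) = cmod c * (jb x ^ k * cmod (partial_derivs is f x))"
    unfolding partial_derivs_cmult[OF schwartz_smooth[OF f]] by (simp add: norm_mult)
  also have "\<dots> \<le> cmod c * schwartz_seminorm k is f"
    by (intro mult_left_mono schwartz_seminorm_upper f) simp
  finally show "jb x ^ k * cmod (partial_derivs is (\<lambda>x. c * f x) x) \<le> cmod c * schwartz_seminorm k is f" .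
qed

lemma schwartz_seminorm_diff_commute:
  assumes f: "f \<in> schwartz_space" and g: "g \<in> schwartz_space"
  shows "schwartz_seminorm k is (\<lambda>x. f x - g x) = schwartz_seminorm k is (\<lambda>x. g x - f x)"
proof -
  have *: "schwartz_seminorm k is (\<lambda>x. f x - g x) \<le> schwartz_seminorm k is (\<lambda>x. g x - f x)"
    if f: "f \<in> schwartz_space" and g: "g \<in> schwartz_space" for f g
    using schwartz_seminorm_cmult[OF schwartz_diff[OF g f], of k "is" "-1"] by simp
  from *[OF f g] *[OF g f] show ?thesis by simp
qed

lemma schwartz_seminorm_triangle:
  assumes "f \<in> schwartz_space" "g \<in> schwartz_space" "h \<in> schwartz_space"
  shows "schwartz_seminorm k is (\<lambda>x. f x - h x)
    \<le> schwartz_seminorm k is (\<lambda>x. f x - g x) + schwartz_seminorm k is (\<lambda>x. g x - h x)"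
  using schwartz_seminorm_add[OF schwartz_diff[OF assms(1,2)] schwartz_diff[OF assms(2,3)], of k "is"] by simp

subsection \<open>Tempered distributions\<close>

text \<open>The generating sets are balls with arbitrary centres, and the triangle inequality
  recentres such a ball at \<open>f\<close>. Intersections merge the two seminorm sets and take the
  smaller radius; unions need only one member.\<close>

lemma openin_schwartz_nhd:
  assumes "openin schwartz_topology U" "f \<in> U" "f \<in> schwartz_space"
  shows "\<exists>F d. finite F \<and> d > 0 \<and> (\<forall>g\<in>schwartz_space.
    (\<forall>z\<in>F. schwartz_seminorm (fst z) (snd z) (\<lambda>x. g x - f x) < d) \<longrightarrow> g \<in> U)"
proof -
  let ?B = "{{g \<in> schwartz_space. schwartz_seminorm k is (\<lambda>x. g x - f x) < e} | k is f e.
        f \<in> (schwartz_space :: (real^'a \<Rightarrow> complex) set) \<and> e > 0}"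
  have "generate_topology_on ?B U"
    using assms(1) unfolding schwartz_topology_def openin_topology_generated_by_iff .
  then show ?thesis using assms(2)
  proof (induction U)
    case Empty
    then show ?case by simp
  next
    case (Int U V)
    from Int.IH(1)[OF IntD1[OF Int.prems]] obtain F d where 1: "finite F" "d > 0"
      "\<forall>g\<in>schwartz_space. (\<forall>z\<in>F. schwartz_seminorm (fst z) (snd z) (\<lambda>x. g x - f x) < d) \<longrightarrow> g \<in> U"
      by (elim exE conjE)
    from Int.IH(2)[OF IntD2[OF Int.prems]] obtain F' d' where 2: "finite F'" "d' > 0"
      "\<forall>g\<in>schwartz_space. (\<forall>z\<in>F'. schwartz_seminorm (fst z) (snd z) (\<lambda>x. g x - f x) < d') \<longrightarrow> g \<in> V"
      by (elim exE conjE)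
    have "g \<in> U \<inter> V" if g: "g \<in> schwartz_space"
      "\<forall>z\<in>F \<union> F'. schwartz_seminorm (fst z) (snd z) (\<lambda>x. g x - f x) < min d d'" for g
      using 1(3)[rule_format, OF g(1)] 2(3)[rule_format, OF g(1)] g(2) by simp
    then show ?case using 1(1,2) 2(1,2) by (intro exI[of _ "F \<union> F'"] exI[of _ "min d d'"]) simp
  next
    case (UN K)
    then obtain V where V: "V \<in> K" "f \<in> V" by blast
    from UN.IH[OF V] obtain F d where 1: "finite F" "d > 0"
      "\<forall>g\<in>schwartz_space. (\<forall>z\<in>F. schwartz_seminorm (fst z) (snd z) (\<lambda>x. g x - f x) < d) \<longrightarrow> g \<in> V"
      by (elim exE conjE)
    then show ?case using V(1) by (intro exI[of _ F] exI[of _ d]) blast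
  next
    case (Basis U)
    then obtain k js h e where U: "U = {g \<in> schwartz_space. schwartz_seminorm k js (\<lambda>x. g x - h x) < e}"
      and h: "h \<in> schwartz_space" by blast
    let ?d = "e - schwartz_seminorm k js (\<lambda>x. f x - h x)"
    have d: "?d > 0" using Basis(2) U by simp
    have "g \<in> U" if g: "g \<in> schwartz_space" "schwartz_seminorm k js (\<lambda>x. g x - f x) < ?d" for g
      using schwartz_seminorm_triangle[OF g(1) assms(3) h, of k js] g U by simp
    then show ?case using d by (intro exI[of _ "{(k, js)}"] exI[of _ ?d]) simp
  qed
qed

lemma topspace_schwartz: "topspace (schwartz_topology :: (real^'n::finite \<Rightarrow> complex) topology) = schwartz_space"
proof -
  have "f \<in> \<Union> {{g \<in> schwartz_space. schwartz_seminorm k is (\<lambda>x. g x - f x) < e} | k is f e.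
        f \<in> (schwartz_space :: (real^'n \<Rightarrow> complex) set) \<and> e > 0}" if "f \<in> schwartz_space" for f :: "real^'n \<Rightarrow> complex"
  proof -
    let ?U = "{g \<in> schwartz_space. schwartz_seminorm 0 [] (\<lambda>x. g x - f x) < 1}"
    have "schwartz_seminorm 0 [] (\<lambda>x. f x - f x) \<le> 0" by (rule schwartz_seminorm_le) simp
    then have "f \<in> ?U" using that by simp
    moreover have "?U \<in> {{g \<in> schwartz_space. schwartz_seminorm k is (\<lambda>x. g x - f x) < e} | k is f e.
        f \<in> (schwartz_space :: (real^'n \<Rightarrow> complex) set) \<and> e > 0}"
      by (rule CollectI, intro exI[of _ 0] exI[of _ "[]"] exI[of _ f] exI[of _ 1]) (simp add: that)
    ultimately show ?thesis by (rule UnionI[rotated])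
  qed
  then show ?thesis unfolding schwartz_topology_def topology_generated_by_topspace by blast
qed

section \<open>Linearity and seminorm bounds of tempered distributions\<close>

lemma tempered_linear:
  assumes "u \<in> tempered_distr" "f \<in> schwartz_space" "g \<in> schwartz_space"
  shows "u (\<lambda>x. a * f x + b * g x) = a * u f + b * u g"
  using assms unfolding tempered_distr_def by simp

lemma tempered_cmult:
  assumes "u \<in> tempered_distr" "f \<in> schwartz_space" shows "u (\<lambda>x. a * f x) = a * u f"
  using tempered_linear[OF assms assms(2), of a 0] by simp

lemma tempered_diff:
  assumes "u \<in> tempered_distr" "f \<in> schwartz_space" "g \<in> schwartz_space"
  shows "u (\<lambda>x. f x - g x) = u f - u g"
  using tempered_linear[OF assms, of 1 "-1"] by simp

lemma tempered_sum:
  assumes u: "u \<in> tempered_distr" and "\<And>i. i \<in> I \<Longrightarrow> f i \<in> schwartz_space" and "finite I"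
  shows "u (\<lambda>x. \<Sum>i\<in>I. c i * f i x) = (\<Sum>i\<in>I. c i * u (f i))"
  using assms(3,2)
proof (induction I)
  case empty
  show ?case using tempered_cmult[OF u schwartz_0, of 0] by simp
next
  case (insert i I)
  have S: "(\<lambda>x. \<Sum>i\<in>I. c i * f i x) \<in> schwartz_space" "f i \<in> schwartz_space"
    using insert.prems by (auto intro!: schwartz_sum schwartz_cmult)
  show ?case using tempered_linear[OF u S(2) S(1), of "c i" 1] insert by simp
qed

text \<open>Continuity at 0 provides finitely many seminorms and a radius \<open>d\<close> within
  which the functional stays below 1; scaling extends this to all Schwartz functions.\<close>

lemma tempered_bound:
  assumes u: "u \<in> tempered_distr"
  obtains C F where "C > 0" "finite F"
    "\<And>f. f \<in> schwartz_space \<Longrightarrow> cmod (u f) \<le> C * (\<Sum>z\<in>F. schwartz_seminorm (fst z) (snd z) f)"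
proof -
  have cont: "continuous_map schwartz_topology euclidean u" using u unfolding tempered_distr_def by simp
  let ?U = "{f \<in> topspace schwartz_topology. u f \<in> ball 0 1}"
  have "openin schwartz_topology ?U"
    by (rule openin_continuous_map_preimage[OF cont]) simp
  moreover have "(\<lambda>x. 0) \<in> ?U" using tempered_cmult[OF u schwartz_0, of 0] schwartz_0 by (simp add: topspace_schwartz)
  ultimately have "\<exists>F d. finite F \<and> d > 0 \<and> (\<forall>g\<in>schwartz_space.
    (\<forall>z\<in>F. schwartz_seminorm (fst z) (snd z) (\<lambda>x. g x - 0) < d) \<longrightarrow> g \<in> ?U)"
    by (rule openin_schwartz_nhd[OF _ _ schwartz_0])
  then obtain F d where F: "finite F" "d > 0"
    "\<And>g. g \<in> schwartz_space \<Longrightarrow> (\<forall>z\<in>F. schwartz_seminorm (fst z) (snd z) (\<lambda>x. g x - 0) < d) \<Longrightarrow> g \<in> ?U"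
    by blast
  have "cmod (u f) \<le> (2 / d) * (\<Sum>z\<in>F. schwartz_seminorm (fst z) (snd z) f)" if f: "f \<in> schwartz_space" for f
  proof (rule field_le_epsilon)
    fix e :: real assume e: "e > 0"
    define s where "s = (\<Sum>z\<in>F. schwartz_seminorm (fst z) (snd z) f)"
    have s: "s \<ge> 0" unfolding s_def by (intro sum_nonneg schwartz_seminorm_nonneg f)
    \<comment> \<open>The summand d e / 2 keeps the scaling factor meaningful when all the seminorms
      vanish; it returns as the error \<open>e\<close> at the end.\<close>
    define m where "m = s + d * e / 2"
    have m: "m > 0" using s e F(2) by (simp add: m_def add_nonneg_pos)
    define a where "a = d / (2 * m)"
    have a: "a > 0" using m F(2) by (simp add: a_def)
    have "schwartz_seminorm (fst z) (snd z) (\<lambda>x. complex_of_real a * f x - 0) < d" if z: "z \<in> F" for z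
    proof -
      have "schwartz_seminorm (fst z) (snd z) (\<lambda>x. complex_of_real a * f x) \<le> a * schwartz_seminorm (fst z) (snd z) f"
        using schwartz_seminorm_cmult[OF f, of "fst z" "snd z" "complex_of_real a"] a by simp
      also have "\<dots> \<le> a * m"
      proof (intro mult_left_mono)
        have "schwartz_seminorm (fst z) (snd z) f \<le> s"
          unfolding s_def by (rule member_le_sum[OF z _ F(1)]) (rule schwartz_seminorm_nonneg[OF f])
        then show "schwartz_seminorm (fst z) (snd z) f \<le> m" using e F(2) by (simp add: m_def add_increasing2)
      qed (use a in simp)
      also have "\<dots> < d" using m F(2) by (simp add: a_def)
      finally show ?thesis by simp
    qed
    then have "(\<lambda>x. complex_of_real a * f x) \<in> ?U" by (intro F(3) schwartz_cmult f) blast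
    then have "a * cmod (u f) < 1" using tempered_cmult[OF u f, of "complex_of_real a"] a by (simp add: norm_mult)
    then have "cmod (u f) \<le> 1 / a" using a by (simp add: field_simps)
    also have "1 / a = (2 / d) * s + e" using F(2) m by (simp add: a_def m_def field_simps)
    finally show "cmod (u f) \<le> (2 / d) * (\<Sum>z\<in>F. schwartz_seminorm (fst z) (snd z) f) + e" by (simp add: s_def)
  qed
  then show ?thesis using that[of "2 / d" F] F by simp
qed

lemma tempered_distrI:
  fixes u :: "(real^'n::finite \<Rightarrow> complex) \<Rightarrow> complex"
  assumes ext: "u \<in> extensional schwartz_space"
    and lin: "\<And>f g a b. f \<in> schwartz_space \<Longrightarrow> g \<in> schwartz_space \<Longrightarrow> u (\<lambda>x. a * f x + b * g x) = a * u f + b * u g"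
    and bd: "\<And>f. f \<in> schwartz_space \<Longrightarrow> cmod (u f) \<le> C * schwartz_seminorm k is f"
  shows "u \<in> tempered_distr"
proof -
  have "openin schwartz_topology {f \<in> schwartz_space. u f \<in> V}" if V: "open V" for V
  proof (subst openin_subopen, intro ballI)
    fix f assume "f \<in> {f \<in> schwartz_space. u f \<in> V}"
    then have f: "f \<in> schwartz_space" "u f \<in> V" by auto
    obtain e where e: "e > 0" "ball (u f) e \<subseteq> V" using V f(2) unfolding open_contains_ball by blast
    define d where "d = e / (\<bar>C\<bar> + 1)"
    have d: "d > 0" using e by (simp add: d_def)
    let ?T = "{g \<in> schwartz_space. schwartz_seminorm k is (\<lambda>x. g x - f x) < d}"
    have "openin schwartz_topology ?T"
      unfolding schwartz_topology_def by (rule topology_generated_by_Basis, rule CollectI,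
        intro exI[of _ k] exI[of _ "is"] exI[of _ f] exI[of _ d]) (simp add: f(1) d)
    moreover have "schwartz_seminorm k is (\<lambda>x. f x - f x) \<le> 0"
      by (rule schwartz_seminorm_le) (simp add: partial_derivs_cmult[OF schwartz_smooth[OF schwartz_0], of "is" 0, simplified])
    then have "f \<in> ?T" using f d by simp
    moreover have "?T \<subseteq> {f \<in> schwartz_space. u f \<in> V}"
    proof
      fix g assume "g \<in> ?T"
      then have g: "g \<in> schwartz_space" "schwartz_seminorm k is (\<lambda>x. g x - f x) < d" by auto
      have "u g - u f = u (\<lambda>x. g x - f x)" using lin[OF g(1) f(1), of 1 "-1"] by simp
      then have "cmod (u g - u f) \<le> C * schwartz_seminorm k is (\<lambda>x. g x - f x)"
        using bd[OF schwartz_diff[OF g(1) f(1)]] by simp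
      also have "\<dots> \<le> (\<bar>C\<bar> + 1) * schwartz_seminorm k is (\<lambda>x. g x - f x)"
        by (intro mult_right_mono schwartz_seminorm_nonneg schwartz_diff g f) simp
      also have "\<dots> < (\<bar>C\<bar> + 1) * d" using g(2) by (intro mult_strict_left_mono) simp_all
      also have "\<dots> = e" by (simp add: d_def add_nonneg_eq_0_iff)
      finally have "u g \<in> ball (u f) e" by (simp add: dist_norm norm_minus_commute)
      then show "g \<in> {f \<in> schwartz_space. u f \<in> V}" using e g by blast
    qed
    ultimately show "\<exists>T. openin schwartz_topology T \<and> f \<in> T \<and> T \<subseteq> {f \<in> schwartz_space. u f \<in> V}" by blast
  qed
  then have "continuous_map schwartz_topology euclidean u"
    by (simp add: continuous_map_def topspace_schwartz)
  then show ?thesis using ext lin unfolding tempered_distr_def by simp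
qed

lemma distr_of_fun_apply: "f \<in> schwartz_space \<Longrightarrow> distr_of_fun F f = (LINT x|lborel. F x * f x)"
  by (simp add: distr_of_fun_def)

lemma tempered_distr_of_fun:
  fixes F :: "real^'n::finite \<Rightarrow> complex"
  assumes F: "F \<in> borel_measurable borel" "\<And>x. cmod (F x) \<le> B"
  shows "distr_of_fun F \<in> tempered_distr"
proof (rule tempered_distrI)
  define N where "N = CARD('n) + 1"
  show "distr_of_fun F \<in> extensional schwartz_space" by (simp add: distr_of_fun_def)
  note int = schwartz_bounded_integrable[OF F]
  show "distr_of_fun F (\<lambda>x. a * f x + b * g x) = a * distr_of_fun F f + b * distr_of_fun F g"
    if f: "f \<in> schwartz_space" and g: "g \<in> schwartz_space" for f g a b
  proof -
    have "distr_of_fun F (\<lambda>x. a * f x + b * g x) = (LINT x|lborel. a * (F x * f x) + b * (F x * g x))"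
      by (subst distr_of_fun_apply) (intro schwartz_add schwartz_cmult f g, simp only: distrib_left mult.left_commute)
    also have "\<dots> = (LINT x|lborel. a * (F x * f x)) + (LINT x|lborel. b * (F x * g x))"
      by (intro Bochner_Integration.integral_add integrable_mult_right int f g)
    finally show ?thesis by (simp add: distr_of_fun_apply f g)
  qed
  show "cmod (distr_of_fun F f) \<le> (\<bar>B\<bar> * (LINT x|(lborel::(real^'n) measure). jb x powr - real N)) * schwartz_seminorm N [] f"
    if f: "f \<in> schwartz_space" for f
  proof -
    have iN: "integrable lborel (\<lambda>x::real^'n. jb x powr - real N)" by (rule integrable_jb) (simp add: N_def)
    have "cmod (LINT x|lborel. F x * f x) \<le> (LINT x|(lborel::(real^'n) measure). (\<bar>B\<bar> * schwartz_seminorm N [] f) * jb x powr - real N)"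
    proof (rule Bochner_Integration.integral_norm_bound_integral[OF int[OF f] integrable_mult_right[OF iN]])
      fix x
      have "jb x ^ N * cmod (f x) \<le> schwartz_seminorm N [] f" using schwartz_seminorm_upper[OF f, of x N "[]"] by simp
      then have "cmod (f x) \<le> schwartz_seminorm N [] f * jb x powr - real N"
        by (simp add: powr_minus powr_realpow field_simps)
      moreover have "cmod (F x) \<le> \<bar>B\<bar>" using F(2)[of x] by simp
      ultimately have "cmod (F x) * cmod (f x) \<le> \<bar>B\<bar> * (schwartz_seminorm N [] f * jb x powr - real N)"
        by (intro mult_mono) simp_all
      then show "norm (F x * f x) \<le> (\<bar>B\<bar> * schwartz_seminorm N [] f) * jb x powr - real N"
        by (simp add: norm_mult mult.assoc)
    qed
    then show ?thesis by (simp add: distr_of_fun_apply f mult_ac)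
  qed
qed

lemma tempered_tendsto:
  assumes u: "u \<in> tempered_distr" and S: "\<And>n. f n \<in> schwartz_space" "g \<in> schwartz_space"
    and lim: "\<And>k is. (\<lambda>n. schwartz_seminorm k is (\<lambda>x. f n x - g x)) \<longlonglongrightarrow> 0"
  shows "(\<lambda>n. u (f n)) \<longlonglongrightarrow> u g"
proof -
  obtain C F where C: "C > 0" "finite F"
    "\<And>f. f \<in> schwartz_space \<Longrightarrow> cmod (u f) \<le> C * (\<Sum>z\<in>F. schwartz_seminorm (fst z) (snd z) f)"
    using tempered_bound[OF u] by blast
  have "(\<lambda>n. C * (\<Sum>z\<in>F. schwartz_seminorm (fst z) (snd z) (\<lambda>x. f n x - g x))) \<longlonglongrightarrow> C * (\<Sum>z\<in>F. 0)"
    by (intro tendsto_mult tendsto_const tendsto_sum lim)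
  then have l: "(\<lambda>n. C * (\<Sum>z\<in>F. schwartz_seminorm (fst z) (snd z) (\<lambda>x. f n x - g x))) \<longlonglongrightarrow> 0" by simp
  have "(\<lambda>n. u (f n) - u g) \<longlonglongrightarrow> 0"
  proof (rule Lim_null_comparison[OF _ l], rule always_eventually, rule allI)
    fix n
    show "norm (u (f n) - u g) \<le> C * (\<Sum>z\<in>F. schwartz_seminorm (fst z) (snd z) (\<lambda>x. f n x - g x))"
      using C(3)[OF schwartz_diff[OF S(1)[of n] S(2)]] tempered_diff[OF u S(1)[of n] S(2)] by simp
  qed
  then show ?thesis by (rule LIM_zero_cancel)
qed

section \<open>Moving a distribution under an integral\<close>

lemma simple_function_integral:
  fixes h :: "'z \<Rightarrow> 'b::{banach, second_countable_topology}"
  assumes "finite_measure M" and s: "simple_function M s"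
  shows "(LINT z|M. h (s z)) = (\<Sum>a\<in>s ` space M. measure M (s -` {a} \<inter> space M) *\<^sub>R h a)"
    and "integrable M (\<lambda>z. h (s z))"
proof -
  interpret finite_measure M by fact
  have fin: "finite (s ` space M)" using s by (rule simple_functionD(1))
  have m[measurable]: "s -` {a} \<inter> space M \<in> sets M" for a using s by (rule simple_functionD(2))
  have eq: "h (s z) = (\<Sum>a\<in>s ` space M. indicator (s -` {a} \<inter> space M) z *\<^sub>R h a)" if z: "z \<in> space M" for z
  proof -
    have "(\<Sum>a\<in>s ` space M. indicator (s -` {a} \<inter> space M) z *\<^sub>R h a) = (\<Sum>a\<in>s ` space M. if a = s z then h a else 0)"
      by (intro sum.cong refl) (use z in \<open>simp add: indicator_def eq_commute\<close>)
    then show ?thesis using fin z by simp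
  qed
  have i0: "integrable M (indicator (s -` {a} \<inter> space M) :: 'a \<Rightarrow> real)" for a
    by (intro integrable_real_indicator m) (simp add: emeasure_eq_measure)
  have i: "integrable M (\<lambda>z. indicator (s -` {a} \<inter> space M) z *\<^sub>R h a)" for a
    by (intro integrable_scaleR_left i0)
  have "(LINT z|M. h (s z)) = (LINT z|M. (\<Sum>a\<in>s ` space M. indicator (s -` {a} \<inter> space M) z *\<^sub>R h a))"
    by (rule Bochner_Integration.integral_cong[OF refl]) (rule eq)
  also have "\<dots> = (\<Sum>a\<in>s ` space M. (LINT z|M. indicator (s -` {a} \<inter> space M) z *\<^sub>R h a))"
    by (rule Bochner_Integration.integral_sum[OF i])
  also have "\<dots> = (\<Sum>a\<in>s ` space M. measure M (s -` {a} \<inter> space M) *\<^sub>R h a)"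
    by (intro sum.cong refl) (simp add: i0)
  finally show "(LINT z|M. h (s z)) = (\<Sum>a\<in>s ` space M. measure M (s -` {a} \<inter> space M) *\<^sub>R h a)" .
  have "integrable M (\<lambda>z. (\<Sum>a\<in>s ` space M. indicator (s -` {a} \<inter> space M) z *\<^sub>R h a))"
    by (rule Bochner_Integration.integrable_sum[OF i])
  then show "integrable M (\<lambda>z. h (s z))"
    by (subst Bochner_Integration.integrable_cong[OF refl eq])
qed

text \<open>Simple functions \<open>s i\<close> converging to the identity replace the parameter.
  For them the integral is a finite sum, where linearity suffices. In the limit these sums converge
  to \<theta> in every seminorm, and the values \<open>u (G (s i z))\<close> converge boundedly, so
  both sides tend to the desired ones. Since the measure is finite and the seminorms of the family
  are bounded, constants serve as majorants throughout.\<close>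

lemma tempered_integral:
  fixes G :: "'z::euclidean_space \<Rightarrow> real^'n::finite \<Rightarrow> complex"
  assumes u: "u \<in> tempered_distr" and M: "finite_measure M" and sM: "sets M = sets borel"
    and G: "\<And>z. G z \<in> schwartz_space"
    and cont: "\<And>k is Z z. Z \<longlonglongrightarrow> z \<Longrightarrow> (\<lambda>n. schwartz_seminorm k is (\<lambda>t. G (Z n) t - G z t)) \<longlonglongrightarrow> 0"
    and bdd: "\<And>k is. \<exists>C. \<forall>z. schwartz_seminorm k is (G z) \<le> C"
    and \<theta>: "\<theta> \<in> schwartz_space" "\<And>t. \<theta> t = (LINT z|M. G z t)"
  shows "u \<theta> = (LINT z|M. u (G z))"
proof -
  interpret finite_measure M by fact
  have spM: "space M = UNIV" using sets_eq_imp_space_eq[OF sM] by simp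
  obtain Cb where Cb: "\<And>k is z. schwartz_seminorm k is (G z) \<le> Cb k is" using bdd by metis
  have mM: "f \<in> borel_measurable M" if "f \<in> borel_measurable borel" for f :: "'z \<Rightarrow> 'c::topological_space"
    using that by (simp only: measurable_cong_sets[OF sM refl])
  have pt: "cmod (partial_derivs js (G z) t) \<le> schwartz_seminorm 0 js (G z)" for js z t
    using schwartz_seminorm_upper[OF G[of z], of t 0 js] by simp
  have contd: "continuous_on UNIV (\<lambda>z. partial_derivs js (G z) t)" for js t
    unfolding continuous_on_sequentially
  proof (intro allI ballI impI)
    fix Z :: "nat \<Rightarrow> 'z" and z assume "(\<forall>n. Z n \<in> UNIV) \<and> Z \<longlonglongrightarrow> z"
    then have Z: "Z \<longlonglongrightarrow> z" by simp
    have "(\<lambda>n. partial_derivs js (G (Z n)) t - partial_derivs js (G z) t) \<longlonglongrightarrow> 0"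
    proof (rule Lim_null_comparison[OF _ cont[OF Z, of 0 js]], rule always_eventually, rule allI)
      fix n
      have "partial_derivs js (\<lambda>t. G (Z n) t - G z t) = (\<lambda>t. partial_derivs js (G (Z n)) t - partial_derivs js (G z) t)"
        using partial_derivs_add[OF schwartz_smooth[OF G[of "Z n"]] schwartz_smooth[OF schwartz_cmult[OF G[of z], of "-1"]], of js]
        by (simp add: partial_derivs_cmult[OF schwartz_smooth[OF G[of z]], of js "-1", simplified])
      then show "norm (partial_derivs js (G (Z n)) t - partial_derivs js (G z) t) \<le> schwartz_seminorm 0 js (\<lambda>t. G (Z n) t - G z t)"
        using schwartz_seminorm_upper[OF schwartz_diff[OF G[of "Z n"] G[of z]], of t 0 js] by simp
    qed
    then have "(\<lambda>n. partial_derivs js (G (Z n)) t) \<longlonglongrightarrow> partial_derivs js (G z) t" by (rule LIM_zero_cancel)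
    then show "((\<lambda>z. partial_derivs js (G z) t) \<circ> Z) \<longlonglongrightarrow> partial_derivs js (G z) t" by (simp add: o_def)
  qed
  have intd: "integrable M (\<lambda>z. partial_derivs js (G z) t)" for js t
    by (rule integrable_const_bound[of _ "Cb 0 js"])
      (intro AE_I2 order_trans[OF pt Cb], rule mM[OF borel_measurable_continuous_onI[OF contd]])
  \<comment> \<open>Induction from the outer end of the list, so that each step differentiates a
    formula already known for all \<open>t\<close>.\<close>
  have derivs: "partial_derivs js \<theta> t = (LINT z|M. partial_derivs js (G z) t)" for js t
  proof (induction js arbitrary: t rule: rev_induct)
    case Nil
    show ?case using \<theta>(2) by simp
  next
    case (snoc j js)
    have "partial_derivs (js @ [j]) \<theta> t = partial_deriv j (\<lambda>t. LINT z|M. partial_derivs js (G z) t) t"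
      unfolding partial_derivs_snoc using snoc.IH by presburger
    also have "\<dots> = (LINT z|M. partial_deriv j (partial_derivs js (G z)) t)"
    proof (rule partial_deriv_integral(2)[where B="\<lambda>z. \<Sum>i\<in>UNIV. Cb 0 (js @ [i])"])
      show "integrable M (\<lambda>z. partial_derivs js (G z) t)" for t by (rule intd)
      show "partial_derivs js (G z) differentiable (at s)" for z s
        by (rule schwartz_differentiable[OF schwartz_partial_derivs[OF G]])
      show "cmod (partial_deriv i (partial_derivs js (G z)) s) \<le> (\<Sum>i\<in>UNIV. Cb 0 (js @ [i]))" for z s i
      proof -
        have nn: "0 \<le> Cb 0 (js @ [i])" for i
          using order_trans[OF schwartz_seminorm_nonneg[OF G[of z]] Cb] .
        have "cmod (partial_deriv i (partial_derivs js (G z)) s) \<le> Cb 0 (js @ [i])"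
          using order_trans[OF pt[of "js @ [i]" z s] Cb] by (simp add: partial_derivs_snoc)
        also have "\<dots> \<le> (\<Sum>i\<in>UNIV. Cb 0 (js @ [i]))"
          by (rule member_le_sum[of i UNIV "\<lambda>i. Cb 0 (js @ [i])"]) (simp_all add: nn)
        finally show ?thesis .
      qed
    qed simp
    finally show ?case by (simp add: partial_derivs_snoc)
  qed
  obtain s where s: "\<And>i. simple_function M (s i)" "\<And>z. (\<lambda>i. s i z) \<longlonglongrightarrow> z"
  proof -
    have "(\<lambda>z. z) \<in> borel_measurable M" by (rule mM) simp
    from borel_measurable_implies_sequence_metric[OF this, of 0] show ?thesis using that spM by auto
  qed
  define \<theta>s where "\<theta>s i t = (LINT z|M. G (s i z) t)" for i t
  define w where "w i a = complex_of_real (measure M (s i -` {a} \<inter> space M))" for i a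
  have fin: "finite (s i ` space M)" for i using s(1) by (rule simple_functionD(1))
  have sf: "(LINT z|M. h (s i z)) = (\<Sum>a\<in>s i ` space M. w i a * h a)" for i and h :: "'z \<Rightarrow> complex"
    using simple_function_integral(1)[OF M s(1)[of i], of h] by (simp add: w_def scaleR_conv_of_real)
  have \<theta>s_eq: "\<theta>s i = (\<lambda>t. \<Sum>a\<in>s i ` space M. w i a * G a t)" for i
    unfolding \<theta>s_def by (rule ext, rule sf)
  have \<theta>sS: "\<theta>s i \<in> schwartz_space" for i unfolding \<theta>s_eq by (intro schwartz_sum schwartz_cmult G)
  have u\<theta>s: "u (\<theta>s i) = (LINT z|M. u (G (s i z)))" for i
    unfolding \<theta>s_eq by (rule trans[OF tempered_sum[OF u G fin] sf[symmetric]])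
  have derivs_s: "partial_derivs js (\<theta>s i) t = (LINT z|M. partial_derivs js (G (s i z)) t)" for js i t
  proof -
    have "partial_derivs js (\<lambda>t. \<Sum>a\<in>A. w i a * G a t) = (\<lambda>t. \<Sum>a\<in>A. w i a * partial_derivs js (G a) t)" if "finite A" for A
      using that
    proof (induction A)
      case empty
      show ?case using partial_derivs_cmult[OF schwartz_smooth[OF schwartz_0], of js 0] by simp
    next
      case (insert a A)
      have S: "smooth_fun (\<lambda>t. w i a * G a t)" "smooth_fun (\<lambda>t. \<Sum>a\<in>A. w i a * G a t)"
        by (intro schwartz_smooth schwartz_cmult schwartz_sum G)+
      show ?case using insert partial_derivs_add[OF S, of js] partial_derivs_cmult[OF schwartz_smooth[OF G[of a]], of js "w i a"] by simp
    qed
    from this[OF fin[of i]] show ?thesis unfolding \<theta>s_eq sf[of "\<lambda>z. partial_derivs js (G z) t"] by simp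
  qed
  \<comment> \<open>The seminorm distance between two members of the family. Its joint continuity
    makes \<open>D k js (s i z) z\<close> measurable in \<open>z\<close>.\<close>
  define D where "D k js z y = schwartz_seminorm k js (\<lambda>t. G z t - G y t)" for k js z y
  have Dnn: "0 \<le> D k js z y" for k js z y unfolding D_def by (intro schwartz_seminorm_nonneg schwartz_diff G)
  have Dbd: "D k js z y \<le> 2 * Cb k js" for k js z y
  proof -
    have "D k js z y \<le> schwartz_seminorm k js (G z) + schwartz_seminorm k js (\<lambda>t. (-1) * G y t)"
      using schwartz_seminorm_add[OF G[of z] schwartz_cmult[OF G[of y], of "-1"], of k js] by (simp add: D_def)
    also have "schwartz_seminorm k js (\<lambda>t. (-1) * G y t) \<le> schwartz_seminorm k js (G y)"
      using schwartz_seminorm_cmult[OF G[of y], of k js "-1"] by simp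
    finally show ?thesis using Cb[of k js z] Cb[of k js y] by simp
  qed
  have Dtri: "D k js a c \<le> D k js a b + D k js b c" for k js a b c
    unfolding D_def by (intro schwartz_seminorm_triangle G)
  have Dsym: "D k js a b = D k js b a" for k js a b
    unfolding D_def by (intro schwartz_seminorm_diff_commute G)
  have Dcont: "continuous_on UNIV (\<lambda>p. D k js (fst p) (snd p))" for k js
    unfolding continuous_on_sequentially
  proof (intro allI ballI impI)
    fix P :: "nat \<Rightarrow> 'z \<times> 'z" and p assume "(\<forall>n. P n \<in> UNIV) \<and> P \<longlonglongrightarrow> p"
    then have P: "P \<longlonglongrightarrow> p" by simp
    have l: "(\<lambda>n. D k js (fst (P n)) (fst p) + D k js (snd (P n)) (snd p)) \<longlonglongrightarrow> 0 + 0"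
      unfolding D_def by (intro tendsto_add cont tendsto_fst tendsto_snd P)
    have "(\<lambda>n. D k js (fst (P n)) (snd (P n)) - D k js (fst p) (snd p)) \<longlonglongrightarrow> 0"
    proof (rule Lim_null_comparison[OF _ l[simplified]], rule always_eventually, rule allI)
      fix n
      show "norm (D k js (fst (P n)) (snd (P n)) - D k js (fst p) (snd p)) \<le> D k js (fst (P n)) (fst p) + D k js (snd (P n)) (snd p)"
        using Dtri[of k js "fst (P n)" "snd (P n)" "fst p"] Dtri[of k js "fst p" "snd (P n)" "snd p"]
          Dtri[of k js "fst p" "snd p" "fst (P n)"] Dtri[of k js "fst (P n)" "snd p" "snd (P n)"]
          Dsym[of k js "snd (P n)" "snd p"] Dsym[of k js "fst (P n)" "fst p"]
        by (simp only: real_norm_def abs_le_iff) linarith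
    qed
    then have "(\<lambda>n. D k js (fst (P n)) (snd (P n))) \<longlonglongrightarrow> D k js (fst p) (snd p)" by (rule LIM_zero_cancel)
    then show "((\<lambda>p. D k js (fst p) (snd p)) \<circ> P) \<longlonglongrightarrow> D k js (fst p) (snd p)" by (simp add: o_def)
  qed
  have sm: "s i \<in> measurable M borel" for i by (rule borel_measurable_simple_function[OF s(1)])
  have Dm: "(\<lambda>z. D k js (s i z) z) \<in> borel_measurable M" for k js i
  proof -
    have "(\<lambda>z. (s i z, z)) \<in> measurable M (borel \<Otimes>\<^sub>M borel)" by (intro measurable_Pair sm mM) simp
    then have "(\<lambda>z. (s i z, z)) \<in> measurable M borel" unfolding borel_prod .
    from measurable_compose[OF this borel_measurable_continuous_onI[OF Dcont]] show ?thesis by simp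
  qed
  have Dint: "integrable M (\<lambda>z. D k js (s i z) z)" for k js i
    by (rule integrable_const_bound[of _ "2 * Cb k js"]) (use Dnn Dbd Dm in simp_all)
  have Dlim: "(\<lambda>i. LINT z|M. D k js (s i z) z) \<longlonglongrightarrow> 0" for k js
  proof -
    have "(\<lambda>i. LINT z|M. D k js (s i z) z) \<longlonglongrightarrow> (LINT z|M. 0)"
    proof (rule integral_dominated_convergence[where w="\<lambda>_. 2 * Cb k js"])
      show "AE z in M. (\<lambda>i. D k js (s i z) z) \<longlonglongrightarrow> 0" unfolding D_def by (intro AE_I2 cont s(2))
      show "AE z in M. norm (D k js (s i z) z) \<le> 2 * Cb k js" for i using Dnn Dbd by simp
    qed (simp_all add: Dm)
    then show ?thesis by simp
  qed
  \<comment> \<open>A seminorm of an integral is at most the integral of the seminorms, and the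
    latter tends to 0 by \<open>Dlim\<close>.\<close>
  have sn: "schwartz_seminorm k js (\<lambda>t. \<theta>s i t - \<theta> t) \<le> (LINT z|M. D k js (s i z) z)" for k js i
  proof (rule schwartz_seminorm_le)
    fix t
    have diff: "partial_derivs js (\<lambda>t. f t - g t) = (\<lambda>t. partial_derivs js f t - partial_derivs js g t)"
      if f: "f \<in> schwartz_space" and g: "g \<in> schwartz_space" for f g :: "real^'n \<Rightarrow> complex"
      using partial_derivs_add[OF schwartz_smooth[OF f] schwartz_smooth[OF schwartz_cmult[OF g, of "-1"]], of js]
      by (simp add: partial_derivs_cmult[OF schwartz_smooth[OF g], of js "-1", simplified])
    have isn: "integrable M (\<lambda>z. partial_derivs js (G (s i z)) t)"
      by (rule simple_function_integral(2)[OF M s(1), of "\<lambda>z. partial_derivs js (G z) t"])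
    have "jb t ^ k * cmod (partial_derivs js (\<lambda>t. \<theta>s i t - \<theta> t) t)
        = jb t ^ k * cmod (LINT z|M. partial_derivs js (G (s i z)) t - partial_derivs js (G z) t)"
      unfolding diff[OF \<theta>sS \<theta>(1)] derivs derivs_s
      by (subst Bochner_Integration.integral_diff[OF isn intd]) (rule refl)
    also have "\<dots> \<le> jb t ^ k * (LINT z|M. cmod (partial_derivs js (G (s i z)) t - partial_derivs js (G z) t))"
      by (intro mult_left_mono integral_norm_bound) simp
    also have "\<dots> = (LINT z|M. jb t ^ k * cmod (partial_derivs js (G (s i z)) t - partial_derivs js (G z) t))"
      by (rule Bochner_Integration.integral_mult_right_zero[symmetric])
    also have "\<dots> \<le> (LINT z|M. D k js (s i z) z)"
    proof (rule integral_mono[OF _ Dint])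
      show "integrable M (\<lambda>z. jb t ^ k * cmod (partial_derivs js (G (s i z)) t - partial_derivs js (G z) t))"
        by (intro integrable_mult_right integrable_norm Bochner_Integration.integrable_diff isn intd)
      fix z
      show "jb t ^ k * cmod (partial_derivs js (G (s i z)) t - partial_derivs js (G z) t) \<le> D k js (s i z) z"
        using schwartz_seminorm_upper[OF schwartz_diff[OF G[of "s i z"] G[of z]], of t k js]
        unfolding diff[OF G G] D_def .
    qed
    finally show "jb t ^ k * cmod (partial_derivs js (\<lambda>t. \<theta>s i t - \<theta> t) t) \<le> (LINT z|M. D k js (s i z) z)" .
  qed
  have lim1: "(\<lambda>i. u (\<theta>s i)) \<longlonglongrightarrow> u \<theta>"
  proof (rule tempered_tendsto[OF u \<theta>sS \<theta>(1)])
    fix k js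
    show "(\<lambda>i. schwartz_seminorm k js (\<lambda>t. \<theta>s i t - \<theta> t)) \<longlonglongrightarrow> 0"
    proof (rule Lim_null_comparison[OF _ Dlim], rule always_eventually, rule allI)
      fix i
      show "norm (schwartz_seminorm k js (\<lambda>t. \<theta>s i t - \<theta> t)) \<le> (LINT z|M. D k js (s i z) z)"
        using sn[of k js i] schwartz_seminorm_nonneg[OF schwartz_diff[OF \<theta>sS[of i] \<theta>(1)], of k js] by simp
    qed
  qed
  have ucont: "(\<lambda>n. u (G (Z n))) \<longlonglongrightarrow> u (G z)" if "Z \<longlonglongrightarrow> z" for Z z
    by (rule tempered_tendsto[OF u G G cont[OF that]])
  have um: "(\<lambda>z. u (G z)) \<in> borel_measurable borel"
  proof (rule borel_measurable_continuous_onI, unfold continuous_on_sequentially, intro allI ballI impI)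
    fix Z :: "nat \<Rightarrow> 'z" and z assume "(\<forall>n. Z n \<in> UNIV) \<and> Z \<longlonglongrightarrow> z"
    then show "((\<lambda>z. u (G z)) \<circ> Z) \<longlonglongrightarrow> u (G z)" using ucont[of Z z] by (simp add: o_def)
  qed
  obtain C F where C: "C > 0" "finite F"
    "\<And>f. f \<in> schwartz_space \<Longrightarrow> cmod (u f) \<le> C * (\<Sum>z\<in>F. schwartz_seminorm (fst z) (snd z) f)"
    using tempered_bound[OF u] by blast
  have ubd: "cmod (u (G z)) \<le> C * (\<Sum>z\<in>F. Cb (fst z) (snd z))" for z
    by (rule order_trans[OF C(3)[OF G]]) (intro mult_left_mono sum_mono Cb, use C in simp)
  have lim2: "(\<lambda>i. LINT z|M. u (G (s i z))) \<longlonglongrightarrow> (LINT z|M. u (G z))"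
  proof (rule integral_dominated_convergence[where w="\<lambda>_. C * (\<Sum>z\<in>F. Cb (fst z) (snd z))"])
    show "AE z in M. (\<lambda>i. u (G (s i z))) \<longlonglongrightarrow> u (G z)" by (intro AE_I2 ucont s(2))
    show "AE z in M. norm (u (G (s i z))) \<le> C * (\<Sum>z\<in>F. Cb (fst z) (snd z))" for i by (intro AE_I2 ubd)
    show "(\<lambda>z. u (G z)) \<in> borel_measurable M" by (rule mM[OF um])
    show "(\<lambda>z. u (G (s i z))) \<in> borel_measurable M" for i by (rule measurable_compose[OF sm um])
  qed simp
  show ?thesis by (rule LIMSEQ_unique[OF lim1]) (simp only: u\<theta>s lim2)
qed

subsection \<open>Time-frequency shifts and the reproducing formula\<close>

text \<open>The sign of the frequency is chosen so that testing a distribution on the atom of the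
  conjugated window gives its short-time Fourier transform at (x, \<xi>), up to the normalising
  factor.\<close>

definition atom :: "(real^'n::finite \<Rightarrow> complex) \<Rightarrow> real^'n \<Rightarrow> real^'n \<Rightarrow> real^'n \<Rightarrow> complex" where
  "atom b x \<xi> = (\<lambda>t. b (t - x) * wave (- \<xi>) t)"

lemma atom_schwartz: assumes "b \<in> schwartz_space" shows "atom b x \<xi> \<in> schwartz_space"
  unfolding atom_def by (rule schwartz_mult_slow[OF schwartz_shift[OF assms] slow_wave])

lemma atom_partial_deriv:
  assumes b: "b \<in> schwartz_space"
  shows "partial_deriv i (atom b x \<xi>) = (\<lambda>t. atom (partial_deriv i b) x \<xi> t + (- \<i> * complex_of_real (\<xi> $ i)) * atom b x \<xi> t)"
proof
  fix t
  have "partial_deriv i (atom b x \<xi>) t = partial_deriv i (\<lambda>t. b (t - x)) t * wave (- \<xi>) t + b (t - x) * partial_deriv i (wave (- \<xi>)) t"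
    unfolding atom_def
    by (rule partial_deriv_mult[OF differentiable_shift(1)[OF schwartz_differentiable[OF b]] wave_differentiable])
  also have "partial_deriv i (\<lambda>t. b (t - x)) t = partial_deriv i b (t - x)"
    by (rule differentiable_shift(2)[OF schwartz_differentiable[OF b]])
  finally show "partial_deriv i (atom b x \<xi>) t = atom (partial_deriv i b) x \<xi> t + (- \<i> * complex_of_real (\<xi> $ i)) * atom b x \<xi> t"
    by (simp add: wave_partial_deriv atom_def)
qed

lemma abs_component_le_jb: "\<bar>(\<xi>::real^'n::finite) $ i\<bar> \<le> jb \<xi>"
  using component_le_norm_cart[of \<xi> i] norm_le_jb[of \<xi>] by linarith

text \<open>Peetre's inequality passes the weight in \<open>t\<close> on to the shift, at a cost of
  \<open>k\<close> powers of the bracket of \<open>x\<close>; every derivative falls on the window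
  or brings down one component of the frequency. This polynomial growth is what the rapid decay of
  \<open>amb\<close> has to beat.\<close>

lemma atom_seminorm_bound:
  assumes "b \<in> schwartz_space"
  shows "\<exists>C\<ge>0. \<forall>x \<xi>. schwartz_seminorm k is (atom b x \<xi>) \<le> C * (jb x ^ k * jb \<xi> ^ length is)"
  using assms
proof (induction "is" arbitrary: b)
  case Nil
  let ?C = "2 ^ k * schwartz_seminorm k [] b"
  have "schwartz_seminorm k [] (atom b x \<xi>) \<le> ?C * (jb x ^ k * jb \<xi> ^ length [])" for x \<xi>
  proof (rule schwartz_seminorm_le)
    fix t
    have "jb t \<le> 2 * jb (t - x) * jb x" using jb_add_le[of "t - x" x] by simp
    then have "jb t ^ k * cmod (b (t - x)) \<le> (2 * jb (t - x) * jb x) ^ k * cmod (b (t - x))"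
      by (intro mult_right_mono power_mono) simp_all
    also have "\<dots> = 2 ^ k * jb x ^ k * (jb (t - x) ^ k * cmod (b (t - x)))"
      by (simp only: power_mult_distrib mult_ac)
    also have "\<dots> \<le> 2 ^ k * jb x ^ k * schwartz_seminorm k [] b"
      using schwartz_seminorm_upper[OF Nil.prems, of "t - x" k "[]"] by (intro mult_left_mono) simp_all
    finally show "jb t ^ k * cmod (partial_derivs [] (atom b x \<xi>) t) \<le> ?C * (jb x ^ k * jb \<xi> ^ length [])"
      by (simp add: atom_def norm_mult mult_ac)
  qed
  moreover have "?C \<ge> 0" using schwartz_seminorm_nonneg[OF Nil.prems] by simp
  ultimately show ?case by blast
next
  case (Cons i js)
  obtain C1 where C1: "C1 \<ge> 0" "\<And>x \<xi>. schwartz_seminorm k js (atom (partial_deriv i b) x \<xi>) \<le> C1 * (jb x ^ k * jb \<xi> ^ length js)"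
    using Cons.IH[OF schwartz_partial_deriv[OF Cons.prems]] by blast
  obtain C2 where C2: "C2 \<ge> 0" "\<And>x \<xi>. schwartz_seminorm k js (atom b x \<xi>) \<le> C2 * (jb x ^ k * jb \<xi> ^ length js)"
    using Cons.IH[OF Cons.prems] by blast
  have "schwartz_seminorm k (i # js) (atom b x \<xi>) \<le> (C1 + C2) * (jb x ^ k * jb \<xi> ^ length (i # js))" for x \<xi>
  proof -
    let ?P = "jb x ^ k * jb \<xi> ^ length js"
    have "schwartz_seminorm k (i # js) (atom b x \<xi>) \<le> schwartz_seminorm k js (atom (partial_deriv i b) x \<xi>)
        + schwartz_seminorm k js (\<lambda>t. (- \<i> * complex_of_real (\<xi> $ i)) * atom b x \<xi> t)"
      unfolding schwartz_seminorm_Cons atom_partial_deriv[OF Cons.prems]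
      by (intro schwartz_seminorm_add schwartz_cmult atom_schwartz schwartz_partial_deriv Cons.prems)
    also have "schwartz_seminorm k js (\<lambda>t. (- \<i> * complex_of_real (\<xi> $ i)) * atom b x \<xi> t) \<le> \<bar>\<xi> $ i\<bar> * schwartz_seminorm k js (atom b x \<xi>)"
      using schwartz_seminorm_cmult[OF atom_schwartz[OF Cons.prems, of x \<xi>], of k js "- \<i> * complex_of_real (\<xi> $ i)"]
      by (simp add: norm_mult)
    also have "\<dots> \<le> jb \<xi> * (C2 * ?P)"
      by (intro mult_mono abs_component_le_jb C2 schwartz_seminorm_nonneg atom_schwartz Cons.prems) simp
    also have "schwartz_seminorm k js (atom (partial_deriv i b) x \<xi>) \<le> jb \<xi> * (C1 * ?P)"
    proof -
      have "1 * (C1 * ?P) \<le> jb \<xi> * (C1 * ?P)" using C1(1) jb_ge_1[of \<xi>] by (intro mult_right_mono) simp_all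
      then show ?thesis using C1(2)[of x \<xi>] by simp
    qed
    finally show ?thesis by (simp add: algebra_simps)
  qed
  moreover have "C1 + C2 \<ge> 0" using C1 C2 by simp
  ultimately show ?case by blast
qed

lemma wave_Lipschitz:
  fixes \<xi> \<eta> t :: "real^'n::finite"
  shows "cmod (wave \<xi> t - wave \<eta> t) \<le> real CARD('n) * jb t * norm (\<xi> - \<eta>)"
proof -
  have "cmod (wave t \<xi> - wave t \<eta>) \<le> real CARD('n) * jb t * norm (\<xi> - \<eta>)"
  proof (rule partial_deriv_bound[of UNIV])
    show "wave t differentiable at x" for x by (rule wave_differentiable)
    show "cmod (partial_deriv i (wave t) x) \<le> jb t" for x i
      using abs_component_le_jb[of t i] by (simp add: wave_partial_deriv norm_mult)
  qed simp_all
  then show ?thesis by (simp only: wave_commute[of t])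
qed

text \<open>The move of the atom is split in two: the translation, controlled by the mean value
  inequality near t - x, and the modulation, controlled by the Lipschitz constant of plane waves.
  That constant grows like the bracket of \<open>t\<close>, hence the exponent \<open>Suc k\<close>
  in \<open>A\<close>.\<close>

lemma atom_tendsto_base:
  fixes b :: "real^'n::finite \<Rightarrow> complex"
  assumes b: "b \<in> schwartz_space" and Z: "Z \<longlonglongrightarrow> z"
  shows "(\<lambda>n. schwartz_seminorm k [] (\<lambda>t. atom b (fst (Z n)) (snd (Z n)) t - atom b (fst z) (snd z) t)) \<longlonglongrightarrow> 0"
proof -
  define x where "x = fst z"
  define \<xi> where "\<xi> = snd z"
  define X where "X n = fst (Z n)" for n
  define Y where "Y n = snd (Z n)" for n
  have X: "X \<longlonglongrightarrow> x" unfolding X_def x_def by (rule tendsto_fst[OF Z])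
  have Y: "Y \<longlonglongrightarrow> \<xi>" unfolding Y_def \<xi>_def by (rule tendsto_snd[OF Z])
  define K where "K = (\<Sum>j\<in>UNIV. schwartz_seminorm k [j] b)"
  define L where "L = (2 * (2 + norm x)) ^ k * K"
  define A where "A = schwartz_seminorm (Suc k) [] (\<lambda>t. b (t - x))"
  let ?g = "\<lambda>n. real CARD('n) * L * norm (X n - x) + real CARD('n) * A * norm (Y n - \<xi>)"
  have snn: "0 \<le> schwartz_seminorm k [j] b" for j by (rule schwartz_seminorm_nonneg[OF b])
  have db: "jb t ^ k * cmod (partial_deriv j b w) \<le> L" if w: "w \<in> ball (t - x) 1" for t w j
  proof -
    have "norm (t - w) \<le> norm x + 1"
      using norm_triangle_ineq[of x "t - x - w"] w by (simp add: dist_norm algebra_simps)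
    then have j2: "jb (t - w) \<le> 2 + norm x" using jb_le[of "t - w"] by linarith
    have "jb t \<le> 2 * jb w * jb (t - w)" using jb_add_le[of w "t - w"] by simp
    also have "\<dots> \<le> 2 * jb w * (2 + norm x)" using j2 by (intro mult_left_mono) simp_all
    finally have "jb t ^ k * cmod (partial_deriv j b w) \<le> (2 * jb w * (2 + norm x)) ^ k * cmod (partial_deriv j b w)"
      by (intro mult_right_mono power_mono) simp_all
    also have "\<dots> = (2 * (2 + norm x)) ^ k * (jb w ^ k * cmod (partial_deriv j b w))"
      by (simp only: power_mult_distrib mult_ac)
    also have "\<dots> \<le> (2 * (2 + norm x)) ^ k * K"
    proof (rule mult_left_mono)
      have "jb w ^ k * cmod (partial_deriv j b w) \<le> schwartz_seminorm k [j] b"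
        using schwartz_seminorm_upper[OF b, of w k "[j]"] by simp
      also have "\<dots> \<le> K" unfolding K_def by (rule member_le_sum) (simp_all add: snn)
      finally show "jb w ^ k * cmod (partial_deriv j b w) \<le> K" .
    qed simp
    finally show ?thesis by (simp add: L_def)
  qed
  have main: "schwartz_seminorm k [] (\<lambda>t. atom b (X n) (Y n) t - atom b x \<xi> t) \<le> ?g n" if n: "norm (X n - x) < 1" for n
  proof (rule schwartz_seminorm_le)
    fix t
    have "cmod (b (t - X n) - b (t - x)) \<le> real CARD('n) * (L / jb t ^ k) * norm ((t - X n) - (t - x))"
    proof (rule partial_deriv_bound[of "ball (t - x) 1"])
      show "b differentiable at w" for w by (rule schwartz_differentiable[OF b])
      show "cmod (partial_deriv i b w) \<le> L / jb t ^ k" if "w \<in> ball (t - x) 1" for w i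
        using db[OF that, of i] by (simp add: field_simps)
    qed (use n in \<open>simp_all add: dist_norm norm_minus_commute\<close>)
    then have 1: "jb t ^ k * cmod (b (t - X n) - b (t - x)) \<le> real CARD('n) * L * norm (X n - x)"
      by (simp add: field_simps norm_minus_commute)
    have "cmod (wave (- Y n) t - wave (- \<xi>) t) \<le> real CARD('n) * jb t * norm (- Y n - (- \<xi>))" by (rule wave_Lipschitz)
    also have "norm (- Y n - (- \<xi>)) = norm (Y n - \<xi>)" by (metis minus_diff_minus norm_minus_cancel)
    finally have "jb t ^ k * cmod (b (t - x)) * cmod (wave (- Y n) t - wave (- \<xi>) t)
      \<le> jb t ^ k * cmod (b (t - x)) * (real CARD('n) * jb t * norm (Y n - \<xi>))" by (intro mult_left_mono) simp_all
    also have "\<dots> = real CARD('n) * norm (Y n - \<xi>) * (jb t ^ Suc k * cmod (b (t - x)))" by (simp add: mult_ac)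
    also have "\<dots> \<le> real CARD('n) * norm (Y n - \<xi>) * A"
      using schwartz_seminorm_upper[OF schwartz_shift[OF b, of x], of t "Suc k" "[]"]
      unfolding A_def by (intro mult_left_mono) simp_all
    finally have 2: "jb t ^ k * cmod (b (t - x)) * cmod (wave (- Y n) t - wave (- \<xi>) t) \<le> real CARD('n) * A * norm (Y n - \<xi>)"
      by (simp add: mult_ac)
    have "atom b (X n) (Y n) t - atom b x \<xi> t
        = (b (t - X n) - b (t - x)) * wave (- Y n) t + b (t - x) * (wave (- Y n) t - wave (- \<xi>) t)"
      by (simp add: atom_def algebra_simps)
    then have "cmod (atom b (X n) (Y n) t - atom b x \<xi> t)
        \<le> cmod (b (t - X n) - b (t - x)) + cmod (b (t - x)) * cmod (wave (- Y n) t - wave (- \<xi>) t)"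
      using norm_triangle_ineq[of "(b (t - X n) - b (t - x)) * wave (- Y n) t" "b (t - x) * (wave (- Y n) t - wave (- \<xi>) t)"]
      by (simp add: norm_mult)
    then have "jb t ^ k * cmod (atom b (X n) (Y n) t - atom b x \<xi> t)
        \<le> jb t ^ k * (cmod (b (t - X n) - b (t - x)) + cmod (b (t - x)) * cmod (wave (- Y n) t - wave (- \<xi>) t))"
      by (intro mult_left_mono) simp_all
    then show "jb t ^ k * cmod (partial_derivs [] (\<lambda>t. atom b (X n) (Y n) t - atom b x \<xi> t) t) \<le> ?g n"
      using 1 2 by (simp add: distrib_left mult.assoc)
  qed
  have "?g \<longlonglongrightarrow> real CARD('n) * L * norm (x - x) + real CARD('n) * A * norm (\<xi> - \<xi>)"
    by (intro tendsto_intros X Y)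
  then have g0: "?g \<longlonglongrightarrow> 0" by simp
  have ev: "\<forall>\<^sub>F n in sequentially. norm (X n - x) < 1"
    using tendstoD[OF X, of 1] by (simp add: dist_norm)
  have "(\<lambda>n. schwartz_seminorm k [] (\<lambda>t. atom b (X n) (Y n) t - atom b x \<xi> t)) \<longlonglongrightarrow> 0"
  proof (rule Lim_null_comparison[OF _ g0])
    show "\<forall>\<^sub>F n in sequentially. norm (schwartz_seminorm k [] (\<lambda>t. atom b (X n) (Y n) t - atom b x \<xi> t)) \<le> ?g n"
      using ev
    proof eventually_elim
      case (elim n)
      show ?case using main[OF elim] schwartz_seminorm_nonneg[OF schwartz_diff[OF atom_schwartz[OF b] atom_schwartz[OF b]], of k "[]" "X n" "Y n" x \<xi>]
        by simp
    qed
  qed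
  then show ?thesis by (simp only: X_def Y_def x_def \<xi>_def)
qed

text \<open>Differentiating an atom brings down a frequency component that moves along with the
  sequence. The difference therefore splits into differences of lower order and a fixed atom
  multiplied by the difference of the two components.\<close>

lemma atom_tendsto:
  fixes b :: "real^'n::finite \<Rightarrow> complex"
  assumes "b \<in> schwartz_space" and Z: "Z \<longlonglongrightarrow> z"
  shows "(\<lambda>n. schwartz_seminorm k is (\<lambda>t. atom b (fst (Z n)) (snd (Z n)) t - atom b (fst z) (snd z) t)) \<longlonglongrightarrow> 0"
  using assms(1)
proof (induction "is" arbitrary: b)
  case Nil
  show ?case by (rule atom_tendsto_base[OF Nil.prems Z])
next
  case (Cons i js)
  note b = Cons.prems
  note bi = schwartz_partial_deriv[OF b, of i]
  let ?A = "\<lambda>b n. atom b (fst (Z n)) (snd (Z n))" and ?a = "\<lambda>b. atom b (fst z) (snd z)"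
  let ?D = "\<lambda>b n. schwartz_seminorm k js (\<lambda>t. ?A b n t - ?a b t)"
  let ?c = "\<lambda>n. - \<i> * complex_of_real (snd (Z n) $ i)" and ?k = "- \<i> * complex_of_real (snd z $ i)"
  have pd: "partial_deriv i (\<lambda>t. ?A b n t - ?a b t) = (\<lambda>t. (?A (partial_deriv i b) n t - ?a (partial_deriv i b) t)
      + (?c n * (?A b n t - ?a b t) + (?c n - ?k) * ?a b t))" for n
  proof -
    have "partial_deriv i (\<lambda>t. ?A b n t + (-1) * ?a b t) = (\<lambda>t. partial_deriv i (?A b n) t + partial_deriv i (\<lambda>t. (-1) * ?a b t) t)"
      by (rule ext, rule partial_deriv_add) (intro schwartz_differentiable schwartz_cmult atom_schwartz b)+
    also have "\<dots> = (\<lambda>t. partial_deriv i (?A b n) t + (-1) * partial_deriv i (?a b) t)"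
      by (subst partial_deriv_cmult) (intro schwartz_differentiable atom_schwartz b, rule refl)
    finally show ?thesis unfolding atom_partial_deriv[OF b] by (simp add: algebra_simps)
  qed
  have le: "schwartz_seminorm k (i # js) (\<lambda>t. ?A b n t - ?a b t) \<le>
      ?D (partial_deriv i b) n + (cmod (?c n) * ?D b n + cmod (?c n - ?k) * schwartz_seminorm k js (?a b))" for n
  proof -
    have S: "(\<lambda>t. ?A b n t - ?a b t) \<in> schwartz_space" "?a b \<in> schwartz_space"
      "(\<lambda>t. ?A (partial_deriv i b) n t - ?a (partial_deriv i b) t) \<in> schwartz_space"
      by (intro schwartz_diff atom_schwartz b bi)+
    show ?thesis unfolding schwartz_seminorm_Cons pd
      by (rule order_trans[OF schwartz_seminorm_add[OF S(3) schwartz_add[OF schwartz_cmult[OF S(1)] schwartz_cmult[OF S(2)]]]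
            add_left_mono[OF order_trans[OF schwartz_seminorm_add[OF schwartz_cmult[OF S(1)] schwartz_cmult[OF S(2)]]
            add_mono[OF schwartz_seminorm_cmult[OF S(1)] schwartz_seminorm_cmult[OF S(2)]]]]])
  qed
  have c: "?c \<longlonglongrightarrow> ?k"
    by (intro tendsto_mult tendsto_const tendsto_of_real tendsto_vec_nth tendsto_snd Z)
  have lim: "(\<lambda>n. ?D (partial_deriv i b) n + (cmod (?c n) * ?D b n + cmod (?c n - ?k) * schwartz_seminorm k js (?a b)))
      \<longlonglongrightarrow> 0 + (cmod ?k * 0 + cmod (?k - ?k) * schwartz_seminorm k js (?a b))"
    by (intro tendsto_add tendsto_mult tendsto_norm tendsto_diff tendsto_const c Cons.IH[OF b] Cons.IH[OF bi])
  show ?case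
  proof (rule Lim_null_comparison[OF always_eventually[OF allI]])
    fix n
    show "norm (schwartz_seminorm k (i # js) (\<lambda>t. ?A b n t - ?a b t)) \<le>
      ?D (partial_deriv i b) n + (cmod (?c n) * ?D b n + cmod (?c n - ?k) * schwartz_seminorm k js (?a b))"
      using le[of n] schwartz_seminorm_nonneg[OF schwartz_diff[OF atom_schwartz[OF b] atom_schwartz[OF b]]]
      unfolding real_norm_def by (subst abs_of_nonneg) simp_all
    show "(\<lambda>n. ?D (partial_deriv i b) n + (cmod (?c n) * ?D b n + cmod (?c n - ?k) * schwartz_seminorm k js (?a b))) \<longlonglongrightarrow> 0"
      using lim by simp
  qed
qed

lemma tempered_atom_continuous:
  fixes b :: "real^'n::finite \<Rightarrow> complex"
  assumes u: "u \<in> tempered_distr" and b: "b \<in> schwartz_space"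
  shows "continuous_on UNIV (\<lambda>z. u (atom b (fst z) (snd z)))"
  unfolding continuous_on_sequentially
proof (intro allI ballI impI)
  fix Z :: "nat \<Rightarrow> (real^'n) \<times> (real^'n)" and z assume "(\<forall>n. Z n \<in> UNIV) \<and> Z \<longlonglongrightarrow> z"
  then have Z: "Z \<longlonglongrightarrow> z" by simp
  have "(\<lambda>n. u (atom b (fst (Z n)) (snd (Z n)))) \<longlonglongrightarrow> u (atom b (fst z) (snd z))"
    by (rule tempered_tendsto[OF u atom_schwartz[OF b] atom_schwartz[OF b] atom_tendsto[OF b Z]])
  then show "((\<lambda>z. u (atom b (fst z) (snd z))) \<circ> Z) \<longlonglongrightarrow> u (atom b (fst z) (snd z))" by (simp add: o_def)
qed

text \<open>A cross-ambiguity function: the short-time Fourier transform of \<open>b\<close> with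
  the conjugate of \<open>a\<close> as window, up to normalisation and the sign of the frequency. It
  provides the coefficients in the expansion of \<open>b\<close> into atoms.\<close>

definition amb :: "(real^'n::finite \<Rightarrow> complex) \<Rightarrow> (real^'n \<Rightarrow> complex) \<Rightarrow> real^'n \<Rightarrow> real^'n \<Rightarrow> complex" where
  "amb a b x \<xi> = osc (\<lambda>t. a (t - x) * b t) \<xi>"

lemma osc_add: "integrable lborel f \<Longrightarrow> integrable lborel g \<Longrightarrow> osc (\<lambda>t. f t + g t) \<xi> = osc f \<xi> + osc g \<xi>"
  unfolding osc_def distrib_right by (intro Bochner_Integration.integral_add integrable_mult_wave)

lemma osc_cmult: "osc (\<lambda>t. c * f t) \<xi> = c * osc f \<xi>"
  unfolding osc_def mult.assoc by (rule Bochner_Integration.integral_mult_right_zero)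

lemma osc_diff: "integrable lborel f \<Longrightarrow> integrable lborel g \<Longrightarrow> osc (\<lambda>t. f t - g t) \<xi> = osc f \<xi> - osc g \<xi>"
  unfolding osc_def left_diff_distrib by (intro Bochner_Integration.integral_diff integrable_mult_wave)

lemma osc_sum: "(\<And>i. i \<in> I \<Longrightarrow> integrable lborel (f i)) \<Longrightarrow> osc (\<lambda>t. \<Sum>i\<in>I. f i t) \<xi> = (\<Sum>i\<in>I. osc (f i) \<xi>)"
  unfolding osc_def sum_distrib_right by (intro Bochner_Integration.integral_sum integrable_mult_wave)

lemma amb_product_schwartz:
  "a \<in> schwartz_space \<Longrightarrow> b \<in> schwartz_space \<Longrightarrow> (\<lambda>t. a (t - x) * b t) \<in> schwartz_space"
  by (intro schwartz_mult schwartz_shift)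

text \<open>This is \<open>osc_bessel\<close> for the product under the transform, with its second
  derivatives expanded by Leibniz's rule. Only ambiguity functions of derivatives appear on the
  right, so the identity can be iterated.\<close>

lemma amb_bessel:
  fixes a b :: "real^'n::finite \<Rightarrow> complex"
  assumes a: "a \<in> schwartz_space" and b: "b \<in> schwartz_space"
  shows "complex_of_real ((jb \<xi>)\<^sup>2) * amb a b x \<xi> = amb a b x \<xi> -
    (\<Sum>i\<in>UNIV. amb (partial_deriv i (partial_deriv i a)) b x \<xi> + 2 * amb (partial_deriv i a) (partial_deriv i b) x \<xi>
      + amb a (partial_deriv i (partial_deriv i b)) x \<xi>)"
proof -
  let ?p = "\<lambda>a b t. a (t - x) * b t"
  have pd: "partial_deriv i (?p a b) = (\<lambda>t. ?p (partial_deriv i a) b t + ?p a (partial_deriv i b) t)"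
    if a: "a \<in> schwartz_space" and b: "b \<in> schwartz_space" for a b :: "real^'n \<Rightarrow> complex" and i
  proof
    fix t
    show "partial_deriv i (?p a b) t = ?p (partial_deriv i a) b t + ?p a (partial_deriv i b) t"
      unfolding partial_deriv_mult[OF differentiable_shift(1)[OF schwartz_differentiable[OF a]] schwartz_differentiable[OF b]]
        differentiable_shift(2)[OF schwartz_differentiable[OF a]] by (rule refl)
  qed
  have pd2: "partial_deriv i (partial_deriv i (?p a b)) = (\<lambda>t. ?p (partial_deriv i (partial_deriv i a)) b t
      + 2 * ?p (partial_deriv i a) (partial_deriv i b) t + ?p a (partial_deriv i (partial_deriv i b)) t)" for i
  proof
    fix t
    have "partial_deriv i (\<lambda>t. ?p (partial_deriv i a) b t + ?p a (partial_deriv i b) t) t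
      = partial_deriv i (?p (partial_deriv i a) b) t + partial_deriv i (?p a (partial_deriv i b)) t"
      by (intro partial_deriv_add schwartz_differentiable amb_product_schwartz schwartz_partial_deriv a b)
    then show "partial_deriv i (partial_deriv i (?p a b)) t = ?p (partial_deriv i (partial_deriv i a)) b t
      + 2 * ?p (partial_deriv i a) (partial_deriv i b) t + ?p a (partial_deriv i (partial_deriv i b)) t"
      unfolding pd[OF a b] pd[OF schwartz_partial_deriv[OF a] b] pd[OF a schwartz_partial_deriv[OF b]] by simp
  qed
  have I: "integrable lborel (?p a b)" if "a \<in> schwartz_space" "b \<in> schwartz_space" for a b :: "real^'n \<Rightarrow> complex"
    by (rule schwartz_integrable[OF amb_product_schwartz[OF that]])
  note S = a b schwartz_partial_deriv[OF a] schwartz_partial_deriv[OF b]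
    schwartz_partial_deriv[OF schwartz_partial_deriv[OF a]] schwartz_partial_deriv[OF schwartz_partial_deriv[OF b]]
  have o3: "osc (\<lambda>t. ?p (partial_deriv i (partial_deriv i a)) b t
      + 2 * ?p (partial_deriv i a) (partial_deriv i b) t + ?p a (partial_deriv i (partial_deriv i b)) t) \<xi>
    = amb (partial_deriv i (partial_deriv i a)) b x \<xi> + 2 * amb (partial_deriv i a) (partial_deriv i b) x \<xi>
      + amb a (partial_deriv i (partial_deriv i b)) x \<xi>" for i
    unfolding amb_def osc_cmult[symmetric]
    by (subst osc_add) (intro Bochner_Integration.integrable_add integrable_mult_right I S,
        intro I S, subst osc_add, intro I S, intro integrable_mult_right I S, rule refl)
  have "complex_of_real ((jb \<xi>)\<^sup>2) * amb a b x \<xi> = osc (bessel (?p a b)) \<xi>"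
    unfolding amb_def by (rule osc_bessel[OF amb_product_schwartz[OF a b], symmetric])
  also have "\<dots> = osc (?p a b) \<xi> - osc (\<lambda>t. \<Sum>i\<in>UNIV. (?p (partial_deriv i (partial_deriv i a)) b t
      + 2 * ?p (partial_deriv i a) (partial_deriv i b) t + ?p a (partial_deriv i (partial_deriv i b)) t)) \<xi>"
    unfolding bessel_def pd2
    by (intro osc_diff I[OF a b] Bochner_Integration.integrable_sum Bochner_Integration.integrable_add integrable_mult_right I S)
  also have "osc (\<lambda>t. \<Sum>i\<in>UNIV. (?p (partial_deriv i (partial_deriv i a)) b t
      + 2 * ?p (partial_deriv i a) (partial_deriv i b) t + ?p a (partial_deriv i (partial_deriv i b)) t)) \<xi>
    = (\<Sum>i\<in>UNIV. osc (\<lambda>t. ?p (partial_deriv i (partial_deriv i a)) b t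
      + 2 * ?p (partial_deriv i a) (partial_deriv i b) t + ?p a (partial_deriv i (partial_deriv i b)) t) \<xi>)"
    by (intro osc_sum Bochner_Integration.integrable_add integrable_mult_right I S)
  finally show ?thesis unfolding o3 amb_def .
qed

text \<open>Decay in \<open>x\<close> comes from Peetre's inequality, since a(t - x) and b(t) cannot
  both be large when \<open>x\<close> is. Decay in the frequency is gained two powers at a time from
  \<open>amb_bessel\<close>, whose terms all have the same form with other Schwartz
  functions.\<close>

lemma amb_bound:
  fixes a b :: "real^'n::finite \<Rightarrow> complex"
  assumes a: "a \<in> schwartz_space" and b: "b \<in> schwartz_space" and r: "r \<ge> 0"
  obtains C where "C > 0" "\<And>x \<xi>. cmod (amb a b x \<xi>) \<le> C * (jb x powr - r * jb \<xi> powr - r)"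
proof -
  have *: "\<exists>C\<ge>0. \<forall>x \<xi>. jb \<xi> ^ (2 * k) * cmod (amb a b x \<xi>) \<le> C * jb x powr - r"
    if "a \<in> schwartz_space" "b \<in> schwartz_space" for a b :: "real^'n \<Rightarrow> complex" and k
    using that
  proof (induction k arbitrary: a b)
    case 0
    note a = 0(1) and b = 0(2)
    define m where "m = real CARD('n) + 1"
    obtain A where A: "A > 0" "\<And>x. cmod (a x) \<le> A * jb x powr - r" using rapidD[OF schwartz_rapid[OF a]] by blast
    \<comment> \<open>Of this decay, \<open>r\<close> powers pay for Peetre's inequality and the
      remaining m = n + 1 keep the integral in \<open>t\<close> finite.\<close>
    obtain B where B: "B > 0" "\<And>x. cmod (b x) \<le> B * jb x powr - (r + m)" using rapidD[OF schwartz_rapid[OF b]] by blast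
    let ?I = "LINT t|(lborel::(real^'n) measure). jb t powr - m"
    have iI: "integrable lborel (\<lambda>t::real^'n. jb t powr - m)" by (rule integrable_jb) (simp add: m_def)
    have "cmod (amb a b x \<xi>) \<le> (A * B * 2 powr r * ?I) * jb x powr - r" for x \<xi>
    proof -
      have "cmod (amb a b x \<xi>) \<le> (LINT t|lborel. cmod (a (t - x) * b t))"
        unfolding amb_def by (rule norm_osc_le)
      also have "\<dots> \<le> (LINT t|(lborel::(real^'n) measure). (A * B * 2 powr r * jb x powr - r) * jb t powr - m)"
      proof (rule integral_mono)
        show "integrable lborel (\<lambda>t. cmod (a (t - x) * b t))"
          by (intro integrable_norm schwartz_integrable amb_product_schwartz a b)
        show "integrable lborel (\<lambda>t::real^'n. (A * B * 2 powr r * jb x powr - r) * jb t powr - m)"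
          by (intro integrable_mult_right iI)
        fix t
        have "jb (t - x) powr - r \<le> 2 powr r * jb t powr r * jb x powr - r"
          using jb_powr_add_le[of t "- x" "- r"] r by simp
        then have "A * jb (t - x) powr - r \<le> A * (2 powr r * jb t powr r * jb x powr - r)"
          using A by (intro mult_left_mono) simp_all
        then have "cmod (a (t - x)) \<le> A * (2 powr r * jb t powr r * jb x powr - r)"
          using A(2)[of "t - x"] by linarith
        then have "cmod (a (t - x)) * cmod (b t) \<le> (A * (2 powr r * jb t powr r * jb x powr - r)) * (B * jb t powr - (r + m))"
          using B A by (intro mult_mono) simp_all
        also have "\<dots> = (A * B * 2 powr r * jb x powr - r) * (jb t powr r * jb t powr - (r + m))" by (simp only: mult_ac)
        also have "jb t powr r * jb t powr - (r + m) = jb t powr - m" by (simp flip: powr_add)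
        finally show "cmod (a (t - x) * b t) \<le> (A * B * 2 powr r * jb x powr - r) * jb t powr - m" by (simp add: norm_mult)
      qed
      also have "\<dots> = (A * B * 2 powr r * ?I) * jb x powr - r" by simp
      finally show ?thesis .
    qed
    moreover have "A * B * 2 powr r * ?I \<ge> 0" using A B by (intro mult_nonneg_nonneg integral_nonneg_AE) simp_all
    ultimately show ?case by auto
  next
    case (Suc k)
    note a = Suc.prems(1) and b = Suc.prems(2)
    let ?Q = "\<lambda>C a b. C \<ge> 0 \<and> (\<forall>x \<xi>. jb \<xi> ^ (2 * k) * cmod (amb a b x \<xi>) \<le> C * jb x powr - r)"
    obtain C0 where C0: "?Q C0 a b" using Suc.IH[OF a b] by blast
    have "\<exists>C. ?Q C (partial_deriv i (partial_deriv i a)) b" for i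
      using Suc.IH[OF schwartz_partial_deriv[OF schwartz_partial_deriv[OF a]] b] by blast
    then obtain C1 where C1: "\<And>i. ?Q (C1 i) (partial_deriv i (partial_deriv i a)) b" by metis
    have "\<exists>C. ?Q C (partial_deriv i a) (partial_deriv i b)" for i
      using Suc.IH[OF schwartz_partial_deriv[OF a] schwartz_partial_deriv[OF b]] by blast
    then obtain C2 where C2: "\<And>i. ?Q (C2 i) (partial_deriv i a) (partial_deriv i b)" by metis
    have "\<exists>C. ?Q C a (partial_deriv i (partial_deriv i b))" for i
      using Suc.IH[OF a schwartz_partial_deriv[OF schwartz_partial_deriv[OF b]]] by blast
    then obtain C3 where C3: "\<And>i. ?Q (C3 i) a (partial_deriv i (partial_deriv i b))" by metis
    let ?C = "C0 + (\<Sum>i\<in>UNIV. C1 i + 2 * C2 i + C3 i)"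
    have "jb \<xi> ^ (2 * Suc k) * cmod (amb a b x \<xi>) \<le> ?C * jb x powr - r" for x \<xi>
    proof -
      let ?J = "jb \<xi> ^ (2 * k)" and ?X = "jb x powr - r"
      let ?au = "\<lambda>i. amb (partial_deriv i (partial_deriv i a)) b x \<xi>" and ?av = "\<lambda>i. amb (partial_deriv i a) (partial_deriv i b) x \<xi>"
        and ?aw = "\<lambda>i. amb a (partial_deriv i (partial_deriv i b)) x \<xi>"
      have "jb \<xi> ^ (2 * Suc k) * cmod (amb a b x \<xi>) = ?J * cmod (complex_of_real ((jb \<xi>)\<^sup>2) * amb a b x \<xi>)"
        by (simp add: norm_mult norm_power power_add power2_eq_square mult_ac)
      also have "\<dots> = ?J * cmod (amb a b x \<xi> - (\<Sum>i\<in>UNIV. ?au i + 2 * ?av i + ?aw i))"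
        unfolding amb_bessel[OF a b] by (rule refl)
      also have "\<dots> \<le> ?J * (cmod (amb a b x \<xi>) + (\<Sum>i\<in>UNIV. cmod (?au i) + 2 * cmod (?av i) + cmod (?aw i)))"
      proof (intro mult_left_mono order_trans[OF norm_triangle_ineq4] add_left_mono order_trans[OF norm_sum] sum_mono)
        fix i
        have "cmod (?au i + 2 * ?av i + ?aw i) \<le> cmod (?au i) + cmod (2 * ?av i) + cmod (?aw i)"
          by (rule order_trans[OF norm_triangle_ineq add_right_mono[OF norm_triangle_ineq]])
        then show "cmod (?au i + 2 * ?av i + ?aw i) \<le> cmod (?au i) + 2 * cmod (?av i) + cmod (?aw i)" by (simp add: norm_mult)
      qed simp
      also have "\<dots> = ?J * cmod (amb a b x \<xi>) + (\<Sum>i\<in>UNIV. ?J * cmod (?au i) + 2 * (?J * cmod (?av i)) + ?J * cmod (?aw i))"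
        by (simp only: distrib_left sum_distrib_left mult.left_commute)
      also have "\<dots> \<le> C0 * ?X + (\<Sum>i\<in>UNIV. C1 i * ?X + 2 * (C2 i * ?X) + C3 i * ?X)"
        using C0 C1 C2 C3 by (intro add_mono sum_mono mult_left_mono) simp_all
      also have "\<dots> = ?C * ?X" by (simp only: distrib_right sum_distrib_right mult.assoc)
      finally show ?thesis .
    qed
    moreover have "?C \<ge> 0" using C0 C1 C2 C3 by (intro add_nonneg_nonneg sum_nonneg mult_nonneg_nonneg) simp_all
    ultimately show ?case by blast
  qed
  obtain k :: nat where k: "r \<le> real k" using real_arch_simple by blast
  obtain C where C: "C \<ge> 0" "\<And>x \<xi>. jb \<xi> ^ (2 * k) * cmod (amb a b x \<xi>) \<le> C * jb x powr - r" using *[OF a b, of k] by blast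
  have "cmod (amb a b x \<xi>) \<le> (C + 1) * (jb x powr - r * jb \<xi> powr - r)" for x \<xi>
  proof -
    have "cmod (amb a b x \<xi>) = (jb \<xi> ^ (2 * k) * cmod (amb a b x \<xi>)) * jb \<xi> powr - real (2 * k)"
      by (simp add: powr_minus powr_realpow del: of_nat_mult)
    also have "\<dots> \<le> (C * jb x powr - r) * jb \<xi> powr - r"
      using k C(1) by (intro mult_mono C(2) jb_powr_mono) simp_all
    also have "\<dots> \<le> (C + 1) * (jb x powr - r * jb \<xi> powr - r)" by (simp add: algebra_simps)
    finally show ?thesis .
  qed
  then show ?thesis using that[of "C + 1"] C(1) by simp
qed

text \<open>Read as the distribution with density \<open>b\<close> tested on atoms of
  \<open>a\<close>, the function inherits the continuity already proved for all tempered
  distributions.\<close>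

lemma amb_continuous:
  fixes a b :: "real^'n::finite \<Rightarrow> complex"
  assumes a: "a \<in> schwartz_space" and b: "b \<in> schwartz_space"
  shows "continuous_on UNIV (\<lambda>z. amb a b (fst z) (snd z))"
proof -
  obtain B where B: "\<And>x. cmod (b x) \<le> B" using schwartz_bounded[OF b] by blast
  have T: "distr_of_fun b \<in> tempered_distr" by (rule tempered_distr_of_fun[OF schwartz_measurable[OF b] B])
  have eq: "amb a b x \<xi> = distr_of_fun b (atom a x (- \<xi>))" for x \<xi>
    unfolding distr_of_fun_apply[OF atom_schwartz[OF a]] by (simp add: amb_def osc_def atom_def mult_ac)
  have "continuous_on UNIV ((\<lambda>z. distr_of_fun b (atom a (fst z) (snd z))) \<circ> (\<lambda>z. (fst z, - snd z)))"
    by (rule continuous_on_compose[OF _ continuous_on_subset[OF tempered_atom_continuous[OF T a]]])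
      (intro continuous_intros, simp)
  then show ?thesis by (simp add: o_def eq)
qed

section \<open>The reproducing formula\<close>

lemma norm_sq_integral_pos:
  fixes \<phi> :: "real^'n::finite \<Rightarrow> complex"
  assumes \<phi>: "\<phi> \<in> schwartz_space" "\<phi> \<noteq> (\<lambda>_. 0)"
  shows "(LINT t|lborel. \<phi> t * cnj (\<phi> t)) = complex_of_real (LINT t|lborel. (cmod (\<phi> t))\<^sup>2)"
    and "(LINT t|lborel. (cmod (\<phi> t))\<^sup>2) > 0"
proof -
  have e: "\<phi> t * cnj (\<phi> t) = complex_of_real ((cmod (\<phi> t))\<^sup>2)" for t by (rule complex_norm_square[symmetric])
  show "(LINT t|lborel. \<phi> t * cnj (\<phi> t)) = complex_of_real (LINT t|lborel. (cmod (\<phi> t))\<^sup>2)" unfolding e by (rule integral_complex_of_real)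
  have S: "(\<lambda>t. \<phi> t * cnj (\<phi> t)) \<in> schwartz_space" by (intro schwartz_mult schwartz_cnj \<phi>)
  have i: "integrable lborel (\<lambda>t. (cmod (\<phi> t))\<^sup>2)"
    using integrable_norm[OF schwartz_integrable[OF S]] by (simp add: norm_mult power2_eq_square)
  have nn: "0 \<le> (LINT t|lborel. (cmod (\<phi> t))\<^sup>2)" by (rule integral_nonneg_AE) simp
  have "(LINT t|lborel. (cmod (\<phi> t))\<^sup>2) \<noteq> 0"
  proof
    assume 0: "(LINT t|lborel. (cmod (\<phi> t))\<^sup>2) = 0"
    then have "AE t in lborel. (cmod (\<phi> t))\<^sup>2 = 0"
      using integral_nonneg_eq_0_iff_AE[OF i] by simp
    then have ae: "AE t in lborel. \<phi> t = 0" by simp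
    obtain t0 where t0: "\<phi> t0 \<noteq> 0" using \<phi>(2) by auto
    have op: "open {t. \<phi> t \<noteq> 0}"
      using open_Collect_neq[OF schwartz_continuous[OF \<phi>(1)] continuous_on_const] .
    then obtain e where e: "e > 0" "ball t0 e \<subseteq> {t. \<phi> t \<noteq> 0}" using t0 unfolding open_contains_ball by blast
    have "{t \<in> space lborel. \<not> \<phi> t = 0} \<in> null_sets lborel"
      using ae op by (subst (asm) AE_iff_null) (simp_all add: borel_open)
    then have "emeasure lborel (ball t0 e) \<le> 0"
      using emeasure_mono[OF e(2), of lborel] op by (simp add: borel_open null_sets_def)
    moreover have "emeasure lborel (ball t0 e) > 0" using e(1) by (simp add: emeasure_ball)
    ultimately show False by simp
  qed
  then show "(LINT t|lborel. (cmod (\<phi> t))\<^sup>2) > 0" using nn by linarith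
qed

lemma nn_integral_jb_pair_finite:
  assumes "r > real CARD('n::finite)"
  shows "(\<integral>\<^sup>+z. ennreal (jb (fst z) powr - r * jb (snd z) powr - r) \<partial>(lborel :: ((real^'n) \<times> (real^'n)) measure)) < \<infinity>"
proof -
  have "(\<integral>\<^sup>+z. ennreal (jb (fst z) powr - r * jb (snd z) powr - r) \<partial>(lborel :: ((real^'n) \<times> (real^'n)) measure))
     = (\<integral>\<^sup>+x. \<integral>\<^sup>+y. ennreal (jb (x::real^'n) powr - r) * ennreal (jb (y::real^'n) powr - r) \<partial>lborel \<partial>lborel)"
    unfolding lborel_prod[symmetric]
    by (subst lborel.nn_integral_fst[symmetric]) (simp_all add: ennreal_mult)
  also have "\<dots> = (\<integral>\<^sup>+x. ennreal (jb (x::real^'n) powr - r) \<partial>lborel) * (\<integral>\<^sup>+y. ennreal (jb (y::real^'n) powr - r) \<partial>lborel)"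
    by (simp add: nn_integral_cmult nn_integral_multc)
  also have "\<dots> < \<infinity>" using nn_integral_jb_finite[OF assms] by (simp add: ennreal_mult_less_top)
  finally show ?thesis .
qed

text \<open>For fixed \<open>x\<close>, Fourier inversion in the frequency recovers (2 pi)^n
  \<phi>(t - x) \<theta>(t); multiplying by the conjugate of \<phi>(t - x) and integrating over
  \<open>x\<close> leaves a constant times \<theta>(t). This expands \<theta> into atoms, and
  \<open>tempered_integral\<close> lets \<open>u\<close> act on them one by one.\<close>

lemma reproducing_formula:
  fixes \<phi> \<theta> :: "real^'n::finite \<Rightarrow> complex"
  assumes u: "u \<in> tempered_distr" and \<phi>: "\<phi> \<in> schwartz_space" and \<theta>: "\<theta> \<in> schwartz_space"
  shows "complex_of_real ((2 * pi) ^ CARD('n)) * (LINT t|lborel. \<phi> t * cnj (\<phi> t)) * u \<theta>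
    = (LINT z|lborel. amb \<phi> \<theta> (fst z) (snd z) * u (atom (\<lambda>t. cnj (\<phi> t)) (fst z) (snd z)))"
proof -
  define r where "r = real CARD('n) + 1"
  have r: "r \<ge> 0" "r > real CARD('n)" by (simp_all add: r_def)
  \<comment> \<open>Lebesgue measure on phase space is infinite, while
    \<open>tempered_integral\<close> works over a finite measure. An integrable weight is therefore
    split off the rapidly decaying coefficient, leaving the quotient \<open>g\<close>.\<close>
  define w where "w z = jb (fst z) powr - r * jb (snd z) powr - r" for z :: "(real^'n) \<times> (real^'n)"
  have w: "w z > 0" for z by (simp add: w_def)
  have wc: "continuous_on UNIV w" unfolding w_def by (intro continuous_intros) simp_all
  have wm[measurable]: "w \<in> borel_measurable borel" by (rule borel_measurable_continuous_onI[OF wc])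
  define M where "M = density lborel (\<lambda>z. ennreal (w z))"
  have sM: "sets M = sets borel" by (simp add: M_def)
  have fM: "finite_measure M"
  proof (rule finite_measureI)
    have "emeasure M (space M) = (\<integral>\<^sup>+z. ennreal (w z) * indicator (space lborel) z \<partial>lborel)"
      unfolding M_def space_density by (rule emeasure_density) simp_all
    also have "\<dots> < \<infinity>" unfolding w_def using nn_integral_jb_pair_finite[OF r(2)] by simp
    finally show "emeasure M (space M) \<noteq> \<infinity>" by simp
  qed
  define \<phi>' where "\<phi>' = (\<lambda>t. cnj (\<phi> t))"
  have \<phi>': "\<phi>' \<in> schwartz_space" unfolding \<phi>'_def by (rule schwartz_cnj[OF \<phi>])
  define g where "g z = amb \<phi> \<theta> (fst z) (snd z) / complex_of_real (w z)" for z
  have gc: "continuous_on UNIV g" unfolding g_def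
    using w by (intro continuous_on_divide amb_continuous \<phi> \<theta> continuous_on_of_real wc) (simp add: less_imp_neq[symmetric])
  define a where "a z = atom \<phi>' (fst z) (snd z)" for z
  have aS: "a z \<in> schwartz_space" for z unfolding a_def by (rule atom_schwartz[OF \<phi>'])
  define G where "G z = (\<lambda>t. g z * a z t)" for z
  have GS: "G z \<in> schwartz_space" for z unfolding G_def by (rule schwartz_cmult[OF aS])
  have wg: "w z *\<^sub>R (g z * c) = amb \<phi> \<theta> (fst z) (snd z) * c" for z c
    using w[of z] by (simp add: g_def scaleR_conv_of_real)
  define K where "K = complex_of_real ((2 * pi) ^ CARD('n)) * (LINT t|lborel. \<phi> t * cnj (\<phi> t))"
  have "u (\<lambda>t. K * \<theta> t) = (LINT z|M. u (G z))"
  proof (rule tempered_integral[OF u fM sM GS])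
    show "(\<lambda>t. K * \<theta> t) \<in> schwartz_space" by (rule schwartz_cmult[OF \<theta>])
  next
    fix k :: nat and js :: "'n list" and Z :: "nat \<Rightarrow> (real^'n) \<times> (real^'n)" and z assume Z: "Z \<longlonglongrightarrow> z"
    have gl: "(\<lambda>n. g (Z n)) \<longlonglongrightarrow> g z" by (rule continuous_on_tendsto_compose[OF gc Z]) simp_all
    have al: "(\<lambda>n. schwartz_seminorm k js (\<lambda>t. a (Z n) t - a z t)) \<longlonglongrightarrow> 0" unfolding a_def by (rule atom_tendsto[OF \<phi>' Z])
    have lim: "(\<lambda>n. cmod (g (Z n)) * schwartz_seminorm k js (\<lambda>t. a (Z n) t - a z t) + cmod (g (Z n) - g z) * schwartz_seminorm k js (a z))
        \<longlonglongrightarrow> cmod (g z) * 0 + cmod (g z - g z) * schwartz_seminorm k js (a z)"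
      by (intro tendsto_add tendsto_mult tendsto_norm tendsto_diff tendsto_const gl al)
    show "(\<lambda>n. schwartz_seminorm k js (\<lambda>t. G (Z n) t - G z t)) \<longlonglongrightarrow> 0"
    proof (rule Lim_null_comparison[OF always_eventually[OF allI]])
      fix n
      have "(\<lambda>t. G (Z n) t - G z t) = (\<lambda>t. g (Z n) * (a (Z n) t - a z t) + (g (Z n) - g z) * a z t)"
        by (simp add: G_def algebra_simps)
      then have "schwartz_seminorm k js (\<lambda>t. G (Z n) t - G z t) \<le>
        cmod (g (Z n)) * schwartz_seminorm k js (\<lambda>t. a (Z n) t - a z t) + cmod (g (Z n) - g z) * schwartz_seminorm k js (a z)"
        using order_trans[OF schwartz_seminorm_add[OF schwartz_cmult[OF schwartz_diff[OF aS[of "Z n"] aS[of z]]] schwartz_cmult[OF aS[of z]]]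
            add_mono[OF schwartz_seminorm_cmult[OF schwartz_diff[OF aS[of "Z n"] aS[of z]]] schwartz_seminorm_cmult[OF aS[of z]]]]
        by simp
      then show "norm (schwartz_seminorm k js (\<lambda>t. G (Z n) t - G z t)) \<le>
        cmod (g (Z n)) * schwartz_seminorm k js (\<lambda>t. a (Z n) t - a z t) + cmod (g (Z n) - g z) * schwartz_seminorm k js (a z)"
        using schwartz_seminorm_nonneg[OF schwartz_diff[OF GS GS]] unfolding real_norm_def by (subst abs_of_nonneg) simp_all
    next
      show "(\<lambda>n. cmod (g (Z n)) * schwartz_seminorm k js (\<lambda>t. a (Z n) t - a z t) + cmod (g (Z n) - g z) * schwartz_seminorm k js (a z)) \<longlonglongrightarrow> 0"
        using lim by simp
    qed
  next
    fix k "is"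
    obtain C where C: "C \<ge> 0" "\<And>x \<xi>. schwartz_seminorm k is (atom \<phi>' x \<xi>) \<le> C * (jb x ^ k * jb \<xi> ^ length is)"
      using atom_seminorm_bound[OF \<phi>', of k "is"] by blast
    \<comment> \<open>Decay of this order outweighs the division by \<open>w\<close> and the
      polynomial growth of the atom seminorms together.\<close>
    define R where "R = r + real (k + length is)"
    obtain D where D: "D > 0" "\<And>x \<xi>. cmod (amb \<phi> \<theta> x \<xi>) \<le> D * (jb x powr - R * jb \<xi> powr - R)"
      using amb_bound[OF \<phi> \<theta>, of R] r by (auto simp: R_def)
    have "schwartz_seminorm k is (G z) \<le> D * C" for z
    proof -
      obtain x \<xi> where z: "z = (x, \<xi>)" by (cases z)
      have p: "jb y powr - R * (jb y powr r * jb y ^ l) \<le> 1" if "l \<le> k + length is" for y :: "real^'n" and l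
      proof -
        have "jb y powr - R * (jb y powr r * jb y ^ l) = jb y powr (- R + (r + real l))"
        proof -
          have "jb y ^ l = jb y powr real l" by (simp add: powr_realpow)
          then show ?thesis by (simp only: powr_add)
        qed
        also have "\<dots> \<le> 1" using that by (intro jb_powr_le_1) (simp add: R_def)
        finally show ?thesis .
      qed
      have "schwartz_seminorm k is (G z) \<le> cmod (g z) * schwartz_seminorm k is (a z)"
        unfolding G_def by (rule schwartz_seminorm_cmult[OF aS])
      also have "\<dots> \<le> (D * (jb x powr - R * jb \<xi> powr - R) * (jb x powr r * jb \<xi> powr r)) * (C * (jb x ^ k * jb \<xi> ^ length is))"
      proof (rule mult_mono)
        have "cmod (g z) = cmod (amb \<phi> \<theta> x \<xi>) * (jb x powr r * jb \<xi> powr r)"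
          using w[of z] by (simp add: g_def norm_divide norm_mult w_def z powr_minus field_simps)
        also have "\<dots> \<le> D * (jb x powr - R * jb \<xi> powr - R) * (jb x powr r * jb \<xi> powr r)"
          by (intro mult_right_mono D) simp
        finally show "cmod (g z) \<le> D * (jb x powr - R * jb \<xi> powr - R) * (jb x powr r * jb \<xi> powr r)" .
        show "schwartz_seminorm k is (a z) \<le> C * (jb x ^ k * jb \<xi> ^ length is)" unfolding a_def z fst_conv snd_conv by (rule C(2))
      qed (use D in \<open>simp_all add: schwartz_seminorm_nonneg aS\<close>)
      also have "\<dots> = D * C * ((jb x powr - R * (jb x powr r * jb x ^ k)) * (jb \<xi> powr - R * (jb \<xi> powr r * jb \<xi> ^ length is)))"
        by (simp only: mult_ac)
      also have "\<dots> \<le> D * C * (1 * 1)"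
        using C(1) D(1) by (intro mult_left_mono mult_mono p) simp_all
      finally show ?thesis by simp
    qed
    then show "\<exists>C. \<forall>z. schwartz_seminorm k is (G z) \<le> C" by blast
  next
    fix t
    obtain D where D: "D > 0" "\<And>x \<xi>. cmod (amb \<phi> \<theta> x \<xi>) \<le> D * (jb x powr - r * jb \<xi> powr - r)"
      using amb_bound[OF \<phi> \<theta> r(1)] by blast
    obtain B where B: "\<And>x. cmod (\<phi>' x) \<le> B" using schwartz_bounded[OF \<phi>'] by blast
    have B0: "B \<ge> 0" using order_trans[OF norm_ge_zero B] .
    let ?h = "\<lambda>z. amb \<phi> \<theta> (fst z) (snd z) * a z t"
    have [measurable]: "(\<lambda>z. amb \<phi> \<theta> (fst z) (snd z)) \<in> borel_measurable borel"
      by (rule borel_measurable_continuous_onI[OF amb_continuous[OF \<phi> \<theta>]])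
    have [measurable]: "\<phi>' \<in> borel_measurable borel" by (rule schwartz_measurable[OF \<phi>'])
    have "continuous_on UNIV (\<lambda>z::(real^'n) \<times> (real^'n). \<phi>' (t - fst z))"
      by (rule continuous_on_compose2[OF schwartz_continuous[OF \<phi>', of UNIV]]) (intro continuous_intros, simp)
    then have am[measurable]: "(\<lambda>z. a z t) \<in> borel_measurable borel" unfolding a_def atom_def
      by (intro borel_measurable_continuous_onI continuous_on_mult continuous_on_wave continuous_intros)
    have gm[measurable]: "g \<in> borel_measurable borel" by (rule borel_measurable_continuous_onI[OF gc])
    have wi: "integrable lborel w"
    proof (rule integrableI_nonneg)
      show "(\<integral>\<^sup>+z. ennreal (w z) \<partial>lborel) < \<infinity>" unfolding w_def using nn_integral_jb_pair_finite[OF r(2)] by simp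
    qed (use w in \<open>simp_all add: less_imp_le\<close>)
    have hi: "integrable lborel ?h"
    proof (rule Bochner_Integration.integrable_bound[OF integrable_mult_right[OF wi, of "D * B"]])
      show "AE z in lborel. norm (?h z) \<le> norm (D * B * w z)"
      proof (rule AE_I2)
        fix z
        have "cmod (amb \<phi> \<theta> (fst z) (snd z)) * cmod (a z t) \<le> (D * w z) * B"
          unfolding w_def using D B0 by (intro mult_mono) (simp_all add: a_def atom_def norm_mult B)
        then show "norm (?h z) \<le> norm (D * B * w z)" using D B0 w[of z] by (simp add: norm_mult abs_mult mult_ac)
      qed
    qed measurable
    have "(LINT z|M. G z t) = (LINT z|lborel. w z *\<^sub>R (g z * a z t))"
      unfolding M_def G_def using w by (subst integral_density) (simp_all add: less_imp_le)
    also have "\<dots> = (LINT z|(lborel \<Otimes>\<^sub>M lborel). ?h z)" unfolding wg lborel_prod by (rule refl)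
    also have "\<dots> = (LINT x|lborel. LINT \<xi>|lborel. ?h (x, \<xi>))"
      by (rule lborel_pair.integral_fst'[symmetric]) (simp only: lborel_prod hi)
    also have "\<dots> = (LINT x|lborel. (complex_of_real ((2 * pi) ^ CARD('n)) * \<theta> t) * (\<phi> (t - x) * cnj (\<phi> (t - x))))"
    proof (rule Bochner_Integration.integral_cong[OF refl])
      fix x
      have "(LINT \<xi>|lborel. ?h (x, \<xi>)) = (LINT \<xi>|lborel. \<phi>' (t - x) * (amb \<phi> \<theta> x \<xi> * wave (- t) \<xi>))"
        by (simp add: a_def atom_def wave_minus wave_commute[of t] mult_ac)
      also have "\<dots> = \<phi>' (t - x) * osc (osc (\<lambda>s. \<phi> (s - x) * \<theta> s)) (- t)"
        unfolding amb_def osc_def[of "osc _"] by (rule Bochner_Integration.integral_mult_right_zero)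
      also have "osc (osc (\<lambda>s. \<phi> (s - x) * \<theta> s)) (- t) = complex_of_real ((2 * pi) ^ CARD('n)) * (\<phi> (t - x) * \<theta> t)"
        by (rule schwartz_inversion[OF amb_product_schwartz[OF \<phi> \<theta>]])
      finally show "(LINT \<xi>|lborel. ?h (x, \<xi>)) = (complex_of_real ((2 * pi) ^ CARD('n)) * \<theta> t) * (\<phi> (t - x) * cnj (\<phi> (t - x)))"
        unfolding \<phi>'_def by (simp only: mult_ac)
    qed
    also have "\<dots> = (complex_of_real ((2 * pi) ^ CARD('n)) * \<theta> t) * (LINT x|lborel. \<phi> (t - x) * cnj (\<phi> (t - x)))"
      by (rule Bochner_Integration.integral_mult_right_zero)
    also have "(LINT x|lborel. \<phi> (t - x) * cnj (\<phi> (t - x))) = (LINT x|lborel. \<phi> x * cnj (\<phi> x))"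
    proof -
      have "(\<lambda>x. \<phi> x * cnj (\<phi> x)) \<in> borel_measurable borel" by (intro schwartz_measurable schwartz_mult schwartz_cnj \<phi>)
      from integral_reflect(1)[OF this, of t] show ?thesis .
    qed
    finally show "K * \<theta> t = (LINT z|M. G z t)" unfolding K_def by (simp only: mult_ac)
  qed
  also have "\<dots> = (LINT z|lborel. w z *\<^sub>R (g z * u (a z)))"
  proof -
    have gm: "g \<in> borel_measurable borel" by (rule borel_measurable_continuous_onI[OF gc])
    have um: "(\<lambda>z. u (a z)) \<in> borel_measurable borel"
      unfolding a_def by (rule borel_measurable_continuous_onI[OF tempered_atom_continuous[OF u \<phi>']])
    have "u (G z) = g z * u (a z)" for z unfolding G_def by (rule tempered_cmult[OF u aS])
    then show ?thesis unfolding M_def using w gm um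
      by (subst integral_density) (simp_all add: less_imp_le)
  qed
  finally have "u (\<lambda>t. K * \<theta> t) = (LINT z|lborel. amb \<phi> \<theta> (fst z) (snd z) * u (a z))" unfolding wg .
  then show ?thesis unfolding tempered_cmult[OF u \<theta>] K_def a_def \<phi>'_def .
qed

subsection \<open>Modulation norms and change of window\<close>

text \<open>A form of the modulation norm suited to estimates: \<open>b\<close> is the already
  conjugated window, the normalising factor is gone, and the weight stands outside the inner norm.
  The passage through \<open>modulation_norm_eq\<close> costs only a constant.\<close>

definition mod_norm :: "(real^'n::finite \<Rightarrow> complex) \<Rightarrow> ereal \<Rightarrow> ereal \<Rightarrow> real \<Rightarrow> 'n distr \<Rightarrow> ennreal" where
  "mod_norm b p q s u = Lp_norm q (\<lambda>\<xi>. ennreal (jb \<xi> powr s) * Lp_norm p (\<lambda>x. ennreal (cmod (u (atom b x \<xi>)))))"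

text \<open>The reverse inequality is the forward one for the factor 1/c.\<close>

lemma Lp_norm_cmult_eq:
  assumes "1 \<le> p" "f \<in> borel_measurable borel" "c > 0"
  shows "Lp_norm p (\<lambda>x. ennreal c * f x) = ennreal c * Lp_norm p f"
proof (rule antisym)
  show "Lp_norm p (\<lambda>x. ennreal c * f x) \<le> ennreal c * Lp_norm p f" by (rule Lp_norm_cmult[OF assms(1,2)])
  have cc: "ennreal (1 / c) * (ennreal c * a) = a" for a
    using assms(3) by (simp add: mult.assoc[symmetric] flip: ennreal_mult)
  have "Lp_norm p (\<lambda>x. ennreal (1 / c) * (ennreal c * f x)) \<le> ennreal (1 / c) * Lp_norm p (\<lambda>x. ennreal c * f x)"
    by (rule Lp_norm_cmult[OF assms(1)]) (use assms(2) in measurable)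
  then have "Lp_norm p f \<le> ennreal (1 / c) * Lp_norm p (\<lambda>x. ennreal c * f x)" unfolding cc .
  then have "ennreal c * Lp_norm p f \<le> ennreal c * (ennreal (1 / c) * Lp_norm p (\<lambda>x. ennreal c * f x))"
    by (rule mult_left_mono) simp
  also have "\<dots> = Lp_norm p (\<lambda>x. ennreal c * f x)"
    using assms(3) by (simp add: mult.assoc[symmetric] flip: ennreal_mult)
  finally show "ennreal c * Lp_norm p f \<le> Lp_norm p (\<lambda>x. ennreal c * f x)" .
qed

lemma tempered_atom_measurable:
  assumes "u \<in> tempered_distr" "b \<in> schwartz_space"
  shows "case_prod (\<lambda>x \<xi>. ennreal (cmod (u (atom b x \<xi>)))) \<in> borel_measurable (borel \<Otimes>\<^sub>M borel)"
proof -
  have "(\<lambda>z. u (atom b (fst z) (snd z))) \<in> borel_measurable (borel \<Otimes>\<^sub>M borel)"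
    unfolding borel_prod by (rule borel_measurable_continuous_onI[OF tempered_atom_continuous[OF assms]])
  then show ?thesis unfolding split_beta' by measurable
qed

lemma modulation_norm_eq:
  fixes \<phi> :: "real^'n::finite \<Rightarrow> complex"
  assumes p: "1 \<le> p" and q: "1 \<le> q" and \<phi>: "\<phi> \<in> schwartz_space" and u: "u \<in> tempered_distr"
  shows "modulation_norm \<phi> p q s u =
    ennreal ((2 * pi) powr (- real CARD('n) / 2)) * mod_norm (\<lambda>t. cnj (\<phi> t)) p q s u"
proof -
  define c where "c = (2 * pi) powr (- real CARD('n) / 2)"
  have c: "c > 0" by (simp add: c_def)
  let ?b = "\<lambda>t. cnj (\<phi> t)"
  define V where "V x \<xi> = ennreal (cmod (u (atom ?b x \<xi>)))" for x \<xi>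
  have Vm[measurable]: "case_prod V \<in> borel_measurable (borel \<Otimes>\<^sub>M borel)"
    unfolding V_def[abs_def] by (rule tempered_atom_measurable[OF u schwartz_cnj[OF \<phi>]])
  have e: "stft \<phi> u x \<xi> = complex_of_real c * u (atom ?b x \<xi>)" for x \<xi>
    unfolding stft_def atom_def wave_def c_def by simp
  have 1: "ennreal (cmod (stft \<phi> u x \<xi> * complex_of_real (jb \<xi> powr s))) = ennreal (c * jb \<xi> powr s) * V x \<xi>" for x \<xi>
    unfolding e V_def using c by (simp add: norm_mult ennreal_mult mult_ac)
  have 2: "Lp_norm p (\<lambda>x. ennreal (c * jb \<xi> powr s) * V x \<xi>) = ennreal c * (ennreal (jb \<xi> powr s) * Lp_norm p (\<lambda>x. V x \<xi>))" for \<xi>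
  proof -
    have "Lp_norm p (\<lambda>x. ennreal (c * jb \<xi> powr s) * V x \<xi>) = ennreal (c * jb \<xi> powr s) * Lp_norm p (\<lambda>x. V x \<xi>)"
      by (rule Lp_norm_cmult_eq[OF p]) (measurable, use c in simp)
    then show ?thesis using c by (simp add: ennreal_mult mult.assoc)
  qed
  have [measurable]: "(\<lambda>\<xi>. Lp_norm p (\<lambda>x. V x \<xi>)) \<in> borel_measurable borel" by (rule Lp_norm_measurable[OF p Vm])
  have "modulation_norm \<phi> p q s u = Lp_norm q (\<lambda>\<xi>. ennreal c * (ennreal (jb \<xi> powr s) * Lp_norm p (\<lambda>x. V x \<xi>)))"
    unfolding modulation_norm_def 1 2 by (rule refl)
  also have "\<dots> = ennreal c * Lp_norm q (\<lambda>\<xi>. ennreal (jb \<xi> powr s) * Lp_norm p (\<lambda>x. V x \<xi>))"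
    by (rule Lp_norm_cmult_eq[OF q _ c]) measurable
  finally show ?thesis unfolding mod_norm_def V_def c_def .
qed

section \<open>Change of window\<close>

lemma norm_integral_le_nn_integral:
  fixes f :: "'a \<Rightarrow> complex"
  shows "ennreal (norm (LINT x|M. f x)) \<le> (\<integral>\<^sup>+x. ennreal (norm (f x)) \<partial>M)"
proof (cases "integrable M f")
  case True
  then show ?thesis by (rule integral_norm_bound_ennreal)
next
  case False
  then show ?thesis by (simp add: not_integrable_integral_eq)
qed

text \<open>Shifting \<open>b\<close> in time and frequency translates the ambiguity function up to
  a phase, which the modulus removes.\<close>

lemma norm_amb_atom:
  assumes a: "a \<in> schwartz_space" and b: "b \<in> schwartz_space"
  shows "cmod (amb a (atom b y \<eta>) x \<xi>) = cmod (amb a b (x - y) (\<xi> - \<eta>))"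
proof -
  let ?f = "\<lambda>t. a (t - x) * (b (t - y) * wave (- \<eta>) t) * wave \<xi> t"
  have [measurable]: "a \<in> borel_measurable borel" "b \<in> borel_measurable borel"
    by (rule schwartz_measurable[OF a], rule schwartz_measurable[OF b])
  have m: "?f \<in> borel_measurable borel" by measurable
  have "amb a (atom b y \<eta>) x \<xi> = (LINT t|lborel. ?f t)" by (simp only: amb_def osc_def atom_def)
  also have "\<dots> = (LINT t|lborel. ?f (t + y))" by (rule integral_shift(1)[OF m, symmetric])
  also have "\<dots> = (LINT t|lborel. wave (\<xi> - \<eta>) y * (a (t - (x - y)) * b t * wave (\<xi> - \<eta>) t))"
  proof (rule Bochner_Integration.integral_cong[OF refl])
    fix t
    have 1: "t + y - x = t - (x - y)" "t + y - y = t" by simp_all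
    have 2: "wave (- \<eta>) (t + y) * wave \<xi> (t + y) = wave (\<xi> - \<eta>) y * wave (\<xi> - \<eta>) t"
      by (simp add: wave_diff wave_add_right mult_ac)
    show "?f (t + y) = wave (\<xi> - \<eta>) y * (a (t - (x - y)) * b t * wave (\<xi> - \<eta>) t)"
      unfolding 1 mult.assoc[of _ "wave (- \<eta>) (t + y)"] using 2 by (simp add: mult_ac)
  qed
  also have "\<dots> = wave (\<xi> - \<eta>) y * amb a b (x - y) (\<xi> - \<eta>)"
    unfolding amb_def osc_def by (rule Bochner_Integration.integral_mult_right_zero)
  finally show ?thesis by (simp add: norm_mult)
qed

text \<open>The reproducing formula is applied to an atom of the new window. By covariance and
  \<open>amb_bound\<close> its coefficients are dominated by a convolution kernel in both variables,
  with any prescribed decay.\<close>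

lemma atom_pointwise_bound:
  fixes \<phi> \<gamma> :: "real^'n::finite \<Rightarrow> complex"
  assumes \<phi>: "\<phi> \<in> schwartz_space" "\<phi> \<noteq> (\<lambda>_. 0)" and \<gamma>: "\<gamma> \<in> schwartz_space" and r: "r \<ge> 0"
  obtains C :: ennreal where "C < \<infinity>"
    "\<And>u y \<eta>. u \<in> tempered_distr \<Longrightarrow> ennreal (cmod (u (atom \<gamma> y \<eta>))) \<le>
      C * (\<integral>\<^sup>+\<xi>. ennreal (jb (\<xi> - \<eta>) powr - r) * (\<integral>\<^sup>+x. ennreal (jb (x - y) powr - r) *
        ennreal (cmod (u (atom (\<lambda>t. cnj (\<phi> t)) x \<xi>))) \<partial>lborel) \<partial>lborel)"
proof -
  obtain D where D: "D > 0" "\<And>x \<xi>. cmod (amb \<phi> \<gamma> x \<xi>) \<le> D * (jb x powr - r * jb \<xi> powr - r)"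
    using amb_bound[OF \<phi>(1) \<gamma> r] by blast
  define K where "K = (2 * pi) ^ CARD('n) * (LINT t|lborel. (cmod (\<phi> t))\<^sup>2)"
  have K: "K > 0" using norm_sq_integral_pos(2)[OF \<phi>] by (simp add: K_def)
  have \<phi>': "(\<lambda>t. cnj (\<phi> t)) \<in> schwartz_space" by (rule schwartz_cnj[OF \<phi>(1)])
  have bound: "ennreal (cmod (u (atom \<gamma> y \<eta>))) \<le>
      ennreal (D / K) * (\<integral>\<^sup>+\<xi>. ennreal (jb (\<xi> - \<eta>) powr - r) * (\<integral>\<^sup>+x. ennreal (jb (x - y) powr - r) *
        ennreal (cmod (u (atom (\<lambda>t. cnj (\<phi> t)) x \<xi>))) \<partial>lborel) \<partial>lborel)"
    if u: "u \<in> tempered_distr" for u y \<eta>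
  proof -
    define V where "V x \<xi> = ennreal (cmod (u (atom (\<lambda>t. cnj (\<phi> t)) x \<xi>)))" for x \<xi>
    have Vm[measurable]: "case_prod V \<in> borel_measurable (borel \<Otimes>\<^sub>M borel)"
      unfolding V_def[abs_def] by (rule tempered_atom_measurable[OF u \<phi>'])
    let ?f = "\<lambda>z. amb \<phi> (atom \<gamma> y \<eta>) (fst z) (snd z) * u (atom (\<lambda>t. cnj (\<phi> t)) (fst z) (snd z))"
    let ?g = "\<lambda>z. ennreal D * (ennreal (jb (snd z - \<eta>) powr - r) * (ennreal (jb (fst z - y) powr - r) * V (fst z) (snd z)))"
    have gm: "?g \<in> borel_measurable (borel \<Otimes>\<^sub>M borel)" by measurable
    have "complex_of_real K * u (atom \<gamma> y \<eta>) = (LINT z|lborel. ?f z)"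
      using reproducing_formula[OF u \<phi>(1) atom_schwartz[OF \<gamma>, of y \<eta>]]
      unfolding norm_sq_integral_pos(1)[OF \<phi>] K_def by (simp only: of_real_mult)
    then have "cmod (complex_of_real K * u (atom \<gamma> y \<eta>)) = cmod (LINT z|lborel. ?f z)" by (rule arg_cong)
    then have eq: "ennreal K * ennreal (cmod (u (atom \<gamma> y \<eta>))) = ennreal (cmod (LINT z|lborel. ?f z))"
      using K by (simp add: norm_mult flip: ennreal_mult)
    have "ennreal (cmod (LINT z|lborel. ?f z)) \<le> (\<integral>\<^sup>+z. ennreal (cmod (?f z)) \<partial>lborel)"
      by (rule norm_integral_le_nn_integral)
    also have "\<dots> \<le> (\<integral>\<^sup>+z. ?g z \<partial>lborel)"
    proof (rule nn_integral_mono)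
      fix z
      have "cmod (?f z) \<le> D * (jb (fst z - y) powr - r * jb (snd z - \<eta>) powr - r) * cmod (u (atom (\<lambda>t. cnj (\<phi> t)) (fst z) (snd z)))"
        unfolding norm_mult norm_amb_atom[OF \<phi>(1) \<gamma>] by (intro mult_right_mono D) simp
      then have "ennreal (cmod (?f z)) \<le> ennreal (D * (jb (fst z - y) powr - r * jb (snd z - \<eta>) powr - r) * cmod (u (atom (\<lambda>t. cnj (\<phi> t)) (fst z) (snd z))))"
        by (rule ennreal_leI)
      also have "\<dots> = ?g z" unfolding V_def using D(1) by (simp add: ennreal_mult mult_ac)
      finally show "ennreal (cmod (?f z)) \<le> ?g z" .
    qed
    also have "\<dots> = (\<integral>\<^sup>+z. ?g z \<partial>(lborel \<Otimes>\<^sub>M lborel))" by (simp only: lborel_prod)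
    also have "\<dots> = (\<integral>\<^sup>+\<xi>. \<integral>\<^sup>+x. ?g (x, \<xi>) \<partial>lborel \<partial>lborel)"
      by (rule lborel_pair.nn_integral_snd[symmetric]) (use gm in simp)
    also have "\<dots> = (\<integral>\<^sup>+\<xi>. ennreal D * (ennreal (jb (\<xi> - \<eta>) powr - r) * (\<integral>\<^sup>+x. ennreal (jb (x - y) powr - r) * V x \<xi> \<partial>lborel)) \<partial>lborel)"
    proof (rule nn_integral_cong)
      fix \<xi>
      have [measurable]: "(\<lambda>x. V x \<xi>) \<in> borel_measurable borel" by measurable
      have "(\<integral>\<^sup>+x. ?g (x, \<xi>) \<partial>lborel) = (\<integral>\<^sup>+x. (ennreal D * ennreal (jb (\<xi> - \<eta>) powr - r)) * (ennreal (jb (x - y) powr - r) * V x \<xi>) \<partial>lborel)"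
        by (simp only: fst_conv snd_conv mult.assoc)
      also have "\<dots> = (ennreal D * ennreal (jb (\<xi> - \<eta>) powr - r)) * (\<integral>\<^sup>+x. ennreal (jb (x - y) powr - r) * V x \<xi> \<partial>lborel)"
        by (rule nn_integral_cmult) measurable
      finally show "(\<integral>\<^sup>+x. ?g (x, \<xi>) \<partial>lborel) = ennreal D * (ennreal (jb (\<xi> - \<eta>) powr - r) * (\<integral>\<^sup>+x. ennreal (jb (x - y) powr - r) * V x \<xi> \<partial>lborel))"
        by (simp only: mult.assoc)
    qed
    also have "\<dots> = ennreal D * (\<integral>\<^sup>+\<xi>. ennreal (jb (\<xi> - \<eta>) powr - r) * (\<integral>\<^sup>+x. ennreal (jb (x - y) powr - r) * V x \<xi> \<partial>lborel) \<partial>lborel)"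
      by (rule nn_integral_cmult) measurable
    finally have le: "ennreal K * ennreal (cmod (u (atom \<gamma> y \<eta>))) \<le> ennreal D *
        (\<integral>\<^sup>+\<xi>. ennreal (jb (\<xi> - \<eta>) powr - r) * (\<integral>\<^sup>+x. ennreal (jb (x - y) powr - r) * V x \<xi> \<partial>lborel) \<partial>lborel)"
      unfolding eq .
    have "ennreal (cmod (u (atom \<gamma> y \<eta>))) = ennreal (1 / K) * (ennreal K * ennreal (cmod (u (atom \<gamma> y \<eta>))))"
      using K by (simp add: mult.assoc[symmetric] flip: ennreal_mult)
    also have "\<dots> \<le> ennreal (1 / K) * (ennreal D *
        (\<integral>\<^sup>+\<xi>. ennreal (jb (\<xi> - \<eta>) powr - r) * (\<integral>\<^sup>+x. ennreal (jb (x - y) powr - r) * V x \<xi> \<partial>lborel) \<partial>lborel))"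
      by (rule mult_left_mono[OF le]) simp
    also have "\<dots> = ennreal (D / K) *
        (\<integral>\<^sup>+\<xi>. ennreal (jb (\<xi> - \<eta>) powr - r) * (\<integral>\<^sup>+x. ennreal (jb (x - y) powr - r) * V x \<xi> \<partial>lborel) \<partial>lborel)"
      using K D(1) by (simp add: mult.assoc[symmetric] flip: ennreal_mult)
    finally show ?thesis unfolding V_def .
  qed
  show ?thesis by (rule that[OF _ bound]) simp_all
qed

lemma jb_kernel_integral:
  fixes y :: "real^'n::finite"
  assumes "r > real CARD('n)"
  shows "(\<integral>\<^sup>+x. ennreal (jb (x - y) powr - r) \<partial>lborel) = (\<integral>\<^sup>+(x::real^'n). ennreal (jb x powr - r) \<partial>lborel)"
    and "(\<integral>\<^sup>+x. ennreal (jb (y - x) powr - r) \<partial>lborel) = (\<integral>\<^sup>+(x::real^'n). ennreal (jb x powr - r) \<partial>lborel)"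
proof -
  show "(\<integral>\<^sup>+x. ennreal (jb (x - y) powr - r) \<partial>lborel) = (\<integral>\<^sup>+(x::real^'n). ennreal (jb x powr - r) \<partial>lborel)"
    using nn_integral_shift[of "\<lambda>x::real^'n. ennreal (jb x powr - r)" "- y"] by simp
  then show "(\<integral>\<^sup>+x. ennreal (jb (y - x) powr - r) \<partial>lborel) = (\<integral>\<^sup>+(x::real^'n). ennreal (jb x powr - r) \<partial>lborel)"
    by (simp add: jb_minus_commute[of y])
qed

text \<open>Hoelder's inequality in \<open>x\<close> against the L^p' norm of the kernel, which does
  not depend on \<open>y\<close>: an L^p norm in time is turned into a bound uniform in
  time.\<close>

lemma atom_sup_bound:
  fixes \<phi> \<gamma> :: "real^'n::finite \<Rightarrow> complex"
  assumes p: "1 \<le> p" and \<phi>: "\<phi> \<in> schwartz_space" "\<phi> \<noteq> (\<lambda>_. 0)" and \<gamma>: "\<gamma> \<in> schwartz_space"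
    and r: "r > real CARD('n)"
  obtains C :: ennreal where "C < \<infinity>"
    "\<And>u y \<eta>. u \<in> tempered_distr \<Longrightarrow> ennreal (cmod (u (atom \<gamma> y \<eta>))) \<le>
      C * (\<integral>\<^sup>+\<xi>. ennreal (jb (\<xi> - \<eta>) powr - r) * Lp_norm p (\<lambda>x. ennreal (cmod (u (atom (\<lambda>t. cnj (\<phi> t)) x \<xi>)))) \<partial>lborel)"
proof -
  have r0: "r \<ge> 0" using r by simp
  obtain C :: ennreal where C: "C < \<infinity>"
    "\<And>u y \<eta>. u \<in> tempered_distr \<Longrightarrow> ennreal (cmod (u (atom \<gamma> y \<eta>))) \<le>
      C * (\<integral>\<^sup>+\<xi>. ennreal (jb (\<xi> - \<eta>) powr - r) * (\<integral>\<^sup>+x. ennreal (jb (x - y) powr - r) *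
        ennreal (cmod (u (atom (\<lambda>t. cnj (\<phi> t)) x \<xi>))) \<partial>lborel) \<partial>lborel)"
    using atom_pointwise_bound[OF \<phi> \<gamma> r0] by blast
  obtain p' where p': "1 \<le> p'" "1 / p + 1 / p' = 1" using conjugate_exponent_exists[OF p] by blast
  define L where "L = Lp_norm p' (\<lambda>x::real^'n. ennreal (jb x powr - r))"
  have L: "L < \<infinity>" unfolding L_def by (rule Lp_norm_jb_finite[OF p'(1) r])
  have bound: "ennreal (cmod (u (atom \<gamma> y \<eta>))) \<le> (C * (2 * L)) *
     (\<integral>\<^sup>+\<xi>. ennreal (jb (\<xi> - \<eta>) powr - r) * Lp_norm p (\<lambda>x. ennreal (cmod (u (atom (\<lambda>t. cnj (\<phi> t)) x \<xi>)))) \<partial>lborel)"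
    if u: "u \<in> tempered_distr" for u y \<eta>
  proof -
    define V where "V x \<xi> = ennreal (cmod (u (atom (\<lambda>t. cnj (\<phi> t)) x \<xi>)))" for x \<xi>
    have Vm[measurable]: "case_prod V \<in> borel_measurable (borel \<Otimes>\<^sub>M borel)"
      unfolding V_def[abs_def] by (rule tempered_atom_measurable[OF u schwartz_cnj[OF \<phi>(1)]])
    have Nm[measurable]: "(\<lambda>\<xi>. Lp_norm p (\<lambda>x. V x \<xi>)) \<in> borel_measurable borel" by (rule Lp_norm_measurable[OF p Vm])
    have inner: "(\<integral>\<^sup>+x. ennreal (jb (x - y) powr - r) * V x \<xi> \<partial>lborel) \<le> (2 * L) * Lp_norm p (\<lambda>x. V x \<xi>)" for \<xi>
    proof -
      have "(\<integral>\<^sup>+x. V x \<xi> * ennreal (jb (x - y) powr - r) \<partial>lborel) \<le> 2 * (Lp_norm p (\<lambda>x. V x \<xi>) * Lp_norm p' (\<lambda>x. ennreal (jb (x - y) powr - r)))"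
        by (rule Lp_Hoelder[OF p p']) measurable
      also have "Lp_norm p' (\<lambda>x. ennreal (jb (x - y) powr - r)) = L"
        unfolding L_def using Lp_norm_shift[OF p'(1), of "\<lambda>x::real^'n. ennreal (jb x powr - r)" "- y"] by simp
      finally show ?thesis by (simp add: mult_ac)
    qed
    have "ennreal (cmod (u (atom \<gamma> y \<eta>))) \<le> C * (\<integral>\<^sup>+\<xi>. ennreal (jb (\<xi> - \<eta>) powr - r) * (\<integral>\<^sup>+x. ennreal (jb (x - y) powr - r) * V x \<xi> \<partial>lborel) \<partial>lborel)"
      using C(2)[OF u] unfolding V_def .
    also have "\<dots> \<le> C * (\<integral>\<^sup>+\<xi>. (2 * L) * (ennreal (jb (\<xi> - \<eta>) powr - r) * Lp_norm p (\<lambda>x. V x \<xi>)) \<partial>lborel)"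
    proof (intro mult_left_mono nn_integral_mono)
      fix \<xi>
      show "ennreal (jb (\<xi> - \<eta>) powr - r) * (\<integral>\<^sup>+x. ennreal (jb (x - y) powr - r) * V x \<xi> \<partial>lborel) \<le>
        (2 * L) * (ennreal (jb (\<xi> - \<eta>) powr - r) * Lp_norm p (\<lambda>x. V x \<xi>))"
        unfolding mult.left_commute[of "2 * L"] by (rule mult_left_mono[OF inner]) simp
    qed simp
    also have "\<dots> = C * ((2 * L) * (\<integral>\<^sup>+\<xi>. ennreal (jb (\<xi> - \<eta>) powr - r) * Lp_norm p (\<lambda>x. V x \<xi>) \<partial>lborel))"
    proof -
      have "(\<integral>\<^sup>+\<xi>. (2 * L) * (ennreal (jb (\<xi> - \<eta>) powr - r) * Lp_norm p (\<lambda>x. V x \<xi>)) \<partial>lborel)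
        = (2 * L) * (\<integral>\<^sup>+\<xi>. ennreal (jb (\<xi> - \<eta>) powr - r) * Lp_norm p (\<lambda>x. V x \<xi>) \<partial>lborel)"
        by (rule nn_integral_cmult) measurable
      then show ?thesis by (simp only:)
    qed
    finally show ?thesis unfolding V_def by (simp only: mult.assoc)
  qed
  show ?thesis by (rule that[OF _ bound]) (use C(1) L in \<open>simp_all add: ennreal_mult_less_top\<close>)
qed

text \<open>Here the L^p norm in time is kept: Minkowski's inequality takes it under the frequency
  integral, and Young's inequality disposes of the convolution in time.\<close>

lemma atom_Lp_bound:
  fixes \<phi> \<gamma> :: "real^'n::finite \<Rightarrow> complex"
  assumes p: "1 \<le> p" and \<phi>: "\<phi> \<in> schwartz_space" "\<phi> \<noteq> (\<lambda>_. 0)" and \<gamma>: "\<gamma> \<in> schwartz_space"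
    and r: "r > real CARD('n)"
  obtains C :: ennreal where "C < \<infinity>"
    "\<And>u \<eta>. u \<in> tempered_distr \<Longrightarrow> Lp_norm p (\<lambda>y. ennreal (cmod (u (atom \<gamma> y \<eta>)))) \<le>
      C * (\<integral>\<^sup>+\<xi>. ennreal (jb (\<xi> - \<eta>) powr - r) * Lp_norm p (\<lambda>x. ennreal (cmod (u (atom (\<lambda>t. cnj (\<phi> t)) x \<xi>)))) \<partial>lborel)"
proof -
  have r0: "r \<ge> 0" using r by simp
  obtain C :: ennreal where C: "C < \<infinity>"
    "\<And>u y \<eta>. u \<in> tempered_distr \<Longrightarrow> ennreal (cmod (u (atom \<gamma> y \<eta>))) \<le>
      C * (\<integral>\<^sup>+\<xi>. ennreal (jb (\<xi> - \<eta>) powr - r) * (\<integral>\<^sup>+x. ennreal (jb (x - y) powr - r) *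
        ennreal (cmod (u (atom (\<lambda>t. cnj (\<phi> t)) x \<xi>))) \<partial>lborel) \<partial>lborel)"
    using atom_pointwise_bound[OF \<phi> \<gamma> r0] by blast
  define L where "L = (\<integral>\<^sup>+(x::real^'n). ennreal (jb x powr - r) \<partial>lborel)"
  have L: "L < \<infinity>" unfolding L_def by (rule nn_integral_jb_finite[OF r])
  have bound: "Lp_norm p (\<lambda>y. ennreal (cmod (u (atom \<gamma> y \<eta>)))) \<le> (C * (2 * (2 * L))) *
     (\<integral>\<^sup>+\<xi>. ennreal (jb (\<xi> - \<eta>) powr - r) * Lp_norm p (\<lambda>x. ennreal (cmod (u (atom (\<lambda>t. cnj (\<phi> t)) x \<xi>)))) \<partial>lborel)"
    if u: "u \<in> tempered_distr" for u \<eta>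
  proof -
    define V where "V x \<xi> = ennreal (cmod (u (atom (\<lambda>t. cnj (\<phi> t)) x \<xi>)))" for x \<xi>
    have Vm[measurable]: "case_prod V \<in> borel_measurable (borel \<Otimes>\<^sub>M borel)"
      unfolding V_def[abs_def] by (rule tempered_atom_measurable[OF u schwartz_cnj[OF \<phi>(1)]])
    have Nm[measurable]: "(\<lambda>\<xi>. Lp_norm p (\<lambda>x. V x \<xi>)) \<in> borel_measurable borel" by (rule Lp_norm_measurable[OF p Vm])
    have Vs[measurable]: "(\<lambda>x. V x \<xi>) \<in> borel_measurable borel" for \<xi> by measurable
    define I where "I y \<xi> = (\<integral>\<^sup>+x. ennreal (jb (x - y) powr - r) * V x \<xi> \<partial>lborel)" for y \<xi>
    have Im[measurable]: "case_prod I \<in> borel_measurable (borel \<Otimes>\<^sub>M borel)"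
      unfolding I_def[abs_def] by measurable
    have IL: "Lp_norm p (\<lambda>y. I y \<xi>) \<le> 2 * L * Lp_norm p (\<lambda>x. V x \<xi>)" for \<xi>
    proof -
      have "I y \<xi> = (\<integral>\<^sup>+x. ennreal (jb x powr - r) * V (y - x) \<xi> \<partial>lborel)" for y
      proof -
        have "I y \<xi> = (\<integral>\<^sup>+x. ennreal (jb (y - x) powr - r) * V x \<xi> \<partial>lborel)"
          unfolding I_def by (simp only: jb_minus_commute[of y])
        also have "\<dots> = (\<integral>\<^sup>+x. ennreal (jb x powr - r) * V (y - x) \<xi> \<partial>lborel)"
          by (rule convolution_commute[symmetric]) measurable
        finally show ?thesis .
      qed
      then have "Lp_norm p (\<lambda>y. I y \<xi>) \<le> 2 * ((\<integral>\<^sup>+(x::real^'n). ennreal (jb x powr - r) \<partial>lborel) * Lp_norm p (\<lambda>x. V x \<xi>))"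
        using Lp_norm_convolution[OF p, of "\<lambda>x. ennreal (jb x powr - r)" "\<lambda>x. V x \<xi>"] by simp
      then show ?thesis by (simp only: L_def mult.assoc)
    qed
    have pm: "case_prod (\<lambda>y \<xi>. ennreal (jb (\<xi> - \<eta>) powr - r) * I y \<xi>) \<in> borel_measurable (borel \<Otimes>\<^sub>M borel)" by measurable
    have um: "(\<lambda>y. ennreal (cmod (u (atom \<gamma> y \<eta>)))) \<in> borel_measurable borel"
      using measurable_compose[OF measurable_Pair2'[of \<eta> borel borel] tempered_atom_measurable[OF u \<gamma>]] by simp
    have "Lp_norm p (\<lambda>y. ennreal (cmod (u (atom \<gamma> y \<eta>)))) \<le>
        Lp_norm p (\<lambda>y. C * (\<integral>\<^sup>+\<xi>. ennreal (jb (\<xi> - \<eta>) powr - r) * I y \<xi> \<partial>lborel))"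
      by (rule Lp_norm_mono[OF p um]) (use C(2)[OF u] in \<open>simp only: I_def V_def\<close>)
    also have "\<dots> \<le> C * Lp_norm p (\<lambda>y. \<integral>\<^sup>+\<xi>. ennreal (jb (\<xi> - \<eta>) powr - r) * I y \<xi> \<partial>lborel)"
      by (rule Lp_norm_cmult[OF p]) measurable
    also have "\<dots> \<le> C * (2 * (\<integral>\<^sup>+\<xi>. Lp_norm p (\<lambda>y. ennreal (jb (\<xi> - \<eta>) powr - r) * I y \<xi>) \<partial>lborel))"
      by (intro mult_left_mono Lp_norm_Minkowski p pm) simp
    also have "\<dots> \<le> C * (2 * (\<integral>\<^sup>+\<xi>. (2 * L) * (ennreal (jb (\<xi> - \<eta>) powr - r) * Lp_norm p (\<lambda>x. V x \<xi>)) \<partial>lborel))"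
    proof (intro mult_left_mono nn_integral_mono)
      fix \<xi>
      have "Lp_norm p (\<lambda>y. ennreal (jb (\<xi> - \<eta>) powr - r) * I y \<xi>) \<le> ennreal (jb (\<xi> - \<eta>) powr - r) * Lp_norm p (\<lambda>y. I y \<xi>)"
        by (rule Lp_norm_cmult[OF p]) measurable
      also have "\<dots> \<le> ennreal (jb (\<xi> - \<eta>) powr - r) * (2 * L * Lp_norm p (\<lambda>x. V x \<xi>))"
        by (rule mult_left_mono[OF IL]) simp
      finally show "Lp_norm p (\<lambda>y. ennreal (jb (\<xi> - \<eta>) powr - r) * I y \<xi>) \<le> (2 * L) * (ennreal (jb (\<xi> - \<eta>) powr - r) * Lp_norm p (\<lambda>x. V x \<xi>))"
        by (simp only: mult.left_commute)
    qed simp_all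
    also have "\<dots> = C * (2 * ((2 * L) * (\<integral>\<^sup>+\<xi>. ennreal (jb (\<xi> - \<eta>) powr - r) * Lp_norm p (\<lambda>x. V x \<xi>) \<partial>lborel)))"
    proof -
      have "(\<integral>\<^sup>+\<xi>. (2 * L) * (ennreal (jb (\<xi> - \<eta>) powr - r) * Lp_norm p (\<lambda>x. V x \<xi>)) \<partial>lborel)
        = (2 * L) * (\<integral>\<^sup>+\<xi>. ennreal (jb (\<xi> - \<eta>) powr - r) * Lp_norm p (\<lambda>x. V x \<xi>) \<partial>lborel)"
        by (rule nn_integral_cmult) measurable
      then show ?thesis by (simp only:)
    qed
    finally show ?thesis unfolding V_def by (simp only: mult.assoc)
  qed
  show ?thesis by (rule that[OF _ bound]) (use C(1) L in \<open>simp_all add: ennreal_mult_less_top\<close>)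
qed

text \<open>Peetre's inequality moves the weight through the convolution at the price of |s| powers
  of the kernel's decay; Young's inequality does the rest.\<close>

lemma weighted_convolution:
  fixes N :: "real^'n::finite \<Rightarrow> ennreal"
  assumes q: "1 \<le> q" and r: "r > real CARD('n) + \<bar>s\<bar>" and [measurable]: "N \<in> borel_measurable borel"
  shows "Lp_norm q (\<lambda>\<eta>. ennreal (jb \<eta> powr s) * (\<integral>\<^sup>+\<xi>. ennreal (jb (\<xi> - \<eta>) powr - r) * N \<xi> \<partial>lborel))
    \<le> (ennreal (2 powr \<bar>s\<bar>) * 2 * (\<integral>\<^sup>+(x::real^'n). ennreal (jb x powr - (r - \<bar>s\<bar>)) \<partial>lborel)) * Lp_norm q (\<lambda>\<xi>. ennreal (jb \<xi> powr s) * N \<xi>)"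
proof -
  let ?k = "\<lambda>x::real^'n. ennreal (jb x powr - (r - \<bar>s\<bar>))" and ?N = "\<lambda>\<xi>. ennreal (jb \<xi> powr s) * N \<xi>"
  have pt: "ennreal (jb \<eta> powr s) * (\<integral>\<^sup>+\<xi>. ennreal (jb (\<xi> - \<eta>) powr - r) * N \<xi> \<partial>lborel)
      \<le> ennreal (2 powr \<bar>s\<bar>) * (\<integral>\<^sup>+\<xi>. ?k \<xi> * ?N (\<eta> - \<xi>) \<partial>lborel)" for \<eta>
  proof -
    have "ennreal (jb \<eta> powr s) * (\<integral>\<^sup>+\<xi>. ennreal (jb (\<xi> - \<eta>) powr - r) * N \<xi> \<partial>lborel)
       = (\<integral>\<^sup>+\<xi>. ennreal (jb \<eta> powr s) * (ennreal (jb (\<xi> - \<eta>) powr - r) * N \<xi>) \<partial>lborel)"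
      by (rule nn_integral_cmult[symmetric]) measurable
    also have "\<dots> \<le> (\<integral>\<^sup>+\<xi>. ennreal (2 powr \<bar>s\<bar>) * (?k (\<eta> - \<xi>) * ?N \<xi>) \<partial>lborel)"
    proof (rule nn_integral_mono)
      fix \<xi>
      have "jb \<eta> powr s \<le> 2 powr \<bar>s\<bar> * jb (\<eta> - \<xi>) powr \<bar>s\<bar> * jb \<xi> powr s" using jb_powr_add_le[of "\<eta> - \<xi>" \<xi> s] by simp
      then have "jb \<eta> powr s * jb (\<xi> - \<eta>) powr - r \<le> (2 powr \<bar>s\<bar> * jb (\<eta> - \<xi>) powr \<bar>s\<bar> * jb \<xi> powr s) * jb (\<xi> - \<eta>) powr - r"
        by (rule mult_right_mono) simp
      also have "\<dots> = 2 powr \<bar>s\<bar> * ((jb (\<eta> - \<xi>) powr \<bar>s\<bar> * jb (\<eta> - \<xi>) powr - r) * jb \<xi> powr s)"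
        by (simp only: jb_minus_commute[of \<xi>] mult_ac)
      also have "jb (\<eta> - \<xi>) powr \<bar>s\<bar> * jb (\<eta> - \<xi>) powr - r = jb (\<eta> - \<xi>) powr - (r - \<bar>s\<bar>)" by (simp flip: powr_add)
      finally have "ennreal (jb \<eta> powr s * jb (\<xi> - \<eta>) powr - r) \<le> ennreal (2 powr \<bar>s\<bar> * (jb (\<eta> - \<xi>) powr - (r - \<bar>s\<bar>) * jb \<xi> powr s))"
        by (rule ennreal_leI)
      then have "ennreal (jb \<eta> powr s * jb (\<xi> - \<eta>) powr - r) * N \<xi> \<le> ennreal (2 powr \<bar>s\<bar> * (jb (\<eta> - \<xi>) powr - (r - \<bar>s\<bar>) * jb \<xi> powr s)) * N \<xi>"
        by (rule mult_right_mono) simp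
      then show "ennreal (jb \<eta> powr s) * (ennreal (jb (\<xi> - \<eta>) powr - r) * N \<xi>) \<le> ennreal (2 powr \<bar>s\<bar>) * (?k (\<eta> - \<xi>) * ?N \<xi>)"
        by (simp add: ennreal_mult mult.assoc)
    qed
    also have "\<dots> = ennreal (2 powr \<bar>s\<bar>) * (\<integral>\<^sup>+\<xi>. ?k (\<eta> - \<xi>) * ?N \<xi> \<partial>lborel)"
      by (rule nn_integral_cmult) measurable
    also have "(\<integral>\<^sup>+\<xi>. ?k (\<eta> - \<xi>) * ?N \<xi> \<partial>lborel) = (\<integral>\<^sup>+\<xi>. ?k \<xi> * ?N (\<eta> - \<xi>) \<partial>lborel)"
      by (rule convolution_commute[symmetric]) measurable
    finally show ?thesis .
  qed
  have "Lp_norm q (\<lambda>\<eta>. ennreal (jb \<eta> powr s) * (\<integral>\<^sup>+\<xi>. ennreal (jb (\<xi> - \<eta>) powr - r) * N \<xi> \<partial>lborel))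
     \<le> Lp_norm q (\<lambda>\<eta>. ennreal (2 powr \<bar>s\<bar>) * (\<integral>\<^sup>+\<xi>. ?k \<xi> * ?N (\<eta> - \<xi>) \<partial>lborel))"
    by (rule Lp_norm_mono[OF q _ pt]) measurable
  also have "\<dots> \<le> ennreal (2 powr \<bar>s\<bar>) * Lp_norm q (\<lambda>\<eta>. \<integral>\<^sup>+\<xi>. ?k \<xi> * ?N (\<eta> - \<xi>) \<partial>lborel)"
    by (rule Lp_norm_cmult[OF q]) measurable
  also have "\<dots> \<le> ennreal (2 powr \<bar>s\<bar>) * (2 * ((\<integral>\<^sup>+x. ?k x \<partial>lborel) * Lp_norm q ?N))"
  proof (rule mult_left_mono)
    show "Lp_norm q (\<lambda>\<eta>. \<integral>\<^sup>+\<xi>. ?k \<xi> * ?N (\<eta> - \<xi>) \<partial>lborel) \<le> 2 * ((\<integral>\<^sup>+x. ?k x \<partial>lborel) * Lp_norm q ?N)"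
      by (rule Lp_norm_convolution[OF q]) measurable
  qed simp
  finally show ?thesis by (simp only: mult.assoc)
qed

lemma mod_norm_window_change:
  fixes \<phi> \<gamma> :: "real^'n::finite \<Rightarrow> complex"
  assumes p: "1 \<le> p" and q: "1 \<le> q" and \<phi>: "\<phi> \<in> schwartz_space" "\<phi> \<noteq> (\<lambda>_. 0)" and \<gamma>: "\<gamma> \<in> schwartz_space"
  obtains C :: ennreal where "C < \<infinity>"
    "\<And>u. u \<in> tempered_distr \<Longrightarrow> mod_norm \<gamma> p q s u \<le> C * mod_norm (\<lambda>t. cnj (\<phi> t)) p q s u"
proof -
  define r where "r = real CARD('n) + \<bar>s\<bar> + 1"
  have r: "r > real CARD('n)" "r > real CARD('n) + \<bar>s\<bar>" by (simp_all add: r_def)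
  obtain C :: ennreal where C: "C < \<infinity>"
    "\<And>u \<eta>. u \<in> tempered_distr \<Longrightarrow> Lp_norm p (\<lambda>y. ennreal (cmod (u (atom \<gamma> y \<eta>)))) \<le>
      C * (\<integral>\<^sup>+\<xi>. ennreal (jb (\<xi> - \<eta>) powr - r) * Lp_norm p (\<lambda>x. ennreal (cmod (u (atom (\<lambda>t. cnj (\<phi> t)) x \<xi>)))) \<partial>lborel)"
    using atom_Lp_bound[OF p \<phi> \<gamma> r(1)] by blast
  define L where "L = ennreal (2 powr \<bar>s\<bar>) * 2 * (\<integral>\<^sup>+(x::real^'n). ennreal (jb x powr - (r - \<bar>s\<bar>)) \<partial>lborel)"
  have L: "L < \<infinity>" unfolding L_def using nn_integral_jb_finite[where 'n='n, of "r - \<bar>s\<bar>"]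
    by (simp add: ennreal_mult_less_top r_def)
  have bound: "mod_norm \<gamma> p q s u \<le> (C * L) * mod_norm (\<lambda>t. cnj (\<phi> t)) p q s u" if u: "u \<in> tempered_distr" for u
  proof -
    define N where "N \<xi> = Lp_norm p (\<lambda>x. ennreal (cmod (u (atom (\<lambda>t. cnj (\<phi> t)) x \<xi>))))" for \<xi>
    have [measurable]: "N \<in> borel_measurable borel" unfolding N_def[abs_def]
      by (rule Lp_norm_measurable[OF p tempered_atom_measurable[OF u schwartz_cnj[OF \<phi>(1)]]])
    have [measurable]: "(\<lambda>\<eta>. Lp_norm p (\<lambda>y. ennreal (cmod (u (atom \<gamma> y \<eta>))))) \<in> borel_measurable borel"
      by (rule Lp_norm_measurable[OF p tempered_atom_measurable[OF u \<gamma>]])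
    have "mod_norm \<gamma> p q s u \<le> Lp_norm q (\<lambda>\<eta>. C * (ennreal (jb \<eta> powr s) * (\<integral>\<^sup>+\<xi>. ennreal (jb (\<xi> - \<eta>) powr - r) * N \<xi> \<partial>lborel)))"
      unfolding mod_norm_def
    proof (rule Lp_norm_mono[OF q])
      fix \<eta>
      show "ennreal (jb \<eta> powr s) * Lp_norm p (\<lambda>x. ennreal (cmod (u (atom \<gamma> x \<eta>)))) \<le>
        C * (ennreal (jb \<eta> powr s) * (\<integral>\<^sup>+\<xi>. ennreal (jb (\<xi> - \<eta>) powr - r) * N \<xi> \<partial>lborel))"
        unfolding mult.left_commute[of C] N_def by (rule mult_left_mono[OF C(2)[OF u]]) simp
    qed measurable
    also have "\<dots> \<le> C * Lp_norm q (\<lambda>\<eta>. ennreal (jb \<eta> powr s) * (\<integral>\<^sup>+\<xi>. ennreal (jb (\<xi> - \<eta>) powr - r) * N \<xi> \<partial>lborel))"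
      by (rule Lp_norm_cmult[OF q]) measurable
    also have "\<dots> \<le> C * (L * Lp_norm q (\<lambda>\<xi>. ennreal (jb \<xi> powr s) * N \<xi>))"
    proof (rule mult_left_mono)
      show "Lp_norm q (\<lambda>\<eta>. ennreal (jb \<eta> powr s) * (\<integral>\<^sup>+\<xi>. ennreal (jb (\<xi> - \<eta>) powr - r) * N \<xi> \<partial>lborel))
        \<le> L * Lp_norm q (\<lambda>\<xi>. ennreal (jb \<xi> powr s) * N \<xi>)"
        unfolding L_def by (rule weighted_convolution[OF q r(2)]) measurable
    qed simp
    finally show ?thesis unfolding mod_norm_def N_def by (simp only: mult.assoc)
  qed
  show ?thesis by (rule that[OF _ bound]) (use C(1) L in \<open>simp_all add: ennreal_mult_less_top\<close>)
qed

text \<open>Since \<theta> is its own atom at the origin, \<open>atom_sup_bound\<close> applies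
  there. The frequency integral that remains is paired with the weighted norm by Hoelder, and
  \<open>r\<close> is so large that r + s exceeds \<open>n\<close> whatever the sign of
  \<open>s\<close>.\<close>

lemma mod_norm_test_bound:
  fixes \<phi> \<theta> :: "real^'n::finite \<Rightarrow> complex"
  assumes p: "1 \<le> p" and q: "1 \<le> q" and \<phi>: "\<phi> \<in> schwartz_space" "\<phi> \<noteq> (\<lambda>_. 0)" and \<theta>: "\<theta> \<in> schwartz_space"
  obtains C :: ennreal where "C < \<infinity>"
    "\<And>u. u \<in> tempered_distr \<Longrightarrow> ennreal (cmod (u \<theta>)) \<le> C * mod_norm (\<lambda>t. cnj (\<phi> t)) p q s u"
proof -
  define r where "r = real CARD('n) + \<bar>s\<bar> + 1"
  have r: "r > real CARD('n)" by (simp add: r_def)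
  obtain C :: ennreal where C: "C < \<infinity>"
    "\<And>u y \<eta>. u \<in> tempered_distr \<Longrightarrow> ennreal (cmod (u (atom \<theta> y \<eta>))) \<le>
      C * (\<integral>\<^sup>+\<xi>. ennreal (jb (\<xi> - \<eta>) powr - r) * Lp_norm p (\<lambda>x. ennreal (cmod (u (atom (\<lambda>t. cnj (\<phi> t)) x \<xi>)))) \<partial>lborel)"
    using atom_sup_bound[OF p \<phi> \<theta> r] by blast
  obtain q' where q': "1 \<le> q'" "1 / q + 1 / q' = 1" using conjugate_exponent_exists[OF q] by blast
  define L where "L = Lp_norm q' (\<lambda>\<xi>::real^'n. ennreal (jb \<xi> powr - (r + s)))"
  have L: "L < \<infinity>" unfolding L_def by (rule Lp_norm_jb_finite[OF q'(1)]) (simp add: r_def)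
  have bound: "ennreal (cmod (u \<theta>)) \<le> (C * (2 * L)) * mod_norm (\<lambda>t. cnj (\<phi> t)) p q s u" if u: "u \<in> tempered_distr" for u
  proof -
    define N where "N \<xi> = Lp_norm p (\<lambda>x. ennreal (cmod (u (atom (\<lambda>t. cnj (\<phi> t)) x \<xi>))))" for \<xi>
    have [measurable]: "N \<in> borel_measurable borel" unfolding N_def[abs_def]
      by (rule Lp_norm_measurable[OF p tempered_atom_measurable[OF u schwartz_cnj[OF \<phi>(1)]]])
    have at0: "atom \<theta> 0 0 = \<theta>" by (simp add: atom_def)
    have "ennreal (cmod (u \<theta>)) \<le> C * (\<integral>\<^sup>+\<xi>. ennreal (jb \<xi> powr - r) * N \<xi> \<partial>lborel)"
      using C(2)[OF u, of 0 0] unfolding at0 N_def by simp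
    also have "(\<integral>\<^sup>+\<xi>. ennreal (jb \<xi> powr - r) * N \<xi> \<partial>lborel) =
        (\<integral>\<^sup>+\<xi>. (ennreal (jb \<xi> powr s) * N \<xi>) * ennreal (jb \<xi> powr - (r + s)) \<partial>lborel)"
    proof (rule nn_integral_cong)
      fix \<xi> :: "real^'n"
      have "jb \<xi> powr s * jb \<xi> powr - (r + s) = jb \<xi> powr - r" by (simp flip: powr_add)
      then have "ennreal (jb \<xi> powr s) * ennreal (jb \<xi> powr - (r + s)) = ennreal (jb \<xi> powr - r)" by (simp flip: ennreal_mult)
      then show "ennreal (jb \<xi> powr - r) * N \<xi> = (ennreal (jb \<xi> powr s) * N \<xi>) * ennreal (jb \<xi> powr - (r + s))"
        by (metis mult.commute mult.left_commute)
    qed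
    also have "\<dots> \<le> 2 * (Lp_norm q (\<lambda>\<xi>. ennreal (jb \<xi> powr s) * N \<xi>) * L)"
      unfolding L_def by (rule Lp_Hoelder[OF q q']) measurable
    finally have "ennreal (cmod (u \<theta>)) \<le> C * (2 * (Lp_norm q (\<lambda>\<xi>. ennreal (jb \<xi> powr s) * N \<xi>) * L))"
      by (simp add: mult_left_mono)
    then show ?thesis unfolding mod_norm_def N_def by (simp only: mult_ac)
  qed
  show ?thesis by (rule that[OF _ bound]) (use C(1) L in \<open>simp_all add: ennreal_mult_less_top\<close>)
qed

text \<open>The hypothesis on \<open>jb powr - s\<close> says that the weight embeds \<open>L\<^sup>q\<close> into \<open>L\<^sup>1\<close>, which is exactly
  what makes the time-frequency content of \<open>u\<close> summable in frequency, uniformly in time.\<close>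

lemma mod_norm_majorant:
  fixes \<phi> :: "real^'n::finite \<Rightarrow> complex"
  assumes p: "1 \<le> p" and q: "1 \<le> q" "1 \<le> q'" "1 / q + 1 / q' = 1" and \<phi>: "\<phi> \<in> schwartz_space" "\<phi> \<noteq> (\<lambda>_. 0)"
    and s: "Lp_norm q' (\<lambda>\<xi>::real^'n. ennreal (jb \<xi> powr - s)) < \<infinity>"
  obtains C :: ennreal where "C < \<infinity>"
    "\<And>u. u \<in> tempered_distr \<Longrightarrow> \<exists>m. m \<in> borel_measurable borel \<and>
      (\<forall>x \<xi>. ennreal (cmod (u (atom (\<lambda>t. cnj (\<phi> t)) x \<xi>))) \<le> m \<xi>) \<and>
      (\<integral>\<^sup>+\<xi>. m \<xi> \<partial>lborel) \<le> C * mod_norm (\<lambda>t. cnj (\<phi> t)) p q s u"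
proof -
  define r where "r = real CARD('n) + 1"
  have r: "r > real CARD('n)" by (simp add: r_def)
  have \<phi>': "(\<lambda>t. cnj (\<phi> t)) \<in> schwartz_space" by (rule schwartz_cnj[OF \<phi>(1)])
  obtain C :: ennreal where C: "C < \<infinity>"
    "\<And>u y \<eta>. u \<in> tempered_distr \<Longrightarrow> ennreal (cmod (u (atom (\<lambda>t. cnj (\<phi> t)) y \<eta>))) \<le>
      C * (\<integral>\<^sup>+\<xi>. ennreal (jb (\<xi> - \<eta>) powr - r) * Lp_norm p (\<lambda>x. ennreal (cmod (u (atom (\<lambda>t. cnj (\<phi> t)) x \<xi>)))) \<partial>lborel)"
    using atom_sup_bound[OF p \<phi> \<phi>' r] by blast
  define L where "L = (\<integral>\<^sup>+(x::real^'n). ennreal (jb x powr - r) \<partial>lborel)"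
  have L: "L < \<infinity>" unfolding L_def by (rule nn_integral_jb_finite[OF r])
  define W where "W = Lp_norm q' (\<lambda>\<xi>::real^'n. ennreal (jb \<xi> powr - s))"
  have bound: "\<exists>m. m \<in> borel_measurable borel \<and>
      (\<forall>x \<xi>. ennreal (cmod (u (atom (\<lambda>t. cnj (\<phi> t)) x \<xi>))) \<le> m \<xi>) \<and>
      (\<integral>\<^sup>+\<xi>. m \<xi> \<partial>lborel) \<le> (C * (L * (2 * W))) * mod_norm (\<lambda>t. cnj (\<phi> t)) p q s u" if u: "u \<in> tempered_distr" for u
  proof -
    define N where "N \<xi> = Lp_norm p (\<lambda>x. ennreal (cmod (u (atom (\<lambda>t. cnj (\<phi> t)) x \<xi>))))" for \<xi>
    have [measurable]: "N \<in> borel_measurable borel" unfolding N_def[abs_def]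
      by (rule Lp_norm_measurable[OF p tempered_atom_measurable[OF u \<phi>']])
    \<comment> \<open>The norm in time does not bound the transform pointwise in time, but its
      convolution with the kernel does, and that has the same integral up to a constant.\<close>
    define m where "m \<eta> = C * (\<integral>\<^sup>+\<xi>. ennreal (jb (\<xi> - \<eta>) powr - r) * N \<xi> \<partial>lborel)" for \<eta>
    have mm: "m \<in> borel_measurable borel" unfolding m_def[abs_def] by measurable
    have "(\<integral>\<^sup>+\<eta>. m \<eta> \<partial>lborel) = C * (\<integral>\<^sup>+\<eta>. \<integral>\<^sup>+\<xi>. ennreal (jb (\<xi> - \<eta>) powr - r) * N \<xi> \<partial>lborel \<partial>lborel)"
      unfolding m_def by (rule nn_integral_cmult) measurable
    also have "(\<integral>\<^sup>+\<eta>. \<integral>\<^sup>+\<xi>. ennreal (jb (\<xi> - \<eta>) powr - r) * N \<xi> \<partial>lborel \<partial>lborel)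
        = (\<integral>\<^sup>+\<xi>. \<integral>\<^sup>+\<eta>. ennreal (jb (\<xi> - \<eta>) powr - r) * N \<xi> \<partial>lborel \<partial>lborel)"
      by (rule lborel_pair.Fubini') measurable
    also have "\<dots> = (\<integral>\<^sup>+\<xi>. L * N \<xi> \<partial>lborel)"
    proof (rule nn_integral_cong)
      fix \<xi> :: "real^'n"
      have "(\<integral>\<^sup>+\<eta>. ennreal (jb (\<xi> - \<eta>) powr - r) * N \<xi> \<partial>lborel) = (\<integral>\<^sup>+\<eta>. ennreal (jb (\<xi> - \<eta>) powr - r) \<partial>lborel) * N \<xi>"
        by (rule nn_integral_multc) measurable
      then show "(\<integral>\<^sup>+\<eta>. ennreal (jb (\<xi> - \<eta>) powr - r) * N \<xi> \<partial>lborel) = L * N \<xi>"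
        unfolding L_def jb_kernel_integral(2)[OF r] .
    qed
    also have "\<dots> = L * (\<integral>\<^sup>+\<xi>. N \<xi> \<partial>lborel)" by (rule nn_integral_cmult) measurable
    also have "(\<integral>\<^sup>+\<xi>. N \<xi> \<partial>lborel) = (\<integral>\<^sup>+\<xi>. (ennreal (jb \<xi> powr s) * N \<xi>) * ennreal (jb \<xi> powr - s) \<partial>lborel)"
    proof (rule nn_integral_cong)
      fix \<xi> :: "real^'n"
      have "jb \<xi> powr s * jb \<xi> powr - s = 1" by (simp flip: powr_add)
      then have "ennreal (jb \<xi> powr s) * ennreal (jb \<xi> powr - s) = 1" by (simp flip: ennreal_mult)
      then show "N \<xi> = (ennreal (jb \<xi> powr s) * N \<xi>) * ennreal (jb \<xi> powr - s)"
        by (metis mult.commute mult.left_commute mult.right_neutral)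
    qed
    finally have eq: "(\<integral>\<^sup>+\<eta>. m \<eta> \<partial>lborel) = C * (L * (\<integral>\<^sup>+\<xi>. (ennreal (jb \<xi> powr s) * N \<xi>) * ennreal (jb \<xi> powr - s) \<partial>lborel))" .
    have "(\<integral>\<^sup>+\<xi>. (ennreal (jb \<xi> powr s) * N \<xi>) * ennreal (jb \<xi> powr - s) \<partial>lborel) \<le> 2 * (Lp_norm q (\<lambda>\<xi>. ennreal (jb \<xi> powr s) * N \<xi>) * W)"
      unfolding W_def by (rule Lp_Hoelder[OF q]) measurable
    then have "(\<integral>\<^sup>+\<eta>. m \<eta> \<partial>lborel) \<le> C * (L * (2 * (Lp_norm q (\<lambda>\<xi>. ennreal (jb \<xi> powr s) * N \<xi>) * W)))"
      unfolding eq by (intro mult_left_mono) simp_all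
    then have "(\<integral>\<^sup>+\<eta>. m \<eta> \<partial>lborel) \<le> (C * (L * (2 * W))) * mod_norm (\<lambda>t. cnj (\<phi> t)) p q s u"
      unfolding mod_norm_def N_def by (simp only: mult_ac)
    moreover have "ennreal (cmod (u (atom (\<lambda>t. cnj (\<phi> t)) x \<xi>))) \<le> m \<xi>" for x \<xi>
      unfolding m_def N_def by (rule C(2)[OF u])
    ultimately show ?thesis using mm by blast
  qed
  show ?thesis by (rule that[OF _ bound]) (use C(1) L s in \<open>simp_all add: ennreal_mult_less_top W_def\<close>)
qed

subsection \<open>Sufficiency\<close>

text \<open>The density is a synthesis integral: the transform of \<open>u\<close> times shifted and
  modulated windows, evaluated at a point. The majorant makes it converge absolutely, uniformly in
  \<open>t\<close>, and testing it against \<theta> leads back to the reproducing formula by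
  Fubini.\<close>

lemma distr_of_fun_of_majorant:
  fixes \<phi> :: "real^'n::finite \<Rightarrow> complex"
  assumes u: "u \<in> tempered_distr" and \<phi>: "\<phi> \<in> schwartz_space" "\<phi> \<noteq> (\<lambda>_. 0)"
    and m[measurable]: "m \<in> borel_measurable borel"
    and um: "\<And>x \<xi>. ennreal (cmod (u (atom (\<lambda>t. cnj (\<phi> t)) x \<xi>))) \<le> m \<xi>" and mfin: "(\<integral>\<^sup>+\<xi>. m \<xi> \<partial>lborel) < \<infinity>"
  obtains F B where "continuous_on UNIV F" "\<And>x. cmod (F x) \<le> B" "u = distr_of_fun F"
proof -
  have \<phi>': "(\<lambda>t. cnj (\<phi> t)) \<in> schwartz_space" by (rule schwartz_cnj[OF \<phi>(1)])
  define v where "v z = u (atom (\<lambda>t. cnj (\<phi> t)) (fst z) (snd z))" for z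
  have vc: "continuous_on UNIV v" unfolding v_def by (rule tempered_atom_continuous[OF u \<phi>'])
  have vm[measurable]: "v \<in> borel_measurable (borel \<Otimes>\<^sub>M borel)" unfolding borel_prod by (rule borel_measurable_continuous_onI[OF vc])
  have \<phi>m[measurable]: "\<phi> \<in> borel_measurable borel" by (rule schwartz_measurable[OF \<phi>(1)])
  define K where "K = (2 * pi) ^ CARD('n) * (LINT t|lborel. (cmod (\<phi> t))\<^sup>2)"
  have K: "K > 0" using norm_sq_integral_pos(2)[OF \<phi>] by (simp add: K_def)
  define H where "H t z = v z * (\<phi> (t - fst z) * wave (snd z) t)" for t z
  have Hm[measurable]: "case_prod (\<lambda>z t. H t z) \<in> borel_measurable ((borel \<Otimes>\<^sub>M borel) \<Otimes>\<^sub>M borel)"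
    unfolding H_def split_beta' by measurable
  have Hm1[measurable]: "H t \<in> borel_measurable (borel \<Otimes>\<^sub>M borel)" for t unfolding H_def[abs_def] by measurable
  have nn: "(\<integral>\<^sup>+z. ennreal (cmod (v z)) * k (fst z) \<partial>lborel) \<le> (\<integral>\<^sup>+\<xi>. m \<xi> \<partial>lborel) * (\<integral>\<^sup>+x. k x \<partial>lborel)"
    if [measurable]: "k \<in> borel_measurable borel" for k
  proof -
    have "(\<integral>\<^sup>+z. ennreal (cmod (v z)) * k (fst z) \<partial>lborel) = (\<integral>\<^sup>+z. ennreal (cmod (v z)) * k (fst z) \<partial>(lborel \<Otimes>\<^sub>M lborel))"
      by (simp only: lborel_prod)
    also have "\<dots> \<le> (\<integral>\<^sup>+z. m (snd z) * k (fst z) \<partial>(lborel \<Otimes>\<^sub>M lborel))"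
      by (intro nn_integral_mono mult_right_mono) (simp_all add: v_def um)
    also have "\<dots> = (\<integral>\<^sup>+\<xi>. \<integral>\<^sup>+x. m \<xi> * k x \<partial>lborel \<partial>lborel)"
      by (subst lborel_pair.nn_integral_snd[symmetric]) simp_all
    also have "\<dots> = (\<integral>\<^sup>+\<xi>. m \<xi> * (\<integral>\<^sup>+x. k x \<partial>lborel) \<partial>lborel)"
      by (intro nn_integral_cong nn_integral_cmult) simp
    also have "\<dots> = (\<integral>\<^sup>+\<xi>. m \<xi> \<partial>lborel) * (\<integral>\<^sup>+x. k x \<partial>lborel)" by (rule nn_integral_multc) simp
    finally show ?thesis .
  qed
  define M1 where "M1 = (\<integral>\<^sup>+\<xi>. m \<xi> \<partial>lborel) * (\<integral>\<^sup>+x. ennreal (cmod (\<phi> x)) \<partial>lborel)"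
  have \<phi>fin: "(\<integral>\<^sup>+x. ennreal (cmod (\<phi> x)) \<partial>lborel) < \<infinity>"
    using schwartz_integrable[OF \<phi>(1)] by (simp add: integrable_iff_bounded)
  have M1: "M1 < \<infinity>" using mfin \<phi>fin by (simp add: M1_def ennreal_mult_less_top)
  have Hn: "(\<integral>\<^sup>+z. ennreal (cmod (H t z)) \<partial>lborel) \<le> M1" for t
  proof -
    have "(\<integral>\<^sup>+z. ennreal (cmod (H t z)) \<partial>lborel) = (\<integral>\<^sup>+z. ennreal (cmod (v z)) * (\<lambda>x. ennreal (cmod (\<phi> (t - x)))) (fst z) \<partial>lborel)"
      by (simp add: H_def norm_mult ennreal_mult)
    also have "\<dots> \<le> (\<integral>\<^sup>+\<xi>. m \<xi> \<partial>lborel) * (\<integral>\<^sup>+x. ennreal (cmod (\<phi> (t - x))) \<partial>lborel)"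
      by (rule nn[of "\<lambda>x. ennreal (cmod (\<phi> (t - x)))"]) measurable
    also have "(\<integral>\<^sup>+x. ennreal (cmod (\<phi> (t - x))) \<partial>lborel) = (\<integral>\<^sup>+x. ennreal (cmod (\<phi> x)) \<partial>lborel)"
      by (rule nn_integral_reflect[of "\<lambda>x. ennreal (cmod (\<phi> x))" t]) measurable
    finally show ?thesis by (simp only: M1_def)
  qed
  define F where "F t = complex_of_real (1 / K) * (LINT z|lborel. H t z)" for t
  have Fb: "cmod (F t) \<le> 1 / K * enn2real M1" for t
  proof -
    have "ennreal (cmod (LINT z|lborel. H t z)) \<le> M1"
      by (rule order_trans[OF norm_integral_le_nn_integral Hn])
    then have "cmod (LINT z|lborel. H t z) \<le> enn2real M1" using M1 by (cases M1) simp_all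
    then have "1 / K * cmod (LINT z|lborel. H t z) \<le> 1 / K * enn2real M1" using K by (intro mult_left_mono) simp_all
    then show ?thesis unfolding F_def norm_mult norm_of_real using K by simp
  qed
  have Fc: "continuous_on UNIV F"
    unfolding continuous_on_sequentially
  proof (intro allI ballI impI)
    fix T :: "nat \<Rightarrow> real^'n" and t assume "(\<forall>n. T n \<in> UNIV) \<and> T \<longlonglongrightarrow> t"
    then have T: "T \<longlonglongrightarrow> t" by simp
    define r where "r = real CARD('n) + 1"
    obtain C where C: "C > 0" "\<And>x. cmod (\<phi> x) \<le> C * jb x powr - r" using rapidD[OF schwartz_rapid[OF \<phi>(1)]] by blast
    have "(\<lambda>n. jb (T n)) \<longlonglongrightarrow> jb t"
      by (rule continuous_on_tendsto_compose[OF continuous_on_jb[OF continuous_on_id, of UNIV] T]) simp_all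
    then have "Bseq (\<lambda>n. jb (T n))" by (intro convergent_imp_Bseq convergentI)
    then obtain J where J: "J > 0" "\<And>n. norm (jb (T n)) \<le> J" by (auto simp: Bseq_def)
    \<comment> \<open>A convergent sequence of base points has bounded brackets, so Peetre's
      inequality gives one decay bound for all the shifted windows and hence a single
      majorant.\<close>
    define D where "D = C * (2 powr r * J powr r)"
    have D: "D > 0" using C J by (simp add: D_def)
    have dom: "cmod (H (T n) z) \<le> cmod (v z) * (D * jb (fst z) powr - r)" for n z
    proof -
      have "jb (T n - fst z) powr - r \<le> 2 powr r * jb (T n) powr r * jb (fst z) powr - r"
      proof -
        have "\<bar>r\<bar> = r" by (simp add: r_def)
        then show ?thesis using jb_powr_add_le[of "T n" "- fst z" "- r"] by simp
      qed
      also have "\<dots> \<le> 2 powr r * J powr r * jb (fst z) powr - r"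
        using J(2)[of n] by (intro mult_right_mono mult_left_mono powr_mono2) (simp_all add: r_def)
      finally have "C * jb (T n - fst z) powr - r \<le> D * jb (fst z) powr - r"
        using C(1) by (simp add: D_def mult.assoc mult_left_mono)
      then have "cmod (\<phi> (T n - fst z)) \<le> D * jb (fst z) powr - r" using C(2)[of "T n - fst z"] by linarith
      then have "cmod (v z) * cmod (\<phi> (T n - fst z)) \<le> cmod (v z) * (D * jb (fst z) powr - r)" by (rule mult_left_mono) simp
      then show ?thesis by (simp add: H_def norm_mult)
    qed
    have "(\<lambda>n. LINT z|lborel. H (T n) z) \<longlonglongrightarrow> (LINT z|lborel. H t z)"
    proof (rule integral_dominated_convergence[where w="\<lambda>z. cmod (v z) * (D * jb (fst z) powr - r)"])
      show "AE z in lborel. (\<lambda>n. H (T n) z) \<longlonglongrightarrow> H t z"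
      proof (rule AE_I2)
        fix z :: "(real^'n) \<times> (real^'n)"
        have "(\<lambda>n. \<phi> (T n - fst z)) \<longlonglongrightarrow> \<phi> (t - fst z)"
          by (rule continuous_on_tendsto_compose[OF schwartz_continuous[OF \<phi>(1), of UNIV] tendsto_diff[OF T tendsto_const]]) simp_all
        moreover have "(\<lambda>n. wave (snd z) (T n)) \<longlonglongrightarrow> wave (snd z) t"
          by (rule continuous_on_tendsto_compose[OF continuous_on_wave[OF continuous_on_const continuous_on_id, of UNIV] T]) simp_all
        ultimately show "(\<lambda>n. H (T n) z) \<longlonglongrightarrow> H t z" unfolding H_def by (intro tendsto_mult tendsto_const)
      qed
      show "AE z in lborel. norm (H (T n) z) \<le> cmod (v z) * (D * jb (fst z) powr - r)" for n by (intro AE_I2 dom)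
      show "integrable lborel (\<lambda>z. cmod (v z) * (D * jb (fst z) powr - r))"
      proof (rule integrableI_nonneg)
        have "(\<lambda>z. cmod (v z) * (D * jb (fst z) powr - r)) \<in> borel_measurable (borel \<Otimes>\<^sub>M borel)" by measurable
        then show "(\<lambda>z. cmod (v z) * (D * jb (fst z) powr - r)) \<in> borel_measurable lborel" by (simp add: borel_prod)
        show "AE z in lborel. 0 \<le> cmod (v z) * (D * jb (fst z) powr - r)" using D by simp
        have "(\<integral>\<^sup>+z. ennreal (cmod (v z) * (D * jb (fst z) powr - r)) \<partial>lborel)
          = (\<integral>\<^sup>+z. ennreal (cmod (v z)) * (\<lambda>x. ennreal D * ennreal (jb x powr - r)) (fst z) \<partial>lborel)"
          using D by (simp add: ennreal_mult)
        also have "\<dots> \<le> (\<integral>\<^sup>+\<xi>. m \<xi> \<partial>lborel) * (\<integral>\<^sup>+(x::real^'n). ennreal D * ennreal (jb x powr - r) \<partial>lborel)"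
          by (rule nn[of "\<lambda>x. ennreal D * ennreal (jb x powr - r)"]) measurable
        also have "\<dots> = (\<integral>\<^sup>+\<xi>. m \<xi> \<partial>lborel) * (ennreal D * (\<integral>\<^sup>+(x::real^'n). ennreal (jb x powr - r) \<partial>lborel))"
          by (subst nn_integral_cmult) simp_all
        also have "\<dots> < \<infinity>" using mfin nn_integral_jb_finite[where 'n='n, of r] by (simp add: ennreal_mult_less_top r_def)
        finally show "(\<integral>\<^sup>+z. ennreal (cmod (v z) * (D * jb (fst z) powr - r)) \<partial>lborel) < \<infinity>" .
      qed
      show "H t \<in> borel_measurable lborel" using Hm1[of t] by (simp add: borel_prod)
      show "H (T n) \<in> borel_measurable lborel" for n using Hm1[of "T n"] by (simp add: borel_prod)
    qed
    then show "(F \<circ> T) \<longlonglongrightarrow> F t" unfolding F_def o_def by (intro tendsto_mult tendsto_const)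
  qed
  have "u = distr_of_fun F"
  proof (rule ext)
    fix \<theta>
    show "u \<theta> = distr_of_fun F \<theta>"
    proof (cases "\<theta> \<in> schwartz_space")
      case False
      have "u \<in> extensional schwartz_space" using u by (simp add: tempered_distr_def)
      then show ?thesis using False by (simp add: extensional_def distr_of_fun_def)
    next
      case True
      have \<theta>m[measurable]: "\<theta> \<in> borel_measurable borel" by (rule schwartz_measurable[OF True])
      have \<theta>fin: "(\<integral>\<^sup>+x. ennreal (cmod (\<theta> x)) \<partial>lborel) < \<infinity>"
        using schwartz_integrable[OF True] by (simp add: integrable_iff_bounded)
      have int: "integrable (lborel \<Otimes>\<^sub>M lborel) (\<lambda>(z, t). H t z * \<theta> t)"
      proof (rule integrableI_bounded)
        have "(\<lambda>(z, t). H t z * \<theta> t) \<in> borel_measurable ((borel \<Otimes>\<^sub>M borel) \<Otimes>\<^sub>M borel)"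
          unfolding H_def split_beta' by measurable
        then show mm: "(\<lambda>(z, t). H t z * \<theta> t) \<in> borel_measurable (lborel \<Otimes>\<^sub>M lborel)"
          by (simp add: borel_prod lborel_prod)
        have "(\<integral>\<^sup>+p. ennreal (norm (case p of (z, t) \<Rightarrow> H t z * \<theta> t)) \<partial>(lborel \<Otimes>\<^sub>M lborel))
           = (\<integral>\<^sup>+t. \<integral>\<^sup>+z. ennreal (norm (case (z, t) of (z, t) \<Rightarrow> H t z * \<theta> t)) \<partial>lborel \<partial>lborel)"
          by (rule lborel_pair.nn_integral_snd[symmetric]) (use mm in measurable)
        also have "\<dots> \<le> (\<integral>\<^sup>+t. M1 * ennreal (cmod (\<theta> t)) \<partial>lborel)"
        proof (rule nn_integral_mono)
          fix t
          have "(\<integral>\<^sup>+z. ennreal (norm (case (z, t) of (z, t) \<Rightarrow> H t z * \<theta> t)) \<partial>lborel) = (\<integral>\<^sup>+z. ennreal (cmod (H t z)) * ennreal (cmod (\<theta> t)) \<partial>lborel)"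
            by (simp add: norm_mult ennreal_mult)
          also have "\<dots> = (\<integral>\<^sup>+z. ennreal (cmod (H t z)) \<partial>lborel) * ennreal (cmod (\<theta> t))"
            by (rule nn_integral_multc) (use Hm1[of t] in \<open>simp add: borel_prod\<close>)
          also have "\<dots> \<le> M1 * ennreal (cmod (\<theta> t))" by (rule mult_right_mono[OF Hn]) simp
          finally show "(\<integral>\<^sup>+z. ennreal (norm (case (z, t) of (z, t) \<Rightarrow> H t z * \<theta> t)) \<partial>lborel) \<le> M1 * ennreal (cmod (\<theta> t))" .
        qed
        also have "\<dots> = M1 * (\<integral>\<^sup>+t. ennreal (cmod (\<theta> t)) \<partial>lborel)" by (rule nn_integral_cmult) measurable
        also have "\<dots> < \<infinity>" using M1 \<theta>fin by (simp add: ennreal_mult_less_top)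
        finally show "(\<integral>\<^sup>+p. ennreal (norm (case p of (z, t) \<Rightarrow> H t z * \<theta> t)) \<partial>(lborel \<Otimes>\<^sub>M lborel)) < \<infinity>" .
      qed
      have "complex_of_real K * u \<theta> = (LINT z|lborel. amb \<phi> \<theta> (fst z) (snd z) * v z)"
        using reproducing_formula[OF u \<phi>(1) True]
        unfolding norm_sq_integral_pos(1)[OF \<phi>] K_def v_def by (simp only: of_real_mult)
      also have "\<dots> = (LINT z|lborel. LINT t|lborel. H t z * \<theta> t)"
      proof (rule Bochner_Integration.integral_cong[OF refl])
        fix z
        have "amb \<phi> \<theta> (fst z) (snd z) * v z = (LINT t|lborel. \<phi> (t - fst z) * \<theta> t * wave (snd z) t * v z)"
          unfolding amb_def osc_def by (rule Bochner_Integration.integral_mult_left_zero[symmetric])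
        also have "\<dots> = (LINT t|lborel. H t z * \<theta> t)" unfolding H_def by (simp only: mult_ac)
        finally show "amb \<phi> \<theta> (fst z) (snd z) * v z = (LINT t|lborel. H t z * \<theta> t)" .
      qed
      also have "\<dots> = (LINT t|lborel. LINT z|lborel. H t z * \<theta> t)"
        by (rule lborel_pair.Fubini_integral[OF int, symmetric])
      also have "\<dots> = (LINT t|lborel. complex_of_real K * (F t * \<theta> t))"
      proof (rule Bochner_Integration.integral_cong[OF refl])
        fix t
        have "(LINT z|lborel. H t z * \<theta> t) = (LINT z|lborel. H t z) * \<theta> t" by (rule Bochner_Integration.integral_mult_left_zero)
        also have "(LINT z|lborel. H t z) = complex_of_real K * F t"
          unfolding F_def mult.assoc[symmetric] of_real_mult[symmetric] using K by simp
        finally show "(LINT z|lborel. H t z * \<theta> t) = complex_of_real K * (F t * \<theta> t)" by (simp only: mult.assoc)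
      qed
      also have "\<dots> = complex_of_real K * (LINT t|lborel. F t * \<theta> t)" by (rule Bochner_Integration.integral_mult_right_zero)
      finally have "u \<theta> = (LINT t|lborel. F t * \<theta> t)" using K by simp
      then show ?thesis by (simp add: distr_of_fun_apply True)
    qed
  qed
  then show ?thesis by (rule that[OF Fc Fb])
qed

text \<open>The convolution theorem: F G b^2 factors as (F b)(G b), so factors seen through
  \<open>b\<close> have a product seen through \<open>b\<close> squared. The first factor is written
  by Fourier inversion, which is where \<open>iF\<close> enters, and the second follows by
  duality.\<close>

lemma atom_of_product:
  fixes F G b :: "real^'n::finite \<Rightarrow> complex"
  assumes b: "b \<in> schwartz_space"
    and F: "continuous_on UNIV F" "\<And>x. cmod (F x) \<le> BF" and G: "continuous_on UNIV G" "\<And>x. cmod (G x) \<le> BG"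
    and iF: "integrable lborel (\<lambda>\<xi>. distr_of_fun F (atom b x \<xi>))"
  shows "complex_of_real ((2 * pi) ^ CARD('n)) * distr_of_fun (\<lambda>t. F t * G t) (atom (\<lambda>t. b t * b t) x \<xi>)
    = (LINT \<zeta>|lborel. distr_of_fun F (atom b x \<zeta>) * distr_of_fun G (atom b x (\<xi> - \<zeta>)))"
proof -
  define A where "A t = F t * b (t - x)" for t
  define B where "B t = G t * b (t - x)" for t
  note bx = schwartz_shift[OF b, of x]
  have Fm: "F \<in> borel_measurable borel" by (rule borel_measurable_continuous_onI[OF F(1)])
  have Gm: "G \<in> borel_measurable borel" by (rule borel_measurable_continuous_onI[OF G(1)])
  have iA: "integrable lborel A" unfolding A_def by (rule schwartz_bounded_integrable[OF Fm F(2) bx])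
  have iB: "integrable lborel B" unfolding B_def by (rule schwartz_bounded_integrable[OF Gm G(2) bx])
  have Am[measurable]: "A \<in> borel_measurable borel" and Bm[measurable]: "B \<in> borel_measurable borel" using iA iB by simp_all
  have cA: "continuous_on UNIV A" unfolding A_def by (intro continuous_on_mult F(1) schwartz_continuous[OF bx])
  obtain Bb where Bb: "\<And>x. cmod (b x) \<le> Bb" using schwartz_bounded[OF b] by blast
  have bA: "cmod (A t) \<le> BF * Bb" for t
    unfolding A_def norm_mult by (intro mult_mono F(2) Bb order_trans[OF norm_ge_zero F(2)]) simp
  have uF: "distr_of_fun F (atom b x \<zeta>) = osc A (- \<zeta>)" for \<zeta>
    unfolding distr_of_fun_apply[OF atom_schwartz[OF b]] by (simp add: osc_def A_def atom_def mult_ac)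
  have uG: "distr_of_fun G (atom b x \<zeta>) = osc B (- \<zeta>)" for \<zeta>
    unfolding distr_of_fun_apply[OF atom_schwartz[OF b]] by (simp add: osc_def B_def atom_def mult_ac)
  have ioA: "integrable lborel (osc A)"
    using iF unfolding uF using integral_reflect(2)[of "osc A" 0] by simp
  define h where "h t = B t * wave (- \<xi>) t" for t
  have ih: "integrable lborel h" unfolding h_def by (rule integrable_mult_wave[OF iB])
  have hm[measurable]: "h \<in> borel_measurable borel" using ih by simp
  have ihm: "integrable lborel (\<lambda>t. h (- t))" using integral_reflect(2)[OF hm, of 0] ih by simp
  have S2: "(\<lambda>t. b t * b t) \<in> schwartz_space" by (intro schwartz_mult b)
  have "complex_of_real ((2 * pi) ^ CARD('n)) * distr_of_fun (\<lambda>t. F t * G t) (atom (\<lambda>t. b t * b t) x \<xi>)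
     = (LINT t|lborel. complex_of_real ((2 * pi) ^ CARD('n)) * (F t * G t * atom (\<lambda>t. b t * b t) x \<xi> t))"
    unfolding distr_of_fun_apply[OF atom_schwartz[OF S2]] by (rule Bochner_Integration.integral_mult_right_zero[symmetric])
  also have "\<dots> = (LINT t|lborel. osc (osc A) (- t) * h t)"
  proof (rule Bochner_Integration.integral_cong[OF refl])
    fix t
    show "complex_of_real ((2 * pi) ^ CARD('n)) * (F t * G t * atom (\<lambda>t. b t * b t) x \<xi> t) = osc (osc A) (- t) * h t"
      unfolding fourier_inversion[OF iA cA bA ioA] h_def A_def B_def atom_def by (simp only: mult_ac)
  qed
  also have "\<dots> = (LINT t|lborel. (\<lambda>t. osc (osc A) t * h (- t)) (0 - t))" by simp
  also have "\<dots> = (LINT t|lborel. osc (osc A) t * h (- t))"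
    by (rule integral_reflect(1)) measurable
  also have "\<dots> = (LINT y|lborel. osc A y * osc (\<lambda>t. h (- t)) y)"
    by (rule osc_duality[OF ioA ihm])
  also have "\<dots> = (LINT y|lborel. osc A y * osc B (- \<xi> - y))"
  proof (rule Bochner_Integration.integral_cong[OF refl])
    fix y
    have "osc (\<lambda>t. h (- t)) y = (LINT t|lborel. (\<lambda>t. h t * wave (- y) t) (0 - t))"
      by (simp add: osc_def wave_minus_right)
    also have "\<dots> = (LINT t|lborel. h t * wave (- y) t)" by (rule integral_reflect(1)) measurable
    also have "\<dots> = osc B (- \<xi> - y)" unfolding h_def osc_def wave_diff[of "- \<xi>" y] by (simp only: mult.assoc)
    finally show "osc A y * osc (\<lambda>t. h (- t)) y = osc A y * osc B (- \<xi> - y)" by simp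
  qed
  also have "\<dots> = (LINT \<zeta>|lborel. (\<lambda>y. osc A y * osc B (- \<xi> - y)) (0 - \<zeta>))"
    by (rule integral_reflect(1)[symmetric]) measurable
  also have "\<dots> = (LINT \<zeta>|lborel. distr_of_fun F (atom b x \<zeta>) * distr_of_fun G (atom b x (\<xi> - \<zeta>)))"
    unfolding uF uG by simp
  finally show ?thesis .
qed

text \<open>The weight is distributed over the two frequencies by \<open>jb_powr_add_le_sum\<close>.
  In each of the two terms the weighted factor keeps its L^p norm in time, while the other is
  replaced by its majorant; the majorant is uniform in time, which is why the exponent
  \<open>p\<close> survives the multiplication. Minkowski's and Young's inequalities then finish in
  frequency.\<close>

lemma mod_norm_product:
  fixes F G b :: "real^'n::finite \<Rightarrow> complex"
  assumes p: "1 \<le> p" and q: "1 \<le> q" and s: "s \<ge> 0" and b: "b \<in> schwartz_space"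
    and F: "continuous_on UNIV F" "\<And>x. cmod (F x) \<le> BF" and G: "continuous_on UNIV G" "\<And>x. cmod (G x) \<le> BG"
    and mF[measurable]: "mF \<in> borel_measurable borel" and mG[measurable]: "mG \<in> borel_measurable borel"
    and majF: "\<And>x \<xi>. ennreal (cmod (distr_of_fun F (atom b x \<xi>))) \<le> mF \<xi>" and finF: "(\<integral>\<^sup>+\<xi>. mF \<xi> \<partial>lborel) < \<infinity>"
    and majG: "\<And>x \<xi>. ennreal (cmod (distr_of_fun G (atom b x \<xi>))) \<le> mG \<xi>"
  shows "mod_norm (\<lambda>t. b t * b t) p q s (distr_of_fun (\<lambda>t. F t * G t)) \<le>
    ennreal (4 powr s) * (4 * (2 * (2 * ((\<integral>\<^sup>+\<xi>. mG \<xi> \<partial>lborel) * mod_norm b p q s (distr_of_fun F))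
      + 2 * ((\<integral>\<^sup>+\<xi>. mF \<xi> \<partial>lborel) * mod_norm b p q s (distr_of_fun G)))))"
proof -
  let ?u = "distr_of_fun F" and ?v = "distr_of_fun G" and ?h = "distr_of_fun (\<lambda>t. F t * G t)"
  have Fm: "F \<in> borel_measurable borel" by (rule borel_measurable_continuous_onI[OF F(1)])
  have Gm: "G \<in> borel_measurable borel" by (rule borel_measurable_continuous_onI[OF G(1)])
  have tu: "?u \<in> tempered_distr" by (rule tempered_distr_of_fun[OF Fm F(2)])
  have tv: "?v \<in> tempered_distr" by (rule tempered_distr_of_fun[OF Gm G(2)])
  have FGb: "cmod (F t * G t) \<le> BF * BG" for t
    unfolding norm_mult by (intro mult_mono F(2) G(2) order_trans[OF norm_ge_zero F(2)]) simp
  have FGm: "(\<lambda>t. F t * G t) \<in> borel_measurable borel" using Fm Gm by measurable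
  have th: "?h \<in> tempered_distr" by (rule tempered_distr_of_fun[OF FGm FGb])
  have S2: "(\<lambda>t. b t * b t) \<in> schwartz_space" by (intro schwartz_mult b)
  define U where "U x \<xi> = ennreal (cmod (?u (atom b x \<xi>)))" for x \<xi>
  define V where "V x \<xi> = ennreal (cmod (?v (atom b x \<xi>)))" for x \<xi>
  define W where "W x \<xi> = ennreal (cmod (?h (atom (\<lambda>t. b t * b t) x \<xi>)))" for x \<xi>
  have Um[measurable]: "case_prod U \<in> borel_measurable (borel \<Otimes>\<^sub>M borel)"
    unfolding U_def[abs_def] by (rule tempered_atom_measurable[OF tu b])
  have Vm[measurable]: "case_prod V \<in> borel_measurable (borel \<Otimes>\<^sub>M borel)"
    unfolding V_def[abs_def] by (rule tempered_atom_measurable[OF tv b])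
  have Wm[measurable]: "case_prod W \<in> borel_measurable (borel \<Otimes>\<^sub>M borel)"
    unfolding W_def[abs_def] by (rule tempered_atom_measurable[OF th S2])
  define NU where "NU \<xi> = ennreal (jb \<xi> powr s) * Lp_norm p (\<lambda>x. U x \<xi>)" for \<xi>
  define NV where "NV \<xi> = ennreal (jb \<xi> powr s) * Lp_norm p (\<lambda>x. V x \<xi>)" for \<xi>
  have LU[measurable]: "(\<lambda>\<xi>. Lp_norm p (\<lambda>x. U x \<xi>)) \<in> borel_measurable borel" by (rule Lp_norm_measurable[OF p Um])
  have LV[measurable]: "(\<lambda>\<xi>. Lp_norm p (\<lambda>x. V x \<xi>)) \<in> borel_measurable borel" by (rule Lp_norm_measurable[OF p Vm])
  have LW[measurable]: "(\<lambda>\<xi>. Lp_norm p (\<lambda>x. W x \<xi>)) \<in> borel_measurable borel" by (rule Lp_norm_measurable[OF p Wm])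
  have [measurable]: "NU \<in> borel_measurable borel" "NV \<in> borel_measurable borel"
    unfolding NU_def[abs_def] NV_def[abs_def] by measurable
  have WUV: "W x \<xi> \<le> (\<integral>\<^sup>+\<zeta>. U x \<zeta> * V x (\<xi> - \<zeta>) \<partial>lborel)" for x \<xi>
  proof -
    have iF: "integrable lborel (\<lambda>\<xi>. ?u (atom b x \<xi>))"
    proof (rule integrableI_bounded)
      have "continuous_on UNIV ((\<lambda>z. ?u (atom b (fst z) (snd z))) \<circ> (\<lambda>\<xi>. (x, \<xi>)))"
        by (intro continuous_on_compose continuous_on_subset[OF tempered_atom_continuous[OF tu b]] continuous_intros) simp
      then have "continuous_on UNIV (\<lambda>\<xi>. ?u (atom b x \<xi>))" by (simp add: o_def)
      then show "(\<lambda>\<xi>. ?u (atom b x \<xi>)) \<in> borel_measurable lborel" by (simp add: borel_measurable_continuous_onI)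
      have "(\<integral>\<^sup>+\<xi>. ennreal (norm (?u (atom b x \<xi>))) \<partial>lborel) \<le> (\<integral>\<^sup>+\<xi>. mF \<xi> \<partial>lborel)"
        by (intro nn_integral_mono majF)
      also note finF
      finally show "(\<integral>\<^sup>+\<xi>. ennreal (norm (?u (atom b x \<xi>))) \<partial>lborel) < \<infinity>" .
    qed
    \<comment> \<open>The factor (2 pi)^n of the convolution identity is at least 1 and may be
      dropped.\<close>
    have "1 * cmod (?h (atom (\<lambda>t. b t * b t) x \<xi>)) \<le> (2 * pi) ^ CARD('n) * cmod (?h (atom (\<lambda>t. b t * b t) x \<xi>))"
      using pi_ge_two by (intro mult_right_mono one_le_power) simp_all
    also have "\<dots> = cmod (LINT \<zeta>|lborel. ?u (atom b x \<zeta>) * ?v (atom b x (\<xi> - \<zeta>)))"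
      unfolding atom_of_product[OF b F G iF, symmetric] by (simp add: norm_mult norm_power)
    finally have "W x \<xi> \<le> ennreal (cmod (LINT \<zeta>|lborel. ?u (atom b x \<zeta>) * ?v (atom b x (\<xi> - \<zeta>))))"
      unfolding W_def by (intro ennreal_leI) simp
    also have "\<dots> \<le> (\<integral>\<^sup>+\<zeta>. ennreal (cmod (?u (atom b x \<zeta>) * ?v (atom b x (\<xi> - \<zeta>)))) \<partial>lborel)"
      by (rule norm_integral_le_nn_integral)
    also have "\<dots> = (\<integral>\<^sup>+\<zeta>. U x \<zeta> * V x (\<xi> - \<zeta>) \<partial>lborel)" unfolding U_def V_def by (simp add: norm_mult ennreal_mult)
    finally show ?thesis .
  qed
  define P where "P x \<xi> \<zeta> = (ennreal (jb \<zeta> powr s) * U x \<zeta>) * mG (\<xi> - \<zeta>) + mF \<zeta> * (ennreal (jb (\<xi> - \<zeta>) powr s) * V x (\<xi> - \<zeta>))" for x \<xi> \<zeta>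
  have Pm[measurable]: "case_prod (\<lambda>x \<zeta>. P x \<xi> \<zeta>) \<in> borel_measurable (borel \<Otimes>\<^sub>M borel)" for \<xi>
    unfolding P_def by measurable
  have sW: "ennreal (jb \<xi> powr s) * W x \<xi> \<le> ennreal (4 powr s) * (\<integral>\<^sup>+\<zeta>. P x \<xi> \<zeta> \<partial>lborel)" for x \<xi>
  proof -
    have [measurable]: "(\<lambda>\<zeta>. U x \<zeta>) \<in> borel_measurable borel" "(\<lambda>\<zeta>. V x \<zeta>) \<in> borel_measurable borel" by measurable
    have "ennreal (jb \<xi> powr s) * W x \<xi> \<le> ennreal (jb \<xi> powr s) * (\<integral>\<^sup>+\<zeta>. U x \<zeta> * V x (\<xi> - \<zeta>) \<partial>lborel)"
      by (rule mult_left_mono[OF WUV]) simp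
    also have "\<dots> = (\<integral>\<^sup>+\<zeta>. ennreal (jb \<xi> powr s) * (U x \<zeta> * V x (\<xi> - \<zeta>)) \<partial>lborel)"
      by (rule nn_integral_cmult[symmetric]) measurable
    also have "\<dots> \<le> (\<integral>\<^sup>+\<zeta>. ennreal (4 powr s) * P x \<xi> \<zeta> \<partial>lborel)"
    proof (rule nn_integral_mono)
      fix \<zeta>
      have "jb \<xi> powr s \<le> 4 powr s * (jb \<zeta> powr s + jb (\<xi> - \<zeta>) powr s)" using jb_powr_add_le_sum[OF s, of \<zeta> "\<xi> - \<zeta>"] by simp
      then have "ennreal (jb \<xi> powr s) \<le> ennreal (4 powr s * (jb \<zeta> powr s + jb (\<xi> - \<zeta>) powr s))" by (rule ennreal_leI)
      also have "\<dots> = ennreal (4 powr s) * (ennreal (jb \<zeta> powr s) + ennreal (jb (\<xi> - \<zeta>) powr s))"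
        by (simp add: ennreal_mult ennreal_plus)
      finally have "ennreal (jb \<xi> powr s) * (U x \<zeta> * V x (\<xi> - \<zeta>)) \<le>
         (ennreal (4 powr s) * (ennreal (jb \<zeta> powr s) + ennreal (jb (\<xi> - \<zeta>) powr s))) * (U x \<zeta> * V x (\<xi> - \<zeta>))"
        by (rule mult_right_mono) simp
      also have "\<dots> = ennreal (4 powr s) * ((ennreal (jb \<zeta> powr s) * U x \<zeta>) * V x (\<xi> - \<zeta>) + U x \<zeta> * (ennreal (jb (\<xi> - \<zeta>) powr s) * V x (\<xi> - \<zeta>)))"
        by (simp only: distrib_left distrib_right mult_ac)
      also have "\<dots> \<le> ennreal (4 powr s) * P x \<xi> \<zeta>"
        unfolding P_def U_def V_def by (intro mult_left_mono add_mono mult_right_mono majF majG) simp_all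
      finally show "ennreal (jb \<xi> powr s) * (U x \<zeta> * V x (\<xi> - \<zeta>)) \<le> ennreal (4 powr s) * P x \<xi> \<zeta>" .
    qed
    also have "\<dots> = ennreal (4 powr s) * (\<integral>\<^sup>+\<zeta>. P x \<xi> \<zeta> \<partial>lborel)" by (rule nn_integral_cmult) measurable
    finally show ?thesis .
  qed
  have LpP: "Lp_norm p (\<lambda>x. P x \<xi> \<zeta>) \<le> 2 * (NU \<zeta> * mG (\<xi> - \<zeta>) + mF \<zeta> * NV (\<xi> - \<zeta>))" for \<xi> \<zeta>
  proof -
    have [measurable]: "(\<lambda>x. U x \<zeta>) \<in> borel_measurable borel" "(\<lambda>x. V x (\<xi> - \<zeta>)) \<in> borel_measurable borel" by measurable
    have "Lp_norm p (\<lambda>x. P x \<xi> \<zeta>) \<le> 2 * (Lp_norm p (\<lambda>x. (mG (\<xi> - \<zeta>) * ennreal (jb \<zeta> powr s)) * U x \<zeta>)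
        + Lp_norm p (\<lambda>x. (mF \<zeta> * ennreal (jb (\<xi> - \<zeta>) powr s)) * V x (\<xi> - \<zeta>)))"
      using Lp_norm_add[OF p, of "\<lambda>x. (mG (\<xi> - \<zeta>) * ennreal (jb \<zeta> powr s)) * U x \<zeta>" "\<lambda>x. (mF \<zeta> * ennreal (jb (\<xi> - \<zeta>) powr s)) * V x (\<xi> - \<zeta>)"]
      unfolding P_def by (simp add: mult_ac)
    also have "\<dots> \<le> 2 * ((mG (\<xi> - \<zeta>) * ennreal (jb \<zeta> powr s)) * Lp_norm p (\<lambda>x. U x \<zeta>)
        + (mF \<zeta> * ennreal (jb (\<xi> - \<zeta>) powr s)) * Lp_norm p (\<lambda>x. V x (\<xi> - \<zeta>)))"
      by (intro mult_left_mono add_mono Lp_norm_cmult p) simp_all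
    also have "\<dots> = 2 * (NU \<zeta> * mG (\<xi> - \<zeta>) + mF \<zeta> * NV (\<xi> - \<zeta>))" unfolding NU_def NV_def by (simp only: mult_ac)
    finally show ?thesis .
  qed
  have conv: "ennreal (jb \<xi> powr s) * Lp_norm p (\<lambda>x. W x \<xi>) \<le>
      ennreal (4 powr s) * (4 * ((\<integral>\<^sup>+\<zeta>. mG \<zeta> * NU (\<xi> - \<zeta>) \<partial>lborel) + (\<integral>\<^sup>+\<zeta>. mF \<zeta> * NV (\<xi> - \<zeta>) \<partial>lborel)))" for \<xi>
  proof -
    have [measurable]: "(\<lambda>x. W x \<xi>) \<in> borel_measurable borel" by measurable
    have "ennreal (jb \<xi> powr s) * Lp_norm p (\<lambda>x. W x \<xi>) = Lp_norm p (\<lambda>x. ennreal (jb \<xi> powr s) * W x \<xi>)"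
      by (rule Lp_norm_cmult_eq[OF p, symmetric]) simp_all
    also have "\<dots> \<le> Lp_norm p (\<lambda>x. ennreal (4 powr s) * (\<integral>\<^sup>+\<zeta>. P x \<xi> \<zeta> \<partial>lborel))"
      by (rule Lp_norm_mono[OF p _ sW]) measurable
    also have "\<dots> \<le> ennreal (4 powr s) * Lp_norm p (\<lambda>x. \<integral>\<^sup>+\<zeta>. P x \<xi> \<zeta> \<partial>lborel)"
      by (rule Lp_norm_cmult[OF p]) measurable
    also have "\<dots> \<le> ennreal (4 powr s) * (2 * (\<integral>\<^sup>+\<zeta>. Lp_norm p (\<lambda>x. P x \<xi> \<zeta>) \<partial>lborel))"
      by (intro mult_left_mono Lp_norm_Minkowski p Pm) simp
    also have "\<dots> \<le> ennreal (4 powr s) * (2 * (\<integral>\<^sup>+\<zeta>. 2 * (NU \<zeta> * mG (\<xi> - \<zeta>) + mF \<zeta> * NV (\<xi> - \<zeta>)) \<partial>lborel))"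
      by (intro mult_left_mono nn_integral_mono LpP) simp_all
    also have "(\<integral>\<^sup>+\<zeta>. 2 * (NU \<zeta> * mG (\<xi> - \<zeta>) + mF \<zeta> * NV (\<xi> - \<zeta>)) \<partial>lborel) = 2 * (\<integral>\<^sup>+\<zeta>. NU \<zeta> * mG (\<xi> - \<zeta>) + mF \<zeta> * NV (\<xi> - \<zeta>) \<partial>lborel)"
      by (rule nn_integral_cmult) measurable
    also have "(\<integral>\<^sup>+\<zeta>. NU \<zeta> * mG (\<xi> - \<zeta>) + mF \<zeta> * NV (\<xi> - \<zeta>) \<partial>lborel) = (\<integral>\<^sup>+\<zeta>. NU \<zeta> * mG (\<xi> - \<zeta>) \<partial>lborel) + (\<integral>\<^sup>+\<zeta>. mF \<zeta> * NV (\<xi> - \<zeta>) \<partial>lborel)"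
      by (rule nn_integral_add) measurable
    also have "(\<integral>\<^sup>+\<zeta>. NU \<zeta> * mG (\<xi> - \<zeta>) \<partial>lborel) = (\<integral>\<^sup>+\<zeta>. NU (\<xi> - \<zeta>) * mG \<zeta> \<partial>lborel)"
      by (rule convolution_commute) measurable
    also have "(\<integral>\<^sup>+\<zeta>. NU (\<xi> - \<zeta>) * mG \<zeta> \<partial>lborel) = (\<integral>\<^sup>+\<zeta>. mG \<zeta> * NU (\<xi> - \<zeta>) \<partial>lborel)"
      by (simp only: mult.commute)
    also have "2 * (2 * X) = 4 * X" for X :: ennreal by (simp add: mult.assoc[symmetric])
    finally show ?thesis .
  qed
  have cm: "(\<lambda>\<xi>. \<integral>\<^sup>+\<zeta>. mG \<zeta> * NU (\<xi> - \<zeta>) \<partial>lborel) \<in> borel_measurable borel" "(\<lambda>\<xi>. \<integral>\<^sup>+\<zeta>. mF \<zeta> * NV (\<xi> - \<zeta>) \<partial>lborel) \<in> borel_measurable borel"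
    by measurable
  have "mod_norm (\<lambda>t. b t * b t) p q s ?h = Lp_norm q (\<lambda>\<xi>. ennreal (jb \<xi> powr s) * Lp_norm p (\<lambda>x. W x \<xi>))"
    unfolding mod_norm_def W_def by (rule refl)
  also have "\<dots> \<le> Lp_norm q (\<lambda>\<xi>. (ennreal (4 powr s) * 4) * ((\<integral>\<^sup>+\<zeta>. mG \<zeta> * NU (\<xi> - \<zeta>) \<partial>lborel) + (\<integral>\<^sup>+\<zeta>. mF \<zeta> * NV (\<xi> - \<zeta>) \<partial>lborel)))"
    by (rule Lp_norm_mono[OF q]) (measurable, use conv in \<open>simp only: mult.assoc\<close>)
  also have "\<dots> \<le> (ennreal (4 powr s) * 4) * Lp_norm q (\<lambda>\<xi>. (\<integral>\<^sup>+\<zeta>. mG \<zeta> * NU (\<xi> - \<zeta>) \<partial>lborel) + (\<integral>\<^sup>+\<zeta>. mF \<zeta> * NV (\<xi> - \<zeta>) \<partial>lborel))"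
    by (rule Lp_norm_cmult[OF q]) (use cm in measurable)
  also have "\<dots> \<le> (ennreal (4 powr s) * 4) * (2 * (Lp_norm q (\<lambda>\<xi>. \<integral>\<^sup>+\<zeta>. mG \<zeta> * NU (\<xi> - \<zeta>) \<partial>lborel) + Lp_norm q (\<lambda>\<xi>. \<integral>\<^sup>+\<zeta>. mF \<zeta> * NV (\<xi> - \<zeta>) \<partial>lborel)))"
    by (intro mult_left_mono Lp_norm_add q cm) simp
  also have "\<dots> \<le> (ennreal (4 powr s) * 4) * (2 * (2 * ((\<integral>\<^sup>+\<zeta>. mG \<zeta> \<partial>lborel) * Lp_norm q NU) + 2 * ((\<integral>\<^sup>+\<zeta>. mF \<zeta> \<partial>lborel) * Lp_norm q NV)))"
  proof (intro mult_left_mono add_mono)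
    show "Lp_norm q (\<lambda>\<xi>. \<integral>\<^sup>+\<zeta>. mG \<zeta> * NU (\<xi> - \<zeta>) \<partial>lborel) \<le> 2 * ((\<integral>\<^sup>+\<zeta>. mG \<zeta> \<partial>lborel) * Lp_norm q NU)"
      by (rule Lp_norm_convolution[OF q]) measurable
    show "Lp_norm q (\<lambda>\<xi>. \<integral>\<^sup>+\<zeta>. mF \<zeta> * NV (\<xi> - \<zeta>) \<partial>lborel) \<le> 2 * ((\<integral>\<^sup>+\<zeta>. mF \<zeta> \<partial>lborel) * Lp_norm q NV)"
      by (rule Lp_norm_convolution[OF q]) measurable
  qed simp_all
  finally show ?thesis unfolding mod_norm_def U_def V_def NU_def[abs_def] NV_def[abs_def] by (simp only: mult.assoc)
qed

text \<open>Limits of functionals on test functions are unique. Sufficiency uses the existence half;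
  necessity uses the other half to identify an abstractly given product with the pointwise
  one.\<close>

lemma distr_product_of_fun:
  fixes F G \<psi> :: "real^'n::finite \<Rightarrow> complex"
  assumes \<psi>: "smooth_fun \<psi>" "compact (closure {\<xi>. \<psi> \<xi> \<noteq> 0})" "\<psi> 0 = 1"
    and F: "continuous_on UNIV F" "\<And>x. cmod (F x) \<le> A" and G: "continuous_on UNIV G" "\<And>x. cmod (G x) \<le> B"
  shows "distr_product \<psi> (distr_of_fun F) (distr_of_fun G) h \<longleftrightarrow> h = distr_of_fun (\<lambda>t. F t * G t)"
proof
  note lim = product_tendsto[OF \<psi> F G]
  show "h = distr_of_fun (\<lambda>t. F t * G t)" if "distr_product \<psi> (distr_of_fun F) (distr_of_fun G) h"
  proof (rule ext)
    fix \<theta>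
    show "h \<theta> = distr_of_fun (\<lambda>t. F t * G t) \<theta>"
    proof (cases "\<theta> \<in> schwartz_space")
      case True
      then show ?thesis
        using that lim[OF True] LIMSEQ_unique unfolding distr_product_def distr_tendsto_def by blast
    next
      case False
      have "h \<in> extensional schwartz_space" using that unfolding distr_product_def distr_tendsto_def tempered_distr_def by simp
      then show ?thesis using False by (simp add: extensional_def distr_of_fun_def)
    qed
  qed
  have "(\<lambda>t. F t * G t) \<in> borel_measurable borel"
    by (intro borel_measurable_continuous_onI continuous_on_mult F G)
  moreover have "cmod (F t * G t) \<le> A * B" for t
    unfolding norm_mult by (intro mult_mono F(2) G(2) order_trans[OF norm_ge_zero F(2)]) simp
  ultimately have "distr_of_fun (\<lambda>t. F t * G t) \<in> tempered_distr" by (rule tempered_distr_of_fun)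
  then show "distr_product \<psi> (distr_of_fun F) (distr_of_fun G) h" if "h = distr_of_fun (\<lambda>t. F t * G t)"
    using lim unfolding that distr_product_def distr_tendsto_def by blast
qed

lemma multiplication_algebra_sufficient:
  fixes \<phi> \<psi> :: "real^'n::finite \<Rightarrow> complex"
  assumes p: "1 \<le> p" and q: "1 \<le> q" "1 \<le> q'" "1 / q + 1 / q' = 1" and \<phi>: "\<phi> \<in> schwartz_space" "\<phi> \<noteq> (\<lambda>_. 0)"
    and \<psi>: "smooth_fun \<psi>" "compact (closure {\<xi>. \<psi> \<xi> \<noteq> 0})" "\<psi> 0 = 1"
    and s: "s \<ge> 0" "Lp_norm q' (\<lambda>\<xi>::real^'n. ennreal (jb \<xi> powr - s)) < \<infinity>"
  shows "is_multiplication_algebra \<phi> \<psi> p q s"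
proof -
  define b where "b = (\<lambda>t. cnj (\<phi> t))"
  have b: "b \<in> schwartz_space" unfolding b_def by (rule schwartz_cnj[OF \<phi>(1)])
  define c0 where "c0 = (2 * pi) powr (- real CARD('n) / 2)"
  have c0: "c0 > 0" by (simp add: c0_def)
  have MN: "modulation_norm \<phi> p q s u = ennreal c0 * mod_norm b p q s u" if "u \<in> tempered_distr" for u
    unfolding c0_def b_def by (rule modulation_norm_eq[OF p q(1) \<phi>(1) that])
  have MN': "mod_norm b p q s u = ennreal (1 / c0) * modulation_norm \<phi> p q s u" if "u \<in> tempered_distr" for u
    unfolding MN[OF that] using c0 by (simp add: mult.assoc[symmetric] flip: ennreal_mult)
  obtain C1 :: ennreal where C1: "C1 < \<infinity>"
    "\<And>u. u \<in> tempered_distr \<Longrightarrow> \<exists>m. m \<in> borel_measurable borel \<and> (\<forall>x \<xi>. ennreal (cmod (u (atom b x \<xi>))) \<le> m \<xi>) \<and>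
      (\<integral>\<^sup>+\<xi>. m \<xi> \<partial>lborel) \<le> C1 * mod_norm b p q s u"
    unfolding b_def using mod_norm_majorant[OF p q \<phi> s(2)] by blast
  \<comment> \<open>The product estimate comes out in the window \<open>b\<close> squared; a change
    of window based on the square of \<phi> leads back to \<open>b\<close>.\<close>
  have \<phi>\<phi>: "(\<lambda>t. \<phi> t * \<phi> t) \<in> schwartz_space" "(\<lambda>t. \<phi> t * \<phi> t) \<noteq> (\<lambda>_. 0)"
    using \<phi> by (auto intro: schwartz_mult simp: fun_eq_iff)
  obtain C2 :: ennreal where C2: "C2 < \<infinity>"
    "\<And>u. u \<in> tempered_distr \<Longrightarrow> mod_norm b p q s u \<le> C2 * mod_norm (\<lambda>t. cnj (\<phi> t * \<phi> t)) p q s u"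
    using mod_norm_window_change[OF p q(1) \<phi>\<phi> b] by blast
  have bb: "(\<lambda>t. cnj (\<phi> t * \<phi> t)) = (\<lambda>t. b t * b t)" by (simp add: b_def)
  \<comment> \<open>One factor \<open>c0\<close> restores the normalisation on the product, and two
    factors 1 / c0 remove it from the inputs.\<close>
  define C3 where "C3 = ennreal c0 * (C2 * (ennreal (4 powr s) * (4 * (2 * (4 * C1))) * (ennreal (1 / c0) * ennreal (1 / c0))))"
  have C3: "C3 < \<infinity>" using C1(1) C2(1) by (simp add: C3_def ennreal_mult_less_top)
  have main: "\<exists>h\<in>modulation_space \<phi> p q s. distr_product \<psi> f g h \<and>
      modulation_norm \<phi> p q s h \<le> C3 * modulation_norm \<phi> p q s f * modulation_norm \<phi> p q s g"
    if f: "f \<in> modulation_space \<phi> p q s" and g: "g \<in> modulation_space \<phi> p q s" for f g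
  proof -
    have tf: "f \<in> tempered_distr" "modulation_norm \<phi> p q s f < \<infinity>" using f by (simp_all add: modulation_space_def)
    have tg: "g \<in> tempered_distr" "modulation_norm \<phi> p q s g < \<infinity>" using g by (simp_all add: modulation_space_def)
    have nf: "mod_norm b p q s f < \<infinity>" unfolding MN'[OF tf(1)] using tf(2) by (simp add: ennreal_mult_less_top)
    have ng: "mod_norm b p q s g < \<infinity>" unfolding MN'[OF tg(1)] using tg(2) by (simp add: ennreal_mult_less_top)
    obtain mf where mf: "mf \<in> borel_measurable borel" "\<And>x \<xi>. ennreal (cmod (f (atom b x \<xi>))) \<le> mf \<xi>"
      "(\<integral>\<^sup>+\<xi>. mf \<xi> \<partial>lborel) \<le> C1 * mod_norm b p q s f" using C1(2)[OF tf(1)] by (elim exE conjE) blast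
    obtain mg where mg: "mg \<in> borel_measurable borel" "\<And>x \<xi>. ennreal (cmod (g (atom b x \<xi>))) \<le> mg \<xi>"
      "(\<integral>\<^sup>+\<xi>. mg \<xi> \<partial>lborel) \<le> C1 * mod_norm b p q s g" using C1(2)[OF tg(1)] by (elim exE conjE) blast
    have ff: "(\<integral>\<^sup>+\<xi>. mf \<xi> \<partial>lborel) < \<infinity>"
      by (rule order_le_less_trans[OF mf(3)]) (use C1(1) nf in \<open>simp add: ennreal_mult_less_top\<close>)
    have fg: "(\<integral>\<^sup>+\<xi>. mg \<xi> \<partial>lborel) < \<infinity>"
      by (rule order_le_less_trans[OF mg(3)]) (use C1(1) ng in \<open>simp add: ennreal_mult_less_top\<close>)
    obtain F BF where F: "continuous_on UNIV F" "\<And>x. cmod (F x) \<le> BF" "f = distr_of_fun F"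
      using distr_of_fun_of_majorant[OF tf(1) \<phi> mf(1) mf(2)[unfolded b_def] ff] by blast
    obtain G BG where G: "continuous_on UNIV G" "\<And>x. cmod (G x) \<le> BG" "g = distr_of_fun G"
      using distr_of_fun_of_majorant[OF tg(1) \<phi> mg(1) mg(2)[unfolded b_def] fg] by blast
    define h where "h = distr_of_fun (\<lambda>t. F t * G t)"
    have prod: "distr_product \<psi> f g h"
      unfolding F(3) G(3) using distr_product_of_fun[OF \<psi> F(1,2) G(1,2), of h] by (simp add: h_def)
    then have th: "h \<in> tempered_distr" unfolding distr_product_def distr_tendsto_def by blast
    have "mod_norm b p q s h \<le> C2 * mod_norm (\<lambda>t. b t * b t) p q s h" using C2(2)[OF th] unfolding bb .
    also have "\<dots> \<le> C2 * (ennreal (4 powr s) * (4 * (2 * (2 * ((\<integral>\<^sup>+\<xi>. mg \<xi> \<partial>lborel) * mod_norm b p q s f)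
        + 2 * ((\<integral>\<^sup>+\<xi>. mf \<xi> \<partial>lborel) * mod_norm b p q s g)))))"
      unfolding h_def F(3) G(3)
      by (rule mult_left_mono[OF mod_norm_product[OF p q(1) s(1) b F(1,2) G(1,2) mf(1) mg(1)]])
        (use mf(2) mg(2) ff F(3) G(3) in simp_all)
    also have "\<dots> \<le> C2 * (ennreal (4 powr s) * (4 * (2 * (2 * ((C1 * mod_norm b p q s g) * mod_norm b p q s f)
        + 2 * ((C1 * mod_norm b p q s f) * mod_norm b p q s g)))))"
      by (intro mult_left_mono add_mono mult_right_mono mf(3) mg(3)) simp_all
    also have "\<dots> = C2 * (ennreal (4 powr s) * (4 * (2 * (4 * C1))) * (mod_norm b p q s f * mod_norm b p q s g))"
    proof -
      have "2 * ((c * y) * x) + 2 * ((c * x) * y) = 4 * c * (x * y)" for c x y :: ennreal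
      proof -
        have 1: "(c * y) * x = c * (x * y)" "(c * x) * y = c * (x * y)" by (simp_all only: mult_ac)
        show ?thesis unfolding 1 distrib_right[symmetric] by (simp add: mult.assoc)
      qed
      then show ?thesis by (simp only: mult.assoc)
    qed
    finally have le: "mod_norm b p q s h \<le> C2 * (ennreal (4 powr s) * (4 * (2 * (4 * C1))) * (mod_norm b p q s f * mod_norm b p q s g))" .
    have le2: "modulation_norm \<phi> p q s h \<le> C3 * modulation_norm \<phi> p q s f * modulation_norm \<phi> p q s g"
      unfolding MN[OF th] C3_def
      by (rule order_trans[OF mult_left_mono[OF le]], simp, unfold MN'[OF tf(1)] MN'[OF tg(1)]) (simp only: mult_ac order_refl)
    have "modulation_norm \<phi> p q s h < \<infinity>"
      by (rule order_le_less_trans[OF le2]) (use C3 tf(2) tg(2) in \<open>simp add: ennreal_mult_less_top\<close>)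
    then have "h \<in> modulation_space \<phi> p q s" using th by (simp add: modulation_space_def)
    then show ?thesis using prod le2 by blast
  qed
  have "C3 = ennreal (enn2real C3)" using C3 by simp
  then show ?thesis unfolding is_multiplication_algebra_def using main by metis
qed

subsection \<open>Necessity\<close>

text \<open>Comparison of m-th roots: if X > Y > 0 then (X/Y)^m eventually exceeds T / k, so
  constants that do not depend on the power drop out.\<close>

lemma powers_le_imp_le:
  fixes X Y :: real
  assumes "X \<ge> 0" "Y \<ge> 0" "k > 0" and le: "\<And>m. m \<ge> 1 \<Longrightarrow> X ^ m * k \<le> T * Y ^ m"
  shows "X \<le> Y"
proof (rule ccontr)
  assume "\<not> X \<le> Y"
  then have XY: "Y < X" by simp
  show False
  proof (cases "Y = 0")
    case True
    then have "X * k \<le> 0" using le[of 1] by simp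
    moreover have "0 < X * k" by (rule mult_pos_pos) (use XY True assms(3) in simp_all)
    ultimately show False by linarith
  next
    case False
    then have Y: "Y > 0" using assms(2) by simp
    obtain m where m: "T / k < (X / Y) ^ m" using real_arch_pow[of "X / Y" "T / k"] XY Y by (auto simp: field_simps)
    have "(X / Y) ^ m \<le> (X / Y) ^ Suc m" using XY Y by (intro power_increasing) simp_all
    then have "T / k < (X / Y) ^ Suc m" using m by linarith
    then have "T * Y ^ Suc m < X ^ Suc m * k" using assms(3) Y by (simp add: power_divide field_simps)
    then show False using le[of "Suc m"] by linarith
  qed
qed

lemma multiplication_algebra_powers:
  fixes \<phi> \<psi> :: "real^'n::finite \<Rightarrow> complex"
  assumes alg: "is_multiplication_algebra \<phi> \<psi> p q s"
    and \<psi>: "smooth_fun \<psi>" "compact (closure {\<xi>. \<psi> \<xi> \<noteq> 0})" "\<psi> 0 = 1"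
  obtains c :: real where "c \<ge> 1"
    "\<And>f m. f \<in> schwartz_space \<Longrightarrow> distr_of_fun f \<in> modulation_space \<phi> p q s \<Longrightarrow>
      distr_of_fun (\<lambda>t. f t ^ Suc m) \<in> modulation_space \<phi> p q s \<and>
      modulation_norm \<phi> p q s (distr_of_fun (\<lambda>t. f t ^ Suc m)) \<le>
        ennreal (c ^ m) * modulation_norm \<phi> p q s (distr_of_fun f) ^ Suc m"
proof -
  obtain c0 :: real where c0: "\<forall>f\<in>modulation_space \<phi> p q s. \<forall>g\<in>modulation_space \<phi> p q s.
        \<exists>h\<in>modulation_space \<phi> p q s. distr_product \<psi> f g h \<and>
          modulation_norm \<phi> p q s h \<le> ennreal c0 * modulation_norm \<phi> p q s f * modulation_norm \<phi> p q s g"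
    using alg unfolding is_multiplication_algebra_def by blast
  \<comment> \<open>A constant of at least 1 is nonnegative, so its powers pass through
    \<open>ennreal\<close>, and these powers increase with the exponent.\<close>
  define c where "c = max c0 1"
  have c: "c \<ge> 1" "c0 \<le> c" by (simp_all add: c_def)
  have main: "distr_of_fun (\<lambda>t. f t ^ Suc m) \<in> modulation_space \<phi> p q s \<and>
      modulation_norm \<phi> p q s (distr_of_fun (\<lambda>t. f t ^ Suc m)) \<le>
        ennreal (c ^ m) * modulation_norm \<phi> p q s (distr_of_fun f) ^ Suc m"
    if f: "f \<in> schwartz_space" "distr_of_fun f \<in> modulation_space \<phi> p q s" for f m
  proof (induction m)
    case 0
    show ?case using f by simp
  next
    case (Suc m)
    let ?N = "modulation_norm \<phi> p q s"
    have S: "(\<lambda>t. f t ^ Suc m) \<in> schwartz_space" by (rule schwartz_power[OF f(1)]) simp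
    obtain A where A: "\<And>x. cmod (f x) \<le> A" using schwartz_bounded[OF f(1)] by blast
    obtain B where B: "\<And>x. cmod (f x ^ Suc m) \<le> B" using schwartz_bounded[OF S] by blast
    obtain h where h: "h \<in> modulation_space \<phi> p q s" "distr_product \<psi> (distr_of_fun f) (distr_of_fun (\<lambda>t. f t ^ Suc m)) h"
      "?N h \<le> ennreal c0 * ?N (distr_of_fun f) * ?N (distr_of_fun (\<lambda>t. f t ^ Suc m))"
      using c0 f(2) Suc.IH by blast
    have heq: "h = distr_of_fun (\<lambda>t. f t ^ Suc (Suc m))"
      using h(2) distr_product_of_fun[OF \<psi> schwartz_continuous[OF f(1)] A schwartz_continuous[OF S] B, of h] by simp
    have "?N h \<le> ennreal c * ?N (distr_of_fun f) * (ennreal (c ^ m) * ?N (distr_of_fun f) ^ Suc m)"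
      by (rule order_trans[OF h(3)]) (intro mult_mono ennreal_leI c(2) conjunct2[OF Suc.IH] order_refl; simp)
    also have "\<dots> = (ennreal c * ennreal (c ^ m)) * ?N (distr_of_fun f) ^ Suc (Suc m)"
      by (simp only: power_Suc mult_ac)
    also have "ennreal c * ennreal (c ^ m) = ennreal (c ^ Suc m)" using c(1) by (simp flip: ennreal_mult)
    finally show ?case using h(1) unfolding heq by blast
  qed
  show ?thesis by (rule that[OF c(1) main])
qed

text \<open>By duality, the transform of a window times an oscillatory integral is the density
  \<open>a\<close> integrated against a translated ambiguity function. This decays in both
  variables, so the norm in time is a constant and the frequency dependence is a convolution of
  \<open>a\<close> with a bracket kernel.\<close>

lemma mod_norm_synthesis_bound:
  fixes \<gamma> b :: "real^'n::finite \<Rightarrow> complex"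
  assumes p: "1 \<le> p" and q: "1 \<le> q" and \<gamma>: "\<gamma> \<in> schwartz_space" and b: "b \<in> schwartz_space"
  obtains C :: ennreal where "C < \<infinity>"
    "\<And>a :: real^'n \<Rightarrow> real. moments (\<lambda>\<eta>. complex_of_real (a \<eta>)) \<Longrightarrow> (\<And>\<eta>. 0 \<le> a \<eta>) \<Longrightarrow>
      mod_norm b p q s (distr_of_fun (\<lambda>t. \<gamma> t * osc (\<lambda>\<eta>. complex_of_real (a \<eta>)) t))
        \<le> C * Lp_norm q (\<lambda>\<xi>. ennreal (jb \<xi> powr s) * ennreal (a \<xi>))"
proof -
  define r where "r = real CARD('n) + \<bar>s\<bar> + 1"
  have r: "r \<ge> 0" "r > real CARD('n)" "r > real CARD('n) + \<bar>s\<bar>" by (simp_all add: r_def)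
  obtain A where A: "A > 0" "\<And>x \<xi>. cmod (amb b \<gamma> x \<xi>) \<le> A * (jb x powr - r * jb \<xi> powr - r)"
    using amb_bound[OF b \<gamma> r(1)] by blast
  define L where "L = Lp_norm p (\<lambda>x::real^'n. ennreal (jb x powr - r))"
  have L: "L < \<infinity>" unfolding L_def by (rule Lp_norm_jb_finite[OF p r(2)])
  define W where "W = ennreal (2 powr \<bar>s\<bar>) * 2 * (\<integral>\<^sup>+(x::real^'n). ennreal (jb x powr - (r - \<bar>s\<bar>)) \<partial>lborel)"
  have W: "W < \<infinity>" unfolding W_def using nn_integral_jb_finite[where 'n='n, of "r - \<bar>s\<bar>"]
    by (simp add: ennreal_mult_less_top r_def)
  have bound: "mod_norm b p q s (distr_of_fun (\<lambda>t. \<gamma> t * osc (\<lambda>\<eta>. complex_of_real (a \<eta>)) t))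
        \<le> (ennreal A * L * W) * Lp_norm q (\<lambda>\<xi>. ennreal (jb \<xi> powr s) * ennreal (a \<xi>))"
    if a: "moments (\<lambda>\<eta>. complex_of_real (a \<eta>))" "\<And>\<eta>. 0 \<le> a \<eta>" for a :: "real^'n \<Rightarrow> real"
  proof -
    let ?a = "\<lambda>\<eta>::real^'n. complex_of_real (a \<eta>)"
    let ?u = "distr_of_fun (\<lambda>t. \<gamma> t * osc ?a t)"
    have ia: "integrable lborel ?a" by (rule momentsD(2)[OF a(1)])
    have am[measurable]: "a \<in> borel_measurable borel"
      using measurable_compose[OF momentsD(1)[OF a(1)] borel_measurable_Re] by simp
    define I where "I \<xi> = (\<integral>\<^sup>+y. ennreal (jb (y - \<xi>) powr - r) * ennreal (a y) \<partial>lborel)" for \<xi>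
    have Im[measurable]: "I \<in> borel_measurable borel" unfolding I_def[abs_def] by measurable
    have fS: "(\<lambda>t. \<gamma> t * osc ?a t) \<in> schwartz_space" by (rule schwartz_mult_slow[OF \<gamma> osc_slow[OF a(1)]])
    obtain B where B: "\<And>x. cmod (\<gamma> x * osc ?a x) \<le> B" using schwartz_bounded[OF fS] by blast
    have tu: "?u \<in> tempered_distr" by (rule tempered_distr_of_fun[OF schwartz_measurable[OF fS] B])
    have pt: "ennreal (cmod (?u (atom b x \<xi>))) \<le> (ennreal A * I \<xi>) * ennreal (jb x powr - r)" for x \<xi>
    proof -
      define h where "h t = (b (t - x) * \<gamma> t) * wave (- \<xi>) t" for t
      have hS: "h \<in> schwartz_space" unfolding h_def by (rule schwartz_mult_slow[OF amb_product_schwartz[OF b \<gamma>] slow_wave])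
      have oh: "osc h y = amb b \<gamma> x (y - \<xi>)" for y
        unfolding amb_def osc_def h_def wave_diff[of y \<xi>] by (simp only: mult_ac)
      have "?u (atom b x \<xi>) = (LINT t|lborel. osc ?a t * h t)"
        unfolding distr_of_fun_apply[OF atom_schwartz[OF b]] unfolding atom_def h_def by (simp only: mult_ac)
      also have "\<dots> = (LINT y|lborel. ?a y * osc h y)" by (rule osc_duality[OF ia schwartz_integrable[OF hS]])
      finally have "ennreal (cmod (?u (atom b x \<xi>))) \<le> (\<integral>\<^sup>+y. ennreal (cmod (?a y * osc h y)) \<partial>lborel)"
        by (simp only: norm_integral_le_nn_integral)
      also have "\<dots> \<le> (\<integral>\<^sup>+y. (ennreal A * ennreal (jb x powr - r)) * (ennreal (jb (y - \<xi>) powr - r) * ennreal (a y)) \<partial>lborel)"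
      proof (rule nn_integral_mono)
        fix y
        have "cmod (?a y * osc h y) \<le> a y * (A * (jb x powr - r * jb (y - \<xi>) powr - r))"
          unfolding norm_mult oh using a(2)[of y] by (simp add: A(2) mult_left_mono)
        then have "ennreal (cmod (?a y * osc h y)) \<le> ennreal (a y * (A * (jb x powr - r * jb (y - \<xi>) powr - r)))" by (rule ennreal_leI)
        also have "\<dots> = (ennreal A * ennreal (jb x powr - r)) * (ennreal (jb (y - \<xi>) powr - r) * ennreal (a y))"
          using A(1) a(2)[of y] by (simp add: ennreal_mult mult_ac)
        finally show "ennreal (cmod (?a y * osc h y)) \<le> (ennreal A * ennreal (jb x powr - r)) * (ennreal (jb (y - \<xi>) powr - r) * ennreal (a y))" .
      qed
      also have "\<dots> = (ennreal A * ennreal (jb x powr - r)) * I \<xi>"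
        unfolding I_def by (rule nn_integral_cmult) measurable
      finally show ?thesis by (simp only: mult_ac)
    qed
    have Lp: "Lp_norm p (\<lambda>x. ennreal (cmod (?u (atom b x \<xi>)))) \<le> (ennreal A * L) * I \<xi>" for \<xi>
    proof -
      have um: "(\<lambda>x. ennreal (cmod (?u (atom b x \<xi>)))) \<in> borel_measurable borel"
        using measurable_compose[OF measurable_Pair2'[of \<xi> borel borel] tempered_atom_measurable[OF tu b]] by simp
      have "Lp_norm p (\<lambda>x. ennreal (cmod (?u (atom b x \<xi>)))) \<le> Lp_norm p (\<lambda>x::real^'n. (ennreal A * I \<xi>) * ennreal (jb x powr - r))"
        by (rule Lp_norm_mono[OF p um pt])
      also have "\<dots> \<le> (ennreal A * I \<xi>) * L" unfolding L_def by (rule Lp_norm_cmult[OF p]) measurable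
      finally show ?thesis by (simp only: mult_ac)
    qed
    have "mod_norm b p q s ?u \<le> Lp_norm q (\<lambda>\<xi>. (ennreal A * L) * (ennreal (jb \<xi> powr s) * I \<xi>))"
      unfolding mod_norm_def
    proof (rule Lp_norm_mono[OF q])
      show "(\<lambda>\<xi>. ennreal (jb \<xi> powr s) * Lp_norm p (\<lambda>x. ennreal (cmod (?u (atom b x \<xi>))))) \<in> borel_measurable borel"
        using Lp_norm_measurable[OF p tempered_atom_measurable[OF tu b]] by measurable
      fix \<xi>
      show "ennreal (jb \<xi> powr s) * Lp_norm p (\<lambda>x. ennreal (cmod (?u (atom b x \<xi>)))) \<le> (ennreal A * L) * (ennreal (jb \<xi> powr s) * I \<xi>)"
        unfolding mult.left_commute[of "ennreal A * L"] by (rule mult_left_mono[OF Lp]) simp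
    qed
    also have "\<dots> \<le> (ennreal A * L) * Lp_norm q (\<lambda>\<xi>. ennreal (jb \<xi> powr s) * I \<xi>)"
      by (rule Lp_norm_cmult[OF q]) measurable
    also have "\<dots> \<le> (ennreal A * L) * (W * Lp_norm q (\<lambda>\<xi>. ennreal (jb \<xi> powr s) * ennreal (a \<xi>)))"
    proof (rule mult_left_mono)
      show "Lp_norm q (\<lambda>\<xi>. ennreal (jb \<xi> powr s) * I \<xi>) \<le> W * Lp_norm q (\<lambda>\<xi>. ennreal (jb \<xi> powr s) * ennreal (a \<xi>))"
        unfolding I_def W_def by (rule weighted_convolution[OF q r(3)]) measurable
    qed simp
    finally show ?thesis by (simp only: mult.assoc)
  qed
  show ?thesis by (rule that[OF _ bound]) (use L W in \<open>simp_all add: ennreal_mult_less_top\<close>)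
qed

text \<open>The spectral radius argument: in an algebra \<open>\<parallel>f\<^sup>m\<parallel>\<close> grows at most like \<open>(c \<parallel>f\<parallel>)\<^sup>m\<close>, while for
  real \<open>f\<close> the pairing of an even power \<open>f\<^sup>m\<close> with a positive test function grows at least like \<open>J\<^sup>m\<close>
  for every \<open>J < f 0\<close>.\<close>

lemma multiplication_algebra_L1_bound:
  fixes \<phi> \<psi> :: "real^'n::finite \<Rightarrow> complex"
  assumes alg: "is_multiplication_algebra \<phi> \<psi> p q s"
    and p: "1 \<le> p" and q: "1 \<le> q" and \<phi>: "\<phi> \<in> schwartz_space" "\<phi> \<noteq> (\<lambda>_. 0)"
    and \<psi>: "smooth_fun \<psi>" "compact (closure {\<xi>. \<psi> \<xi> \<noteq> 0})" "\<psi> 0 = 1"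
  obtains C :: ennreal where "C < \<infinity>"
    "\<And>a :: real^'n \<Rightarrow> real. moments (\<lambda>\<eta>. complex_of_real (a \<eta>)) \<Longrightarrow> (\<And>\<eta>. 0 \<le> a \<eta>) \<Longrightarrow> (\<And>\<eta>. a (- \<eta>) = a \<eta>) \<Longrightarrow>
      (\<integral>\<^sup>+\<eta>. ennreal (a \<eta>) \<partial>lborel) \<le> C * Lp_norm q (\<lambda>\<xi>. ennreal (jb \<xi> powr s) * ennreal (a \<xi>))"
proof -
  define b where "b = (\<lambda>t. cnj (\<phi> t))"
  have b: "b \<in> schwartz_space" unfolding b_def by (rule schwartz_cnj[OF \<phi>(1)])
  define c0 where "c0 = (2 * pi) powr (- real CARD('n) / 2)"
  have c0: "c0 > 0" by (simp add: c0_def)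
  have MN: "modulation_norm \<phi> p q s u = ennreal c0 * mod_norm b p q s u" if "u \<in> tempered_distr" for u
    unfolding c0_def b_def by (rule modulation_norm_eq[OF p q \<phi>(1) that])
  obtain t1 where t1: "\<phi> t1 \<noteq> 0" using \<phi>(2) by auto
  \<comment> \<open>The squared modulus of the window, moved to a point where it does not vanish and
    normalised there: a nonnegative Schwartz function with value 1 at the origin.\<close>
  define gr where "gr t = (cmod (\<phi> (t - (- t1))))\<^sup>2 / (cmod (\<phi> t1))\<^sup>2" for t
  define \<gamma> where "\<gamma> t = complex_of_real (gr t)" for t
  have \<gamma>S: "\<gamma> \<in> schwartz_space"
  proof -
    have "\<gamma> = (\<lambda>t. complex_of_real (1 / (cmod (\<phi> t1))\<^sup>2) * (\<phi> (t - (- t1)) * cnj (\<phi> (t - (- t1)))))"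
      by (simp add: \<gamma>_def gr_def fun_eq_iff complex_norm_square[symmetric] flip: of_real_mult)
    also have "\<dots> \<in> schwartz_space" by (intro schwartz_cmult schwartz_mult schwartz_cnj schwartz_shift \<phi>)
    finally show ?thesis .
  qed
  have gr0: "gr 0 = 1" using t1 by (simp add: gr_def)
  have grn: "gr t \<ge> 0" for t by (simp add: gr_def)
  have grc: "continuous_on UNIV gr" unfolding gr_def using t1
    by (intro continuous_on_divide continuous_on_power continuous_on_norm continuous_on_const
        schwartz_continuous[OF schwartz_shift[OF \<phi>(1)]]) simp
  obtain c where c: "c \<ge> 1" "\<And>f m. f \<in> schwartz_space \<Longrightarrow> distr_of_fun f \<in> modulation_space \<phi> p q s \<Longrightarrow>
      distr_of_fun (\<lambda>t. f t ^ Suc m) \<in> modulation_space \<phi> p q s \<and>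
      modulation_norm \<phi> p q s (distr_of_fun (\<lambda>t. f t ^ Suc m)) \<le>
        ennreal (c ^ m) * modulation_norm \<phi> p q s (distr_of_fun f) ^ Suc m"
    using multiplication_algebra_powers[OF alg \<psi>] by blast
  obtain C1 :: ennreal where C1: "C1 < \<infinity>"
    "\<And>a :: real^'n \<Rightarrow> real. moments (\<lambda>\<eta>. complex_of_real (a \<eta>)) \<Longrightarrow> (\<And>\<eta>. 0 \<le> a \<eta>) \<Longrightarrow>
      mod_norm b p q s (distr_of_fun (\<lambda>t. \<gamma> t * osc (\<lambda>\<eta>. complex_of_real (a \<eta>)) t))
        \<le> C1 * Lp_norm q (\<lambda>\<xi>. ennreal (jb \<xi> powr s) * ennreal (a \<xi>))"
    using mod_norm_synthesis_bound[OF p q \<gamma>S b] by blast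
  obtain C2 :: ennreal where C2: "C2 < \<infinity>"
    "\<And>u. u \<in> tempered_distr \<Longrightarrow> ennreal (cmod (u \<gamma>)) \<le> C2 * mod_norm b p q s u"
    unfolding b_def using mod_norm_test_bound[OF p q \<phi> \<gamma>S] by blast
  \<comment> \<open>The summand 1 keeps the constant from vanishing, so that an infinite norm on the
    right makes the bound trivial.\<close>
  define C where "C = ennreal c * (ennreal c0 * C1) + 1"
  have C: "C < \<infinity>" using C1(1) by (simp add: C_def ennreal_mult_less_top)
  have bound: "(\<integral>\<^sup>+\<eta>. ennreal (a \<eta>) \<partial>lborel) \<le> C * Lp_norm q (\<lambda>\<xi>. ennreal (jb \<xi> powr s) * ennreal (a \<xi>))"
    if a: "moments (\<lambda>\<eta>. complex_of_real (a \<eta>))" "\<And>\<eta>. 0 \<le> a \<eta>" "\<And>\<eta>. a (- \<eta>) = a \<eta>" for a :: "real^'n \<Rightarrow> real"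
  proof (cases "Lp_norm q (\<lambda>\<xi>. ennreal (jb \<xi> powr s) * ennreal (a \<xi>)) = \<infinity>")
    case True
    have "C \<noteq> 0" by (simp add: C_def)
    then show ?thesis using True by (simp add: ennreal_mult_top)
  next
    case False
    let ?a = "\<lambda>\<eta>::real^'n. complex_of_real (a \<eta>)"
    let ?P = "Lp_norm q (\<lambda>\<xi>. ennreal (jb \<xi> powr s) * ennreal (a \<xi>))"
    have P: "?P < \<infinity>" using False by (simp add: less_top)
    have ia: "integrable lborel ?a" by (rule momentsD(2)[OF a(1)])
    have iar: "integrable lborel a" using integrable_Re[OF ia] by simp
    define I where "I = (LINT \<eta>|lborel. a \<eta>)"
    have I: "(\<integral>\<^sup>+\<eta>. ennreal (a \<eta>) \<partial>lborel) = ennreal I" unfolding I_def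
      by (rule nn_integral_eq_integral[OF iar]) (simp add: a(2))
    define f where "f t = \<gamma> t * osc ?a t" for t
    have fS: "f \<in> schwartz_space" unfolding f_def by (rule schwartz_mult_slow[OF \<gamma>S osc_slow[OF a(1)]])
    \<comment> \<open>Evenness of \<open>a\<close> makes the integral invariant under
      conjugation.\<close>
    have oreal: "osc ?a t = complex_of_real (Re (osc ?a t))" for t
    proof -
      have m: "(\<lambda>\<eta>. ?a \<eta> * wave t \<eta>) \<in> borel_measurable borel" using integrable_mult_wave[OF ia, of t] by simp
      have "cnj (osc ?a t) = (LINT \<eta>|lborel. cnj (?a \<eta> * wave t \<eta>))" unfolding osc_def by (subst Bochner_Integration.integral_cnj) simp
      also have "\<dots> = (LINT \<eta>|lborel. (\<lambda>\<eta>. ?a \<eta> * wave t \<eta>) (0 - \<eta>))"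
        by (simp add: a(3) wave_minus_right wave_minus)
      also have "\<dots> = osc ?a t" unfolding osc_def by (rule integral_reflect(1)[OF m])
      finally have "osc ?a t \<in> \<real>" by (simp add: Reals_cnj_iff)
      then show ?thesis by simp
    qed
    define g where "g t = gr t * Re (osc ?a t)" for t
    have fg: "f t = complex_of_real (g t)" for t unfolding f_def \<gamma>_def g_def by (subst oreal) simp
    have gc: "continuous_on UNIV g"
    proof -
      have "continuous_on UNIV (\<lambda>t. Re (f t))" by (intro continuous_on_Re schwartz_continuous fS)
      then show ?thesis by (simp add: fg)
    qed
    have g0: "g 0 = I"
    proof -
      have "osc ?a 0 = complex_of_real I" unfolding osc_def I_def by (simp add: integral_complex_of_real)
      then show ?thesis by (simp add: g_def gr0)
    qed
    obtain Bf where Bf: "\<And>x. cmod (f x) \<le> Bf" using schwartz_bounded[OF fS] by blast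
    have tf: "distr_of_fun f \<in> tempered_distr" by (rule tempered_distr_of_fun[OF schwartz_measurable[OF fS] Bf])
    have Nf: "modulation_norm \<phi> p q s (distr_of_fun f) \<le> ennreal c0 * (C1 * ?P)"
      unfolding MN[OF tf] using C1(2)[OF a(1,2)] unfolding f_def[symmetric] by (rule mult_left_mono) simp
    also have "\<dots> < \<infinity>" using C1(1) P by (simp add: ennreal_mult_less_top)
    finally have Nfin: "modulation_norm \<phi> p q s (distr_of_fun f) < \<infinity>" .
    then have fM: "distr_of_fun f \<in> modulation_space \<phi> p q s" using tf by (simp add: modulation_space_def)
    obtain x where x: "modulation_norm \<phi> p q s (distr_of_fun f) = ennreal x" "x \<ge> 0"
      using Nfin by (cases "modulation_norm \<phi> p q s (distr_of_fun f)") simp_all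
    obtain T where T: "C2 * ennreal (1 / c0) = ennreal T" "T \<ge> 0"
    proof -
      have "C2 * ennreal (1 / c0) < \<infinity>" using C2(1) by (simp add: ennreal_mult_less_top)
      then show ?thesis using that by (cases "C2 * ennreal (1 / c0)") simp_all
    qed
    have upper: "(LINT t|lborel. g t ^ (2 * m) * gr t) \<le> T * (c * x) ^ (2 * m)" if m: "m \<ge> 1" for m :: nat
    proof -
      obtain k where k: "2 * m = Suc k" using m by (cases "2 * m") simp_all
      let ?u = "distr_of_fun (\<lambda>t. f t ^ Suc k)"
      have kS: "(\<lambda>t. f t ^ Suc k) \<in> schwartz_space" by (rule schwartz_power[OF fS]) simp
      have uM: "?u \<in> modulation_space \<phi> p q s" "modulation_norm \<phi> p q s ?u \<le> ennreal (c ^ k) * modulation_norm \<phi> p q s (distr_of_fun f) ^ Suc k"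
        using c(2)[OF fS fM, of k] by simp_all
      have tu: "?u \<in> tempered_distr" using uM(1) by (simp add: modulation_space_def)
      have "?u \<gamma> = (LINT t|lborel. complex_of_real (g t ^ (2 * m) * gr t))"
        unfolding distr_of_fun_apply[OF \<gamma>S] fg \<gamma>_def k by simp
      then have u\<gamma>: "?u \<gamma> = complex_of_real (LINT t|lborel. g t ^ (2 * m) * gr t)" by (simp only: integral_complex_of_real)
      have "ennreal (LINT t|lborel. g t ^ (2 * m) * gr t) \<le> ennreal (cmod (?u \<gamma>))" unfolding u\<gamma> by (intro ennreal_leI) simp
      also have "\<dots> \<le> C2 * mod_norm b p q s ?u" by (rule C2(2)[OF tu])
      also have "mod_norm b p q s ?u = ennreal (1 / c0) * modulation_norm \<phi> p q s ?u"
        unfolding MN[OF tu] using c0 by (simp add: mult.assoc[symmetric] flip: ennreal_mult)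
      also have "C2 * (ennreal (1 / c0) * modulation_norm \<phi> p q s ?u) = ennreal T * modulation_norm \<phi> p q s ?u"
        by (simp only: mult.assoc[symmetric] T(1))
      also have "\<dots> \<le> ennreal T * (ennreal (c ^ k) * ennreal x ^ Suc k)"
        by (rule mult_left_mono) (use uM(2) x(1) in simp_all)
      also have "\<dots> = ennreal (T * (c ^ k * x ^ Suc k))"
      proof -
        have "ennreal x ^ Suc k = ennreal (x ^ Suc k)" by (rule ennreal_power[OF x(2)])
        moreover have "ennreal (c ^ k) * ennreal (x ^ Suc k) = ennreal (c ^ k * x ^ Suc k)"
          using c(1) x(2) by (intro ennreal_mult[symmetric]) simp_all
        moreover have "ennreal T * ennreal (c ^ k * x ^ Suc k) = ennreal (T * (c ^ k * x ^ Suc k))"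
          using c(1) x(2) T(2) by (intro ennreal_mult[symmetric]) simp_all
        ultimately show ?thesis by (simp only:)
      qed
      finally have "(LINT t|lborel. g t ^ (2 * m) * gr t) \<le> T * (c ^ k * x ^ Suc k)"
        by (subst (asm) ennreal_le_iff) (use T(2) c(1) x(2) in simp_all)
      also have "\<dots> \<le> T * (c ^ Suc k * x ^ Suc k)"
        using c(1) x(2) T(2) by (intro mult_left_mono mult_right_mono power_increasing) simp_all
      finally show ?thesis by (simp only: power_mult_distrib k)
    qed
    have "I \<le> c * x"
    proof (rule ccontr)
      assume "\<not> I \<le> c * x"
      then have lt: "c * x < I" by simp
      \<comment> \<open>A level strictly between the two values; by continuity \<open>g\<close>
        exceeds it on a whole ball around the origin.\<close>
      define J where "J = (I + c * x) / 2"
      have cx: "c * x \<ge> 0" using c(1) x(2) by simp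
      have J: "c * x < J" "J < I" "J \<ge> 0" using lt cx by (simp_all add: J_def)
      define U where "U = {t. J < g t} \<inter> {t. 1 / 2 < gr t}"
      have "open U" unfolding U_def
        by (intro open_Int open_Collect_less continuous_on_const gc grc)
      moreover have "0 \<in> U" using J(2) by (simp add: U_def g0 gr0)
      ultimately obtain d where d: "d > 0" "ball 0 d \<subseteq> U" unfolding open_contains_ball by blast
      \<comment> \<open>Half the volume of the ball, as the test function exceeds 1 / 2 on
        it.\<close>
      define \<kappa> where "\<kappa> = measure lborel (ball (0::real^'n) d) / 2"
      have \<kappa>: "\<kappa> > 0" using d(1) by (simp add: \<kappa>_def content_ball)
      \<comment> \<open>Only even powers are available, so the root comparison is made for the
        squares.\<close>
      have "J\<^sup>2 \<le> (c * x)\<^sup>2"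
      proof (rule powers_le_imp_le[OF _ _ \<kappa>])
        fix m :: nat assume m: "m \<ge> 1"
        have S: "(\<lambda>t. f t ^ (2 * m) * \<gamma> t) \<in> schwartz_space"
          using m by (intro schwartz_mult schwartz_power fS \<gamma>S) simp
        have nn: "0 \<le> g t ^ (2 * m) * gr t" for t using grn[of t] by (simp add: power_mult)
        have "cmod (f t ^ (2 * m) * \<gamma> t) = g t ^ (2 * m) * gr t" for t
        proof -
          have "f t ^ (2 * m) * \<gamma> t = complex_of_real (g t ^ (2 * m) * gr t)" by (simp add: fg \<gamma>_def)
          then show ?thesis using nn[of t] by (simp only: norm_of_real abs_of_nonneg)
        qed
        then have iG: "integrable lborel (\<lambda>t. g t ^ (2 * m) * gr t)"
          using integrable_norm[OF schwartz_integrable[OF S]] by simp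
        have ib: "integrable lborel (indicator (ball (0::real^'n) d) :: real^'n \<Rightarrow> real)"
          by (intro integrable_real_indicator) (simp_all add: emeasure_lborel_ball_finite[unfolded infinity_ennreal_def])
        have "(J\<^sup>2) ^ m * \<kappa> = (LINT t|lborel. (J ^ (2 * m) * (1 / 2)) * indicator (ball (0::real^'n) d) t)"
          unfolding \<kappa>_def by (simp add: power_mult)
        also have "\<dots> \<le> (LINT t|lborel. g t ^ (2 * m) * gr t)"
        proof (rule integral_mono[OF integrable_mult_right[OF ib] iG])
          fix t :: "real^'n"
          show "(J ^ (2 * m) * (1 / 2)) * indicator (ball 0 d) t \<le> g t ^ (2 * m) * gr t"
          proof (cases "t \<in> ball 0 d")
            case True
            then have "J < g t" "1 / 2 < gr t" using d(2) by (auto simp: U_def)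
            then have "J ^ (2 * m) * (1 / 2) \<le> g t ^ (2 * m) * gr t"
              using J(3) by (intro mult_mono power_mono) simp_all
            then show ?thesis using True by simp
          next
            case False
            then show ?thesis using nn[of t] by simp
          qed
        qed
        also have "\<dots> \<le> T * (c * x) ^ (2 * m)" by (rule upper[OF m])
        also have "\<dots> = T * ((c * x)\<^sup>2) ^ m" by (simp only: power_mult)
        finally show "(J\<^sup>2) ^ m * \<kappa> \<le> T * ((c * x)\<^sup>2) ^ m" .
      qed simp_all
      then have "J \<le> c * x" by (rule power2_le_imp_le[OF _ cx])
      then show False using J(1) by simp
    qed
    then have "ennreal I \<le> ennreal c * modulation_norm \<phi> p q s (distr_of_fun f)"
      unfolding x(1) using c(1) x(2) by (simp add: ennreal_leI flip: ennreal_mult)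
    also have "\<dots> \<le> ennreal c * (ennreal c0 * (C1 * ?P))" by (rule mult_left_mono[OF Nf]) simp
    also have "\<dots> \<le> C * ?P" unfolding C_def distrib_right mult.assoc by (rule add_increasing2) simp_all
    finally show ?thesis unfolding I .
  qed
  show ?thesis by (rule that[OF C bound])
qed

section \<open>Test densities and the condition on the weight\<close>

lemma moments_cutoff:
  fixes h :: "real^'n::finite \<Rightarrow> real"
  assumes [measurable]: "h \<in> borel_measurable borel" and h: "\<And>\<eta>. \<eta> \<in> ball 0 R \<Longrightarrow> \<bar>h \<eta>\<bar> \<le> B"
  shows "moments (\<lambda>\<eta>. complex_of_real (h \<eta> * indicator (ball 0 R) \<eta>))"
  unfolding moments_def
proof (intro conjI allI)
  have ind: "(\<lambda>\<eta>::real^'n. indicator (ball 0 R) \<eta> :: real) \<in> borel_measurable borel" by (rule borel_measurable_indicator) simp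
  then have m: "(\<lambda>\<eta>. h \<eta> * indicator (ball 0 R) \<eta>) \<in> borel_measurable borel" by measurable
  then show "(\<lambda>\<eta>. complex_of_real (h \<eta> * indicator (ball 0 R) \<eta>)) \<in> borel_measurable borel" by measurable
  fix k :: nat
  have ib: "integrable lborel (indicator (ball (0::real^'n) R) :: real^'n \<Rightarrow> real)"
    by (intro integrable_real_indicator) (simp_all add: emeasure_lborel_ball_finite[unfolded infinity_ennreal_def])
  show "integrable lborel (\<lambda>\<eta>. jb \<eta> ^ k * cmod (complex_of_real (h \<eta> * indicator (ball 0 R) \<eta>)))"
  proof (rule Bochner_Integration.integrable_bound[OF integrable_mult_right[OF ib, of "(1 + \<bar>R\<bar>) ^ k * \<bar>B\<bar>"]])
    show "(\<lambda>\<eta>. jb \<eta> ^ k * cmod (complex_of_real (h \<eta> * indicator (ball 0 R) \<eta>))) \<in> borel_measurable lborel"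
      using m by measurable
    show "AE \<eta> in lborel. norm (jb \<eta> ^ k * cmod (complex_of_real (h \<eta> * indicator (ball 0 R) \<eta>))) \<le> norm ((1 + \<bar>R\<bar>) ^ k * \<bar>B\<bar> * indicator (ball (0::real^'n) R) \<eta>)"
    proof (rule AE_I2)
      fix \<eta> :: "real^'n"
      show "norm (jb \<eta> ^ k * cmod (complex_of_real (h \<eta> * indicator (ball 0 R) \<eta>))) \<le> norm ((1 + \<bar>R\<bar>) ^ k * \<bar>B\<bar> * indicator (ball (0::real^'n) R) \<eta>)"
      proof (cases "\<eta> \<in> ball 0 R")
        case True
        then have "jb \<eta> \<le> 1 + \<bar>R\<bar>" using jb_le[of \<eta>] by simp
        then have "jb \<eta> ^ k * \<bar>h \<eta>\<bar> \<le> (1 + \<bar>R\<bar>) ^ k * \<bar>B\<bar>"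
          using h[OF True] by (intro mult_mono power_mono) simp_all
        then show ?thesis using True by (simp add: abs_mult)
      qed simp
    qed
  qed
qed

lemma jb_powr_le_on_ball:
  assumes "\<eta> \<in> ball 0 R" shows "jb \<eta> powr e \<le> (1 + \<bar>R\<bar>) powr \<bar>e\<bar>"
proof -
  have "jb \<eta> powr e \<le> jb \<eta> powr \<bar>e\<bar>" by (rule jb_powr_mono) simp
  also have "\<dots> \<le> (1 + \<bar>R\<bar>) powr \<bar>e\<bar>" using jb_le[of \<eta>] assms by (intro powr_mono2) simp_all
  finally show ?thesis .
qed

text \<open>Near-extremal densities are inserted into the L^1 bound. For 1 < q < infinity the power
  is such that both sides are powers of one cut-off integral Z, and Z <= K Z^(1/q) bounds Z
  independently of the radius. For q = infinity the density is the inverse weight, and the cut-off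
  integrals are bounded by \<open>C\<close> directly. For q = 1 the volume of an annulus cancels,
  which leaves 1 <= K R^s for all large R.\<close>

lemma multiplication_algebra_necessary:
  fixes \<phi> \<psi> :: "real^'n::finite \<Rightarrow> complex"
  assumes alg: "is_multiplication_algebra \<phi> \<psi> p q s"
    and p: "1 \<le> p" and q: "1 \<le> q" "1 \<le> q'" "1 / q + 1 / q' = 1" and \<phi>: "\<phi> \<in> schwartz_space" "\<phi> \<noteq> (\<lambda>_. 0)"
    and \<psi>: "smooth_fun \<psi>" "compact (closure {\<xi>. \<psi> \<xi> \<noteq> 0})" "\<psi> 0 = 1"
  shows "(s \<ge> 0 \<and> q = 1) \<or> ereal (real CARD('n)) / q' < ereal s"
proof -
  obtain C :: ennreal where C: "C < \<infinity>" "\<And>a :: real^'n \<Rightarrow> real. moments (\<lambda>\<eta>. complex_of_real (a \<eta>)) \<Longrightarrow> (\<And>\<eta>. 0 \<le> a \<eta>) \<Longrightarrow> (\<And>\<eta>. a (- \<eta>) = a \<eta>) \<Longrightarrow>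
      (\<integral>\<^sup>+\<eta>. ennreal (a \<eta>) \<partial>lborel) \<le> C * Lp_norm q (\<lambda>\<xi>::real^'n. ennreal (jb \<xi> powr s) * ennreal (a \<xi>))"
    using multiplication_algebra_L1_bound[OF alg p q(1) \<phi> \<psi>] by blast
  have power: "(\<integral>\<^sup>+\<eta>\<in>ball 0 R. ennreal (jb (\<eta>::real^'n) powr - e) \<partial>lborel) \<le>
      C * Lp_norm q (\<lambda>\<xi>::real^'n. ennreal (jb \<xi> powr (s - e)) * indicator (ball 0 R) \<xi>)" for R e
  proof -
    let ?a = "\<lambda>\<eta>::real^'n. jb \<eta> powr - e * indicator (ball 0 R) \<eta>"
    have le: "(\<integral>\<^sup>+\<eta>. ennreal (?a \<eta>) \<partial>lborel) \<le> C * Lp_norm q (\<lambda>\<xi>::real^'n. ennreal (jb \<xi> powr s) * ennreal (?a \<xi>))"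
    proof (rule C(2))
      show "moments (\<lambda>\<eta>. complex_of_real (?a \<eta>))"
      proof (rule moments_cutoff)
        show "\<bar>jb \<eta> powr - e\<bar> \<le> (1 + \<bar>R\<bar>) powr \<bar>- e\<bar>" if "\<eta> \<in> ball 0 R" for \<eta> :: "real^'n"
          using jb_powr_le_on_ball[OF that, of "- e"] by simp
      qed measurable
    qed (simp_all add: indicator_def)
    have e1: "ennreal (?a \<eta>) = ennreal (jb \<eta> powr - e) * indicator (ball 0 R) \<eta>" for \<eta> :: "real^'n"
      by (simp add: indicator_def)
    have e2: "ennreal (jb \<xi> powr s) * ennreal (?a \<xi>) = ennreal (jb \<xi> powr (s - e)) * indicator (ball 0 R) \<xi>" for \<xi> :: "real^'n"
    proof (cases "\<xi> \<in> ball 0 R")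
      case True
      have "jb \<xi> powr s * jb \<xi> powr - e = jb \<xi> powr (s - e)" by (simp flip: powr_add)
      then show ?thesis using True by (simp flip: ennreal_mult)
    qed simp
    show ?thesis using le unfolding e2 unfolding e1 .
  qed
  from q show ?thesis
  proof (cases rule: conjugate_exponent_cases)
    case 1
    have "s \<ge> 0"
    proof (rule ccontr)
      assume "\<not> s \<ge> 0"
      then have s: "s < 0" by simp
      obtain K where K: "C = ennreal K" "K \<ge> 0" using C(1) by (cases C) simp_all
      have key: "1 \<le> K * R powr s" if R: "R \<ge> 1" for R
      proof -
        let ?D = "ball 0 (R + 1) - ball (0::real^'n) R"
        let ?a = "\<lambda>\<eta>::real^'n. indicator (- ball 0 R) \<eta> * indicator (ball 0 (R + 1)) \<eta> :: real"
        have Dm: "?D \<in> sets lborel" by (intro sets.Diff) simp_all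
        have a: "ennreal (?a \<eta>) = indicator ?D \<eta>" for \<eta> :: "real^'n" by (auto simp: indicator_def)
        have cm: "(indicator (- ball 0 R) :: real^'n \<Rightarrow> real) \<in> borel_measurable borel"
          by (rule borel_measurable_indicator) (rule borel_closed, simp add: closed_Compl)
        have "(\<integral>\<^sup>+\<eta>. ennreal (?a \<eta>) \<partial>lborel) \<le> C * Lp_norm q (\<lambda>\<xi>::real^'n. ennreal (jb \<xi> powr s) * ennreal (?a \<xi>))"
        proof (rule C(2))
          show "moments (\<lambda>\<eta>. complex_of_real (?a \<eta>))" by (rule moments_cutoff[OF cm, of _ 1]) (simp add: indicator_def)
        qed (simp_all add: indicator_def)
        then have "emeasure lborel ?D \<le> C * (\<integral>\<^sup>+\<xi>. ennreal (jb \<xi> powr s) * indicator ?D \<xi> \<partial>lborel)"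
          unfolding a 1 Lp_norm_1 nn_integral_indicator[OF Dm] .
        also have "(\<integral>\<^sup>+\<xi>. ennreal (jb \<xi> powr s) * indicator ?D \<xi> \<partial>lborel) \<le> (\<integral>\<^sup>+\<xi>. ennreal (R powr s) * indicator ?D \<xi> \<partial>lborel)"
        proof (rule nn_integral_mono)
          fix \<xi> :: "real^'n"
          show "ennreal (jb \<xi> powr s) * indicator ?D \<xi> \<le> ennreal (R powr s) * indicator ?D \<xi>"
          proof (cases "\<xi> \<in> ?D")
            case True
            then have "R \<le> jb \<xi>" using norm_le_jb[of \<xi>] by simp
            then have "jb \<xi> powr s \<le> R powr s" using s R by (intro powr_mono2') simp_all
            then show ?thesis using True by (simp add: ennreal_leI)
          qed simp
        qed
        also have "\<dots> = ennreal (R powr s) * emeasure lborel ?D" by (rule nn_integral_cmult_indicator[OF Dm])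
        finally have le: "emeasure lborel ?D \<le> ennreal K * (ennreal (R powr s) * emeasure lborel ?D)"
          unfolding K(1) by (simp add: mult_left_mono)
        have "emeasure lborel ?D \<le> emeasure lborel (ball (0::real^'n) (R + 1))" by (rule emeasure_mono) auto
        also have "\<dots> < \<infinity>" by (rule emeasure_lborel_ball_finite)
        finally obtain z where z: "emeasure lborel ?D = ennreal z" "z \<ge> 0" by (cases "emeasure lborel ?D") simp_all
        obtain i :: 'n where True by simp
        \<comment> \<open>A ball of radius 1 / 2 centred half way across the annulus shows that its
          measure is positive, so that \<open>z\<close> can be cancelled.\<close>
        define w :: "real^'n" where "w = (R + 1 / 2) *\<^sub>R axis i 1"
        have nw: "norm w = R + 1 / 2" using R by (simp add: w_def norm_axis_1)
        have "ball w (1 / 2) \<subseteq> ?D"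
        proof
          fix v assume "v \<in> ball w (1 / 2)"
          then have "norm (w - v) < 1 / 2" by (simp add: dist_norm)
          then have "norm v < R + 1" "R < norm v" using norm_triangle_ineq2[of w v] norm_triangle_ineq2[of v w] nw
            by (simp_all add: norm_minus_commute)
          then show "v \<in> ?D" by simp
        qed
        then have "emeasure lborel (ball w (1 / 2)) \<le> ennreal z" unfolding z(1)[symmetric] by (rule emeasure_mono[OF _ Dm])
        moreover have "emeasure lborel (ball w (1 / 2)) > 0" by (simp add: emeasure_ball)
        ultimately have zp: "z > 0" using order_less_le_trans by fastforce
        have "ennreal z \<le> ennreal (K * (R powr s * z))" using le unfolding z(1) using K(2) z(2) by (simp flip: ennreal_mult)
        then have "z \<le> K * (R powr s * z)" by (subst (asm) ennreal_le_iff) (use K(2) z(2) in simp_all)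
        then have "1 * z \<le> (K * R powr s) * z" by (simp add: mult.assoc)
        then show ?thesis using zp by simp
      qed
      \<comment> \<open>Makes the s-th power of R at most 1 / (2 (K + 1)), which contradicts
        \<open>key\<close>; the maximum with 1 meets the hypothesis of \<open>key\<close>.\<close>
      define R where "R = max 1 ((2 * (K + 1)) powr (1 / - s))"
      have "R powr s \<le> ((2 * (K + 1)) powr (1 / - s)) powr s"
        using s K(2) by (intro powr_mono2') (simp_all add: R_def)
      also have "\<dots> = (2 * (K + 1)) powr ((1 / - s) * s)" by (rule powr_powr)
      also have "(1 / - s) * s = - 1" using s by simp
      also have "(2 * (K + 1)) powr - 1 = 1 / (2 * (K + 1))" using K(2) by (intro powr_neg_one) simp
      finally have "K * R powr s \<le> K * (1 / (2 * (K + 1)))" using K(2) by (rule mult_left_mono)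
      also have "\<dots> < 1" using K(2) by (simp add: divide_less_eq)
      finally show False using key[of R] by (simp add: R_def)
    qed
    then show ?thesis using 1 by simp
  next
    case 2
    have "(\<integral>\<^sup>+\<eta>\<in>ball 0 R. ennreal (jb (\<eta>::real^'n) powr - s) \<partial>lborel) \<le> C" for R
    proof -
      have "Lp_norm q (\<lambda>\<xi>::real^'n. ennreal (jb \<xi> powr (s - s)) * indicator (ball 0 R) \<xi>) \<le> 1"
        unfolding 2 Lp_norm_infinity
      proof (rule esssup_I)
        have "(indicator (ball 0 R) :: real^'n \<Rightarrow> ennreal) \<in> borel_measurable borel"
          by (rule borel_measurable_indicator) simp
        then show "(\<lambda>\<xi>::real^'n. ennreal (jb \<xi> powr (s - s)) * indicator (ball 0 R) \<xi>) \<in> borel_measurable lborel" by simp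
        show "AE \<xi> in lborel. ennreal (jb (\<xi>::real^'n) powr (s - s)) * indicator (ball 0 R) \<xi> \<le> 1"
          by (simp add: indicator_def)
      qed
      then have "C * Lp_norm q (\<lambda>\<xi>::real^'n. ennreal (jb \<xi> powr (s - s)) * indicator (ball 0 R) \<xi>) \<le> C * 1"
        by (rule mult_left_mono) simp
      from order_trans[OF power[where R = R and e = s] this] show ?thesis by (simp only: mult_1_right)
    qed
    then have "s > real CARD('n)" by (rule nn_integral_jb_bounded_imp[OF C(1)])
    then show ?thesis using 2 by (simp add: divide_ereal_def one_ereal_def)
  next
    case (3 r r')
    \<comment> \<open>The equality case of Hoelder's inequality: with this exponent (s - e) r = - e,
      so the weighted norm is a power of the very integral that is to be bounded.\<close>
    define e where "e = s * r'"
    have rr: "(s - e) * r = - e"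
    proof -
      have "r + r' = r * r'" using 3 by (simp add: field_simps)
      have "(s - e) * r = s * (r - r * r')" by (simp add: e_def algebra_simps)
      also have "r - r * r' = - r'" using \<open>r + r' = r * r'\<close> by simp
      finally show ?thesis by (simp add: e_def)
    qed
    obtain K where K: "C = ennreal K" "K \<ge> 0" using C(1) by (cases C) simp_all
    have "(\<integral>\<^sup>+\<eta>\<in>ball 0 R. ennreal (jb (\<eta>::real^'n) powr - e) \<partial>lborel) \<le> ennreal (K powr r')" for R
    proof -
      let ?Z = "\<integral>\<^sup>+\<eta>\<in>ball 0 R. ennreal (jb (\<eta>::real^'n) powr - e) \<partial>lborel"
      \<comment> \<open>Finiteness for each single radius comes first, since a power of this
        integral is cancelled below.\<close>
      have "?Z \<le> (\<integral>\<^sup>+(\<eta>::real^'n). ennreal ((1 + \<bar>R\<bar>) powr \<bar>- e\<bar>) * indicator (ball 0 R) \<eta> \<partial>lborel)"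
      proof (rule nn_integral_mono)
        fix \<eta> :: "real^'n"
        show "ennreal (jb \<eta> powr - e) * indicator (ball 0 R) \<eta> \<le> ennreal ((1 + \<bar>R\<bar>) powr \<bar>- e\<bar>) * indicator (ball 0 R) \<eta>"
          using jb_powr_le_on_ball[of \<eta> R "- e"] by (cases "\<eta> \<in> ball 0 R") (simp_all add: ennreal_leI)
      qed
      also have "\<dots> = ennreal ((1 + \<bar>R\<bar>) powr \<bar>- e\<bar>) * emeasure lborel (ball (0::real^'n) R)"
        by (rule nn_integral_cmult_indicator) simp
      also have "\<dots> < \<infinity>" using emeasure_lborel_ball_finite[of "0::real^'n" R] by (simp add: ennreal_mult_less_top)
      finally obtain z where z: "?Z = ennreal z" "z \<ge> 0" by (cases ?Z) simp_all
      have "Lp_norm q (\<lambda>\<xi>::real^'n. ennreal (jb \<xi> powr (s - e)) * indicator (ball 0 R) \<xi>) = ennreal_powr ?Z (1 / r)"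
      proof -
        have "ennreal_powr (ennreal (jb \<xi> powr (s - e)) * indicator (ball 0 R) \<xi>) r = ennreal (jb \<xi> powr - e) * indicator (ball 0 R) \<xi>" for \<xi> :: "real^'n"
          by (cases "\<xi> \<in> ball 0 R") (simp_all add: powr_powr rr)
        then show ?thesis unfolding 3 Lp_norm_ereal by simp
      qed
      then have "ennreal z \<le> ennreal K * ennreal (z powr (1 / r))" using power[where R = R and e = e] unfolding z(1) K(1) using z(2) by simp
      also have "\<dots> = ennreal (K * z powr (1 / r))" using K(2) by (simp add: ennreal_mult)
      finally have zle: "z \<le> K * z powr (1 / r)" by (subst (asm) ennreal_le_iff) (use K(2) in simp_all)
      have "z \<le> K powr r'"
      proof (cases "z = 0")
        case False
        then have zp: "z > 0" using z(2) by simp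
        have "z powr (1 / r') * z powr (1 / r) = z" using 3 zp by (simp add: add.commute flip: powr_add)
        then have "z powr (1 / r') * z powr (1 / r) \<le> K * z powr (1 / r)" using zle by simp
        then have "z powr (1 / r') \<le> K" using zp by (simp add: mult_le_cancel_right)
        then have "(z powr (1 / r')) powr r' \<le> K powr r'" using 3 by (intro powr_mono2) simp_all
        then show ?thesis using 3 zp by (simp add: powr_powr)
      qed simp
      then show ?thesis unfolding z(1) by (rule ennreal_leI)
    qed
    then have "e > real CARD('n)" by (rule nn_integral_jb_bounded_imp[rotated]) simp
    then have "real CARD('n) / r' < s" using 3 by (simp add: e_def divide_less_eq)
    then show ?thesis using 3 by (simp add: divide_ereal_def divide_inverse)
  qed
qed

text \<open>Both alternatives lead to the one hypothesis under which sufficiency is proved. With q =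
  1 the dual norm is a supremum, for which s >= 0 is enough; with q > 1 the strict inequality
  already forces \<open>s\<close> to be positive and is the integrability threshold of the
  bracket.\<close>

lemma Lp_norm_weight_finite:
  assumes q: "1 \<le> q" "1 \<le> q'" "1 / q + 1 / q' = 1"
    and c: "(s \<ge> 0 \<and> q = 1) \<or> ereal (real CARD('n::finite)) / q' < ereal s"
  shows "s \<ge> 0" "Lp_norm q' (\<lambda>\<xi>::real^'n. ennreal (jb \<xi> powr - s)) < \<infinity>"
proof -
  have "s \<ge> 0 \<and> Lp_norm q' (\<lambda>\<xi>::real^'n. ennreal (jb \<xi> powr - s)) < \<infinity>"
    using q
  proof (cases rule: conjugate_exponent_cases)
    case 1
    have s: "s \<ge> 0" using c 1 by auto
    have "Lp_norm q' (\<lambda>\<xi>::real^'n. ennreal (jb \<xi> powr - s)) \<le> 1"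
      unfolding 1 Lp_norm_infinity using s by (intro esssup_I AE_I2) (simp_all add: jb_powr_le_1)
    then show ?thesis using s by (simp add: order_le_less_trans)
  next
    case 2
    have s: "s > real CARD('n)" using c 2 by (simp add: divide_ereal_def one_ereal_def)
    then show ?thesis unfolding 2 Lp_norm_1 using nn_integral_jb_finite[OF s] by simp
  next
    case (3 r r')
    have "real CARD('n) / r' < s" using c 3 by (simp add: one_ereal_def divide_ereal_def divide_inverse)
    then have s: "s * r' > real CARD('n)" using 3 by (simp add: divide_less_eq)
    then have "s * r' > 0" by (rule le_less_trans[rotated]) simp
    then have "s > 0" using 3 by (simp add: zero_less_mult_iff)
    moreover have "(\<integral>\<^sup>+(\<xi>::real^'n). ennreal (jb \<xi> powr - (s * r')) \<partial>lborel) < \<infinity>" by (rule nn_integral_jb_finite[OF s])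
    then have "Lp_norm q' (\<lambda>\<xi>::real^'n. ennreal (jb \<xi> powr - s)) < \<infinity>"
      unfolding 3 Lp_norm_ereal by (simp add: powr_powr less_top[symmetric])
    ultimately show ?thesis by simp
  qed
  then show "s \<ge> 0" "Lp_norm q' (\<lambda>\<xi>::real^'n. ennreal (jb \<xi> powr - s)) < \<infinity>" by simp_all
qed

theorem theorem3p5:
  fixes p q q' :: ereal and s :: real
    and \<phi> \<psi> :: "real ^ 'n::finite \<Rightarrow> complex"
  assumes "1 \<le> p" and "1 \<le> q"
    and "1 \<le> q'" and "1 / q + 1 / q' = 1"
    and "\<phi> \<in> schwartz_space" and "\<phi> \<noteq> (\<lambda>_. 0)"
    and "smooth_fun \<psi>" and "compact (closure {\<xi>. \<psi> \<xi> \<noteq> 0})"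
    and "\<forall>\<^sub>F \<xi> in nhds 0. \<psi> \<xi> = 1"
  shows "is_multiplication_algebra \<phi> \<psi> p q s \<longleftrightarrow>
           (s \<ge> 0 \<and> q = 1) \<or> ereal (real CARD('n)) / q' < ereal s"
proof -
  have \<psi>0: "\<psi> 0 = 1" by (rule eventually_nhds_x_imp_x[OF assms(9)])
  show ?thesis
  proof
    assume "is_multiplication_algebra \<phi> \<psi> p q s"
    then show "(s \<ge> 0 \<and> q = 1) \<or> ereal (real CARD('n)) / q' < ereal s"
      by (rule multiplication_algebra_necessary[OF _ assms(1-8) \<psi>0])
  next
    assume "(s \<ge> 0 \<and> q = 1) \<or> ereal (real CARD('n)) / q' < ereal s"
    from Lp_norm_weight_finite[OF assms(2-4) this]
    show "is_multiplication_algebra \<phi> \<psi> p q s"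
      by (rule multiplication_algebra_sufficient[OF assms(1-8) \<psi>0])
  qed
qed

end
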